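(* Let $\{(u_{0\tau},v_{0\tau})\}_{0<\tau<1}$ be a family of initial data in $H^1(\mathbb{R})\times H^1(\mathbb{R})$ ($u_{0\tau}$ complex-valued, $v_{0\tau}$ real-valued) such that (i) $\lim_{\tau\to0}\|u_{0\tau}-u_0\|_{H^1}=0$ for some $u_0\in H^1(\mathbb{R})$. Suppose further that one of the following holds: (ii) $\sup_{0<\tau<1}\|v_{0\tau}\|_{L^2}<\infty$; or (iii) $\sup_{0<\tau<1}E_\tau(0)\le 0$ and $\|v_{0\tau}\|_{L^2}=O(\tau^{-1+\gamma})$ for some $0<\gamma\ll1$, where $$E_\tau(0)=\int_{\mathbb{R}}\Big(|\partial_xu_{0\tau}|^2+2v_{0\tau}|u_{0\tau}|^2+v_{0\tau}^2\Big)dx .$$ For $0<\tau<1$ let $(u_\tau,v_\tau)$ be the global solution in $H^1\times H^1$ of the focusing Schrödinger–Debye system $$\begin{cases} i\partial_t u_\tau+\tfrac12\partial_x^2 u_\tau=u_\tau v_\tau,\\ \tau\partial_t v_\tau+v_\tau=-|u_\tau|^2,\\ u_\tau(x,0)=u_{0\tau}(x),\quad v_\tau(x,0)=v_{0\tau}(x),\end{cases}\qquad x\in\mathbb{R},\ t\ge0,$$ and let $u$ be the global solution in $L^2$ of the cubic nonlinear Schrödinger equation $i\partial_tu+\tfrac12\partial_x^2u=-|u|^2u$ with $u(x,0)=u_0(x)$. Then for all $T^*>0$, $$\lim_{\tau\to0}\|u_\tau-u\|_{L^\infty_{T^*}L^2_x}=0\qquad\text{and}\qquad \lim_{\tau\to0}\big\|v_\tau+|u|^2\big\|_{L^1_{T^*}L^2_x}=0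 .$$
   Context: Solutions are understood in the integral (Duhamel) sense: with $S(t)=e^{it\partial_x^2/2}$, $u_\tau(t)=S(t)u_{0\tau}-i\int_0^tS(t-s)u_\tau(s)v_\tau(s)\,ds$, $v_\tau(t)=e^{-t/\tau}v_{0\tau}-\frac1\tau\int_0^te^{-(t-s)/\tau}|u_\tau(s)|^2\,ds$, and $u(t)=S(t)u_0+i\int_0^tS(t-s)|u(s)|^2u(s)\,ds$. It is known that for each $\tau$ and each data in $H^1\times H^1$ the system has a unique global solution $(u_\tau,v_\tau)\in C([0,\infty);H^1\times H^1)$, and that the cubic equation is globally well-posed in $L^2$ and in $H^1$. $L^r_{T^*}L^q_x$ denotes $L^r([0,T^*];L^q(\mathbb{R}))$. The notation $\|v_{0\tau}\|_{L^2}=O(\tau^{-1+\gamma})$ means that there is a constant $C$ with $\|v_{0\tau}\|_{L^2}\le C\tau^{-1+\gamma}$ for all $0<\tau<1$; $0<\gamma\ll1$ means that $\gamma$ is a small positive number. *)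

theory Defs
  imports "HOL-Analysis.Analysis" "HOL-Probability.Essential_Supremum"
begin

text \<open>
  Elements of \<open>L\<^sup>2(\<real>)\<close> and \<open>H\<^sup>1(\<real>)\<close> are represented by Lebesgue measurable functions; identities
  between them are identities almost everywhere. Functions of time and space are curried, time first.
\<close>

section \<open>Lebesgue norms\<close>

definition enn_powr :: "ennreal \<Rightarrow> real \<Rightarrow> ennreal" where
  "enn_powr y a = (if y = \<infinity> then \<infinity> else ennreal (enn2real y powr a))"

text \<open>The exponent \<open>p\<close> ranges over \<open>(0,\<infinity>]\<close>. The function is \<open>[0,\<infinity>]\<close>-valued so that norms can be iterated.\<close>

definition Lp_norm :: "ennreal \<Rightarrow> 'a measure \<Rightarrow> ('a \<Rightarrow> ennreal) \<Rightarrow> ennreal" where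
  "Lp_norm p M f =
     (if p = \<infinity> then esssup M f
      else enn_powr (\<integral>\<^sup>+ x. enn_powr (f x) (enn2real p) \<partial>M) (1 / enn2real p))"

definition space_norm :: "ennreal \<Rightarrow> (real \<Rightarrow> 'a::real_normed_vector) \<Rightarrow> ennreal" where
  "space_norm q f = Lp_norm q lebesgue (\<lambda>x. ennreal (norm (f x)))"

abbreviation L2_norm :: "(real \<Rightarrow> 'a::real_normed_vector) \<Rightarrow> ennreal" where
  "L2_norm \<equiv> space_norm 2"

text \<open>The norm of \<open>L\<^sup>r([0,T]; L\<^sup>q(\<real>))\<close>.\<close>

definition mixed_norm ::
    "ennreal \<Rightarrow> ennreal \<Rightarrow> real \<Rightarrow> (real \<Rightarrow> real \<Rightarrow> 'a::real_normed_vector) \<Rightarrow> ennreal" where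
  "mixed_norm r q T f = Lp_norm r (lebesgue_on {0..T}) (\<lambda>t. space_norm q (f t))"

definition L2_space :: "(real \<Rightarrow> 'a::euclidean_space) set" where
  "L2_space = {f. f \<in> borel_measurable lebesgue \<and> L2_norm f < \<infinity>}"

section \<open>The Sobolev space \<open>H\<^sup>1(\<real>)\<close>\<close>

definition test_function :: "(real \<Rightarrow> real) \<Rightarrow> bool" where
  "test_function \<phi> \<longleftrightarrow>
     (\<forall>k. (deriv ^^ k) \<phi> differentiable_on UNIV) \<and> (\<exists>R. \<forall>x. R < \<bar>x\<bar> \<longrightarrow> \<phi> x = 0)"

definition has_weak_deriv :: "(real \<Rightarrow> 'a::euclidean_space) \<Rightarrow> (real \<Rightarrow> 'a) \<Rightarrow> bool" where
  "has_weak_deriv f g \<longleftrightarrow>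
     (\<forall>\<phi>. test_function \<phi> \<longrightarrow>
        (LINT x|lebesgue. deriv \<phi> x *\<^sub>R f x) = - (LINT x|lebesgue. \<phi> x *\<^sub>R g x))"

definition H1_space :: "(real \<Rightarrow> 'a::euclidean_space) set" where
  "H1_space = {f \<in> L2_space. \<exists>g \<in> L2_space. has_weak_deriv f g}"

definition weak_deriv :: "(real \<Rightarrow> 'a::euclidean_space) \<Rightarrow> real \<Rightarrow> 'a" where
  "weak_deriv f = (SOME g. g \<in> L2_space \<and> has_weak_deriv f g)"

text \<open>Only meaningful for \<open>f \<in> H1_space\<close>.\<close>

definition H1_norm :: "(real \<Rightarrow> 'a::euclidean_space) \<Rightarrow> ennreal" where
  "H1_norm f = enn_powr (L2_norm f ^ 2 + L2_norm (weak_deriv f) ^ 2) (1 / 2)"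

section \<open>Continuous curves and Bochner integrals\<close>

text \<open>\<open>C([0,\<infinity>); L\<^sup>2)\<close> and \<open>C([0,\<infinity>); H\<^sup>1)\<close>\<close>

definition C_L2 :: "(real \<Rightarrow> real \<Rightarrow> 'a::euclidean_space) set" where
  "C_L2 = {f. \<forall>t\<ge>0. f t \<in> L2_space \<and>
                ((\<lambda>s. L2_norm (\<lambda>x. f s x - f t x)) \<longlongrightarrow> 0) (at t within {0..})}"

definition C_H1 :: "(real \<Rightarrow> real \<Rightarrow> 'a::euclidean_space) set" where
  "C_H1 = {f. \<forall>t\<ge>0. f t \<in> H1_space \<and>
                ((\<lambda>s. H1_norm (\<lambda>x. f s x - f t x)) \<longlongrightarrow> 0) (at t within {0..})}"

text \<open>
  An \<open>L\<^sup>2\<close>-valued simple function \<open>\<Sum>\<^sub>k \<chi>\<^bsub>A\<^sub>k\<^esub> h\<^sub>k\<close> on \<open>[0,t]\<close> is given by the list of the pairs \<open>(A\<^sub>k, h\<^sub>k)\<close>.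
\<close>

definition simple_on :: "real \<Rightarrow> (real set \<times> (real \<Rightarrow> 'a::euclidean_space)) list \<Rightarrow> bool" where
  "simple_on t \<sigma> \<longleftrightarrow> (\<forall>(A, h) \<in> set \<sigma>. A \<in> sets lebesgue \<and> A \<subseteq> {0..t} \<and> h \<in> L2_space)"

definition simple_value ::
    "(real set \<times> (real \<Rightarrow> 'a::euclidean_space)) list \<Rightarrow> real \<Rightarrow> real \<Rightarrow> 'a" where
  "simple_value \<sigma> s x = (\<Sum>(A, h)\<leftarrow>\<sigma>. indicator A s *\<^sub>R h x)"

definition simple_integral :: "(real set \<times> (real \<Rightarrow> 'a::euclidean_space)) list \<Rightarrow> real \<Rightarrow> 'a" where
  "simple_integral \<sigma> x = (\<Sum>(A, h)\<leftarrow>\<sigma>. measure lebesgue A *\<^sub>R h x)"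

text \<open>
  \<open>G\<close> is the Bochner integral \<open>\<integral>\<^sub>0\<^sup>t F(s) ds\<close> in \<open>L\<^sup>2(\<real>)\<close>. The values of \<open>F\<close> on a null set of times
  are irrelevant.
\<close>

definition has_L2_integral ::
    "(real \<Rightarrow> real \<Rightarrow> 'a::euclidean_space) \<Rightarrow> (real \<Rightarrow> 'a) \<Rightarrow> real \<Rightarrow> bool" where
  "has_L2_integral F G t \<longleftrightarrow>
     G \<in> L2_space \<and> (AE s in lebesgue_on {0..t}. F s \<in> L2_space) \<and>
     (\<exists>\<sigma>. (\<forall>n. simple_on t (\<sigma> n)) \<and>
        (\<forall>n. (\<lambda>s. L2_norm (\<lambda>x. F s x - simple_value (\<sigma> n) s x))
               \<in> borel_measurable (lebesgue_on {0..t})) \<and>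
        (\<lambda>n. \<integral>\<^sup>+ s. L2_norm (\<lambda>x. F s x - simple_value (\<sigma> n) s x) \<partial>lebesgue_on {0..t})
           \<longlonglongrightarrow> 0 \<and>
        (\<lambda>n. L2_norm (\<lambda>x. G x - simple_integral (\<sigma> n) x)) \<longlonglongrightarrow> 0)"

section \<open>The free Schroedinger group\<close>

text \<open>
  The unitary Fourier transform on \<open>L\<^sup>2(\<real>)\<close>, as the \<open>L\<^sup>2\<close>-limit of the truncated integrals
  \<open>(2\<pi>)\<^bsup>-1/2\<^esup> \<integral>\<^bsub>|x|\<le>R\<^esub> e\<^bsup>-i\<xi>x\<^esup> f(x) dx\<close> (Plancherel); it is determined up to null sets.
\<close>

definition fourier_L2 :: "(real \<Rightarrow> complex) \<Rightarrow> real \<Rightarrow> complex" where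
  "fourier_L2 f = (SOME F. F \<in> L2_space \<and>
     ((\<lambda>R. L2_norm (\<lambda>\<xi>. F \<xi> - (LINT x|lebesgue_on {-R..R}. cis (- (\<xi> * x)) * f x) / sqrt (2 * pi)))
        \<longlongrightarrow> 0) at_top)"

definition inverse_fourier_L2 :: "(real \<Rightarrow> complex) \<Rightarrow> real \<Rightarrow> complex" where
  "inverse_fourier_L2 F = (\<lambda>x. fourier_L2 F (- x))"

text \<open>\<open>S(t) = e\<^bsup>it\<partial>\<^sub>x\<^sup>2/2\<^esup>\<close> is the Fourier multiplier with symbol \<open>e\<^bsup>-it\<xi>\<^sup>2/2\<^esup>\<close>.\<close>

definition schroedinger :: "real \<Rightarrow> (real \<Rightarrow> complex) \<Rightarrow> real \<Rightarrow> complex" where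
  "schroedinger t f = inverse_fourier_L2 (\<lambda>\<xi>. cis (- (t * \<xi>\<^sup>2 / 2)) * fourier_L2 f \<xi>)"

section \<open>Solutions\<close>

definition SD_solution ::
    "real \<Rightarrow> (real \<Rightarrow> complex) \<Rightarrow> (real \<Rightarrow> real) \<Rightarrow>
     (real \<Rightarrow> real \<Rightarrow> complex) \<Rightarrow> (real \<Rightarrow> real \<Rightarrow> real) \<Rightarrow> bool" where
  "SD_solution \<tau> u0 v0 u v \<longleftrightarrow>
     u \<in> C_H1 \<and> v \<in> C_H1 \<and>
     (\<forall>t\<ge>0. \<exists>G. has_L2_integral (\<lambda>s. schroedinger (t - s) (\<lambda>x. u s x * of_real (v s x))) G t \<and>
        (AE x in lebesgue. u t x = schroedinger t u0 x - \<i> * G x)) \<and>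
     (\<forall>t\<ge>0. \<exists>G. has_L2_integral (\<lambda>s x. exp (- (t - s) / \<tau>) * (cmod (u s x))\<^sup>2) G t \<and>
        (AE x in lebesgue. v t x = exp (- t / \<tau>) * v0 x - (1 / \<tau>) * G x))"

text \<open>
  The global \<open>L\<^sup>2\<close> solution of the cubic equation: the solution of the Duhamel equation in the
  well-posedness class \<open>C([0,\<infinity>); L\<^sup>2) \<inter> L\<^sup>4\<^sub>l\<^sub>o\<^sub>c([0,\<infinity>); L\<^sup>\<infinity>)\<close>, \<open>(4,\<infinity>)\<close> being an admissible pair. For a curve
  in this class \<open>|u|\<^sup>2u\<close> lies in \<open>L\<^sup>2\<^sub>l\<^sub>o\<^sub>c([0,\<infinity>); L\<^sup>2)\<close>, so that the Duhamel integral is a Bochner integral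
  in \<open>L\<^sup>2\<close>; in \<open>C([0,\<infinity>); L\<^sup>2)\<close> alone \<open>|u|\<^sup>2u\<close> need not be locally integrable.
\<close>

definition NLS_L2_solution :: "(real \<Rightarrow> complex) \<Rightarrow> (real \<Rightarrow> real \<Rightarrow> complex) \<Rightarrow> bool" where
  "NLS_L2_solution u0 u \<longleftrightarrow>
     u \<in> C_L2 \<and> (\<forall>T>0. mixed_norm 4 \<infinity> T u < \<infinity>) \<and>
     (\<forall>t\<ge>0. \<exists>G. has_L2_integral
                   (\<lambda>s. schroedinger (t - s) (\<lambda>x. of_real ((cmod (u s x))\<^sup>2) * u s x)) G t \<and>
        (AE x in lebesgue. u t x = schroedinger t u0 x + \<i> * G x))"

definition SD_energy :: "(real \<Rightarrow> complex) \<Rightarrow> (real \<Rightarrow> real) \<Rightarrow> real" where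
  "SD_energy u0 v0 =
     (LINT x|lebesgue. (cmod (weak_deriv u0 x))\<^sup>2 + 2 * v0 x * (cmod (u0 x))\<^sup>2 + (v0 x)\<^sup>2)"

end

theory Submission
  imports Defs "HOL-Probability.Sinc_Integral" "HOL-Computational_Algebra.Polynomial"
begin

text \<open>
  Along the Schroedinger--Debye flow the mass is conserved and the energy
  \<open>\<parallel>\<partial>\<^sub>xu\<parallel>\<^sup>2/2 + \<integral>v|u|\<^sup>2 + \<parallel>v\<parallel>\<^sup>2/2\<close> satisfies \<open>E(t) - E(0) = -\<tau>\<^sup>-\<^sup>1 \<integral>\<^sub>0\<^sup>t \<parallel>v + |u|\<^sup>2\<parallel>\<^sup>2 ds\<close>. By the
  Gagliardo--Nirenberg inequality this bounds \<open>u\<close> in \<open>H\<^sup>1\<close> uniformly in \<open>\<tau>\<close>, and the dissipation makes \<open>v + |u|\<^sup>2\<close> of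
  size \<open>\<tau>\<^bsup>1/2\<^esup>\<close> in \<open>L\<^sup>1\<^sub>t L\<^sup>2\<^sub>x\<close>, as soon as the data are bounded in \<open>H\<^sup>1 \<times> L\<^sup>2\<close>. A nonpositive initial energy
  gives \<open>\<parallel>v\<^sub>0\<parallel> \<le> 2 \<parallel>|u\<^sub>0|\<^sup>2\<parallel>\<close>, so that case (iii) is a case of (ii). Hence \<open>u\<^sub>\<tau>\<close> solves the cubic equation up to
  an error of size \<open>\<tau>\<^bsup>1/2\<^esup>\<close>, and Duhamel's formula with Gronwall's lemma applies to \<open>\<parallel>u\<^sub>\<tau> - u\<parallel>\<close>: the difference
  of the cubic terms is controlled since \<open>u \<in> L\<^sup>4\<^sub>t L\<^sup>\<infinity>\<^sub>x\<close>.

  The Sobolev norm and the group are handled on the Fourier side, in the quotient Hilbert space of square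
  integrable functions modulo null sets. For the Plancherel theorem the Gram matrix of the transforms of
  indicator functions is computed from \<open>\<integral> (sin x / x)\<^sup>2 dx = \<pi>\<close>, and indicators are dense.
\<close>

section \<open>The Hilbert space of square integrable functions\<close>

text \<open>The solutions are only curves in H^1, so \<open>u\<close> need not have a time
  derivative in L^2 and the energy cannot be differentiated directly. The sharp frequency cut-offs
  \<open>PN n\<close> turn the free generator into a bounded operator. They leave an error in which
  the product of \<open>v\<close> with the high frequencies of \<open>u\<close> is differentiated
  once; this is why a product estimate in H^1 is proved, by means of translations. The energy
  argument lives on the Fourier side, whereas H^1 is defined through test functions. The two
  descriptions are joined by extending the weak derivative identity from compactly supported to
  band-limited functions, with smooth cut-offs in space. The Hilbert space is a real one; complex
  linearity is carried by the operator \<open>J\<close>, multiplication by the imaginary unit. In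
  the comparison, the Lipschitz coefficient of the cubic term grows like the square of the supremum
  norm of the limit and is therefore only square integrable in time. Gronwall's lemma is applied to
  the square of the difference, after Cauchy-Schwarz in time.\<close>

lemma L2_norm_alt:
  fixes f :: "real \<Rightarrow> 'a::real_normed_vector"
  shows "L2_norm f = enn_powr (\<integral>\<^sup>+ x. ennreal ((norm (f x))\<^sup>2) \<partial>lebesgue) (1 / 2)"
proof -
  have "enn_powr (ennreal (norm (f x))) 2 = ennreal ((norm (f x))\<^sup>2)" for x
    by (simp add: enn_powr_def)
  then show ?thesis by (simp add: space_norm_def Lp_norm_def)
qed

lemma L2_norm_less_top_iff:
  fixes f :: "real \<Rightarrow> 'a::real_normed_vector"
  shows "L2_norm f < \<infinity> \<longleftrightarrow> (\<integral>\<^sup>+ x. ennreal ((norm (f x))\<^sup>2) \<partial>lebesgue) < \<infinity>"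
  by (auto simp: L2_norm_alt enn_powr_def less_top)

lemma L2_space_iff:
  fixes f :: "real \<Rightarrow> 'a::euclidean_space"
  shows "f \<in> L2_space \<longleftrightarrow>
    f \<in> borel_measurable lebesgue \<and> integrable lebesgue (\<lambda>x. (norm (f x))\<^sup>2)"
  unfolding L2_space_def mem_Collect_eq L2_norm_less_top_iff integrable_iff_bounded by auto

lemma L2_norm_eq:
  fixes f :: "real \<Rightarrow> 'a::euclidean_space"
  assumes "f \<in> L2_space"
  shows "L2_norm f = ennreal (sqrt (LINT x|lebesgue. (norm (f x))\<^sup>2))"
proof -
  have "(\<integral>\<^sup>+ x. ennreal ((norm (f x))\<^sup>2) \<partial>lebesgue) = ennreal (LINT x|lebesgue. (norm (f x))\<^sup>2)"
    using assms by (intro nn_integral_eq_integral) (auto simp: L2_space_iff)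
  moreover have "0 \<le> (LINT x|lebesgue. (norm (f x))\<^sup>2)" by simp
  ultimately show ?thesis by (simp add: L2_norm_alt enn_powr_def powr_half_sqrt)
qed

lemma L2_space_measurable: "f \<in> L2_space \<Longrightarrow> f \<in> borel_measurable lebesgue"
  by (simp add: L2_space_def)

text \<open>The bound may fail on a null set, so the lemma also covers multiplication by symbols
  that are bounded only almost everywhere.\<close>

lemma L2_space_bound:
  fixes f :: "real \<Rightarrow> 'a::euclidean_space" and g :: "real \<Rightarrow> 'b::euclidean_space"
  assumes "g \<in> L2_space" "f \<in> borel_measurable lebesgue" "AE x in lebesgue. norm (f x) \<le> c * norm (g x)"
  shows "f \<in> L2_space"
  unfolding L2_space_iff
proof
  show "integrable lebesgue (\<lambda>x. (norm (f x))\<^sup>2)"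
  proof (rule Bochner_Integration.integrable_bound)
    show "integrable lebesgue (\<lambda>x. c\<^sup>2 * (norm (g x))\<^sup>2)"
      using assms(1) by (auto simp: L2_space_iff)
    show "(\<lambda>x. (norm (f x))\<^sup>2) \<in> borel_measurable lebesgue" using assms(2) by measurable
    show "AE x in lebesgue. norm ((norm (f x))\<^sup>2) \<le> norm (c\<^sup>2 * (norm (g x))\<^sup>2)"
      using assms(3)
    proof eventually_elim
      case (elim x)
      then show ?case
        using power_mono[OF elim, of 2] by (simp add: power_mult_distrib)
    qed
  qed
qed (use assms in auto)

text \<open>Measurability transfers because Lebesgue measure is complete.\<close>

lemma L2_space_AE:
  fixes f :: "real \<Rightarrow> 'a::euclidean_space"
  assumes "f \<in> L2_space" "AE x in lebesgue. f x = g x"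
  shows "g \<in> L2_space"
proof -
  have "g \<in> borel_measurable lebesgue"
    using borel_measurable_AE assms by (metis L2_space_measurable)
  then show ?thesis
    using assms by (rule_tac L2_space_bound[of f g 1]) auto
qed

lemma L2_space_zero [simp]: "(\<lambda>x. 0) \<in> L2_space"
  by (simp add: L2_space_iff)

lemma L2_space_scaleR [intro]:
  fixes f :: "real \<Rightarrow> 'a::euclidean_space"
  assumes "f \<in> L2_space" shows "(\<lambda>x. c *\<^sub>R f x) \<in> L2_space"
  using assms by (rule_tac L2_space_bound[of f _ "\<bar>c\<bar>"]) (auto simp: L2_space_iff)

lemma L2_space_mult_const [intro]:
  fixes f :: "real \<Rightarrow> complex"
  assumes "f \<in> L2_space" shows "(\<lambda>x. c * f x) \<in> L2_space"
  using assms by (rule_tac L2_space_bound[of f _ "norm c"]) (auto simp: L2_space_iff norm_mult)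

lemma L2_space_minus [intro]:
  fixes f :: "real \<Rightarrow> 'a::euclidean_space"
  assumes "f \<in> L2_space" shows "(\<lambda>x. - f x) \<in> L2_space"
  using L2_space_scaleR[OF assms, of "-1"] by simp

lemma L2_space_add [intro]:
  fixes f g :: "real \<Rightarrow> 'a::euclidean_space"
  assumes "f \<in> L2_space" "g \<in> L2_space" shows "(\<lambda>x. f x + g x) \<in> L2_space"
  unfolding L2_space_iff
proof
  show "integrable lebesgue (\<lambda>x. (norm (f x + g x))\<^sup>2)"
  proof (rule Bochner_Integration.integrable_bound)
    show "integrable lebesgue (\<lambda>x. 2 * (norm (f x))\<^sup>2 + 2 * (norm (g x))\<^sup>2)"
      using assms by (auto simp: L2_space_iff)
    show "(\<lambda>x. (norm (f x + g x))\<^sup>2) \<in> borel_measurable lebesgue"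
      using assms by (auto simp: L2_space_iff)
    show "AE x in lebesgue. norm ((norm (f x + g x))\<^sup>2) \<le> norm (2 * (norm (f x))\<^sup>2 + 2 * (norm (g x))\<^sup>2)"
    proof (rule AE_I2)
      fix x
      have "(norm (f x + g x))\<^sup>2 \<le> (norm (f x) + norm (g x))\<^sup>2"
        by (intro power_mono norm_triangle_ineq) auto
      also have "\<dots> \<le> 2 * (norm (f x))\<^sup>2 + 2 * (norm (g x))\<^sup>2"
        using sum_squares_bound[of "norm (f x)" "norm (g x)"] by (simp add: power2_sum)
      finally show "norm ((norm (f x + g x))\<^sup>2) \<le> norm (2 * (norm (f x))\<^sup>2 + 2 * (norm (g x))\<^sup>2)"
        by simp
    qed
  qed
qed (use assms in \<open>auto simp: L2_space_iff\<close>)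

lemma L2_space_diff [intro]:
  fixes f g :: "real \<Rightarrow> 'a::euclidean_space"
  assumes "f \<in> L2_space" "g \<in> L2_space" shows "(\<lambda>x. f x - g x) \<in> L2_space"
  using L2_space_add[OF assms(1) L2_space_minus[OF assms(2)]] by simp

lemma integrable_L2_inner [intro]:
  fixes f g :: "real \<Rightarrow> 'a::euclidean_space"
  assumes "f \<in> L2_space" "g \<in> L2_space" shows "integrable lebesgue (\<lambda>x. f x \<bullet> g x)"
proof (rule Bochner_Integration.integrable_bound)
  show "integrable lebesgue (\<lambda>x. (norm (f x))\<^sup>2 + (norm (g x))\<^sup>2)"
    using assms by (auto simp: L2_space_iff)
  show "(\<lambda>x. f x \<bullet> g x) \<in> borel_measurable lebesgue" using assms by (auto simp: L2_space_iff)
  show "AE x in lebesgue. norm (f x \<bullet> g x) \<le> norm ((norm (f x))\<^sup>2 + (norm (g x))\<^sup>2)"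
  proof (rule AE_I2)
    fix x
    have "norm (f x \<bullet> g x) \<le> norm (f x) * norm (g x)" by (simp add: Cauchy_Schwarz_ineq2)
    also have "\<dots> \<le> (norm (f x))\<^sup>2 + (norm (g x))\<^sup>2"
      using sum_squares_bound[of "norm (f x)" "norm (g x)"]
        mult_nonneg_nonneg[OF norm_ge_zero norm_ge_zero, of "f x" "g x"] by linarith
    finally show "norm (f x \<bullet> g x) \<le> norm ((norm (f x))\<^sup>2 + (norm (g x))\<^sup>2)" by simp
  qed
qed

\<comment> \<open>Classes modulo null sets as a real inner product space\<close>
quotient_type cL2 = "real \<Rightarrow> complex" /
  partial: "\<lambda>f g. f \<in> L2_space \<and> g \<in> L2_space \<and> (AE x in lebesgue. f x = g x)"
proof (rule part_equivpI)
  show "\<exists>f::real \<Rightarrow> complex. f \<in> L2_space \<and> f \<in> L2_space \<and> (AE x in lebesgue. f x = f x)"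
    by (rule exI[of _ "\<lambda>x. 0"]) auto
  show "symp (\<lambda>f g::real \<Rightarrow> complex. f \<in> L2_space \<and> g \<in> L2_space \<and> (AE x in lebesgue. f x = g x))"
    by (rule sympI) (auto elim: eventually_mono)
  show "transp (\<lambda>f g::real \<Rightarrow> complex. f \<in> L2_space \<and> g \<in> L2_space \<and> (AE x in lebesgue. f x = g x))"
    by (rule transpI) (auto elim: eventually_elim2)
qed

instantiation cL2 :: real_inner
begin

lift_definition zero_cL2 :: cL2 is "\<lambda>x. 0" by simp
lift_definition plus_cL2 :: "cL2 \<Rightarrow> cL2 \<Rightarrow> cL2" is "\<lambda>f g x. f x + g x"
  by (auto elim: eventually_elim2)
lift_definition minus_cL2 :: "cL2 \<Rightarrow> cL2 \<Rightarrow> cL2" is "\<lambda>f g x. f x - g x"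
  by (auto elim: eventually_elim2)
lift_definition uminus_cL2 :: "cL2 \<Rightarrow> cL2" is "\<lambda>f x. - f x"
  by auto
lift_definition scaleR_cL2 :: "real \<Rightarrow> cL2 \<Rightarrow> cL2" is "\<lambda>c f x. c *\<^sub>R f x"
  by (auto elim: eventually_mono intro: L2_space_scaleR)
text \<open>The inner product of two complex numbers as plane vectors is
  \<open>Re (z * cnj w)\<close>, so this is the real part of the Hermitian product. Its imaginary
  part is recovered by pairing with \<open>J\<close>.\<close>

lift_definition inner_cL2 :: "cL2 \<Rightarrow> cL2 \<Rightarrow> real" is "\<lambda>f g. LINT x|lebesgue. f x \<bullet> g x"
  by (rule integral_cong_AE) (auto simp: L2_space_iff elim: eventually_elim2)

definition norm_cL2 :: "cL2 \<Rightarrow> real" where "norm_cL2 F = sqrt (F \<bullet> F)"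
definition dist_cL2 :: "cL2 \<Rightarrow> cL2 \<Rightarrow> real" where "dist_cL2 F G = norm (F - G)"
definition sgn_cL2 :: "cL2 \<Rightarrow> cL2" where "sgn_cL2 F = scaleR (inverse (norm F)) F"
definition uniformity_cL2 :: "(cL2 \<times> cL2) filter" where
  "uniformity_cL2 = (INF e\<in>{0<..}. principal {(x, y). dist x y < e})"
definition open_cL2 :: "cL2 set \<Rightarrow> bool" where
  "open_cL2 U = (\<forall>x\<in>U. eventually (\<lambda>(x', y). x' = x \<longrightarrow> y \<in> U) uniformity)"

instance
proof
  fix F G H :: cL2 and a b :: real
  show "F + G + H = F + (G + H)" by transfer (auto simp: add.assoc)
  show "F + G = G + F" by transfer (auto simp: add.commute)
  show "0 + F = F" by transfer auto
  show "- F + F = 0" by transfer auto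
  show "F - G = F + - G" by transfer auto
  show "a *\<^sub>R (F + G) = a *\<^sub>R F + a *\<^sub>R G"
    by transfer (auto simp: scaleR_add_right simp del: scaleR_conv_of_real)
  show "(a + b) *\<^sub>R F = a *\<^sub>R F + b *\<^sub>R F"
    by transfer (auto simp: scaleR_add_left simp del: scaleR_conv_of_real)
  show "a *\<^sub>R b *\<^sub>R F = (a * b) *\<^sub>R F" by transfer auto
  show "1 *\<^sub>R F = F" by transfer auto
  show "dist F G = norm (F - G)" by (rule dist_cL2_def)
  show "sgn F = scaleR (inverse (norm F)) F" by (rule sgn_cL2_def)
  show "uniformity = (INF e\<in>{0<..}. principal {(x, y::cL2). dist x y < e})"
    by (rule uniformity_cL2_def)
  show "open U = (\<forall>x\<in>U. eventually (\<lambda>(x', y). x' = x \<longrightarrow> y \<in> U) uniformity)" for U :: "cL2 set"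
    by (rule open_cL2_def)
  show "F \<bullet> G = G \<bullet> F" by transfer (auto simp: inner_commute)
  show "(F + G) \<bullet> H = F \<bullet> H + G \<bullet> H"
    by transfer (auto simp: inner_add_left intro!: Bochner_Integration.integral_add)
  show "(a *\<^sub>R F) \<bullet> G = a * (F \<bullet> G)" by transfer simp
  show "0 \<le> F \<bullet> F" by transfer simp
  show "(F \<bullet> F = 0) = (F = 0)"
  proof transfer
    fix f :: "real \<Rightarrow> complex"
    assume "f \<in> L2_space \<and> f \<in> L2_space \<and> (AE x in lebesgue. f x = f x)"
    then show "((LINT x|lebesgue. f x \<bullet> f x) = 0) =
        (f \<in> L2_space \<and> (\<lambda>x. 0) \<in> (L2_space :: (real \<Rightarrow> complex) set) \<and> (AE x in lebesgue. f x = 0))"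
      by (subst integral_nonneg_eq_0_iff_AE) auto
  qed
  show "norm F = sqrt (F \<bullet> F)" by (rule norm_cL2_def)
qed

end

text \<open>The quotient is partial: outside \<open>L2_space\<close> nothing is known about
  \<open>cls f\<close>. This is why the computation rules below ask for membership, and why
  identities are moved to functions through \<open>rep_cls\<close>, almost everywhere.\<close>

abbreviation cls :: "(real \<Rightarrow> complex) \<Rightarrow> cL2" where "cls \<equiv> abs_cL2"
abbreviation rep :: "cL2 \<Rightarrow> real \<Rightarrow> complex" where "rep \<equiv> rep_cL2"

lemma rep_L2 [simp, intro]: "rep F \<in> L2_space"
  using Quotient3_rep_reflp[OF Quotient3_cL2, of F] by simp

lemma rep_measurable [measurable]: "rep F \<in> borel_measurable lebesgue"
  by (simp add: L2_space_measurable)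

lemma cls_rep [simp]: "cls (rep F) = F"
  by (rule Quotient3_abs_rep[OF Quotient3_cL2])

lemma rep_cls: "f \<in> L2_space \<Longrightarrow> AE x in lebesgue. rep (cls f) x = f x"
  using Quotient3_rep_abs[OF Quotient3_cL2, of f] by simp

lemma cls_eqI: "f \<in> L2_space \<Longrightarrow> AE x in lebesgue. f x = g x \<Longrightarrow> cls f = cls g"
  using Quotient3_rel[OF Quotient3_cL2, of f g] L2_space_AE[of f g] by auto

lemma cls_add: "f \<in> L2_space \<Longrightarrow> g \<in> L2_space \<Longrightarrow> cls (\<lambda>x. f x + g x) = cls f + cls g"
  by (simp add: plus_cL2.abs_eq)
lemma cls_diff: "f \<in> L2_space \<Longrightarrow> g \<in> L2_space \<Longrightarrow> cls (\<lambda>x. f x - g x) = cls f - cls g"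
  by (simp add: minus_cL2.abs_eq)
lemma cls_scaleR: "f \<in> L2_space \<Longrightarrow> cls (\<lambda>x. c *\<^sub>R f x) = c *\<^sub>R cls f"
  by (simp add: scaleR_cL2.abs_eq)
lemma cls_zero: "cls (\<lambda>x. 0) = 0"
  by (simp add: zero_cL2_def)
lemma inner_cls: "f \<in> L2_space \<Longrightarrow> g \<in> L2_space \<Longrightarrow> cls f \<bullet> cls g = (LINT x|lebesgue. f x \<bullet> g x)"
  by (simp add: inner_cL2.abs_eq)
lemma inner_rep: "F \<bullet> G = (LINT x|lebesgue. rep F x \<bullet> rep G x)"
  using inner_cls[of "rep F" "rep G"] by simp

lemma rep_add: "AE x in lebesgue. rep (F + G) x = rep F x + rep G x"
  using rep_cls[of "\<lambda>x. rep F x + rep G x"] by (simp add: cls_add L2_space_add)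
lemma rep_diff: "AE x in lebesgue. rep (F - G) x = rep F x - rep G x"
  using rep_cls[of "\<lambda>x. rep F x - rep G x"] by (simp add: cls_diff L2_space_diff)
lemma rep_scaleR: "AE x in lebesgue. rep (c *\<^sub>R F) x = c *\<^sub>R rep F x"
  using rep_cls[of "\<lambda>x. c *\<^sub>R rep F x"] by (simp add: cls_scaleR L2_space_scaleR del: scaleR_conv_of_real)

lemma cls_sum:
  assumes "finite I" "\<And>i. i \<in> I \<Longrightarrow> f i \<in> L2_space"
  shows "(\<lambda>x. \<Sum>i\<in>I. f i x) \<in> L2_space \<and> cls (\<lambda>x. \<Sum>i\<in>I. f i x) = (\<Sum>i\<in>I. cls (f i))"
  using assms
  by (induction I rule: finite_induct) (auto simp: cls_zero cls_add intro!: L2_space_add)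

lemma norm_cls_power2: "f \<in> L2_space \<Longrightarrow> (norm (cls f))\<^sup>2 = (LINT x|lebesgue. (norm (f x))\<^sup>2)"
  by (simp add: power2_norm_eq_inner inner_cls)

lemma norm_rep_power2: "(norm F)\<^sup>2 = (LINT x|lebesgue. (norm (rep F x))\<^sup>2)"
  using norm_cls_power2[of "rep F"] by simp

lemma L2_norm_cls:
  fixes f :: "real \<Rightarrow> complex"
  assumes "f \<in> L2_space" shows "L2_norm f = ennreal (norm (cls f))"
  using assms by (simp add: L2_norm_eq norm_cls_power2[symmetric])

lemma nn_integral_cls:
  assumes "f \<in> L2_space"
  shows "(\<integral>\<^sup>+ x. ennreal ((norm (f x))\<^sup>2) \<partial>lebesgue) = ennreal ((norm (cls f))\<^sup>2)"
  using assms by (subst nn_integral_eq_integral) (auto simp: L2_space_iff norm_cls_power2)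

lemma norm_cls_mono:
  assumes "f \<in> L2_space" "g \<in> L2_space" "AE x in lebesgue. norm (f x) \<le> c * norm (g x)" "0 \<le> c"
  shows "norm (cls f) \<le> c * norm (cls g)"
proof (rule power2_le_imp_le)
  have "(LINT x|lebesgue. (norm (f x))\<^sup>2) \<le> (LINT x|lebesgue. c\<^sup>2 * (norm (g x))\<^sup>2)"
  proof (rule integral_mono_AE)
    show "AE x in lebesgue. (norm (f x))\<^sup>2 \<le> c\<^sup>2 * (norm (g x))\<^sup>2"
      using assms(3)
    proof eventually_elim
      case (elim x)
      then show ?case using power_mono[OF elim, of 2] by (simp add: power_mult_distrib)
    qed
  qed (use assms in \<open>auto simp: L2_space_iff\<close>)
  then show "(norm (cls f))\<^sup>2 \<le> (c * norm (cls g))\<^sup>2"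
    using assms by (simp add: norm_cls_power2 power_mult_distrib)
qed (use assms in auto)

section \<open>Completeness, and limits in norm versus limits almost everywhere\<close>

lemma cL2_fatou:
  assumes lim: "AE x in lebesgue. (\<lambda>n. f n x) \<longlonglongrightarrow> g x"
    and f: "\<And>n. f n \<in> L2_space" and b: "\<And>n. norm (cls (f n)) \<le> b"
    and g: "g \<in> borel_measurable lebesgue"
  shows "g \<in> L2_space \<and> norm (cls g) \<le> b"
proof -
  have b0: "0 \<le> b" using b[of 0] norm_ge_zero order_trans by blast
  have "(\<integral>\<^sup>+ x. ennreal ((norm (g x))\<^sup>2) \<partial>lebesgue)
      = (\<integral>\<^sup>+ x. liminf (\<lambda>n. ennreal ((norm (f n x))\<^sup>2)) \<partial>lebesgue)"
  proof (rule nn_integral_cong_AE, use lim in eventually_elim)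
    case (elim x)
    then have "(\<lambda>n. ennreal ((norm (f n x))\<^sup>2)) \<longlonglongrightarrow> ennreal ((norm (g x))\<^sup>2)"
      by (intro tendsto_ennrealI tendsto_power tendsto_norm)
    from lim_imp_Liminf[OF trivial_limit_sequentially this] show ?case by (rule sym)
  qed
  also have "\<dots> \<le> liminf (\<lambda>n. \<integral>\<^sup>+ x. ennreal ((norm (f n x))\<^sup>2) \<partial>lebesgue)"
    using f by (intro nn_integral_liminf) (auto simp: L2_space_iff)
  also have "\<dots> \<le> ennreal (b\<^sup>2)"
  proof -
    have "(\<integral>\<^sup>+ x. ennreal ((norm (f n x))\<^sup>2) \<partial>lebesgue) \<le> ennreal (b\<^sup>2)" for n
      unfolding nn_integral_cls[OF f] by (intro ennreal_leI power_mono b norm_ge_zero)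
    then show ?thesis
      by (intro Liminf_le) auto
  qed
  finally have le: "(\<integral>\<^sup>+ x. ennreal ((norm (g x))\<^sup>2) \<partial>lebesgue) \<le> ennreal (b\<^sup>2)" .
  then have gL: "g \<in> L2_space"
    using g by (auto simp: L2_space_iff integrable_iff_bounded intro: le_less_trans)
  moreover have "(norm (cls g))\<^sup>2 \<le> b\<^sup>2"
    using le unfolding nn_integral_cls[OF gL] by simp
  ultimately show ?thesis using b0 by (auto intro: power2_le_imp_le)
qed

text \<open>Increments of size \<open>8\<^sup>-\<^sup>n\<close> make \<open>4\<^sup>n |f\<^sub>n\<^sub>+\<^sub>1 - f\<^sub>n|\<^sup>2\<close> summable almost everywhere.\<close>

lemma AE_convergent_of_fast_Cauchy:
  fixes X :: "nat \<Rightarrow> cL2"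
  assumes X: "\<And>n. norm (X (Suc n) - X n) ^ 2 \<le> (1/8) ^ n"
  shows "AE x in lebesgue. convergent (\<lambda>n. rep (X n) x)"
proof -
  define d where "d n x = (norm (rep (X (Suc n)) x - rep (X n) x))\<^sup>2" for n x
  have dm [measurable]: "d n \<in> borel_measurable lebesgue" for n unfolding d_def by measurable
  have "(\<integral>\<^sup>+ x. (\<Sum>n. ennreal (4 ^ n * d n x)) \<partial>lebesgue)
      = (\<Sum>n. \<integral>\<^sup>+ x. ennreal (4 ^ n * d n x) \<partial>lebesgue)"
    by (rule nn_integral_suminf) measurable
  also have "\<dots> \<le> (\<Sum>n. ennreal ((1/2) ^ n))"
  proof (rule suminf_le)
    fix n
    have "(\<integral>\<^sup>+ x. ennreal (4 ^ n * d n x) \<partial>lebesgue) = ennreal (4 ^ n) * (\<integral>\<^sup>+ x. ennreal (d n x) \<partial>lebesgue)"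
      by (simp add: ennreal_mult' nn_integral_cmult)
    also have "(\<integral>\<^sup>+ x. ennreal (d n x) \<partial>lebesgue) = ennreal ((norm (X (Suc n) - X n))\<^sup>2)"
      unfolding d_def using nn_integral_cls[of "\<lambda>x. rep (X (Suc n)) x - rep (X n) x"]
      by (simp add: L2_space_diff cls_diff)
    also have "ennreal (4 ^ n) * \<dots> \<le> ennreal (4 ^ n) * ennreal ((1/8) ^ n)"
      by (intro mult_left_mono ennreal_leI X) auto
    also have "\<dots> = ennreal ((1/2) ^ n)"
      by (subst ennreal_mult[symmetric]) (auto simp: power_mult_distrib[symmetric])
    finally show "(\<integral>\<^sup>+ x. ennreal (4 ^ n * d n x) \<partial>lebesgue) \<le> ennreal ((1/2) ^ n)" .
  qed auto
  also have "\<dots> < \<infinity>"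
  proof -
    have "(\<Sum>n. ennreal ((1/2) ^ n)) = ennreal (\<Sum>n. (1/2) ^ n)"
      by (rule suminf_ennreal2) (auto intro!: summable_geometric)
    then show ?thesis by simp
  qed
  finally have fin: "(\<integral>\<^sup>+ x. (\<Sum>n. ennreal (4 ^ n * d n x)) \<partial>lebesgue) < \<infinity>" .
  have "AE x in lebesgue. (\<Sum>n. ennreal (4 ^ n * d n x)) \<noteq> \<infinity>"
    by (rule nn_integral_PInf_AE) (use fin in auto)
  then show ?thesis
  proof eventually_elim
    case (elim x)
    then obtain C where C: "(\<Sum>n. ennreal (4 ^ n * d n x)) = ennreal C" "0 \<le> C"
      by (metis ennreal_cases infinity_ennreal_def)
    \<comment> \<open>A single term of the series is at most its sum \<open>C\<close>. Hence at this
      point the increments decay like \<open>(1/2) ^ n\<close>, and the telescoping series converges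
      absolutely.\<close>
    have dn: "norm (rep (X (Suc n)) x - rep (X n) x) \<le> sqrt C * (1/2) ^ n" for n
    proof -
      have "ennreal (4 ^ n * d n x) \<le> ennreal C"
        unfolding C(1)[symmetric] using sum_le_suminf[of "\<lambda>n. ennreal (4 ^ n * d n x)" "{n}"] by auto
      then have "4 ^ n * d n x \<le> C" using C by (simp add: ennreal_le_iff)
      then have "(2 ^ n * norm (rep (X (Suc n)) x - rep (X n) x))\<^sup>2 \<le> C"
        using power_mult_distrib[of "2::real" 2 n] by (simp add: d_def power_mult_distrib power2_eq_square mult_ac)
      then have "2 ^ n * norm (rep (X (Suc n)) x - rep (X n) x) \<le> sqrt C"
        by (rule real_le_rsqrt)
      then show ?thesis by (simp add: field_simps power_divide)
    qed
    have "summable (\<lambda>n. rep (X (Suc n)) x - rep (X n) x)"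
      by (rule summable_comparison_test'[of "\<lambda>n. sqrt C * (1/2) ^ n" 0])
         (use dn in \<open>auto intro!: summable_mult summable_geometric\<close>)
    then have "convergent (\<lambda>n. \<Sum>i<n. rep (X (Suc i)) x - rep (X i) x)"
      by (simp add: summable_iff_convergent)
    then have "convergent (\<lambda>n. rep (X n) x - rep (X 0) x)"
      by (simp add: sum_lessThan_telescope[of "\<lambda>i. rep (X i) x"])
    from convergent_add[OF this convergent_const[of "rep (X 0) x"]] show ?case by simp
  qed
qed

lemma fast_subseq:
  fixes X :: "nat \<Rightarrow> cL2"
  assumes "Cauchy X"
  shows "\<exists>r. strict_mono r \<and> (\<forall>n. norm (X (r (Suc n)) - X (r n)) ^ 2 \<le> (1/8) ^ n)"
proof -
  have "\<exists>N. \<forall>m\<ge>N. \<forall>n\<ge>N. norm (X m - X n) < sqrt ((1/8) ^ k)" for k :: nat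
    using CauchyD[OF assms, of "sqrt ((1/8) ^ k)"] by auto
  then obtain N where N: "\<And>k m n. m \<ge> N k \<Longrightarrow> n \<ge> N k \<Longrightarrow> norm (X m - X n) < sqrt ((1/8) ^ k)"
    by metis
  \<comment> \<open>The maximum keeps \<open>r\<close> strictly increasing while it passes the
    threshold \<open>N (Suc k)\<close>.\<close>
  define r where "r = rec_nat (N 0) (\<lambda>k p. max (Suc p) (N (Suc k)))"
  have r0: "r 0 = N 0" and rS: "\<And>k. r (Suc k) = max (Suc (r k)) (N (Suc k))" by (simp_all add: r_def)
  have "strict_mono r" by (rule strict_monoI_Suc) (simp add: rS less_max_iff_disj)
  moreover have rN: "N n \<le> r n" for n by (cases n) (auto simp: r0 rS)
  moreover have "norm (X (r (Suc n)) - X (r n)) ^ 2 \<le> (1/8) ^ n" for n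
  proof -
    have "N n \<le> r (Suc n)" using rN[of n] by (simp add: rS)
    then have "norm (X (r (Suc n)) - X (r n)) < sqrt ((1/8) ^ n)" using rN[of n] N by blast
    then have "norm (X (r (Suc n)) - X (r n)) ^ 2 \<le> (sqrt ((1/8) ^ n))\<^sup>2"
      by (intro power_mono) auto
    then show ?thesis by simp
  qed
  ultimately show ?thesis by blast
qed

text \<open>Riesz-Fischer: a rapidly Cauchy subsequence converges almost everywhere. Fatou's lemma,
  applied to its differences from a fixed member, puts the pointwise limit into
  \<open>L2_space\<close> and also turns pointwise into norm convergence. A Cauchy sequence with a
  convergent subsequence converges.\<close>

instance cL2 :: complete_space
proof
  fix X :: "nat \<Rightarrow> cL2"
  assume C: "Cauchy X"
  then obtain r where r: "strict_mono r" "\<And>n. norm (X (r (Suc n)) - X (r n)) ^ 2 \<le> (1/8) ^ n"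
    using fast_subseq by blast
  define Y where "Y n = X (r n)" for n
  have CY: "Cauchy Y"
    using Cauchy_subseq_Cauchy[OF C r(1)] by (simp add: Y_def[abs_def] o_def)
  have "AE x in lebesgue. convergent (\<lambda>n. rep (Y n) x)"
    using AE_convergent_of_fast_Cauchy[of Y] r by (simp add: Y_def)
  then have lim: "AE x in lebesgue. (\<lambda>n. rep (Y n) x) \<longlonglongrightarrow> lim (\<lambda>n. rep (Y n) x)"
    by (simp add: convergent_LIMSEQ_iff)
  define g where "g x = lim (\<lambda>n. rep (Y n) x)" for x
  have gm [measurable]: "g \<in> borel_measurable lebesgue" unfolding g_def by measurable
  have key: "(\<lambda>x. g x - rep (Y n) x) \<in> L2_space \<and> norm (cls (\<lambda>x. g x - rep (Y n) x)) \<le> b"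
    if b: "\<And>m. m \<ge> n \<Longrightarrow> norm (Y m - Y n) \<le> b" for n b
  proof (rule cL2_fatou[of "\<lambda>m x. rep (Y (m + n)) x - rep (Y n) x"])
    show "AE x in lebesgue. (\<lambda>m. rep (Y (m + n)) x - rep (Y n) x) \<longlonglongrightarrow> g x - rep (Y n) x"
      using lim unfolding g_def[symmetric]
      by eventually_elim (rule tendsto_diff[OF LIMSEQ_ignore_initial_segment tendsto_const])
    show "norm (cls (\<lambda>x. rep (Y (m + n)) x - rep (Y n) x)) \<le> b" for m
      using b[of "m + n"] by (simp add: cls_diff)
  qed auto
  obtain N where "\<forall>m\<ge>N. \<forall>n\<ge>N. norm (Y m - Y n) < 1"
    using CauchyD[OF CY, of 1] by auto
  then have N: "\<And>m. m \<ge> N \<Longrightarrow> norm (Y m - Y N) \<le> 1" by (simp add: less_imp_le)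
  have "(\<lambda>x. (g x - rep (Y N) x) + rep (Y N) x) \<in> L2_space"
    using key[of N 1, OF N] by (intro L2_space_add) auto
  then have g: "g \<in> L2_space" by simp
  have "Y \<longlonglongrightarrow> cls g"
  proof (rule LIMSEQ_I)
    fix e :: real assume "0 < e"
    then obtain N where N: "\<And>m n. m \<ge> N \<Longrightarrow> n \<ge> N \<Longrightarrow> norm (Y m - Y n) < e / 2"
      using CauchyD[OF CY, of "e / 2"] by auto
    have "norm (Y n - cls g) < e" if "n \<ge> N" for n
    proof -
      have "norm (cls (\<lambda>x. g x - rep (Y n) x)) \<le> e / 2"
        using key[of n "e / 2"] N that by (meson less_imp_le order_trans)
      then have "norm (cls g - Y n) \<le> e / 2" using g by (simp add: cls_diff)
      then show ?thesis using \<open>0 < e\<close> by (simp add: norm_minus_commute)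
    qed
    then show "\<exists>N. \<forall>n\<ge>N. norm (Y n - cls g) < e" by blast
  qed
  then show "convergent X"
    using Cauchy_converges_subseq[OF C r(1)] by (auto simp: Y_def[abs_def] o_def convergent_def)
qed

instance cL2 :: banach ..

lemma AE_subseq_of_tendsto:
  fixes X :: "nat \<Rightarrow> cL2"
  assumes "X \<longlonglongrightarrow> F"
  shows "\<exists>r. strict_mono r \<and> (AE x in lebesgue. (\<lambda>n. rep (X (r n)) x) \<longlonglongrightarrow> rep F x)"
proof -
  have int: "integrable lebesgue (\<lambda>x. (norm (rep (X n) x - rep F x))\<^sup>2)" for n
    using L2_space_diff[OF rep_L2 rep_L2, of "X n" F] by (simp add: L2_space_iff)
  have eq: "(LINT x|lebesgue. norm ((norm (rep (X n) x - rep F x))\<^sup>2)) = (norm (X n - F))\<^sup>2" for n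
    using norm_cls_power2[OF L2_space_diff[OF rep_L2 rep_L2, of "X n" F]] by (simp add: cls_diff)
  have "(\<lambda>n. (norm (X n - F))\<^sup>2) \<longlonglongrightarrow> 0\<^sup>2"
    by (intro tendsto_power) (use assms in \<open>simp add: tendsto_norm_zero_iff LIM_zero\<close>)
  then obtain r where r: "strict_mono r"
      "AE x in lebesgue. (\<lambda>n. (norm (rep (X (r n)) x - rep F x))\<^sup>2) \<longlonglongrightarrow> 0"
    using tendsto_L1_AE_subseq[where u = "\<lambda>n x. (norm (rep (X n) x - rep F x))\<^sup>2", OF int]
    unfolding eq by auto
  have "AE x in lebesgue. (\<lambda>n. rep (X (r n)) x) \<longlonglongrightarrow> rep F x"
    using r(2)
  proof eventually_elim
    case (elim x)
    from tendsto_real_sqrt[OF this]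
    have "(\<lambda>n. norm (rep (X (r n)) x - rep F x)) \<longlonglongrightarrow> 0" by simp
    then show ?case by (simp add: tendsto_norm_zero_iff LIM_zero_iff)
  qed
  then show ?thesis using r(1) by blast
qed

text \<open>A norm limit is the almost everywhere limit of a subsequence, so it agrees with any
  pointwise limit. This identifies limits that come abstractly from completeness, such as limits of
  Fourier transforms, with explicit functions.\<close>

lemma cls_limit_unique:
  assumes X: "(\<lambda>n. cls (f n)) \<longlonglongrightarrow> F" and f: "\<And>n. f n \<in> L2_space"
    and g: "AE x in lebesgue. (\<lambda>n. f n x) \<longlonglongrightarrow> g x"
  shows "g \<in> L2_space \<and> cls g = F"
proof -
  obtain r where r: "strict_mono r" "AE x in lebesgue. (\<lambda>n. rep (cls (f (r n))) x) \<longlonglongrightarrow> rep F x"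
    using AE_subseq_of_tendsto[OF X] by blast
  have "AE x in lebesgue. \<forall>n. rep (cls (f n)) x = f n x"
    unfolding AE_all_countable using rep_cls[OF f] by blast
  then have eq: "AE x in lebesgue. rep F x = g x"
    using r(2) g
  proof eventually_elim
    case (elim x)
    then have "(\<lambda>n. f (r n) x) \<longlonglongrightarrow> g x" using LIMSEQ_subseq_LIMSEQ[OF _ r(1)] by (auto simp: o_def)
    then show ?case using elim LIMSEQ_unique by auto
  qed
  have gL: "g \<in> L2_space" by (rule L2_space_AE[OF rep_L2 eq])
  moreover have "cls (rep F) = cls g" by (rule cls_eqI[OF rep_L2 eq])
  ultimately show ?thesis by simp
qed

text \<open>Both \<open>f n\<close> and \<open>g\<close> are bounded by \<open>h\<close>, so
  \<open>4 * (norm (h x))\<^sup>2\<close> dominates the squared differences.\<close>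

lemma cls_dominated:
  assumes f: "\<And>n. f n \<in> borel_measurable lebesgue" and g: "g \<in> borel_measurable lebesgue"
    and h: "h \<in> L2_space" and le: "\<And>n. AE x in lebesgue. norm (f n x) \<le> norm (h x)"
    and lim: "AE x in lebesgue. (\<lambda>n. f n x) \<longlonglongrightarrow> g x"
  shows "(\<lambda>n. cls (f n)) \<longlonglongrightarrow> cls g" "g \<in> L2_space" "f n \<in> L2_space"
proof -
  show fL: "f n \<in> L2_space" for n using L2_space_bound[OF h f, of n 1] le by simp
  have gh: "AE x in lebesgue. norm (g x) \<le> norm (h x)"
  proof -
    have "AE x in lebesgue. \<forall>n. norm (f n x) \<le> norm (h x)" unfolding AE_all_countable using le by blast
    then show ?thesis using lim
      by eventually_elim (auto intro: LIMSEQ_le_const2 tendsto_norm)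
  qed
  show gL: "g \<in> L2_space" using L2_space_bound[OF h g, of 1] gh by simp
  have "(\<lambda>n. LINT x|lebesgue. (norm (f n x - g x))\<^sup>2) \<longlonglongrightarrow> (LINT x::real|lebesgue. 0)"
  proof (rule integral_dominated_convergence)
    show "integrable lebesgue (\<lambda>x. 4 * (norm (h x))\<^sup>2)" using h by (auto simp: L2_space_iff)
    show "AE x in lebesgue. (\<lambda>n. (norm (f n x - g x))\<^sup>2) \<longlonglongrightarrow> 0"
      using lim
    proof eventually_elim
      case (elim x)
      have "(\<lambda>n. (norm (f n x - g x))\<^sup>2) \<longlonglongrightarrow> (norm (g x - g x))\<^sup>2"
        by (intro tendsto_intros elim)
      then show ?case by simp
    qed
    show "AE x in lebesgue. norm ((norm (f n x - g x))\<^sup>2) \<le> 4 * (norm (h x))\<^sup>2" for n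
      using le[of n] gh
    proof eventually_elim
      case (elim x)
      have "norm (f n x - g x) \<le> 2 * norm (h x)"
        using norm_triangle_ineq4[of "f n x" "g x"] elim by linarith
      then have "(norm (f n x - g x))\<^sup>2 \<le> (2 * norm (h x))\<^sup>2" by (intro power_mono) auto
      then show ?case by (simp add: power_mult_distrib)
    qed
  qed (use f g in measurable)
  then have "(\<lambda>n. (norm (cls (f n) - cls g))\<^sup>2) \<longlonglongrightarrow> 0"
    using norm_cls_power2[OF L2_space_diff[OF fL gL]] by (simp add: cls_diff fL gL)
  from tendsto_real_sqrt[OF this] have "(\<lambda>n. norm (cls (f n) - cls g)) \<longlonglongrightarrow> 0" by simp
  then show "(\<lambda>n. cls (f n)) \<longlonglongrightarrow> cls g" by (simp add: tendsto_norm_zero_iff LIM_zero_iff)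
qed

section \<open>Multiplication operators and affine substitutions\<close>

text \<open>The bound is required only almost everywhere because representatives
  \<open>rep F\<close> of bounded classes will themselves act as symbols. The constant is kept in
  the predicate, as it reappears as a bound for the operator norm.\<close>

definition bdd_symbol :: "(real \<Rightarrow> complex) \<Rightarrow> real \<Rightarrow> bool" where
  "bdd_symbol m c \<longleftrightarrow> m \<in> borel_measurable lebesgue \<and> (AE x in lebesgue. norm (m x) \<le> c) \<and> 0 \<le> c"

definition mulop :: "(real \<Rightarrow> complex) \<Rightarrow> cL2 \<Rightarrow> cL2" where
  "mulop m F = cls (\<lambda>x. m x * rep F x)"

lemma bdd_symbolI:
  assumes "m \<in> borel_measurable lebesgue" "\<And>x. norm (m x) \<le> c"
  shows "bdd_symbol m c"
proof -
  have "0 \<le> c" using assms(2)[of 0] norm_ge_zero order_trans by blast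
  then show ?thesis using assms by (simp add: bdd_symbol_def)
qed

lemma bdd_symbol_mult:
  assumes "bdd_symbol m c" "bdd_symbol k d" shows "bdd_symbol (\<lambda>x. m x * k x) (c * d)"
proof -
  have "AE x in lebesgue. norm (m x * k x) \<le> c * d"
    using assms unfolding bdd_symbol_def
    by (auto elim!: eventually_elim2 simp: norm_mult intro!: mult_mono)
  then show ?thesis using assms unfolding bdd_symbol_def by auto
qed

lemma bdd_symbol_add:
  assumes "bdd_symbol m c" "bdd_symbol k d" shows "bdd_symbol (\<lambda>x. m x + k x) (c + d)"
proof -
  have "AE x in lebesgue. norm (m x + k x) \<le> c + d"
    using assms unfolding bdd_symbol_def
    by (auto elim!: eventually_elim2 intro: norm_triangle_mono)
  then show ?thesis using assms unfolding bdd_symbol_def by auto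
qed

lemma borel_measurable_cnj: "m \<in> borel_measurable M \<Longrightarrow> (\<lambda>x. cnj (m x)) \<in> borel_measurable M"
  by (rule measurable_compose[OF _ borel_measurable_continuous_onI]) (auto intro: continuous_intros)

lemma bdd_symbol_cnj: "bdd_symbol m c \<Longrightarrow> bdd_symbol (\<lambda>x. cnj (m x)) c"
  by (simp add: bdd_symbol_def borel_measurable_cnj)

lemma bdd_symbol_const: "bdd_symbol (\<lambda>x. z) (norm z)"
  by (rule bdd_symbolI) auto

lemma mult_L2:
  assumes "bdd_symbol m c" "f \<in> L2_space" shows "(\<lambda>x. m x * f x) \<in> L2_space"
proof (rule L2_space_bound[OF assms(2), of _ c])
  show "(\<lambda>x. m x * f x) \<in> borel_measurable lebesgue"
    using assms by (intro borel_measurable_times) (auto simp: bdd_symbol_def L2_space_measurable)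
  show "AE x in lebesgue. norm (m x * f x) \<le> c * norm (f x)"
    using assms unfolding bdd_symbol_def by (auto elim!: eventually_mono simp: norm_mult intro!: mult_right_mono)
qed

lemma mulop_cls:
  assumes "bdd_symbol m c" "f \<in> L2_space" shows "mulop m (cls f) = cls (\<lambda>x. m x * f x)"
  unfolding mulop_def
  by (rule cls_eqI) (use rep_cls[OF assms(2)] assms in \<open>auto intro: mult_L2\<close>)

lemma rep_mulop:
  assumes "bdd_symbol m c" shows "AE x in lebesgue. rep (mulop m F) x = m x * rep F x"
  unfolding mulop_def by (rule rep_cls) (use assms in \<open>auto intro: mult_L2\<close>)

lemma norm_mulop:
  assumes "bdd_symbol m c" shows "norm (mulop m F) \<le> c * norm F"
proof -
  have "norm (cls (\<lambda>x. m x * rep F x)) \<le> c * norm (cls (rep F))"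
    using assms by (intro norm_cls_mono mult_L2[OF assms] rep_L2)
      (auto simp: bdd_symbol_def norm_mult elim!: eventually_mono intro!: mult_right_mono)
  then show ?thesis by (simp add: mulop_def)
qed

lemma norm_mulop_unimodular:
  assumes "m \<in> borel_measurable lebesgue" "\<And>x. norm (m x) = 1" shows "norm (mulop m F) = norm F"
proof -
  have "bdd_symbol m 1" using assms by (intro bdd_symbolI) auto
  then have "(norm (mulop m F))\<^sup>2 = (norm F)\<^sup>2"
    unfolding mulop_def
    by (subst norm_cls_power2) (auto simp: norm_mult assms norm_rep_power2 intro: mult_L2)
  then show ?thesis by simp
qed

lemma mulop_add:
  assumes "bdd_symbol m c" shows "mulop m (F + G) = mulop m F + mulop m G"
proof -
  have "mulop m (cls (\<lambda>x. rep F x + rep G x)) = cls (\<lambda>x. m x * rep F x + m x * rep G x)"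
    by (subst mulop_cls[OF assms]) (auto simp: algebra_simps)
  then show ?thesis using assms by (simp add: cls_add mult_L2 mulop_def)
qed

lemma mulop_scaleR:
  assumes "bdd_symbol m c" shows "mulop m (r *\<^sub>R F) = r *\<^sub>R mulop m F"
proof -
  have "mulop m (cls (\<lambda>x. r *\<^sub>R rep F x)) = cls (\<lambda>x. r *\<^sub>R (m x * rep F x))"
    by (subst mulop_cls[OF assms]) (auto simp: algebra_simps simp del: scaleR_conv_of_real)
  then show ?thesis using assms by (simp add: cls_scaleR mult_L2 mulop_def del: scaleR_conv_of_real)
qed

lemma bounded_linear_mulop:
  assumes "bdd_symbol m c" shows "bounded_linear (mulop m)"
  by (rule bounded_linear_intro[where K = c])
     (use assms in \<open>auto simp: mulop_add mulop_scaleR norm_mulop mult.commute\<close>)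

lemma mulop_diff:
  assumes "bdd_symbol m c" shows "mulop m (F - G) = mulop m F - mulop m G"
  using bounded_linear_mulop[OF assms] by (simp add: bounded_linear.linear linear_diff)

lemma mulop_mulop:
  assumes "bdd_symbol m c" "bdd_symbol k d"
  shows "mulop m (mulop k F) = mulop (\<lambda>x. m x * k x) F"
  using mulop_cls[OF assms(1) mult_L2[OF assms(2) rep_L2]]
  by (simp add: mulop_def mult.assoc)

lemma mulop_commute:
  assumes "bdd_symbol m c" "bdd_symbol k d"
  shows "mulop m (mulop k F) = mulop k (mulop m F)"
  using assms by (simp add: mulop_mulop mult.commute)

lemma mulop_cong_AE:
  assumes "AE x in lebesgue. m x = k x" "bdd_symbol m c" shows "mulop m F = mulop k F"
  unfolding mulop_def by (rule cls_eqI[OF mult_L2]) (use assms in auto)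

lemma mulop_symbol_diff:
  assumes "bdd_symbol m c" "bdd_symbol k d"
  shows "mulop (\<lambda>x. m x - k x) F = mulop m F - mulop k F"
  using assms by (simp add: mulop_def cls_diff[symmetric] mult_L2 left_diff_distrib)

lemma mulop_of_real: "mulop (\<lambda>x. of_real r) F = r *\<^sub>R F"
  using cls_scaleR[of "rep F" r] by (simp add: mulop_def scaleR_conv_of_real)

lemma mulop_one [simp]: "mulop (\<lambda>x. 1) F = F"
  by (simp add: mulop_def)

lemma inner_mulop:
  assumes "bdd_symbol m c" shows "mulop m F \<bullet> G = F \<bullet> mulop (\<lambda>x. cnj (m x)) G"
proof -
  have "mulop m F \<bullet> cls (rep G) = (LINT x|lebesgue. (m x * rep F x) \<bullet> rep G x)"
    unfolding mulop_def using assms by (intro inner_cls) (auto intro: mult_L2)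
  also have "\<dots> = (LINT x|lebesgue. rep F x \<bullet> (cnj (m x) * rep G x))"
    by (rule Bochner_Integration.integral_cong) (auto simp: inner_complex_def algebra_simps)
  also have "\<dots> = cls (rep F) \<bullet> mulop (\<lambda>x. cnj (m x)) G"
    unfolding mulop_def using assms
    by (intro inner_cls[symmetric]) (auto intro: mult_L2 bdd_symbol_cnj)
  finally show ?thesis by simp
qed

lemma mulop_tendsto:
  assumes m: "\<And>n. bdd_symbol (m n) c" and k: "k \<in> borel_measurable lebesgue"
    and lim: "AE x in lebesgue. (\<lambda>n. m n x) \<longlonglongrightarrow> k x"
  shows "(\<lambda>n. mulop (m n) F) \<longlonglongrightarrow> mulop k F"
  unfolding mulop_def
proof (rule cls_dominated(1)[where h = "\<lambda>x. c *\<^sub>R rep F x"])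
  have c: "0 \<le> c" using m by (auto simp: bdd_symbol_def)
  show "AE x in lebesgue. norm (m n x * rep F x) \<le> norm (c *\<^sub>R rep F x)" for n
    using m[of n] c unfolding bdd_symbol_def
    by (auto simp: norm_mult elim!: eventually_mono intro!: mult_right_mono)
  show "AE x in lebesgue. (\<lambda>n. m n x * rep F x) \<longlonglongrightarrow> k x * rep F x"
    using lim by eventually_elim (intro tendsto_intros)
qed (use m k in \<open>auto simp: bdd_symbol_def intro!: borel_measurable_times\<close>)

text \<open>Dominated convergence speaks of sequences; first countability of the parameter space
  carries it over to the limit along \<open>at t within S\<close>.\<close>

lemma mulop_continuous_at:
  fixes m :: "'b::first_countable_topology \<Rightarrow> real \<Rightarrow> complex"
  assumes m: "\<And>s. bdd_symbol (m s) c" and lim: "\<And>x. ((\<lambda>s. m s x) \<longlongrightarrow> k x) (at t within S)"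
    and k: "k \<in> borel_measurable lebesgue"
  shows "((\<lambda>s. mulop (m s) F) \<longlongrightarrow> mulop k F) (at t within S)"
  unfolding tendsto_at_iff_sequentially o_def
proof (intro allI impI)
  fix X assume X: "\<forall>i. X i \<in> S - {t}" "X \<longlonglongrightarrow> t"
  have "(\<lambda>n. m (X n) x) \<longlonglongrightarrow> k x" for x
    using lim[of x] X unfolding tendsto_at_iff_sequentially o_def by blast
  then show "(\<lambda>n. mulop (m (X n)) F) \<longlonglongrightarrow> mulop k F"
    by (intro mulop_tendsto[OF m k]) auto
qed

text \<open>Scalars of \<open>cL2\<close> are real, so multiplication by the imaginary unit is an
  operator, and an operator is complex linear when it is real linear and commutes with
  \<open>J\<close>.\<close>

definition J :: "cL2 \<Rightarrow> cL2" where "J = mulop (\<lambda>x. \<i>)"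

lemma bdd_symbol_i: "bdd_symbol (\<lambda>x. \<i>) 1"
  by (rule bdd_symbolI) auto

lemma bounded_linear_J: "bounded_linear J"
  unfolding J_def by (rule bounded_linear_mulop[OF bdd_symbol_i])

lemma J_J [simp]: "J (J F) = - F"
proof -
  have "J (J F) = mulop (\<lambda>x. of_real (-1)) F"
    unfolding J_def using mulop_mulop[OF bdd_symbol_i bdd_symbol_i] by simp
  then show ?thesis unfolding mulop_of_real by simp
qed

lemma inner_J_left: "J F \<bullet> G = - (F \<bullet> J G)"
proof -
  have "J F \<bullet> G = F \<bullet> mulop (\<lambda>x. of_real (-1) * \<i>) G"
    unfolding J_def using inner_mulop[OF bdd_symbol_i, of F G] by simp
  also have "mulop (\<lambda>x. of_real (-1) * \<i>) G = - J G"
    unfolding J_def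
    by (subst mulop_mulop[OF bdd_symbol_const bdd_symbol_i, symmetric]) (simp only: mulop_of_real, simp)
  finally show ?thesis by simp
qed

lemma inner_J_J [simp]: "J F \<bullet> J G = F \<bullet> G"
  by (simp add: inner_J_left)

lemma inner_J_self [simp]: "F \<bullet> J F = 0"
  using inner_J_left[of F F] by (simp add: inner_commute)

lemma norm_J [simp]: "norm (J F) = norm F"
  by (simp add: norm_eq_sqrt_inner)

lemma mulop_J: "bdd_symbol m c \<Longrightarrow> mulop m (J F) = J (mulop m F)"
  unfolding J_def by (rule mulop_commute[OF _ bdd_symbol_i])

lemma J_cls: "f \<in> L2_space \<Longrightarrow> J (cls f) = cls (\<lambda>x. \<i> * f x)"
  unfolding J_def by (rule mulop_cls[OF bdd_symbol_i])

lemma J_add: "J (F + G) = J F + J G" and J_diff: "J (F - G) = J F - J G"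
  and J_minus: "J (- F) = - J F" and J_scaleR: "J (r *\<^sub>R F) = r *\<^sub>R J F"
  using bounded_linear.linear[OF bounded_linear_J]
  by (simp_all add: linear_add linear_diff linear_neg linear_scale)

section \<open>Translations and the reflection as isometries\<close>

lemma lebesgue_affine_distr:
  fixes c t :: real assumes "\<bar>c\<bar> = 1"
  shows "distr lebesgue lebesgue (\<lambda>x. t + c * x) = lebesgue"
proof -
  have "lebesgue = density (distr lebesgue lebesgue (\<lambda>x. t + c * x)) (\<lambda>_. ennreal \<bar>c\<bar>)"
    using assms by (intro lebesgue_real_affine) auto
  also have "\<dots> = distr lebesgue lebesgue (\<lambda>x. t + c * x)"
    using assms by (simp add: density_1)
  finally show ?thesis by simp
qed

lemma affine_measurable_lebesgue:
  fixes c t :: real assumes "\<bar>c\<bar> = 1"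
  shows "(\<lambda>x. t + c * x) \<in> lebesgue \<rightarrow>\<^sub>M lebesgue"
  using lebesgue_affine_measurable[of "\<lambda>_. c" t] assms by auto

lemma AE_affine:
  fixes c t :: real assumes "\<bar>c\<bar> = 1" "AE x in lebesgue. P x"
  shows "AE x in lebesgue. P (t + c * x)"
proof -
  have "AE x in distr lebesgue lebesgue (\<lambda>x. t + c * x). P x"
    unfolding lebesgue_affine_distr[OF assms(1)] by (rule assms(2))
  then show ?thesis by (rule AE_distrD[OF affine_measurable_lebesgue[OF assms(1)]])
qed

lemma integral_affine:
  fixes c t :: real and f :: "real \<Rightarrow> 'a::{banach, second_countable_topology}"
  assumes "\<bar>c\<bar> = 1" "f \<in> borel_measurable lebesgue"
  shows "(LINT x|lebesgue. f (t + c * x)) = (LINT x|lebesgue. f x)"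
  using integral_distr[OF affine_measurable_lebesgue[OF assms(1), of t], of f] assms(2)
  unfolding lebesgue_affine_distr[OF assms(1)] by auto

lemma integrable_affine:
  fixes c t :: real and f :: "real \<Rightarrow> 'a::{banach, second_countable_topology}"
  assumes "\<bar>c\<bar> = 1" "integrable lebesgue f"
  shows "integrable lebesgue (\<lambda>x. f (t + c * x))"
  using integrable_distr[OF affine_measurable_lebesgue[OF assms(1), of t], of f] assms(2)
  unfolding lebesgue_affine_distr[OF assms(1)] by auto

lemma affine_L2:
  fixes c t :: real assumes "\<bar>c\<bar> = 1" "f \<in> L2_space"
  shows "(\<lambda>x. f (t + c * x)) \<in> L2_space"
  using assms integrable_affine[OF assms(1), of "\<lambda>x. (norm (f x))\<^sup>2" t]
    measurable_compose[OF affine_measurable_lebesgue[OF assms(1)]]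
  by (auto simp: L2_space_iff)

text \<open>\<open>c = 1\<close> is a translation, and \<open>t = 0\<close> with
  \<open>c = -1\<close> is the reflection. With \<open>\<bar>c\<bar> = 1\<close> both preserve the
  measure, so the change of variables is done once for the two.\<close>

definition affop :: "real \<Rightarrow> real \<Rightarrow> cL2 \<Rightarrow> cL2" where
  "affop t c F = cls (\<lambda>x. rep F (t + c * x))"

lemma affop_cls:
  assumes "\<bar>c\<bar> = 1" "f \<in> L2_space" shows "affop t c (cls f) = cls (\<lambda>x. f (t + c * x))"
  unfolding affop_def
  by (rule cls_eqI) (use AE_affine[OF assms(1) rep_cls[OF assms(2)]] assms in \<open>auto intro: affine_L2\<close>)

lemma affop_add: "\<bar>c\<bar> = 1 \<Longrightarrow> affop t c (F + G) = affop t c F + affop t c G"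
  using affop_cls[OF _ L2_space_add[OF rep_L2 rep_L2], of c t F G]
  by (simp add: cls_add affine_L2 affop_def)

lemma affop_scaleR: "\<bar>c\<bar> = 1 \<Longrightarrow> affop t c (r *\<^sub>R F) = r *\<^sub>R affop t c F"
  using affop_cls[OF _ L2_space_scaleR[OF rep_L2], of c t r F]
  by (simp add: cls_scaleR affine_L2 affop_def del: scaleR_conv_of_real)

lemma inner_affop: "\<bar>c\<bar> = 1 \<Longrightarrow> affop t c F \<bullet> affop t c G = F \<bullet> G"
  unfolding affop_def
  by (subst inner_cls) (auto intro!: affine_L2 simp: inner_rep integral_affine[of c "\<lambda>x. rep F x \<bullet> rep G x"])

lemma norm_affop: "\<bar>c\<bar> = 1 \<Longrightarrow> norm (affop t c F) = norm F"
  by (simp add: norm_eq_sqrt_inner inner_affop)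

lemma bounded_linear_affop: "\<bar>c\<bar> = 1 \<Longrightarrow> bounded_linear (affop t c)"
  by (rule bounded_linear_intro[where K = 1]) (auto simp: affop_add affop_scaleR norm_affop)

text \<open>The inverse Fourier transform is the transform followed by this reflection, and all
  inversions below are written in that way.\<close>

definition refl_op :: "cL2 \<Rightarrow> cL2" where "refl_op = affop 0 (-1)"

lemma refl_op_refl_op [simp]: "refl_op (refl_op F) = F"
  using affop_cls[of "-1" "\<lambda>x. rep F (-x)" 0] affine_L2[of "-1" "rep F" 0]
  by (simp add: refl_op_def affop_def)

lemma refl_op_cls: "f \<in> L2_space \<Longrightarrow> refl_op (cls f) = cls (\<lambda>x. f (- x))"
  using affop_cls[of "-1" f 0] by (simp add: refl_op_def)

lemma bounded_linear_refl_op: "bounded_linear refl_op"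
  unfolding refl_op_def by (rule bounded_linear_affop) simp

lemma norm_refl_op [simp]: "norm (refl_op F) = norm F"
  by (simp add: refl_op_def norm_affop)

lemma refl_op_J: "refl_op (J F) = J (refl_op F)"
  using refl_op_cls[of "\<lambda>x. \<i> * rep F x"] affine_L2[of "-1" "rep F" 0]
  by (simp add: J_def mulop_def refl_op_cls[of "rep F", simplified] mulop_cls[OF bdd_symbol_i, unfolded mulop_def] L2_space_mult_const)

section \<open>The Fourier transform\<close>

text \<open>The pointwise Fourier integral, meaningful for integrable functions. It does not see
  null sets (\<open>FI_cong_AE\<close>), so \<open>FI (rep F)\<close> depends only on the
  class.\<close>

definition FI :: "(real \<Rightarrow> complex) \<Rightarrow> real \<Rightarrow> complex" where
  "FI f \<xi> = (LINT x|lebesgue. cis (- (\<xi> * x)) * f x) / sqrt (2 * pi)"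

lemma cis_measurable [measurable]: "cis \<in> borel_measurable borel"
  by (intro borel_measurable_continuous_onI continuous_on_cis continuous_on_id)

lemma cis_lebesgue: "(\<lambda>x. cis (c * x)) \<in> borel_measurable lebesgue"
proof -
  have "(\<lambda>x. cis (c * x)) \<in> borel_measurable borel" by measurable
  then show ?thesis by (intro measurable_completion) simp
qed

lemma FI_integrable:
  assumes "integrable lebesgue f" shows "integrable lebesgue (\<lambda>x. cis (- (\<xi> * x)) * f x)"
proof (rule Bochner_Integration.integrable_bound[OF assms])
  show "(\<lambda>x. cis (- (\<xi> * x)) * f x) \<in> borel_measurable lebesgue"
    using assms cis_lebesgue[of "-\<xi>"] by (intro borel_measurable_times) auto
qed (simp add: norm_mult)

lemma FI_cong_AE:
  assumes "f \<in> borel_measurable lebesgue" "g \<in> borel_measurable lebesgue" "AE x in lebesgue. f x = g x"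
  shows "FI f = FI g"
proof
  fix \<xi>
  have "(LINT x|lebesgue. cis (- (\<xi> * x)) * f x) = (LINT x|lebesgue. cis (- (\<xi> * x)) * g x)"
    using assms cis_lebesgue[of "-\<xi>"]
    by (intro integral_cong_AE borel_measurable_times) (auto elim: eventually_mono)
  then show "FI f \<xi> = FI g \<xi>" by (simp add: FI_def)
qed

lemma FI_add: "integrable lebesgue f \<Longrightarrow> integrable lebesgue g \<Longrightarrow> FI (\<lambda>x. f x + g x) \<xi> = FI f \<xi> + FI g \<xi>"
  unfolding FI_def
  by (simp add: distrib_left FI_integrable add_divide_distrib)

lemma FI_diff: "integrable lebesgue f \<Longrightarrow> integrable lebesgue g \<Longrightarrow> FI (\<lambda>x. f x - g x) \<xi> = FI f \<xi> - FI g \<xi>"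
  unfolding FI_def
  by (simp add: right_diff_distrib FI_integrable diff_divide_distrib)

lemma FI_cmult: "FI (\<lambda>x. c * f x) \<xi> = c * FI f \<xi>"
  unfolding FI_def by (simp add: mult.left_commute[of _ c])

lemma norm_FI_le:
  assumes "integrable lebesgue f" shows "norm (FI f \<xi>) \<le> (LINT x|lebesgue. norm (f x))"
proof -
  have 1: "norm (LINT x|lebesgue. cis (- (\<xi> * x)) * f x) \<le> (LINT x|lebesgue. norm (cis (- (\<xi> * x)) * f x))"
    by (rule integral_norm_bound)
  have "1 \<le> 2 * pi" using pi_gt3 by linarith
  then have 2: "1 \<le> sqrt (2 * pi)" by simp
  have "norm (FI f \<xi>) = norm (LINT x|lebesgue. cis (- (\<xi> * x)) * f x) / sqrt (2 * pi)"
    by (simp add: FI_def norm_divide)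
  also have "\<dots> \<le> norm (LINT x|lebesgue. cis (- (\<xi> * x)) * f x) / 1"
    by (rule divide_left_mono) (use 2 in auto)
  finally show ?thesis using 1 by (simp add: norm_mult)
qed

lemma continuous_FI:
  assumes "integrable lebesgue f" shows "continuous_on UNIV (FI f)"
  unfolding continuous_on_sequentially o_def
proof (intro allI ballI impI, elim conjE)
  fix X :: "nat \<Rightarrow> real" and \<xi> assume X: "X \<longlonglongrightarrow> \<xi>"
  have "(\<lambda>n. LINT x|lebesgue. cis (- (X n * x)) * f x) \<longlonglongrightarrow> (LINT x|lebesgue. cis (- (\<xi> * x)) * f x)"
  proof (rule integral_dominated_convergence[where w = "\<lambda>x. norm (f x)"])
    show "AE x in lebesgue. (\<lambda>n. cis (- (X n * x)) * f x) \<longlonglongrightarrow> cis (- (\<xi> * x)) * f x"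
      by (intro AE_I2 tendsto_intros X)
  qed (use assms FI_integrable[OF assms] in \<open>auto simp: norm_mult\<close>)
  then show "(\<lambda>n. FI f (X n)) \<longlonglongrightarrow> FI f \<xi>" unfolding FI_def by (intro tendsto_intros) auto
qed

lemma FI_measurable: "integrable lebesgue f \<Longrightarrow> FI f \<in> borel_measurable lebesgue"
  by (rule measurable_completion) (simp add: borel_measurable_continuous_onI continuous_FI)

text \<open>Stated almost everywhere because it is applied to arbitrary representatives of
  classes.\<close>

definition csupp :: "real \<Rightarrow> (real \<Rightarrow> complex) \<Rightarrow> bool" where
  "csupp R f \<longleftrightarrow> (AE x in lebesgue. R < \<bar>x\<bar> \<longrightarrow> f x = 0)"

lemma bdd_symbol_indicator: "A \<in> sets lebesgue \<Longrightarrow> bdd_symbol (indicator A) 1"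
  by (rule bdd_symbolI) (auto simp: indicator_def)

lemma indicator_L2:
  assumes "A \<in> sets lebesgue" "A \<subseteq> {-R..R}"
  shows "(indicator A :: real \<Rightarrow> complex) \<in> L2_space"
  unfolding L2_space_iff
proof
  have "integrable lebesgue (indicat_real A)"
  proof (rule integrable_real_indicator)
    have "emeasure lebesgue A \<le> emeasure lebesgue {-R..R}"
      by (rule emeasure_mono) (use assms in auto)
    also have "\<dots> < \<infinity>" by (simp add: emeasure_lborel_Icc_eq)
    finally show "emeasure lebesgue A < \<infinity>" .
  qed (use assms in auto)
  moreover have "(\<lambda>x. (norm (indicator A x :: complex))\<^sup>2) = indicat_real A" by (auto simp: indicator_def)
  ultimately show "integrable lebesgue (\<lambda>x. (norm (indicator A x :: complex))\<^sup>2)" by simp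
qed (use assms in auto)

text \<open>Cauchy-Schwarz of \<open>norm (f x)\<close> against the indicator of
  \<open>{-R..R}\<close>. Together with \<open>norm_FI_le\<close>, the second bound turns
  convergence in L^2 on a fixed support into uniform convergence of the Fourier integrals.\<close>

lemma csupp_L1:
  assumes f: "f \<in> L2_space" "csupp R f"
  shows "integrable lebesgue f" "(LINT x|lebesgue. norm (f x)) \<le> norm (cls (indicator {-R..R})) * norm (cls f)"
proof -
  have ind: "(indicator {-R..R} :: real \<Rightarrow> complex) \<in> L2_space" by (rule indicator_L2) auto
  have nf: "(\<lambda>x. of_real (norm (f x)) :: complex) \<in> L2_space"
    using f by (auto simp: L2_space_iff)
  have eq: "AE x in lebesgue. indicator {-R..R} x \<bullet> (of_real (norm (f x)) :: complex) = norm (f x)"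
    using f(2) unfolding csupp_def
    by eventually_elim (auto simp: indicator_def abs_le_iff not_less[symmetric] simp flip: not_less)
  have int: "integrable lebesgue (\<lambda>x. (indicator {-R..R} x :: complex) \<bullet> of_real (norm (f x)))"
    by (rule integrable_L2_inner[OF ind nf])
  then have "integrable lebesgue (\<lambda>x. norm (f x))"
    using f by (subst integrable_cong_AE[OF _ _ eq, symmetric]) (auto simp: L2_space_iff)
  then show "integrable lebesgue f" using f by (subst integrable_norm_iff[symmetric]) (auto simp: L2_space_iff)
  have "(LINT x|lebesgue. norm (f x)) = cls (indicator {-R..R}) \<bullet> cls (\<lambda>x. of_real (norm (f x)))"
    using f by (subst inner_cls[OF ind nf], intro integral_cong_AE borel_measurable_integrable[OF int])
      (use eq in \<open>auto simp: L2_space_iff elim: eventually_mono\<close>)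
  also have "\<dots> \<le> norm (cls (indicator {-R..R})) * norm (cls (\<lambda>x. of_real (norm (f x))))"
    by (rule norm_cauchy_schwarz)
  also have "norm (cls (\<lambda>x. of_real (norm (f x)))) = norm (cls f)"
  proof -
    have "(norm (cls (\<lambda>x. of_real (norm (f x)))))\<^sup>2 = (norm (cls f))\<^sup>2"
      unfolding norm_cls_power2[OF nf] norm_cls_power2[OF f(1)] by simp
    then show ?thesis by (simp add: power2_eq_iff_nonneg)
  qed
  finally show "(LINT x|lebesgue. norm (f x)) \<le> norm (cls (indicator {-R..R})) * norm (cls f)" .
qed

section \<open>Plancherel for indicators of intervals\<close>

lemma nn_integral_sinc_squared: "(\<integral>\<^sup>+ x. ennreal ((sinc x)\<^sup>2) \<partial>lborel) = ennreal pi"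
proof -
  \<comment> \<open>Integration by parts: away from 0 the derivative of
    \<open>- sin x * sinc x\<close> is \<open>(sinc x)\<^sup>2 - sin (2 * x) / x\<close>, and the
    sine integral at \<open>2 * x\<close> supplies the missing term. At infinity only the limit
    \<open>pi / 2\<close> of \<open>Si\<close> survives.\<close>
  define K where "K x = Si (2 * x) - sin x * sinc x" for x
  have K: "(K has_real_derivative (sinc x)\<^sup>2) (at x)" for x
  proof -
    have 1: "((\<lambda>x. Si (2 * x)) has_real_derivative sinc (2 * x) * 2) (at x)"
      by (rule DERIV_chain2[OF DERIV_Si]) (auto intro!: derivative_eq_intros)
    have 2: "((\<lambda>x. sin x * sinc x) has_real_derivative sinc (2 * x) * 2 - (sinc x)\<^sup>2) (at x)"
    \<comment> \<open>At 0 the value of \<open>sinc\<close> is a convention and the quotient rule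
      does not apply. There the difference quotient of \<open>sin x * sinc x\<close> is
      \<open>(sinc h)\<^sup>2\<close>, which tends to 1.\<close>
    proof (cases "x = 0")
      case True
      have "((\<lambda>h. sinc h * sinc h) \<longlongrightarrow> 1 * 1) (at 0)"
        using isCont_sinc[of 0] by (intro tendsto_mult) (simp_all only: isCont_def if_True refl)
      then have "((\<lambda>h. sinc h * sinc h) \<longlongrightarrow> 1) (at 0)" by (simp only: mult_1)
      then have "((\<lambda>h. (sin h * sinc h - sin 0 * sinc 0) / h) \<longlongrightarrow> 1) (at 0)"
        by (rule Lim_transform_eventually[OF _ eventually_at_filter[THEN iffD2, OF always_eventually]])
           (auto simp: power2_eq_square)
      then show ?thesis using True by (simp add: has_field_derivative_iff)
    next
      case False
      have "((\<lambda>x. sin x * (sin x / x)) has_real_derivative sinc (2 * x) * 2 - (sinc x)\<^sup>2) (at x)"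
        using False by (auto intro!: derivative_eq_intros simp: field_simps power2_eq_square sin_double[of x, unfolded mult.commute[of 2 x]])
      then show ?thesis
        by (rule has_field_derivative_transform_within_open[where S = "- {0}"]) (use False in auto)
    qed
    show ?thesis unfolding K_def using DERIV_diff[OF 1 2] by simp
  qed
  have lim: "(K \<longlongrightarrow> pi / 2) at_top"
  proof -
    have "((\<lambda>x::real. sin x * sinc x) \<longlongrightarrow> 0) at_top"
    proof (rule Lim_null_comparison[where g = "\<lambda>x. 1 / x"])
      show "\<forall>\<^sub>F x in at_top. norm (sin x * sinc x) \<le> 1 / x"
        using eventually_gt_at_top[of 0]
      proof eventually_elim
        case (elim x)
        have "\<bar>sin x\<bar> * \<bar>sin x\<bar> \<le> 1 * 1" by (intro mult_mono) auto
        then show ?case using elim by (simp add: abs_mult divide_right_mono)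
      qed
      show "((\<lambda>x::real. 1 / x) \<longlongrightarrow> 0) at_top"
        by (intro tendsto_divide_0[OF tendsto_const] filterlim_at_top_imp_at_infinity filterlim_ident)
    qed
    moreover have "((\<lambda>x. Si (2 * x)) \<longlongrightarrow> pi / 2) at_top"
      by (rule filterlim_compose[OF Si_at_top])
         (intro filterlim_tendsto_pos_mult_at_top[OF tendsto_const] filterlim_ident, simp)
    ultimately show ?thesis unfolding K_def[abs_def] using tendsto_diff by fastforce
  qed
  have m: "(\<lambda>x. (sinc x)\<^sup>2) \<in> borel_measurable borel" by measurable
  have "(\<integral>\<^sup>+ x. ennreal ((sinc x)\<^sup>2) * indicator {0..} x \<partial>lborel) = ennreal (pi / 2 - K 0)"
    by (rule nn_integral_FTC_atLeast[OF m K _ lim]) auto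
  also have "K 0 = 0" by (simp add: K_def Si_alt_def flip: zero_ereal_def)
  finally have A: "(\<integral>\<^sup>+ x. ennreal ((sinc x)\<^sup>2) * indicator {0..} x \<partial>lborel) = ennreal (pi / 2)" by simp
  then have B: "(\<integral>\<^sup>+ x. ennreal ((sinc x)\<^sup>2) * indicator {..0} x \<partial>lborel) = ennreal (pi / 2)"
    using nn_integral_real_affine[of "\<lambda>x. ennreal ((sinc x)\<^sup>2) * indicator {0..} x" "-1" 0]
    by (simp add: indicator_def cong: if_cong)
  have "(\<integral>\<^sup>+ x. ennreal ((sinc x)\<^sup>2) \<partial>lborel)
      = (\<integral>\<^sup>+ x. ennreal ((sinc x)\<^sup>2) * indicator {0..} x + ennreal ((sinc x)\<^sup>2) * indicator {..0} x \<partial>lborel)"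
    by (rule nn_integral_cong_AE, use AE_lborel_singleton[of 0] in eventually_elim) (auto simp: indicator_def)
  also have "\<dots> = ennreal (pi / 2) + ennreal (pi / 2)"
    unfolding A[symmetric] by (subst nn_integral_add) (simp_all only: B A, measurable)
  also have "\<dots> = ennreal pi" by (simp flip: ennreal_plus)
  finally show ?thesis .
qed

text \<open>Half-open intervals, so that the difference of two indicators with the same left end is
  again one, at every point (\<open>ind_diff\<close>).\<close>

abbreviation ind :: "real \<Rightarrow> real \<Rightarrow> real \<Rightarrow> complex" where "ind a b \<equiv> indicator {a<..b}"

lemma ind_L2 [simp, intro]: "ind a b \<in> L2_space"
proof (rule indicator_L2)
  show "{a<..b} \<subseteq> {-(max \<bar>a\<bar> \<bar>b\<bar>)..max \<bar>a\<bar> \<bar>b\<bar>}" by auto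
qed auto

lemma csupp_ind: "\<bar>a\<bar> \<le> R \<Longrightarrow> \<bar>b\<bar> \<le> R \<Longrightarrow> csupp R (ind a b)"
  unfolding csupp_def by (rule AE_I2) (auto simp: indicator_def)

lemma integrable_ind: "integrable lebesgue (ind a b)"
  by (rule csupp_L1[where R = "max \<bar>a\<bar> \<bar>b\<bar>"]) (auto intro: csupp_ind)

lemma norm_cls_ind:
  assumes "a \<le> b" shows "(norm (cls (ind a b)))\<^sup>2 = b - a"
proof -
  have "(\<lambda>x. (norm (ind a b x))\<^sup>2) = indicat_real {a<..b}" by (auto simp: indicator_def)
  then show ?thesis using assms by (simp add: norm_cls_power2)
qed

lemma FI_ind:
  assumes "a \<le> b" "\<xi> \<noteq> 0"
  shows "FI (ind a b) \<xi> = (cis (- (\<xi> * b)) - cis (- (\<xi> * a))) * \<i> / of_real \<xi> / sqrt (2 * pi)"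
proof -
  define F where "F x = cis (- (\<xi> * x)) * \<i> / of_real \<xi>" for x
  have F: "(F has_vector_derivative cis (- (\<xi> * x))) (at x within {a..b})" for x
    unfolding F_def cis_conv_exp
    by (rule derivative_eq_intros has_vector_derivative_real_field refl | simp add: assms field_simps)+
  have "(LINT x|lebesgue. cis (- (\<xi> * x)) * ind a b x) = (LINT x|lebesgue. indicator {a..b} x *\<^sub>R cis (- (\<xi> * x)))"
  proof (rule integral_cong_AE)
    have "AE x in lebesgue. x \<noteq> a" using AE_lborel_singleton[of a] AE_completion by blast
    then show "AE x in lebesgue. cis (- (\<xi> * x)) * ind a b x = indicator {a..b} x *\<^sub>R cis (- (\<xi> * x))"
      by eventually_elim (auto simp: indicator_def)
  qed (use cis_lebesgue[of "-\<xi>"] in \<open>auto intro!: borel_measurable_times borel_measurable_scaleR borel_measurable_indicator\<close>)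
  also have "\<dots> = (LINT x|lborel. indicator {a..b} x *\<^sub>R cis (- (\<xi> * x)))"
    by (rule integral_completion) measurable
  also have "\<dots> = F b - F a"
    by (rule integral_FTC_Icc[OF assms(1) F]) (auto intro!: continuous_intros)
  finally have e: "(LINT x|lebesgue. cis (- (\<xi> * x)) * ind a b x) = F b - F a" .
  show ?thesis unfolding FI_def e F_def by (simp add: diff_divide_distrib left_diff_distrib)
qed

lemma norm_FI_ind:
  assumes "a \<le> b" "\<xi> \<noteq> 0"
  shows "(norm (FI (ind a b) \<xi>))\<^sup>2 = (b - a)\<^sup>2 / (2 * pi) * (sinc ((b - a) / 2 * \<xi>))\<^sup>2"
proof (cases "a = b")
  case False
  \<comment> \<open>Half the phase difference of the two exponentials, whose difference has modulus
    \<open>2 * \<bar>sin d\<bar>\<close>.\<close>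
  define d where "d = (b - a) / 2 * \<xi>"
  have d: "d \<noteq> 0" using assms False by (simp add: d_def)
  have "(norm (cis (- (\<xi> * b)) - cis (- (\<xi> * a))))\<^sup>2 = 2 - 2 * cos (2 * d)"
  proof -
    have "(norm (cis p - cis q))\<^sup>2 = 2 - 2 * cos (q - p)" for p q
      unfolding cmod_power2 using sin_cos_squared_add[of p] sin_cos_squared_add[of q]
      by (simp add: cos_diff power2_eq_square algebra_simps)
    moreover have "- (\<xi> * a) - - (\<xi> * b) = 2 * d" by (simp add: d_def field_simps)
    ultimately show ?thesis by metis
  qed
  also have "\<dots> = 4 * (sin d)\<^sup>2" by (simp add: cos_double_sin)
  finally have "(norm (FI (ind a b) \<xi>))\<^sup>2 = 4 * (sin d)\<^sup>2 / \<xi>\<^sup>2 / (2 * pi)"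
    unfolding FI_ind[OF assms] by (simp add: norm_divide norm_mult power_divide power_mult_distrib)
  also have "\<dots> = (b - a)\<^sup>2 / (2 * pi) * (sinc d)\<^sup>2"
  proof -
    define e where "e = b - a"
    have "e \<noteq> 0" "d\<^sup>2 = e\<^sup>2 * \<xi>\<^sup>2 / 4"
      using False by (auto simp: e_def d_def power_mult_distrib power_divide)
    then show ?thesis
      using assms(2) d unfolding e_def[symmetric] by (simp add: power_divide field_simps)
  qed
  finally show ?thesis by (simp add: d_def)
qed (simp add: FI_def)

text \<open>By \<open>norm_FI_ind\<close> the squared transform is a rescaled
  \<open>(sinc x)\<^sup>2\<close>. The substitution with factor \<open>(b - a) / 2\<close> leaves
  the integral \<open>pi\<close>, and the constants multiply to \<open>b - a\<close>.\<close>

lemma plancherel_ind: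
  assumes "a \<le> b" shows "FI (ind a b) \<in> L2_space \<and> (norm (cls (FI (ind a b))))\<^sup>2 = b - a"
proof -
  have ae: "AE \<xi> in lebesgue. \<xi> \<noteq> (0::real)" using AE_lborel_singleton[of "0::real"] AE_completion by blast
  have m: "(\<lambda>x. ennreal ((sinc x)\<^sup>2)) \<in> borel_measurable borel" by measurable
  have "(\<integral>\<^sup>+ \<xi>. ennreal ((norm (FI (ind a b) \<xi>))\<^sup>2) \<partial>lebesgue)
      = (\<integral>\<^sup>+ \<xi>. ennreal ((b - a)\<^sup>2 / (2 * pi)) * ennreal ((sinc ((b - a) / 2 * \<xi>))\<^sup>2) \<partial>lebesgue)"
  proof (rule nn_integral_cong_AE, use ae in eventually_elim)
    case (elim \<xi>)
    show ?case unfolding norm_FI_ind[OF assms elim] by (rule ennreal_mult') simp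
  qed
  also have "\<dots> = (\<integral>\<^sup>+ \<xi>. ennreal ((b - a)\<^sup>2 / (2 * pi)) * ennreal ((sinc ((b - a) / 2 * \<xi>))\<^sup>2) \<partial>lborel)"
    by (rule nn_integral_completion)
  also have "\<dots> = ennreal ((b - a)\<^sup>2 / (2 * pi)) * (\<integral>\<^sup>+ \<xi>. ennreal ((sinc ((b - a) / 2 * \<xi>))\<^sup>2) \<partial>lborel)"
    by (rule nn_integral_cmult) measurable
  also have "\<dots> = ennreal (b - a)"
  proof (cases "a = b")
    case False
    then have d: "(b - a) / 2 \<noteq> 0" "0 < b - a" using assms by auto
    have "ennreal pi = ennreal ((b - a) / 2) * (\<integral>\<^sup>+ \<xi>. ennreal ((sinc ((b - a) / 2 * \<xi>))\<^sup>2) \<partial>lborel)"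
      using nn_integral_real_affine[OF m d(1), of 0] d nn_integral_sinc_squared by (simp cong: if_cong)
    then have "ennreal ((b - a) / pi) * ennreal pi = ennreal ((b - a) / pi) * ennreal ((b - a) / 2) * (\<integral>\<^sup>+ \<xi>. ennreal ((sinc ((b - a) / 2 * \<xi>))\<^sup>2) \<partial>lborel)"
      by (simp add: mult.assoc)
    also have "ennreal ((b - a) / pi) * ennreal ((b - a) / 2) = ennreal ((b - a)\<^sup>2 / (2 * pi))"
      using d by (subst ennreal_mult[symmetric]) (auto simp: power2_eq_square field_simps)
    also have "ennreal ((b - a) / pi) * ennreal pi = ennreal (b - a)"
      using d by (subst ennreal_mult[symmetric]) auto
    finally show ?thesis by simp
  qed simp
  finally have *: "(\<integral>\<^sup>+ \<xi>. ennreal ((norm (FI (ind a b) \<xi>))\<^sup>2) \<partial>lebesgue) = ennreal (b - a)" .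
  have L: "FI (ind a b) \<in> L2_space"
    unfolding L2_space_iff integrable_iff_bounded using * FI_measurable[OF integrable_ind] by auto
  show ?thesis
    using L * unfolding nn_integral_cls[OF L] using assms by simp
qed

lemma ind_diff:
  assumes "c \<le> a" "a \<le> b" shows "ind c b x - ind c a x = ind a b x"
  using assms by (auto simp: indicator_def)

lemma plancherel_ind_diff:
  assumes "c \<le> a" "c \<le> b"
  shows "(norm (cls (ind c b) - cls (ind c a)))\<^sup>2 = \<bar>b - a\<bar>"
    "(norm (cls (FI (ind c b)) - cls (FI (ind c a))))\<^sup>2 = \<bar>b - a\<bar>"
proof -
  have *: "(norm (cls (ind c b) - cls (ind c a)))\<^sup>2 = b - a \<and>
    (norm (cls (FI (ind c b)) - cls (FI (ind c a))))\<^sup>2 = b - a" if "c \<le> a" "a \<le> b" for a b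
  proof -
    have "FI (\<lambda>x. ind c b x - ind c a x) = (\<lambda>\<xi>. FI (ind c b) \<xi> - FI (ind c a) \<xi>)"
      by (rule ext) (simp add: FI_diff integrable_ind)
    then have "cls (FI (ind c b)) - cls (FI (ind c a)) = cls (FI (ind a b))"
      using plancherel_ind[of c a] plancherel_ind[of c b] that by (simp add: cls_diff[symmetric] ind_diff)
    moreover have "cls (ind c b) - cls (ind c a) = cls (ind a b)"
      using that by (simp add: cls_diff[symmetric] ind_diff)
    ultimately show ?thesis using plancherel_ind[of a b] norm_cls_ind[of a b] that by simp
  qed
  show "(norm (cls (ind c b) - cls (ind c a)))\<^sup>2 = \<bar>b - a\<bar>"
    "(norm (cls (FI (ind c b)) - cls (FI (ind c a))))\<^sup>2 = \<bar>b - a\<bar>"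
    using *[of a b] *[of b a] assms by (auto simp: norm_minus_commute abs_if)
qed

text \<open>Polarisation: the real inner product of two vectors is determined by their norms and the
  norm of their difference. Differences of intervals with a common left end are intervals, so all
  three norms are known.\<close>

lemma gram_ind:
  assumes "c \<le> a" "c \<le> b"
  shows "cls (FI (ind c a)) \<bullet> cls (FI (ind c b)) = cls (ind c a) \<bullet> cls (ind c b)"
proof -
  have pol: "2 * (x \<bullet> y) = (norm x)\<^sup>2 + (norm y)\<^sup>2 - (norm (y - x))\<^sup>2" for x y :: cL2
    by (simp add: power2_norm_eq_inner inner_diff inner_commute)
  have "2 * (cls (FI (ind c a)) \<bullet> cls (FI (ind c b))) = 2 * (cls (ind c a) \<bullet> cls (ind c b))"
    unfolding pol plancherel_ind_diff[OF assms]
    using plancherel_ind[of c a] plancherel_ind[of c b] norm_cls_ind[of c a] norm_cls_ind[of c b] assms by simp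
  then show ?thesis by simp
qed

text \<open>The transform of a real function is Hermitian, so the imaginary part of the inner product of two
  such transforms is the integral of an odd function.\<close>

lemma gram_ind_J:
  assumes "c \<le> a" "c \<le> b"
  shows "cls (FI (ind c a)) \<bullet> J (cls (FI (ind c b))) = 0" "cls (ind c a) \<bullet> J (cls (ind c b)) = 0"
proof -
  have L: "FI (ind c a) \<in> L2_space" "FI (ind c b) \<in> L2_space" using plancherel_ind assms by auto
  have herm: "FI (ind c b) (- \<xi>) = cnj (FI (ind c b) \<xi>)" for b \<xi>
  proof -
    have "cnj (LINT x|lebesgue. cis (- (\<xi> * x)) * ind c b x) = (LINT x|lebesgue. cnj (cis (- (\<xi> * x)) * ind c b x))"
      by (rule Bochner_Integration.integral_cnj[symmetric])
    also have "\<dots> = (LINT x|lebesgue. cis (- (- \<xi> * x)) * ind c b x)"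
      by (rule Bochner_Integration.integral_cong) (auto simp: cis_cnj indicator_def)
    finally show ?thesis by (simp add: FI_def)
  qed
  define g where "g \<xi> = FI (ind c a) \<xi> \<bullet> (\<i> * FI (ind c b) \<xi>)" for \<xi>
  have g: "integrable lebesgue g" unfolding g_def using L by (intro integrable_L2_inner) auto
  have "(LINT \<xi>|lebesgue. g \<xi>) = (LINT \<xi>|lebesgue. g (0 + (-1) * \<xi>))"
    using g by (intro integral_affine[symmetric]) auto
  also have "\<dots> = (LINT \<xi>|lebesgue. - g \<xi>)"
    unfolding g_def by (rule Bochner_Integration.integral_cong) (auto simp: herm inner_complex_def)
  finally have "(LINT \<xi>|lebesgue. g \<xi>) = 0" by simp
  then show "cls (FI (ind c a)) \<bullet> J (cls (FI (ind c b))) = 0"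
    unfolding g_def using L by (simp add: J_cls inner_cls L2_space_mult_const)
  have "(\<lambda>x. ind c a x \<bullet> (\<i> * ind c b x)) = (\<lambda>x. 0)"
    by (auto simp: indicator_def inner_complex_def)
  then show "cls (ind c a) \<bullet> J (cls (ind c b)) = 0"
    by (simp add: J_cls inner_cls L2_space_mult_const)
qed

text \<open>The common left end \<open>-R\<close> is what the Gram identities ask for. The copies
  under \<open>J\<close> make the real span closed under complex scalars.\<close>

definition interval_classes :: "real \<Rightarrow> cL2 set" where
  "interval_classes R = (\<lambda>a. cls (ind (-R) a)) ` {-R..R} \<union> (\<lambda>a. J (cls (ind (-R) a))) ` {-R..R}"

lemma csupp_cong: "csupp R f \<Longrightarrow> AE x in lebesgue. g x = f x \<Longrightarrow> csupp R g"
  unfolding csupp_def by (auto elim: eventually_elim2)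

lemma csupp_rep_add:
  assumes "csupp R (rep F)" "csupp R (rep G)" shows "csupp R (rep (F + G))"
  using assms rep_add[of F G] unfolding csupp_def by eventually_elim auto

lemma csupp_rep_scaleR:
  assumes "csupp R (rep F)" shows "csupp R (rep (c *\<^sub>R F))"
  using assms rep_scaleR[of c F] unfolding csupp_def by eventually_elim auto

lemma csupp_rep_cls: "f \<in> L2_space \<Longrightarrow> csupp R f \<Longrightarrow> csupp R (rep (cls f))"
  by (erule csupp_cong) (rule rep_cls)

lemma FI_rep_cls: "f \<in> L2_space \<Longrightarrow> FI (rep (cls f)) = FI f"
  by (intro FI_cong_AE rep_cls) (auto simp: L2_space_measurable)

lemma FI_rep_add:
  assumes "csupp R (rep F)" "csupp R (rep G)"
  shows "FI (rep (F + G)) = (\<lambda>\<xi>. FI (rep F) \<xi> + FI (rep G) \<xi>)"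
proof -
  have "FI (rep (F + G)) = FI (\<lambda>x. rep F x + rep G x)"
    by (rule FI_cong_AE) (auto intro: rep_add)
  then show ?thesis using csupp_L1(1)[OF rep_L2 assms(1)] csupp_L1(1)[OF rep_L2 assms(2)]
    by (auto simp: FI_add)
qed

lemma FI_rep_scaleR: "FI (rep (c *\<^sub>R F)) = (\<lambda>\<xi>. c *\<^sub>R FI (rep F) \<xi>)"
proof -
  have "FI (rep (c *\<^sub>R F)) = FI (\<lambda>x. of_real c * rep F x)"
    by (rule FI_cong_AE) (use rep_scaleR[of c F] in \<open>auto simp: scaleR_conv_of_real\<close>)
  then show ?thesis by (auto simp: FI_cmult scaleR_conv_of_real)
qed

lemma FI_rep_J: "FI (rep (J F)) = (\<lambda>\<xi>. \<i> * FI (rep F) \<xi>)"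
proof -
  have "FI (rep (J F)) = FI (\<lambda>x. \<i> * rep F x)"
    by (rule FI_cong_AE) (use rep_mulop[OF bdd_symbol_i] in \<open>auto simp: J_def\<close>)
  then show ?thesis by (auto simp: FI_cmult)
qed

text \<open>The side conditions travel with the identity: additivity of \<open>FI\<close> needs
  integrability, which the compact support provides, and rules for \<open>cls\<close> need
  membership in \<open>L2_space\<close>. Bundled in this way, the predicate defines a subspace in
  each variable.\<close>

definition plancherel_pair :: "real \<Rightarrow> cL2 \<Rightarrow> cL2 \<Rightarrow> bool" where
  "plancherel_pair R F G \<longleftrightarrow> csupp R (rep F) \<and> csupp R (rep G) \<and> FI (rep F) \<in> L2_space \<and>
     FI (rep G) \<in> L2_space \<and> cls (FI (rep F)) \<bullet> cls (FI (rep G)) = F \<bullet> G"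

lemma plancherel_pair_sym: "plancherel_pair R F G \<Longrightarrow> plancherel_pair R G F"
  by (auto simp: plancherel_pair_def inner_commute)

lemma plancherel_pair_generators:
  assumes "F \<in> interval_classes R" "G \<in> interval_classes R"
  shows "plancherel_pair R F G"
proof -
  have B: "plancherel_pair R (cls (ind (-R) a)) (cls (ind (-R) b))"
    "plancherel_pair R (J (cls (ind (-R) a))) (cls (ind (-R) b))"
    "plancherel_pair R (J (cls (ind (-R) a))) (J (cls (ind (-R) b)))" if "a \<in> {-R..R}" "b \<in> {-R..R}" for a b
  proof -
    have F: "FI (ind (-R) a) \<in> L2_space" "FI (ind (-R) b) \<in> L2_space" using that plancherel_ind by auto
    have c: "csupp R (rep (cls (ind (-R) a)))" "csupp R (rep (cls (ind (-R) b)))"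
      using that by (auto intro!: csupp_rep_cls csupp_ind)
    have cJ: "csupp R (rep (J (cls (ind (-R) a))))" "csupp R (rep (J (cls (ind (-R) b))))"
      using c rep_mulop[OF bdd_symbol_i, of "cls (ind (-R) a)"] rep_mulop[OF bdd_symbol_i, of "cls (ind (-R) b)"]
      unfolding csupp_def J_def by (auto elim: eventually_elim2)
    have g: "cls (FI (ind (-R) a)) \<bullet> cls (FI (ind (-R) b)) = cls (ind (-R) a) \<bullet> cls (ind (-R) b)"
      using that by (intro gram_ind) auto
    have gJ: "cls (FI (ind (-R) a)) \<bullet> J (cls (FI (ind (-R) b))) = cls (ind (-R) a) \<bullet> J (cls (ind (-R) b))"
      using gram_ind_J[of "-R" a b] that by auto
    show "plancherel_pair R (cls (ind (-R) a)) (cls (ind (-R) b))"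
      using F c g by (simp add: plancherel_pair_def FI_rep_cls)
    show "plancherel_pair R (J (cls (ind (-R) a))) (cls (ind (-R) b))"
      using F c cJ gJ by (simp add: plancherel_pair_def FI_rep_J FI_rep_cls L2_space_mult_const flip: J_cls)
         (simp add: inner_J_left)
    show "plancherel_pair R (J (cls (ind (-R) a))) (J (cls (ind (-R) b)))"
      using F c cJ g by (simp add: plancherel_pair_def FI_rep_J FI_rep_cls L2_space_mult_const flip: J_cls)
  qed
  show ?thesis
    using assms unfolding interval_classes_def by (auto intro: B plancherel_pair_sym)
qed

lemma rep_zero: "AE x in lebesgue. rep 0 x = 0"
  using rep_cls[of "\<lambda>x. 0"] by (simp add: cls_zero)

lemma FI_rep_zero: "FI (rep 0) = (\<lambda>\<xi>. 0)"
  using FI_rep_scaleR[of 0 0] by simp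

lemma plancherel_pair_subspace:
  assumes "csupp R (rep G)" "FI (rep G) \<in> L2_space" shows "subspace {F. plancherel_pair R F G}"
proof (rule subspaceI)
  show "0 \<in> {F. plancherel_pair R F G}"
    using assms rep_zero by (auto simp: plancherel_pair_def cls_zero csupp_def FI_rep_zero)
  show "F + F' \<in> {F. plancherel_pair R F G}"
    if "F \<in> {F. plancherel_pair R F G}" "F' \<in> {F. plancherel_pair R F G}" for F F'
    using that unfolding plancherel_pair_def
    by (auto simp: FI_rep_add cls_add inner_add_left L2_space_add csupp_rep_add)
  show "c *\<^sub>R F \<in> {F. plancherel_pair R F G}" if "F \<in> {F. plancherel_pair R F G}" for c F
    using that unfolding plancherel_pair_def
    by (auto simp: FI_rep_scaleR cls_scaleR L2_space_scaleR csupp_rep_scaleR simp del: scaleR_conv_of_real)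
qed

lemma plancherel_pair_span:
  assumes "F \<in> span (interval_classes R)" "G \<in> span (interval_classes R)" "0 \<le> R"
  shows "plancherel_pair R F G"
proof -
  have 1: "plancherel_pair R F G" if F: "F \<in> span (interval_classes R)" and G: "G \<in> interval_classes R" for F G
  proof -
    have "plancherel_pair R G G" by (rule plancherel_pair_generators[OF G G])
    then have "subspace {F. plancherel_pair R F G}"
      by (intro plancherel_pair_subspace) (auto simp: plancherel_pair_def)
    from span_subspace_induct[OF F this] show ?thesis using plancherel_pair_generators[OF _ G] by auto
  qed
  \<comment> \<open>Pairing \<open>G\<close> with some generator yields the side conditions on
    \<open>G\<close>, namely compact support and square integrability of its transform. Here
    \<open>0 \<le> R\<close> guarantees that a generator exists.\<close>
  have "cls (ind (-R) R) \<in> interval_classes R" using assms(3) by (auto simp: interval_classes_def)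
  from 1[OF assms(2) this] have "subspace {F. plancherel_pair R F G}"
    by (intro plancherel_pair_subspace) (auto simp: plancherel_pair_def)
  from span_subspace_induct[OF assms(1) this] show ?thesis
    using plancherel_pair_sym[OF 1[OF assms(2)]] by auto
qed

section \<open>Density of step functions\<close>

lemma subspace_closure:
  fixes S :: "'a::real_normed_vector set" assumes "subspace S" shows "subspace (closure S)"
proof (rule subspaceI)
  show "0 \<in> closure S" using assms closure_subset subspace_0 by blast
  show "x + y \<in> closure S" if xy: "x \<in> closure S" "y \<in> closure S" for x y
  proof -
    from xy obtain X Y where "\<And>n. X n \<in> S" "X \<longlonglongrightarrow> x" "\<And>n. Y n \<in> S" "Y \<longlonglongrightarrow> y"
      unfolding closure_sequential by blast
    then have "\<forall>n. X n + Y n \<in> S" "(\<lambda>n. X n + Y n) \<longlonglongrightarrow> x + y"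
      using assms by (auto intro: subspace_add tendsto_add)
    then show ?thesis unfolding closure_sequential by (intro exI[of _ "\<lambda>n. X n + Y n"]) auto
  qed
  show "c *\<^sub>R x \<in> closure S" if "x \<in> closure S" for c x
  proof -
    from that obtain X where "\<And>n. X n \<in> S" "X \<longlonglongrightarrow> x"
      unfolding closure_sequential by blast
    then have "\<forall>n. c *\<^sub>R X n \<in> S" "(\<lambda>n. c *\<^sub>R X n) \<longlonglongrightarrow> c *\<^sub>R x"
      using assms by (auto intro: subspace_scale tendsto_intros)
    then show ?thesis unfolding closure_sequential by (intro exI[of _ "\<lambda>n. c *\<^sub>R X n"]) auto
  qed
qed

definition interval_space :: "real \<Rightarrow> cL2 set" where
  "interval_space R = closure (span (interval_classes R))"

lemma interval_space_subspace: "subspace (interval_space R)"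
  unfolding interval_space_def by (rule subspace_closure[OF subspace_span])

lemma interval_space_limit: "(\<And>n. X n \<in> interval_space R) \<Longrightarrow> X \<longlonglongrightarrow> F \<Longrightarrow> F \<in> interval_space R"
  unfolding interval_space_def using closed_sequential_limits[of "closure (span (interval_classes R))"] by blast

text \<open>Stability under \<open>J\<close> makes this closed real subspace a complex one, which
  simple functions with complex values require.\<close>

lemma interval_space_J:
  assumes "F \<in> interval_space R" shows "J F \<in> interval_space R"
proof -
  interpret J: bounded_linear J by (rule bounded_linear_J)
  have J: "J F \<in> span (interval_classes R)" if "F \<in> interval_classes R" for F
  proof -
    from that obtain a where a: "a \<in> {-R..R}" "F = cls (ind (-R) a) \<or> F = J (cls (ind (-R) a))"
      by (auto simp: interval_classes_def)
    then have "cls (ind (-R) a) \<in> span (interval_classes R)" "J (cls (ind (-R) a)) \<in> span (interval_classes R)"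
      by (auto simp: interval_classes_def intro!: span_base)
    with a(2) show ?thesis by (auto intro: span_neg)
  qed
  have sp: "J ` span (interval_classes R) \<subseteq> span (interval_classes R)"
    unfolding linear_span_image[OF J.linear, symmetric] by (rule span_minimal) (use J in auto)
  have "J ` closure (span (interval_classes R)) \<subseteq> closure (J ` span (interval_classes R))"
    by (rule closure_bounded_linear_image_subset[OF bounded_linear_J])
  also have "\<dots> \<subseteq> closure (span (interval_classes R))" by (rule closure_mono[OF sp])
  finally show ?thesis using assms unfolding interval_space_def by blast
qed

lemma interval_space_cmult:
  assumes "f \<in> L2_space" "cls f \<in> interval_space R" shows "cls (\<lambda>x. c * f x) \<in> interval_space R"
proof -
  have "cls (\<lambda>x. c * f x) = cls (\<lambda>x. Re c *\<^sub>R f x + Im c *\<^sub>R (\<i> * f x))"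
    by (rule arg_cong[of _ _ cls]) (auto simp: complex_eq_iff)
  also have "\<dots> = Re c *\<^sub>R cls f + Im c *\<^sub>R J (cls f)"
    using assms(1) by (simp add: cls_add cls_scaleR L2_space_scaleR L2_space_mult_const J_cls del: scaleR_conv_of_real)
  finally show ?thesis
    using assms interval_space_J[OF assms(2)] interval_space_subspace[of R]
    by (simp add: subspace_add subspace_scale)
qed

lemma indicator_inter_L2:
  assumes "A \<in> sets lebesgue" shows "(indicator (A \<inter> {-R<..R}) :: real \<Rightarrow> complex) \<in> L2_space"
  by (rule indicator_L2[where R = R]) (use assms in auto)

text \<open>Half-lines are stable under intersection and generate the Borel sets, so the pi-lambda
  theorem applies. Complements inside \<open>{-R<..R}\<close> are differences of classes, and
  countable disjoint unions are norm limits by dominated convergence.\<close>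

lemma interval_space_borel:
  assumes "A \<in> sets borel" "0 \<le> R"
  shows "cls (indicator (A \<inter> {-R<..R})) \<in> interval_space R"
proof -
  have R: "cls (ind (-R) a) \<in> interval_space R" if "a \<in> {-R..R}" for a
    unfolding interval_space_def
    by (intro subsetD[OF closure_subset] span_base) (use that in \<open>auto simp: interval_classes_def\<close>)
  have z: "cls (\<lambda>x. 0) \<in> interval_space R" by (simp add: cls_zero subspace_0[OF interval_space_subspace])
  have eq: "sets (borel :: real measure) = sigma_sets UNIV (range (\<lambda>a. {..a}))"
    unfolding borel_eq_atMost by (rule sets_measure_of) auto
  have "Int_stable (range (\<lambda>a::real. {..a}))"
    by (auto simp: Int_stable_def)
  moreover have "range (\<lambda>a::real. {..a}) \<subseteq> Pow UNIV" by simp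
  moreover note assms(1)[unfolded eq]
  ultimately show ?thesis
  proof (induction rule: sigma_sets_induct_disjoint)
    case (basic A)
    then obtain a where A: "A = {..a}" by auto
    show ?case
    proof (cases "-R \<le> a")
      case True
      then have "A \<inter> {-R<..R} = {-R<..min a R}" using A by auto
      then show ?thesis using R[of "min a R"] True assms(2) by auto
    next
      case False
      then have "A \<inter> {-R<..R} = {}" using A by auto
      then show ?thesis using z by (simp add: indicator_def)
    qed
  next
    case empty
    show ?case using z by (simp add: indicator_def)
  next
    case (compl A)
    have A: "A \<in> sets lebesgue" using compl(1) eq by (metis sets_completionI_sets sets_lborel)
    have "cls (indicator ((UNIV - A) \<inter> {-R<..R})) = cls (\<lambda>x. ind (-R) R x - indicator (A \<inter> {-R<..R}) x)"
      by (rule arg_cong[of _ _ cls]) (auto simp: indicator_def)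
    also have "\<dots> = cls (ind (-R) R) - cls (indicator (A \<inter> {-R<..R}))"
      by (rule cls_diff) (use indicator_inter_L2[OF A] in auto)
    finally show ?case using compl(2) R[of R] assms(2) interval_space_subspace[of R] by (simp add: subspace_diff)
  next
    case (union A)
    have Am: "A n \<in> sets lebesgue" for n using union(2) eq by (metis range_subsetD sets_completionI_sets sets_lborel)
    have "(\<lambda>x. \<Sum>i<n. indicator (A i \<inter> {-R<..R}) x :: complex) = indicator ((\<Union>i<n. A i) \<inter> {-R<..R})" for n
      by (rule ext, subst indicator_UN_disjoint[symmetric])
         (use union(1) in \<open>auto simp: disjoint_family_on_def indicator_def\<close>)
    moreover have "cls (\<lambda>x. \<Sum>i<n. indicator (A i \<inter> {-R<..R}) x) \<in> interval_space R" for n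
      using cls_sum[of "{..<n}" "\<lambda>i. indicator (A i \<inter> {-R<..R})"] indicator_inter_L2[OF Am]
        union(3) by (auto intro!: subspace_sum[OF interval_space_subspace])
    ultimately have in_space: "cls (indicator ((\<Union>i<n. A i) \<inter> {-R<..R})) \<in> interval_space R" for n by simp
    have "(\<lambda>n. cls (indicator ((\<Union>i<n. A i) \<inter> {-R<..R}))) \<longlonglongrightarrow> cls (indicator ((\<Union>i. A i) \<inter> {-R<..R}))"
    proof (rule cls_dominated(1)[where h = "ind (-R) R"])
      show "AE x in lebesgue. (\<lambda>n. indicator ((\<Union>i<n. A i) \<inter> {-R<..R}) x :: complex)
          \<longlonglongrightarrow> indicator ((\<Union>i. A i) \<inter> {-R<..R}) x"
      proof (rule AE_I2)
        fix x
        have "(\<lambda>n. indicator (\<Union>i<n. A i) x :: complex) \<longlonglongrightarrow> indicator (\<Union>i. A i) x"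
          by (rule LIMSEQ_indicator_UN)
        then have "(\<lambda>n. indicator (\<Union>i<n. A i) x * indicator {-R<..R} x :: complex)
            \<longlonglongrightarrow> indicator (\<Union>i. A i) x * indicator {-R<..R} x"
          by (intro tendsto_intros)
        then show "(\<lambda>n. indicator ((\<Union>i<n. A i) \<inter> {-R<..R}) x :: complex)
          \<longlonglongrightarrow> indicator ((\<Union>i. A i) \<inter> {-R<..R}) x" by (simp add: indicator_inter_arith)
      qed
    qed (use Am in \<open>auto simp: indicator_def intro!: borel_measurable_indicator\<close>)
    then show ?case by (rule interval_space_limit[OF in_space])
  qed
qed

text \<open>A Lebesgue set differs from a Borel set by part of a null set, which the class of its
  indicator ignores.\<close>

lemma interval_space_lebesgue:
  assumes "A \<in> sets lebesgue" "0 \<le> R"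
  shows "cls (indicator (A \<inter> {-R<..R})) \<in> interval_space R"
proof -
  obtain S N N' where A: "A = S \<union> N" "N \<subseteq> N'" "N' \<in> null_sets lborel" "S \<in> sets lborel"
    using assms(1) by (rule sets_completionE)
  have "AE x in lebesgue. x \<notin> N'" using A(3) AE_completion AE_not_in by blast
  then have "AE x in lebesgue. (indicator (A \<inter> {-R<..R}) x :: complex) = indicator (S \<inter> {-R<..R}) x"
    by eventually_elim (use A in \<open>auto simp: indicator_def\<close>)
  then have "cls (indicator (A \<inter> {-R<..R})) = cls (indicator (S \<inter> {-R<..R}))"
    by (rule cls_eqI[OF indicator_inter_L2[OF assms(1)]])
  then show ?thesis using interval_space_borel[of S R] A assms(2) by simp
qed

text \<open>Simple functions bounded by \<open>2 * norm (f x)\<close> converge to \<open>f\<close>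
  pointwise, hence in norm, and each of them is a finite complex combination of indicators of level
  sets.\<close>

lemma interval_space_csupp:
  assumes f: "f \<in> L2_space" "csupp R f" and R: "0 \<le> R"
  shows "cls f \<in> interval_space R"
proof -
  obtain s where s: "\<And>i. simple_function lebesgue (s i)" "\<And>x. (\<lambda>i. s i x) \<longlonglongrightarrow> f x"
      "\<And>i x. norm (s i x) \<le> 2 * norm (f x)"
    using borel_measurable_implies_sequence_metric[OF L2_space_measurable[OF f(1)], of 0]
    by (auto simp: dist_norm)
  have in_space: "cls (\<lambda>x. s i x * ind (-R) R x) \<in> interval_space R" for i
  proof -
    have fin: "finite (range (s i))" and pre: "\<And>y. s i -` {y} \<in> sets lebesgue"
      using simple_functionD[OF s(1)[of i]] by auto
    have "(\<lambda>x. s i x * ind (-R) R x) = (\<lambda>x. \<Sum>y\<in>range (s i). y * indicator (s i -` {y} \<inter> {-R<..R}) x)"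
    proof
      fix x
      have "s i x = (\<Sum>y\<in>range (s i). indicator (s i -` {y}) x *\<^sub>R y)"
        using simple_function_indicator_representation_banach[OF s(1)[of i],
          unfolded space_completion space_lborel space_borel Int_UNIV_right, OF UNIV_I[of x]] .
      then have "s i x * ind (-R) R x = (\<Sum>y\<in>range (s i). indicator (s i -` {y}) x *\<^sub>R y) * ind (-R) R x"
        by (rule arg_cong[where f = "\<lambda>z. z * ind (-R) R x"])
      also have "\<dots> = (\<Sum>y\<in>range (s i). y * indicator (s i -` {y} \<inter> {-R<..R}) x)"
        unfolding sum_distrib_right by (rule sum.cong) (auto simp: indicator_def)
      finally show "s i x * ind (-R) R x = (\<Sum>y\<in>range (s i). y * indicator (s i -` {y} \<inter> {-R<..R}) x)" .
    qed
    moreover have "cls (\<lambda>x. \<Sum>y\<in>range (s i). y * indicator (s i -` {y} \<inter> {-R<..R}) x)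
        = (\<Sum>y\<in>range (s i). cls (\<lambda>x. y * indicator (s i -` {y} \<inter> {-R<..R}) x))"
      using cls_sum[OF fin, of "\<lambda>y x. y * indicator (s i -` {y} \<inter> {-R<..R}) x"]
        indicator_inter_L2[OF pre] by auto
    ultimately show ?thesis
      using interval_space_cmult[OF indicator_inter_L2[OF pre] interval_space_lebesgue[OF pre R]]
      by (auto intro!: subspace_sum[OF interval_space_subspace])
  qed
  have "(\<lambda>i. cls (\<lambda>x. s i x * ind (-R) R x)) \<longlonglongrightarrow> cls (\<lambda>x. f x * ind (-R) R x)"
  proof (rule cls_dominated(1)[where h = "\<lambda>x. 2 *\<^sub>R f x"])
    show "AE x in lebesgue. norm (s n x * ind (-R) R x) \<le> norm (2 *\<^sub>R f x)" for n
      using s(3) by (intro AE_I2) (auto simp: indicator_def norm_mult)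
    show "AE x in lebesgue. (\<lambda>n. s n x * ind (-R) R x) \<longlonglongrightarrow> f x * ind (-R) R x"
      using s(2) by (intro AE_I2 tendsto_intros)
  qed (use f borel_measurable_simple_function[OF s(1)] in
    \<open>auto intro!: borel_measurable_times borel_measurable_indicator simp: L2_space_measurable L2_space_scaleR\<close>)
  then have "cls (\<lambda>x. f x * ind (-R) R x) \<in> interval_space R" by (rule interval_space_limit[OF in_space])
  moreover have "cls f = cls (\<lambda>x. f x * ind (-R) R x)"
  proof (rule cls_eqI[OF f(1)])
    have "AE x in lebesgue. x \<noteq> -R" using AE_lborel_singleton[of "-R"] AE_completion by blast
    then show "AE x in lebesgue. f x = f x * ind (-R) R x"
      using f(2) unfolding csupp_def by eventually_elim (auto simp: indicator_def abs_if split: if_splits)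
  qed
  ultimately show ?thesis by simp
qed

text \<open>On the span of the intervals \<open>FI\<close> is isometric, so transforms of an
  approximating sequence are Cauchy. On a bounded support the same transforms converge pointwise to
  \<open>FI f\<close> by the L^1 bound, and the two limits coincide.\<close>

theorem plancherel_csupp:
  assumes f: "f \<in> L2_space" "csupp R f" and R: "0 \<le> R"
  shows "FI f \<in> L2_space \<and> norm (cls (FI f)) = norm (cls f)"
proof -
  obtain X where X: "\<And>n. X n \<in> span (interval_classes R)" "X \<longlonglongrightarrow> cls f"
    using interval_space_csupp[OF assms] unfolding interval_space_def closure_sequential by blast
  have p: "plancherel_pair R (X n - X m) (X n - X m)" "plancherel_pair R (X n) (X n)" for n m
    using X(1) R by (auto intro!: plancherel_pair_span span_diff)
  have c: "csupp R (rep (X n))" and L: "FI (rep (X n)) \<in> L2_space" for n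
    using p(2)[of n] by (auto simp: plancherel_pair_def)
  define Y where "Y n = cls (FI (rep (X n)))" for n
  have nY: "norm (Y n) = norm (X n)" for n
    using p(2)[of n] by (simp add: plancherel_pair_def Y_def norm_eq_sqrt_inner)
  have dY: "norm (Y n - Y m) = norm (X n - X m)" for n m
  proof -
    \<comment> \<open>\<open>FI_rep_add\<close> speaks of sums of compactly supported classes; this
      detour through \<open>X n - X m + X m\<close> makes it a statement about differences.\<close>
    have "FI (rep (X n)) = FI (rep (X n - X m + X m))" by simp
    also have "\<dots> = (\<lambda>\<xi>. FI (rep (X n - X m)) \<xi> + FI (rep (X m)) \<xi>)"
      by (rule FI_rep_add[OF _ c]) (use p(1)[of n m] in \<open>simp add: plancherel_pair_def\<close>)
    finally have "Y n - Y m = cls (FI (rep (X n - X m)))"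
      using p(1)[of n m] L by (simp add: Y_def plancherel_pair_def cls_add)
    then show ?thesis using p(1)[of n m] by (simp add: plancherel_pair_def norm_eq_sqrt_inner)
  qed
  have "Cauchy X" using X(2) by (rule LIMSEQ_imp_Cauchy)
  then have "Cauchy Y" unfolding Cauchy_def dist_norm dY .
  then obtain G where G: "Y \<longlonglongrightarrow> G" using Cauchy_convergent convergent_def by blast
  have lim: "(\<lambda>n. FI (rep (X n)) \<xi>) \<longlonglongrightarrow> FI f \<xi>" for \<xi>
  proof -
    define K where "K = norm (cls (indicator {-R..R}))"
    have "(\<lambda>n. K * norm (X n - cls f)) \<longlonglongrightarrow> K * 0"
      using X(2) by (intro tendsto_mult tendsto_const) (simp add: tendsto_norm_zero_iff LIM_zero)
    then have to0: "(\<lambda>n. K * norm (X n - cls f)) \<longlonglongrightarrow> 0" by simp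
    have le: "norm (FI (rep (X n)) \<xi> - FI f \<xi>) \<le> K * norm (X n - cls f)" for n
    proof -
      have i: "integrable lebesgue (rep (X n))" "integrable lebesgue f"
        using csupp_L1(1)[OF rep_L2 c] csupp_L1(1)[OF f] by auto
      have s: "csupp R (\<lambda>x. rep (X n) x - f x)" using c[of n] f(2) unfolding csupp_def by eventually_elim auto
      have l: "(\<lambda>x. rep (X n) x - f x) \<in> L2_space" using f by auto
      have "norm (FI (rep (X n)) \<xi> - FI f \<xi>) = norm (FI (\<lambda>x. rep (X n) x - f x) \<xi>)"
        by (simp add: FI_diff i)
      also have "\<dots> \<le> (LINT x|lebesgue. norm (rep (X n) x - f x))" by (rule norm_FI_le) (use i in auto)
      also have "\<dots> \<le> K * norm (cls (\<lambda>x. rep (X n) x - f x))" unfolding K_def by (rule csupp_L1(2)[OF l s])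
      finally show ?thesis using f by (simp add: cls_diff)
    qed
    have "(\<lambda>n. FI (rep (X n)) \<xi> - FI f \<xi>) \<longlonglongrightarrow> 0"
      by (rule Lim_null_comparison[OF always_eventually to0]) (use le in blast)
    then show ?thesis by (rule LIM_zero_cancel)
  qed
  have "FI f \<in> L2_space \<and> cls (FI f) = G"
    by (rule cls_limit_unique[OF G[unfolded Y_def] L]) (use lim in auto)
  moreover have "norm G = norm (cls f)"
    using tendsto_norm[OF G] tendsto_norm[OF X(2)] unfolding nY by (rule LIMSEQ_unique)
  ultimately show ?thesis by simp
qed

section \<open>Truncation in space, and extension of the transform to all classes\<close>

lemma csupp_mono: "csupp R f \<Longrightarrow> R \<le> R' \<Longrightarrow> csupp R' f"
  unfolding csupp_def by (erule eventually_mono) auto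

definition trunc :: "real \<Rightarrow> cL2 \<Rightarrow> cL2" where "trunc R = mulop (indicator {-R..R})"

lemma bdd_symbol_Icc: "bdd_symbol (indicator {a..b}) 1"
  by (rule bdd_symbol_indicator) auto

lemma csupp_trunc: "csupp R (rep (trunc R F))"
  using rep_mulop[OF bdd_symbol_Icc, of "-R" R F] unfolding csupp_def trunc_def
  by eventually_elim (auto simp: indicator_def abs_if split: if_splits)

lemma trunc_id:
  assumes "csupp R (rep F)" "R \<le> R'" shows "trunc R' F = F"
proof -
  have "cls (\<lambda>x. indicator {-R'..R'} x * rep F x) = cls (rep F)"
  proof (rule cls_eqI[OF mult_L2[OF bdd_symbol_Icc rep_L2]])
    show "AE x in lebesgue. indicator {-R'..R'} x * rep F x = rep F x"
      using assms(1) unfolding csupp_def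
      by eventually_elim (use assms(2) in \<open>auto simp: indicator_def abs_if split: if_splits\<close>)
  qed
  then show ?thesis by (simp add: trunc_def mulop_def)
qed

lemma trunc_tendsto: "((\<lambda>R. trunc R F) \<longlongrightarrow> F) at_top"
proof (rule tendsto_at_topI_sequentially)
  fix X :: "nat \<Rightarrow> real" assume X: "filterlim X at_top sequentially"
  have "(\<lambda>n. mulop (indicator {-X n..X n}) F) \<longlonglongrightarrow> mulop (\<lambda>x. 1) F"
  proof (rule mulop_tendsto[OF bdd_symbol_Icc])
    show "AE x in lebesgue. (\<lambda>n. indicator {- X n..X n} x :: complex) \<longlonglongrightarrow> 1"
    proof (rule AE_I2, rule tendsto_eventually)
      fix x :: real
      show "\<forall>\<^sub>F n in sequentially. (indicator {- X n..X n} x :: complex) = 1"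
        using filterlim_at_top[THEN iffD1, OF X, rule_format, of "\<bar>x\<bar>"]
        by eventually_elim (auto simp: indicator_def)
    qed
  qed auto
  then show "(\<lambda>n. trunc (X n) F) \<longlonglongrightarrow> F" by (simp add: trunc_def)
qed

lemma trunc_tendsto_nat: "(\<lambda>n. trunc (real n) F) \<longlonglongrightarrow> F"
  by (rule filterlim_compose[OF trunc_tendsto filterlim_real_sequentially])

text \<open>The induction principle behind the inversion formula: a closed real subspace that
  contains the intervals and their copies under \<open>J\<close> is everything.\<close>

lemma cL2_dense:
  assumes C: "closed C" "subspace C"
    and gen: "\<And>a b. a \<le> b \<Longrightarrow> cls (ind a b) \<in> C" "\<And>a b. a \<le> b \<Longrightarrow> J (cls (ind a b)) \<in> C"
  shows "F \<in> C"
proof -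
  have "interval_classes R \<subseteq> C" for R using gen by (auto simp: interval_classes_def)
  then have sub: "interval_space R \<subseteq> C" for R
    unfolding interval_space_def by (intro closure_minimal span_minimal C)
  have "trunc (real n) F \<in> C" for n
    using interval_space_csupp[OF rep_L2 csupp_trunc, of "real n" F] sub by auto
  from closed_sequentially[OF C(1) this trunc_tendsto_nat] show ?thesis .
qed

text \<open>\<open>lim\<close> carries no information until convergence is known;
  \<open>fourier_limit\<close> obtains it from the isometry on truncations.\<close>

definition fourier :: "cL2 \<Rightarrow> cL2" where
  "fourier F = lim (\<lambda>n. cls (FI (rep (trunc (real n) F))))"

lemma FI_csupp_L2:
  assumes "csupp R (rep F)" shows "FI (rep F) \<in> L2_space"
  using plancherel_csupp[OF rep_L2 csupp_mono[OF assms, of "max R 0"]] by auto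

lemma norm_FI_diff:
  assumes "csupp R (rep F)" "csupp R (rep G)"
  shows "norm (cls (FI (rep F)) - cls (FI (rep G))) = norm (F - G)"
proof -
  \<comment> \<open>Plancherel is available for nonnegative radii, while the given \<open>R\<close>
    may be negative.\<close>
  define R' where "R' = max R 0"
  have c: "csupp R' (rep F)" "csupp R' (rep G)" "0 \<le> R'"
    using assms csupp_mono by (auto simp: R'_def)
  have d: "csupp R' (rep (F - G))"
    using csupp_rep_add[OF c(1) csupp_rep_scaleR[OF c(2), of "-1"]] by simp
  have "FI (rep F) = FI (rep (F - G + G))" by simp
  also have "\<dots> = (\<lambda>\<xi>. FI (rep (F - G)) \<xi> + FI (rep G) \<xi>)" by (rule FI_rep_add[OF d c(2)])
  finally have "cls (FI (rep F)) = cls (FI (rep (F - G))) + cls (FI (rep G))"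
    using FI_csupp_L2[OF d] FI_csupp_L2[OF c(2)] by (simp add: cls_add)
  then show ?thesis using plancherel_csupp[OF rep_L2 d c(3)] by simp
qed

lemma fourier_limit: "(\<lambda>n. cls (FI (rep (trunc (real n) F)))) \<longlonglongrightarrow> fourier F"
proof -
  have eq: "norm (cls (FI (rep (trunc (real n) F))) - cls (FI (rep (trunc (real m) F))))
      = norm (trunc (real n) F - trunc (real m) F)" for n m
    by (rule norm_FI_diff[where R = "max (real n) (real m)"]) (auto intro: csupp_mono[OF csupp_trunc])
  have "Cauchy (\<lambda>n. trunc (real n) F)" by (rule LIMSEQ_imp_Cauchy[OF trunc_tendsto_nat])
  then have "Cauchy (\<lambda>n. cls (FI (rep (trunc (real n) F))))"
    unfolding Cauchy_def dist_norm eq .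
  then show ?thesis unfolding fourier_def by (simp add: Cauchy_convergent_iff convergent_LIMSEQ_iff)
qed

lemma fourier_csupp:
  assumes "csupp R (rep F)" shows "fourier F = cls (FI (rep F))"
proof -
  obtain N where N: "R \<le> real N" using real_arch_simple by blast
  have "\<forall>\<^sub>F n in sequentially. cls (FI (rep (trunc (real n) F))) = cls (FI (rep F))"
  proof (rule eventually_mono[OF eventually_ge_at_top[of N]])
    fix n assume "N \<le> n"
    then have "R \<le> real n" using N by linarith
    then show "cls (FI (rep (trunc (real n) F))) = cls (FI (rep F))" by (simp add: trunc_id[OF assms])
  qed
  from LIMSEQ_unique[OF fourier_limit tendsto_eventually[OF this]] show ?thesis .
qed

lemma fourier_cls_csupp:
  assumes "f \<in> L2_space" "csupp R f" shows "fourier (cls f) = cls (FI f)"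
  using fourier_csupp[OF csupp_rep_cls[OF assms]] by (simp add: FI_rep_cls assms)

lemma norm_fourier [simp]: "norm (fourier F) = norm F"
proof (rule LIMSEQ_unique)
  show "(\<lambda>n. norm (cls (FI (rep (trunc (real n) F))))) \<longlonglongrightarrow> norm (fourier F)"
    by (intro tendsto_norm fourier_limit)
  show "(\<lambda>n. norm (cls (FI (rep (trunc (real n) F))))) \<longlonglongrightarrow> norm F"
    using tendsto_norm[OF trunc_tendsto_nat[of F]] plancherel_csupp[OF rep_L2 csupp_trunc] by simp
qed

lemma trunc_add: "trunc R (F + G) = trunc R F + trunc R G"
  unfolding trunc_def by (rule mulop_add[OF bdd_symbol_Icc])

lemma fourier_add: "fourier (F + G) = fourier F + fourier G"
proof (rule LIMSEQ_unique[OF fourier_limit])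
  have "cls (FI (rep (trunc (real n) (F + G)))) = cls (FI (rep (trunc (real n) F))) + cls (FI (rep (trunc (real n) G)))" for n
    unfolding trunc_add FI_rep_add[OF csupp_trunc csupp_trunc]
    by (intro cls_add FI_csupp_L2[OF csupp_trunc])
  then show "(\<lambda>n. cls (FI (rep (trunc (real n) (F + G))))) \<longlonglongrightarrow> fourier F + fourier G"
    by (simp add: tendsto_add fourier_limit)
qed

lemma fourier_scaleR: "fourier (c *\<^sub>R F) = c *\<^sub>R fourier F"
proof (rule LIMSEQ_unique[OF fourier_limit])
  have "cls (FI (rep (trunc (real n) (c *\<^sub>R F)))) = c *\<^sub>R cls (FI (rep (trunc (real n) F)))" for n
    unfolding trunc_def mulop_scaleR[OF bdd_symbol_Icc] FI_rep_scaleR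
    by (intro cls_scaleR FI_csupp_L2[OF csupp_trunc, unfolded trunc_def])
  then show "(\<lambda>n. cls (FI (rep (trunc (real n) (c *\<^sub>R F))))) \<longlonglongrightarrow> c *\<^sub>R fourier F"
    by (simp add: tendsto_scaleR fourier_limit)
qed

lemma bounded_linear_fourier: "bounded_linear fourier"
  by (rule bounded_linear_intro[where K = 1]) (auto simp: fourier_add fourier_scaleR)

lemma fourier_diff: "fourier (F - G) = fourier F - fourier G"
  by (rule linear_diff[OF bounded_linear.linear[OF bounded_linear_fourier]])

lemma fourier_J: "fourier (J F) = J (fourier F)"
proof (rule LIMSEQ_unique[OF fourier_limit])
  have "cls (FI (rep (trunc (real n) (J F)))) = J (cls (FI (rep (trunc (real n) F))))" for n
    unfolding trunc_def mulop_J[OF bdd_symbol_Icc] FI_rep_J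
    by (rule J_cls[OF FI_csupp_L2[OF csupp_trunc, unfolded trunc_def], symmetric])
  then show "(\<lambda>n. cls (FI (rep (trunc (real n) (J F))))) \<longlonglongrightarrow> J (fourier F)"
    by (simp add: bounded_linear.tendsto[OF bounded_linear_J] fourier_limit)
qed

lemma inner_fourier: "fourier F \<bullet> fourier G = F \<bullet> G"
proof -
  have pol: "2 * (x \<bullet> y) = (norm (x + y))\<^sup>2 - (norm x)\<^sup>2 - (norm y)\<^sup>2" for x y :: cL2
    by (simp add: power2_norm_eq_inner inner_add inner_commute)
  have "2 * (fourier F \<bullet> fourier G) = 2 * (F \<bullet> G)" unfolding pol fourier_add[symmetric] by simp
  then show ?thesis by simp
qed

text \<open>Bridge between the choice operator of the definition and the operator
  \<open>fourier\<close>. The truncated integrals are transforms of truncations, so they converge in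
  norm; the chosen function has the same limit, and limits in the Hilbert space are unique.\<close>

lemma cls_fourier_L2:
  assumes f: "f \<in> L2_space" shows "fourier_L2 f \<in> L2_space \<and> cls (fourier_L2 f) = fourier (cls f)"
proof -
  define h where "h R \<xi> = (LINT x|lebesgue_on {-R..R}. cis (- (\<xi> * x)) * f x) / sqrt (2 * pi)" for R \<xi>
  define P where "P F \<longleftrightarrow> F \<in> L2_space \<and> ((\<lambda>R. L2_norm (\<lambda>\<xi>. F \<xi> - h R \<xi>)) \<longlongrightarrow> 0) at_top" for F
  have L: "(\<lambda>x. indicator {-R..R} x * f x) \<in> L2_space" for R by (rule mult_L2[OF bdd_symbol_Icc f])
  have c: "csupp R (\<lambda>x. indicator {-R..R} x * f x)" for R
    unfolding csupp_def by (rule AE_I2) (auto simp: indicator_def)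
  have hFI: "h R = FI (\<lambda>x. indicator {-R..R} x * f x)" for R
  proof
    fix \<xi>
    have "(LINT x|lebesgue_on {-R..R}. cis (- (\<xi> * x)) * f x)
        = (LINT x|lebesgue. indicator {-R..R} x *\<^sub>R (cis (- (\<xi> * x)) * f x))"
      by (rule integral_restrict_space) simp
    also have "\<dots> = (LINT x|lebesgue. cis (- (\<xi> * x)) * (indicator {-R..R} x * f x))"
      by (rule Bochner_Integration.integral_cong) (auto simp: indicator_def)
    finally show "h R \<xi> = FI (\<lambda>x. indicator {-R..R} x * f x) \<xi>" by (simp add: h_def FI_def)
  qed
  have hL: "h R \<in> L2_space" for R
    using plancherel_csupp[OF L csupp_mono[OF c, of R "max R 0"]] by (simp add: hFI)
  have hcls: "cls (h R) = fourier (trunc R (cls f))" for R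
    unfolding hFI fourier_cls_csupp[OF L c, symmetric] trunc_def mulop_cls[OF bdd_symbol_Icc f] ..
  have hlim: "((\<lambda>R. cls (h R)) \<longlongrightarrow> fourier (cls f)) at_top"
    unfolding hcls by (intro bounded_linear.tendsto[OF bounded_linear_fourier] trunc_tendsto)
  \<comment> \<open>Convergence of the extended real norms to 0 is restated as convergence of
    classes, where existence and uniqueness of the limit are available.\<close>
  have P: "P F \<longleftrightarrow> F \<in> L2_space \<and> ((\<lambda>R. cls (h R)) \<longlongrightarrow> cls F) at_top" for F
  proof (cases "F \<in> L2_space")
    case True
    have "L2_norm (\<lambda>\<xi>. F \<xi> - h R \<xi>) = ennreal (norm (cls (h R) - cls F))" for R
      using L2_norm_cls[OF L2_space_diff[OF True hL]] by (simp add: cls_diff True hL norm_minus_commute)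
    then show ?thesis using True
      by (simp add: P_def ennreal_0[symmetric] tendsto_ennreal_iff tendsto_norm_zero_iff LIM_zero_iff del: ennreal_0)
  qed (simp add: P_def)
  have "P (rep (fourier (cls f)))" using hlim by (simp add: P)
  then have "P (SOME F. P F)" by (rule someI[of P])
  then have "P (fourier_L2 f)" unfolding fourier_L2_def P_def h_def .
  then show ?thesis using tendsto_unique[OF _ hlim] by (auto simp: P)
qed

section \<open>The inversion formula\<close>

lemma ind_integral:
  fixes h :: "real \<Rightarrow> complex"
  assumes "continuous_on UNIV h"
  shows "(LINT x|lebesgue. ind a b x * h x) = integral {a..b} h"
proof -
  have ch: "continuous_on {a..b} h" using assms continuous_on_subset by blast
  have hm: "h \<in> borel_measurable borel" by (rule borel_measurable_continuous_onI[OF assms])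
  then have hl: "h \<in> borel_measurable lebesgue" by (intro measurable_completion) simp
  have "AE x in lebesgue. x \<noteq> a" using AE_lborel_singleton[of a] AE_completion by blast
  then have "AE x in lebesgue. ind a b x * h x = indicator {a..b} x *\<^sub>R h x"
    by eventually_elim (auto simp: indicator_def)
  then have "(LINT x|lebesgue. ind a b x * h x) = (LINT x|lebesgue. indicator {a..b} x *\<^sub>R h x)"
    using hl by (intro integral_cong_AE) (auto intro!: borel_measurable_times borel_measurable_scaleR borel_measurable_indicator)
  also have "\<dots> = (LINT x|lborel. indicator {a..b} x *\<^sub>R h x)"
    using hm by (intro integral_completion) (auto intro!: borel_measurable_scaleR borel_measurable_indicator)
  also have "\<dots> = integral {a..b} h"
    using set_borel_integral_eq_integral(2)[OF borel_integrable_atLeastAtMost'[OF ch]]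
    by (simp add: set_lebesgue_integral_def)
  finally show ?thesis .
qed

text \<open>Fubini on a rectangle for the continuous kernel. Conjugation reverses the sign of the
  phase, and that sign is moved to the argument of the other transform.\<close>

lemma FI_ind_adjoint:
  "(LINT \<xi>|lebesgue. ind c d \<xi> * cnj (FI (ind a b) \<xi>)) = (LINT x|lebesgue. ind a b x * FI (ind c d) (- x))"
proof -
  have cFI: "continuous_on UNIV (FI (ind a b))" for a b by (rule continuous_FI[OF integrable_ind])
  have FI: "FI (ind a b) \<xi> = integral {a..b} (\<lambda>x. cis (- (\<xi> * x))) / sqrt (2 * pi)" for a b \<xi>
    unfolding FI_def by (subst ind_integral[symmetric]) (auto intro!: continuous_intros simp: mult.commute)
  have "(LINT \<xi>|lebesgue. ind c d \<xi> * cnj (FI (ind a b) \<xi>)) = integral {c..d} (\<lambda>\<xi>. cnj (FI (ind a b) \<xi>))"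
    by (intro ind_integral continuous_intros cFI)
  also have "\<dots> = integral {c..d} (\<lambda>\<xi>. integral {a..b} (\<lambda>x. cis (\<xi> * x))) / sqrt (2 * pi)"
    by (simp add: FI Henstock_Kurzweil_Integration.integral_cnj cis_cnj)
  also have "integral {c..d} (\<lambda>\<xi>. integral {a..b} (\<lambda>x. cis (\<xi> * x))) = integral {a..b} (\<lambda>x. integral {c..d} (\<lambda>\<xi>. cis (\<xi> * x)))"
    using integral_swap_continuous[of c a d b "\<lambda>\<xi> x. cis (\<xi> * x)"]
    by (simp add: case_prod_beta' continuous_intros)
  also have "\<dots> / sqrt (2 * pi) = integral {a..b} (\<lambda>x. FI (ind c d) (- x))"
    by (simp add: FI mult.commute)
  also have "\<dots> = (LINT x|lebesgue. ind a b x * FI (ind c d) (- x))"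
    by (intro ind_integral[symmetric] continuous_on_compose2[OF cFI] continuous_intros) auto
  finally show ?thesis .
qed

lemma fourier_ind: "a \<le> b \<Longrightarrow> fourier (cls (ind a b)) = cls (FI (ind a b))"
  by (rule fourier_cls_csupp[OF ind_L2 csupp_ind[where R = "max \<bar>a\<bar> \<bar>b\<bar>"]]) auto

text \<open>\<open>FI_ind_adjoint\<close> is one complex identity. The real inner product sees its
  real part, and pairing with \<open>J\<close> sees its imaginary part, hence two
  statements.\<close>

lemma fourier_adjoint_ind:
  assumes "a \<le> b" "c \<le> d"
  shows "fourier (cls (ind a b)) \<bullet> cls (ind c d) = cls (ind a b) \<bullet> refl_op (fourier (cls (ind c d)))"
    "fourier (cls (ind a b)) \<bullet> J (cls (ind c d)) = cls (ind a b) \<bullet> refl_op (J (fourier (cls (ind c d))))"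
proof -
  have L: "FI (ind a b) \<in> L2_space" "FI (ind c d) \<in> L2_space" "(\<lambda>x. FI (ind c d) (- x)) \<in> L2_space"
    using plancherel_ind assms affine_L2[of "-1" "FI (ind c d)" 0] by auto
  have re: "u \<bullet> v = Re (v * cnj u)" for u v :: complex by (simp add: inner_complex_def)
  have i1: "integrable lebesgue (\<lambda>\<xi>. ind c d \<xi> * cnj (FI (ind a b) \<xi>))"
    by (rule csupp_L1(1)[where R = "max \<bar>c\<bar> \<bar>d\<bar>"])
       (use L mult_L2[OF bdd_symbol_indicator[of "{c<..d}"], of "\<lambda>\<xi>. cnj (FI (ind a b) \<xi>)"] in
         \<open>auto simp: csupp_def indicator_def L2_space_iff borel_measurable_cnj intro!: AE_I2\<close>)
  have i2: "integrable lebesgue (\<lambda>x. ind a b x * FI (ind c d) (- x))"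
    by (rule csupp_L1(1)[where R = "max \<bar>a\<bar> \<bar>b\<bar>"])
       (use L mult_L2[OF bdd_symbol_indicator[of "{a<..b}"], of "\<lambda>x. FI (ind c d) (- x)"] in
         \<open>auto simp: csupp_def indicator_def intro!: AE_I2\<close>)
  have "fourier (cls (ind a b)) \<bullet> cls (ind c d) = (LINT \<xi>|lebesgue. Re (ind c d \<xi> * cnj (FI (ind a b) \<xi>)))"
    unfolding fourier_ind[OF assms(1)] inner_cls[OF L(1) ind_L2] re ..
  also have "\<dots> = (LINT x|lebesgue. Re (ind a b x * FI (ind c d) (- x)))"
    unfolding integral_Re[OF i1] integral_Re[OF i2] FI_ind_adjoint ..
  also have "\<dots> = (LINT x|lebesgue. ind a b x \<bullet> FI (ind c d) (- x))"
    by (rule Bochner_Integration.integral_cong) (auto simp: inner_complex_def indicator_def)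
  also have "\<dots> = cls (ind a b) \<bullet> refl_op (fourier (cls (ind c d)))"
    unfolding fourier_ind[OF assms(2)] refl_op_cls[OF L(2)] inner_cls[OF ind_L2 L(3)] ..
  finally show "fourier (cls (ind a b)) \<bullet> cls (ind c d) = cls (ind a b) \<bullet> refl_op (fourier (cls (ind c d)))" .
  have Li: "(\<lambda>x. \<i> * ind c d x) \<in> L2_space" "(\<lambda>x. \<i> * FI (ind c d) (- x)) \<in> L2_space"
    using L by auto
  have "fourier (cls (ind a b)) \<bullet> J (cls (ind c d)) = (LINT \<xi>|lebesgue. - Im (ind c d \<xi> * cnj (FI (ind a b) \<xi>)))"
    unfolding fourier_ind[OF assms(1)] J_cls[OF ind_L2] inner_cls[OF L(1) Li(1)]
    by (rule Bochner_Integration.integral_cong) (auto simp: inner_complex_def)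
  also have "\<dots> = (LINT x|lebesgue. - Im (ind a b x * FI (ind c d) (- x)))"
    unfolding Bochner_Integration.integral_minus integral_Im[OF i1] integral_Im[OF i2] FI_ind_adjoint ..
  also have "\<dots> = (LINT x|lebesgue. ind a b x \<bullet> (\<i> * FI (ind c d) (- x)))"
    by (rule Bochner_Integration.integral_cong) (auto simp: inner_complex_def indicator_def)
  also have "\<dots> = cls (ind a b) \<bullet> refl_op (J (fourier (cls (ind c d))))"
    unfolding fourier_ind[OF assms(2)] refl_op_J refl_op_cls[OF L(2)] J_cls[OF L(3)] inner_cls[OF ind_L2 Li(2)] ..
  finally show "fourier (cls (ind a b)) \<bullet> J (cls (ind c d)) = cls (ind a b) \<bullet> refl_op (J (fourier (cls (ind c d))))" .
qed

text \<open>Both sides are continuous and linear in each variable, so \<open>cL2_dense\<close>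
  extends the identity from intervals, first in \<open>G\<close> and then in
  \<open>F\<close>.\<close>

lemma fourier_adjoint: "fourier F \<bullet> G = F \<bullet> refl_op (fourier G)"
proof -
  interpret f: bounded_linear fourier by (rule bounded_linear_fourier)
  interpret r: bounded_linear refl_op by (rule bounded_linear_refl_op)
  have closed: "closed {F. fourier F \<bullet> G = F \<bullet> refl_op (fourier G)}"
    "closed {G. fourier F \<bullet> G = F \<bullet> refl_op (fourier G)}" for F G
    by (intro closed_Collect_eq continuous_intros f.continuous_on r.continuous_on)+
  have sub: "subspace {F. fourier F \<bullet> G = F \<bullet> refl_op (fourier G)}"
    "subspace {G. fourier F \<bullet> G = F \<bullet> refl_op (fourier G)}" for F G
    by (auto intro!: subspaceI simp: f.add r.add f.scaleR r.scaleR f.zero r.zero inner_add)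
  have 1: "fourier (cls (ind a b)) \<bullet> G = cls (ind a b) \<bullet> refl_op (fourier G)" if "a \<le> b" for a b G
    using cL2_dense[OF closed(2) sub(2), of "cls (ind a b)" G] that
    by (auto simp: fourier_adjoint_ind fourier_J)
  have 2: "fourier (J F) \<bullet> G = J F \<bullet> refl_op (fourier G)" if "\<And>G. fourier F \<bullet> G = F \<bullet> refl_op (fourier G)" for F G
    using that[of "J G"] by (simp add: fourier_J inner_J_left refl_op_J)
  show ?thesis
    using cL2_dense[OF closed(1) sub(1), of G F] 1 2[OF 1] by auto
qed

text \<open>The adjoint of an isometry is its left inverse, and the adjoint has just been identified
  as the transform followed by the reflection.\<close>

lemma refl_fourier_fourier [simp]: "refl_op (fourier (fourier F)) = F"
proof -
  have "G \<bullet> (refl_op (fourier (fourier F)) - F) = 0" for G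
    using fourier_adjoint[of G "fourier F"] by (simp add: inner_fourier inner_diff_right)
  from this[of "refl_op (fourier (fourier F)) - F"] show ?thesis by simp
qed

lemma fourier_affop:
  assumes "\<bar>c\<bar> = 1" "f \<in> L2_space" "csupp R f"
  shows "fourier (affop t c (cls f)) = cls (\<lambda>\<xi>. cis (\<xi> * t * c) * FI f (c * \<xi>))"
proof -
  \<comment> \<open>As \<open>c\<close> is its own inverse, the substitution
    \<open>y = t + c * x\<close> is undone by \<open>x = c * (y - t)\<close>.\<close>
  have cc: "c * c = 1" using assms(1) by (metis abs_mult_self_eq mult_1)
  have "csupp (R + \<bar>t\<bar>) (\<lambda>x. f (t + c * x))"
    using AE_affine[OF assms(1) assms(3)[unfolded csupp_def], of t] unfolding csupp_def
  proof eventually_elim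
    case (elim x)
    have "\<bar>x\<bar> = \<bar>c * x\<bar>" using assms(1) by (simp add: abs_mult)
    then show ?case using elim by (auto simp: abs_if split: if_splits)
  qed
  then have "fourier (affop t c (cls f)) = cls (FI (\<lambda>x. f (t + c * x)))"
    unfolding affop_cls[OF assms(1,2)] by (rule fourier_cls_csupp[OF affine_L2[OF assms(1,2)]])
  also have "FI (\<lambda>x. f (t + c * x)) = (\<lambda>\<xi>. cis (\<xi> * t * c) * FI f (c * \<xi>))"
  proof
    fix \<xi>
    have "(LINT x|lebesgue. cis (- (\<xi> * x)) * f (t + c * x))
        = (LINT x|lebesgue. (\<lambda>y. cis (- (\<xi> * (c * (y - t)))) * f y) (t + c * x))"
    proof -
      have "c * (t + c * x - t) = x" for x by (metis cc mult.assoc mult_1 add_diff_cancel_left')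
      then show ?thesis by (simp only:)
    qed
    also have "\<dots> = (LINT y|lebesgue. cis (- (\<xi> * (c * (y - t)))) * f y)"
    proof (rule integral_affine[OF assms(1)])
      have "(\<lambda>y. cis (- (\<xi> * (c * (y - t))))) \<in> borel_measurable lebesgue"
        by (rule measurable_completion) measurable
      then show "(\<lambda>y. cis (- (\<xi> * (c * (y - t)))) * f y) \<in> borel_measurable lebesgue"
        using L2_space_measurable[OF assms(2)] by (intro borel_measurable_times)
    qed
    also have "\<dots> = (LINT y|lebesgue. cis (\<xi> * t * c) * (cis (- ((c * \<xi>) * y)) * f y))"
    proof -
      have "cis (- (\<xi> * (c * (y - t)))) = cis (\<xi> * t * c) * cis (- ((c * \<xi>) * y))" for y
        unfolding cis_mult by (rule arg_cong[of _ _ cis]) (simp add: algebra_simps)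
      then show ?thesis by (simp only: mult.assoc)
    qed
    finally show "FI (\<lambda>x. f (t + c * x)) \<xi> = cis (\<xi> * t * c) * FI f (c * \<xi>)"
      by (simp add: FI_def)
  qed
  finally show ?thesis .
qed

lemma bdd_symbol_cis:
  assumes [measurable]: "g \<in> borel_measurable borel" shows "bdd_symbol (\<lambda>\<xi>. cis (g \<xi>)) 1"
proof (rule bdd_symbolI)
  show "(\<lambda>\<xi>. cis (g \<xi>)) \<in> borel_measurable lebesgue"
    by (rule measurable_completion) measurable
qed simp

text \<open>Truncations converge to \<open>F\<close>, so it is enough to compare bounded operators
  where the transform is given by the explicit integral \<open>FI\<close>.\<close>

lemma limit_csupp_eq:
  assumes A: "bounded_linear A" "bounded_linear B"
    and eq: "\<And>R f. f \<in> L2_space \<Longrightarrow> csupp R f \<Longrightarrow> A (cls f) = B (cls f)"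
  shows "A F = B F"
proof (rule LIMSEQ_unique)
  show "(\<lambda>n. A (trunc (real n) F)) \<longlonglongrightarrow> A F"
    by (rule bounded_linear.tendsto[OF A(1) trunc_tendsto_nat])
  have "A (trunc (real n) F) = B (trunc (real n) F)" for n
    using eq[OF rep_L2 csupp_trunc, of n F] by simp
  then show "(\<lambda>n. A (trunc (real n) F)) \<longlonglongrightarrow> B F"
    using bounded_linear.tendsto[OF A(2) trunc_tendsto_nat] by simp
qed

lemma fourier_refl_op: "fourier (refl_op F) = refl_op (fourier F)"
proof (rule limit_csupp_eq[where A = "\<lambda>F. fourier (refl_op F)" and B = "\<lambda>F. refl_op (fourier F)"])
  show "bounded_linear (\<lambda>F. fourier (refl_op F))" "bounded_linear (\<lambda>F. refl_op (fourier F))"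
    by (intro bounded_linear_compose[OF bounded_linear_fourier] bounded_linear_compose[OF bounded_linear_refl_op]
        bounded_linear_fourier bounded_linear_refl_op)+
  fix R :: real and f :: "real \<Rightarrow> complex" assume f: "f \<in> L2_space" "csupp R f"
  have "FI f \<in> L2_space" using FI_csupp_L2[OF csupp_rep_cls[OF f]] FI_rep_cls[OF f(1)] by simp
  then show "fourier (refl_op (cls f)) = refl_op (fourier (cls f))"
    using fourier_affop[of "-1" f R 0] f by (simp add: refl_op_def[symmetric] fourier_cls_csupp[OF f] refl_op_cls)
qed

lemma fourier_translate: "fourier (affop h 1 F) = mulop (\<lambda>\<xi>. cis (\<xi> * h)) (fourier F)"
proof (rule limit_csupp_eq[where A = "\<lambda>F. fourier (affop h 1 F)" and B = "\<lambda>F. mulop (\<lambda>\<xi>. cis (\<xi> * h)) (fourier F)"])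
  have s: "bdd_symbol (\<lambda>\<xi>. cis (\<xi> * h)) 1" by (rule bdd_symbol_cis) measurable
  show "bounded_linear (\<lambda>F. fourier (affop h 1 F))" "bounded_linear (\<lambda>F. mulop (\<lambda>\<xi>. cis (\<xi> * h)) (fourier F))"
    using bounded_linear_compose[OF bounded_linear_fourier bounded_linear_affop[of 1 h]]
      bounded_linear_compose[OF bounded_linear_mulop[OF s] bounded_linear_fourier] by auto
  fix R :: real and f :: "real \<Rightarrow> complex" assume f: "f \<in> L2_space" "csupp R f"
  have "FI f \<in> L2_space" using FI_csupp_L2[OF csupp_rep_cls[OF f]] FI_rep_cls[OF f(1)] by simp
  then show "fourier (affop h 1 (cls f)) = mulop (\<lambda>\<xi>. cis (\<xi> * h)) (fourier (cls f))"
    using fourier_affop[of 1 f R h] f by (simp add: fourier_cls_csupp[OF f] mulop_cls[OF s])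
qed

section \<open>Fourier multipliers and the free group\<close>

text \<open>\<open>refl_op\<close> after \<open>fourier\<close> is the inverse transform, by
  \<open>refl_fourier_fourier\<close>.\<close>

definition fmult :: "(real \<Rightarrow> complex) \<Rightarrow> cL2 \<Rightarrow> cL2" where
  "fmult m F = refl_op (fourier (mulop m (fourier F)))"

lemma fourier_fmult: "fourier (fmult m F) = mulop m (fourier F)"
  by (simp add: fmult_def fourier_refl_op)

lemma fourier_inj: "fourier F = fourier G \<Longrightarrow> F = G"
  by (metis refl_fourier_fourier)

lemma bounded_linear_fmult: "bdd_symbol m c \<Longrightarrow> bounded_linear (fmult m)"
  unfolding fmult_def
  by (intro bounded_linear_compose[OF bounded_linear_refl_op] bounded_linear_compose[OF bounded_linear_fourier]
      bounded_linear_compose[OF bounded_linear_mulop] bounded_linear_fourier)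

lemma norm_fmult: "bdd_symbol m c \<Longrightarrow> norm (fmult m F) \<le> c * norm F"
  unfolding fmult_def using norm_mulop[of m c "fourier F"] by simp

lemma fmult_fmult:
  "bdd_symbol m c \<Longrightarrow> bdd_symbol k d \<Longrightarrow> fmult m (fmult k F) = fmult (\<lambda>\<xi>. m \<xi> * k \<xi>) F"
  by (rule fourier_inj) (simp add: fourier_fmult mulop_mulop)

lemma fmult_commute:
  "bdd_symbol m c \<Longrightarrow> bdd_symbol k d \<Longrightarrow> fmult m (fmult k F) = fmult k (fmult m F)"
  by (simp add: fmult_fmult mult.commute)

lemma fmult_J: "bdd_symbol m c \<Longrightarrow> fmult m (J F) = J (fmult m F)"
  by (rule fourier_inj) (simp add: fourier_fmult fourier_J mulop_J)

lemma inner_fmult: "bdd_symbol m c \<Longrightarrow> fmult m F \<bullet> G = F \<bullet> fmult (\<lambda>\<xi>. cnj (m \<xi>)) G"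
  by (simp add: inner_fourier[symmetric, of _ G] inner_fourier[symmetric, of F] fourier_fmult inner_mulop)

lemma fmult_tendsto:
  assumes "\<And>n. bdd_symbol (m n) c" "k \<in> borel_measurable lebesgue" "\<And>x. (\<lambda>n. m n x) \<longlonglongrightarrow> k x"
  shows "(\<lambda>n. fmult (m n) F) \<longlonglongrightarrow> fmult k F"
  unfolding fmult_def
  by (intro bounded_linear.tendsto[OF bounded_linear_refl_op] bounded_linear.tendsto[OF bounded_linear_fourier]
      mulop_tendsto[OF assms(1,2)] AE_I2 assms(3))

text \<open>By Plancherel a pointwise comparison of symbols becomes a comparison of norms; it is
  used to measure translations by derivatives.\<close>

lemma norm_fmult_mono:
  assumes "bdd_symbol m c" "bdd_symbol k d" "\<And>\<xi>. norm (m \<xi>) \<le> a * norm (k \<xi>)" "0 \<le> a"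
  shows "norm (fmult m F) \<le> a * norm (fmult k F)"
proof -
  have "norm (mulop m (fourier F)) \<le> a * norm (mulop k (fourier F))"
    unfolding mulop_def
    by (rule norm_cls_mono[OF mult_L2[OF assms(1) rep_L2] mult_L2[OF assms(2) rep_L2] AE_I2 assms(4)])
       (use assms(3) in \<open>auto simp: norm_mult mult.assoc[symmetric] intro: mult_right_mono\<close>)
  then show ?thesis by (simp add: fmult_def)
qed

lemma affop_fmult: "affop h 1 F = fmult (\<lambda>\<xi>. cis (\<xi> * h)) F"
  by (rule fourier_inj) (simp add: fourier_translate fourier_fmult)

definition schr :: "real \<Rightarrow> cL2 \<Rightarrow> cL2" where
  "schr t = fmult (\<lambda>\<xi>. cis (- (t * \<xi>\<^sup>2 / 2)))"

lemma bdd_symbol_schr: "bdd_symbol (\<lambda>\<xi>. cis (- (t * \<xi>\<^sup>2 / 2))) 1"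
  by (rule bdd_symbol_cis) measurable

lemma bounded_linear_schr: "bounded_linear (schr t)"
  unfolding schr_def by (rule bounded_linear_fmult[OF bdd_symbol_schr])

lemma schr_schr: "schr s (schr t F) = schr (s + t) F"
  unfolding schr_def fmult_fmult[OF bdd_symbol_schr bdd_symbol_schr] cis_mult
  by (simp add: add_divide_distrib distrib_right)

lemma schr_0 [simp]: "schr 0 F = F"
  by (simp add: schr_def fmult_def)

lemma norm_schr [simp]: "norm (schr t F) = norm F"
  unfolding schr_def fmult_def
  using norm_mulop_unimodular[of "\<lambda>\<xi>. cis (- (t * \<xi>\<^sup>2 / 2))" "fourier F"] bdd_symbol_schr[of t]
  by (simp add: bdd_symbol_def)

lemma inner_schr: "schr t F \<bullet> G = F \<bullet> schr (-t) G"
  unfolding schr_def inner_fmult[OF bdd_symbol_schr] by (simp add: cis_cnj)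

lemma schr_J: "schr t (J F) = J (schr t F)"
  unfolding schr_def by (rule fmult_J[OF bdd_symbol_schr])

lemma schr_diff: "schr t (F - G) = schr t F - schr t G"
  by (rule linear_diff[OF bounded_linear.linear[OF bounded_linear_schr]])

lemma schr_tendsto: "((\<lambda>s. schr s F) \<longlongrightarrow> schr t F) (at t within S)"
  unfolding schr_def fmult_def
proof (intro bounded_linear.tendsto[OF bounded_linear_refl_op] bounded_linear.tendsto[OF bounded_linear_fourier]
    mulop_continuous_at[OF bdd_symbol_schr])
  show "(\<lambda>\<xi>. cis (- (t * \<xi>\<^sup>2 / 2))) \<in> borel_measurable lebesgue"
    using bdd_symbol_schr by (simp add: bdd_symbol_def)
qed (intro tendsto_intros, auto)

text \<open>Strong continuity of the group and the isometry property give joint continuity in time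
  and argument. The affine time covers the integrands of both Duhamel forms,
  \<open>schr (t - s)\<close> and \<open>schr (- s)\<close>.\<close>

lemma schr_tendsto2:
  assumes "(F \<longlongrightarrow> F0) (at t within S)" shows "((\<lambda>s. schr (c + d * s) (F s)) \<longlongrightarrow> schr (c + d * t) F0) (at t within S)"
proof -
  have c: "((\<lambda>s. schr (c + d * s) F0) \<longlongrightarrow> schr (c + d * t) F0) (at t within S)"
    by (rule isCont_tendsto_compose[where g = "\<lambda>s. schr s F0"]) (auto simp: isCont_def schr_tendsto intro!: tendsto_intros)
  have "((\<lambda>s. norm (F s - F0)) \<longlongrightarrow> 0) (at t within S)"
    using assms by (simp add: tendsto_norm_zero_iff LIM_zero_iff)
  moreover have "norm (schr (c + d * s) (F s) - schr (c + d * s) F0) = norm (F s - F0)" for s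
    by (simp flip: schr_diff)
  ultimately have "((\<lambda>s. schr (c + d * s) (F s) - schr (c + d * s) F0) \<longlongrightarrow> 0) (at t within S)"
    by (subst tendsto_norm_zero_iff[symmetric]) simp
  from tendsto_add[OF this c] show ?thesis by simp
qed

lemma cls_schroedinger:
  assumes f: "f \<in> L2_space"
  shows "schroedinger t f \<in> L2_space \<and> cls (schroedinger t f) = schr t (cls f)"
proof -
  define g where "g \<xi> = cis (- (t * \<xi>\<^sup>2 / 2)) * fourier_L2 f \<xi>" for \<xi>
  have F: "fourier_L2 f \<in> L2_space" "cls (fourier_L2 f) = fourier (cls f)" using cls_fourier_L2[OF f] by auto
  have g: "g \<in> L2_space" unfolding g_def by (rule mult_L2[OF bdd_symbol_schr F(1)])
  have G: "fourier_L2 g \<in> L2_space" "cls (fourier_L2 g) = fourier (cls g)" using cls_fourier_L2[OF g] by auto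
  have "cls g = mulop (\<lambda>\<xi>. cis (- (t * \<xi>\<^sup>2 / 2))) (fourier (cls f))"
    unfolding g_def F(2)[symmetric] by (rule mulop_cls[OF bdd_symbol_schr F(1), symmetric])
  then show ?thesis
    using affine_L2[of "-1" "fourier_L2 g" 0] G
    by (simp add: schroedinger_def inverse_fourier_L2_def g_def[symmetric] schr_def fmult_def refl_op_cls[OF G(1), symmetric])
qed

section \<open>The homogeneous Sobolev seminorm\<close>

text \<open>Sharp cut-offs: \<open>PN n\<close> is an orthogonal projection, and \<open>DN n\<close>
  is the derivative composed with it, hence bounded. Because the symbols are exact indicators, the
  relations in \<open>DN_PN\<close> hold without error.\<close>

definition sym_P :: "nat \<Rightarrow> real \<Rightarrow> complex" where "sym_P n = indicator {-real n..real n}"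
definition sym_D :: "nat \<Rightarrow> real \<Rightarrow> complex" where "sym_D n \<xi> = \<i> * of_real \<xi> * indicator {-real n..real n} \<xi>"

definition PN :: "nat \<Rightarrow> cL2 \<Rightarrow> cL2" where "PN n = fmult (sym_P n)"
definition DN :: "nat \<Rightarrow> cL2 \<Rightarrow> cL2" where "DN n = fmult (sym_D n)"

lemma bdd_symbol_P: "bdd_symbol (sym_P n) 1"
  unfolding sym_P_def by (rule bdd_symbol_Icc)

lemma bdd_symbol_D: "bdd_symbol (sym_D n) (real n)"
proof (rule bdd_symbolI)
  show "sym_D n \<in> borel_measurable lebesgue" unfolding sym_D_def
    by (rule measurable_completion) measurable
qed (auto simp: sym_D_def norm_mult indicator_def)

lemma bounded_linear_PN: "bounded_linear (PN n)" and bounded_linear_DN: "bounded_linear (DN n)"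
  unfolding PN_def DN_def by (rule bounded_linear_fmult[OF bdd_symbol_P] bounded_linear_fmult[OF bdd_symbol_D])+

lemma norm_PN: "norm (PN n F) \<le> norm F"
  unfolding PN_def using norm_fmult[OF bdd_symbol_P, of n F] by simp

lemma inner_PN: "PN n F \<bullet> G = F \<bullet> PN n G"
  unfolding PN_def inner_fmult[OF bdd_symbol_P]
  by (rule arg_cong[of _ _ "\<lambda>m. F \<bullet> fmult m G"]) (auto simp: sym_P_def indicator_def)

lemma fmult_uminus: "bdd_symbol m c \<Longrightarrow> fmult (\<lambda>\<xi>. - m \<xi>) F = - fmult m F"
proof -
  assume m: "bdd_symbol m c"
  have "fmult (\<lambda>\<xi>. of_real (-1) * m \<xi>) F = fmult (\<lambda>\<xi>. of_real (-1)) (fmult m F)"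
    by (rule fmult_fmult[OF bdd_symbol_const m, symmetric])
  also have "\<dots> = - fmult m F"
    unfolding fmult_def[of "\<lambda>\<xi>. of_real (-1)"] mulop_of_real
    by (simp add: linear_neg[OF bounded_linear.linear] bounded_linear_fourier bounded_linear_refl_op)
  finally show ?thesis by simp
qed

lemma inner_DN: "DN n F \<bullet> G = - (F \<bullet> DN n G)"
proof -
  have "(\<lambda>\<xi>. cnj (sym_D n \<xi>)) = (\<lambda>\<xi>. - sym_D n \<xi>)" by (auto simp: sym_D_def indicator_def)
  then show ?thesis unfolding DN_def inner_fmult[OF bdd_symbol_D] by (simp add: fmult_uminus[OF bdd_symbol_D])
qed

lemma PN_J: "PN n (J F) = J (PN n F)" and DN_J: "DN n (J F) = J (DN n F)"
  unfolding PN_def DN_def by (simp_all add: fmult_J[OF bdd_symbol_P] fmult_J[OF bdd_symbol_D])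

lemma DN_PN: "m \<le> n \<Longrightarrow> DN n (PN m F) = DN m F" "m \<le> n \<Longrightarrow> DN m (PN n F) = DN m F"
  "m \<le> n \<Longrightarrow> PN m (DN n F) = DN m F" "m \<le> n \<Longrightarrow> PN n (DN m F) = DN m F" "m \<le> n \<Longrightarrow> PN m (PN n F) = PN m F"
  unfolding PN_def DN_def
  by (simp_all add: fmult_fmult[OF bdd_symbol_D bdd_symbol_P] fmult_fmult[OF bdd_symbol_P bdd_symbol_D]
      fmult_fmult[OF bdd_symbol_P bdd_symbol_P])
    (auto intro!: arg_cong[of _ _ "\<lambda>m. fmult m F"] simp: sym_P_def sym_D_def indicator_def)

lemma schr_PN: "schr t (PN n F) = PN n (schr t F)" and schr_DN: "schr t (DN n F) = DN n (schr t F)"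
  unfolding PN_def DN_def schr_def
  by (rule fmult_commute[OF bdd_symbol_schr bdd_symbol_P] fmult_commute[OF bdd_symbol_schr bdd_symbol_D])+

lemma PN_tendsto: "(\<lambda>n. PN n F) \<longlonglongrightarrow> F"
proof -
  have "(\<lambda>n. fmult (sym_P n) F) \<longlonglongrightarrow> fmult (\<lambda>\<xi>. 1) F"
  proof (rule fmult_tendsto[OF bdd_symbol_P])
    show "(\<lambda>n. sym_P n \<xi>) \<longlonglongrightarrow> 1" for \<xi>
    proof (rule tendsto_eventually)
      obtain N where N: "\<bar>\<xi>\<bar> \<le> real N" using real_arch_simple by blast
      show "\<forall>\<^sub>F n in sequentially. sym_P n \<xi> = 1"
        by (rule eventually_mono[OF eventually_ge_at_top[of N]]) (use N in \<open>auto simp: sym_P_def indicator_def abs_le_iff\<close>)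
    qed
  qed auto
  then show ?thesis by (simp add: PN_def fmult_def)
qed

lemma norm_DN_mono: "m \<le> n \<Longrightarrow> norm (DN m F) \<le> norm (DN n F)"
  using norm_PN[of m "DN n F"] by (simp add: DN_PN)

text \<open>H^1 described through bounded operators only: the norms of the truncated derivatives
  increase with \<open>n\<close>, and their supremum \<open>dn\<close> is the norm of the
  derivative. As a real supremum, \<open>dn\<close> is meaningful only under
  \<open>H1c\<close>.\<close>

definition H1c :: "cL2 \<Rightarrow> bool" where "H1c F \<longleftrightarrow> bdd_above (range (\<lambda>n. norm (DN n F)))"
definition dn :: "cL2 \<Rightarrow> real" where "dn F = (SUP n. norm (DN n F))"

lemma H1cI: "(\<And>n. norm (DN n F) \<le> c) \<Longrightarrow> H1c F"
  and dn_le: "(\<And>n. norm (DN n F) \<le> c) \<Longrightarrow> dn F \<le> c"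
  unfolding H1c_def dn_def by (auto intro!: bdd_aboveI2 cSUP_least)

lemma DN_le_dn: "H1c F \<Longrightarrow> norm (DN n F) \<le> dn F"
  unfolding H1c_def dn_def by (rule cSUP_upper) auto

lemma dn_nonneg: "H1c F \<Longrightarrow> 0 \<le> dn F"
  using DN_le_dn[of F 0] norm_ge_zero order_trans by blast

lemma DN_tendsto_dn: "H1c F \<Longrightarrow> (\<lambda>n. norm (DN n F)) \<longlonglongrightarrow> dn F"
  unfolding dn_def H1c_def by (rule LIMSEQ_incseq_SUP) (auto simp: incseq_def intro: norm_DN_mono)

lemma H1c_diff:
  assumes "H1c F" "H1c G" shows "H1c (F - G)" "dn (F - G) \<le> dn F + dn G"
proof -
  have "norm (DN n (F - G)) \<le> dn F + dn G" for n
    using norm_triangle_ineq4[of "DN n F" "DN n G"] DN_le_dn[OF assms(1), of n] DN_le_dn[OF assms(2), of n]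
    by (simp add: linear_diff[OF bounded_linear.linear[OF bounded_linear_DN]])
  then show "H1c (F - G)" "dn (F - G) \<le> dn F + dn G" by (auto intro: H1cI dn_le)
qed

lemma dn_minus: "dn (F - G) = dn (G - F)"
proof -
  have "norm (DN n (F - G)) = norm (DN n (G - F))" for n
    by (simp add: linear_diff[OF bounded_linear.linear[OF bounded_linear_DN]] norm_minus_commute)
  then show ?thesis by (simp add: dn_def)
qed

lemma dn_PN:
  assumes "H1c F" shows "H1c (PN n F)" "dn (PN n F) \<le> dn F"
proof -
  have "norm (DN m (PN n F)) \<le> dn F" for m
  proof (cases "m \<le> n")
    case True
    then show ?thesis using DN_le_dn[OF assms] by (simp add: DN_PN)
  next
    case False
    then show ?thesis using DN_le_dn[OF assms] by (simp add: DN_PN)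
  qed
  then show "H1c (PN n F)" "dn (PN n F) \<le> dn F" by (auto intro: H1cI dn_le)
qed

text \<open>Pythagoras for the projection \<open>PN n\<close> bounds every truncated derivative of
  the tail by \<open>sqrt ((dn F)\<^sup>2 - (norm (DN n F))\<^sup>2)\<close>, uniformly in
  \<open>m\<close>.\<close>

lemma dn_tail:
  assumes "H1c F" shows "(\<lambda>n. dn (F - PN n F)) \<longlonglongrightarrow> 0"
proof -
  have b: "norm (DN m (F - PN n F)) \<le> sqrt ((dn F)\<^sup>2 - (norm (DN n F))\<^sup>2)" for m n
  proof (cases "m \<le> n")
    case True
    have "(norm (DN n F))\<^sup>2 \<le> (dn F)\<^sup>2" using DN_le_dn[OF assms] by (intro power_mono) auto
    then show ?thesis
      using True by (simp add: linear_diff[OF bounded_linear.linear[OF bounded_linear_DN]] DN_PN)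
  next
    case False
    then have e: "DN m (F - PN n F) = DN m F - PN n (DN m F)"
      by (simp add: linear_diff[OF bounded_linear.linear[OF bounded_linear_DN]] DN_PN)
    have pyth: "(norm (X - PN n X))\<^sup>2 = (norm X)\<^sup>2 - (norm (PN n X))\<^sup>2" for X
      using inner_PN[of n X "PN n X"] inner_PN[of n X X]
      by (simp add: power2_norm_eq_inner inner_diff inner_commute DN_PN)
    have "(norm (DN m (F - PN n F)))\<^sup>2 = (norm (DN m F))\<^sup>2 - (norm (DN n F))\<^sup>2"
      unfolding e pyth using False by (simp add: DN_PN)
    also have "\<dots> \<le> (dn F)\<^sup>2 - (norm (DN n F))\<^sup>2"
      using DN_le_dn[OF assms, of m] by (intro diff_right_mono power_mono) auto
    finally show ?thesis by (rule real_le_rsqrt)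
  qed
  show ?thesis
  proof (rule tendsto_sandwich[of "\<lambda>n. 0"])
    show "\<forall>\<^sub>F n in sequentially. dn (F - PN n F) \<le> sqrt ((dn F)\<^sup>2 - (norm (DN n F))\<^sup>2)"
      using b by (intro always_eventually allI dn_le)
    show "\<forall>\<^sub>F n in sequentially. 0 \<le> dn (F - PN n F)"
      using b by (intro always_eventually allI dn_nonneg H1cI)
    have "(\<lambda>n. sqrt ((dn F)\<^sup>2 - (norm (DN n F))\<^sup>2)) \<longlonglongrightarrow> sqrt ((dn F)\<^sup>2 - (dn F)\<^sup>2)"
      by (intro tendsto_intros DN_tendsto_dn assms)
    then show "(\<lambda>n. sqrt ((dn F)\<^sup>2 - (norm (DN n F))\<^sup>2)) \<longlonglongrightarrow> 0" by simp
  qed auto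
qed

text \<open>Cauchy--Schwarz against the weight \<open>(a\<^sup>2 + \<xi>\<^sup>2)\<^sup>-\<^sup>1\<close>, whose integral is at most \<open>\<pi> / a\<close>.\<close>

lemma weight_bound:
  assumes a: "0 < a" and k: "k \<in> L2_space" "csupp (real n) k"
  shows "(LINT \<xi>|lebesgue. norm (k \<xi>))\<^sup>2 \<le> pi * (a * (norm (cls k))\<^sup>2 + (norm (cls (\<lambda>\<xi>. sym_D n \<xi> * k \<xi>)))\<^sup>2 / a)"
proof -
  \<comment> \<open>\<open>w\<close> is the square root of the weight and \<open>p\<close> carries
    its inverse: their pairing is \<open>norm (k \<xi>)\<close> almost everywhere, while the squared
    norm of \<open>p\<close> splits into the two terms of the claim.\<close>
  define w where "w \<xi> = (complex_of_real (1 / sqrt (a\<^sup>2 + \<xi>\<^sup>2)) * indicator {-real n..real n} \<xi>)" for \<xi>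
  define p where "p \<xi> = complex_of_real (sqrt (a\<^sup>2 + \<xi>\<^sup>2) * norm (k \<xi>)) * indicator {-real n..real n} \<xi>" for \<xi>
  have pos: "0 < a\<^sup>2 + \<xi>\<^sup>2" for \<xi> using a by (simp add: add_pos_nonneg)
  have wm: "w \<in> borel_measurable lebesgue" unfolding w_def by (rule measurable_completion) measurable
  have wsq: "(norm (w \<xi>))\<^sup>2 = indicator {-real n..real n} \<xi> *\<^sub>R (1 / (a\<^sup>2 + \<xi>\<^sup>2))" for \<xi>
    using pos[of \<xi>] by (auto simp: w_def indicator_def norm_mult power_divide norm_divide)
  have arc: "((\<lambda>x. arctan (x / a) / a) has_vector_derivative (1 / (a\<^sup>2 + x\<^sup>2))) (at x within S)" for x S
  proof -
    have "((\<lambda>x. arctan (x / a) / a) has_real_derivative (1 / (a\<^sup>2 + x\<^sup>2))) (at x within S)"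
    proof -
      have "0 < a * a * (a * a + x * x)" using a pos[of x] by (simp add: power2_eq_square)
      then have "a * (a * (a * a)) + a * (a * (x * x)) \<noteq> 0" by (simp add: algebra_simps)
      then show ?thesis using a pos[of x] by (auto intro!: derivative_eq_intros simp: field_simps power2_eq_square)
    qed
    then show ?thesis by (simp add: has_real_derivative_iff_has_vector_derivative)
  qed
  have hb: "has_bochner_integral lborel (\<lambda>\<xi>. indicator {-real n..real n} \<xi> *\<^sub>R (1 / (a\<^sup>2 + \<xi>\<^sup>2)))
      (arctan (real n / a) / a - arctan (- real n / a) / a)"
    by (rule has_bochner_integral_FTC_Icc) (use arc pos in \<open>auto intro!: continuous_intros simp: less_imp_neq[symmetric]\<close>)
  have hb': "has_bochner_integral lebesgue (\<lambda>\<xi>. (norm (w \<xi>))\<^sup>2) (arctan (real n / a) / a - arctan (- real n / a) / a)"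
    unfolding wsq using hb borel_measurable_integrable[of lborel "\<lambda>\<xi>. indicator {-real n..real n} \<xi> *\<^sub>R (1 / (a\<^sup>2 + \<xi>\<^sup>2))"]
    by (simp add: has_bochner_integral_iff integrable_completion integral_completion)
  then have wL: "w \<in> L2_space" using wm by (auto simp: L2_space_iff has_bochner_integral_iff)
  have "(norm (cls w))\<^sup>2 = arctan (real n / a) / a - arctan (- real n / a) / a"
    using hb' wL by (simp add: norm_cls_power2 has_bochner_integral_iff)
  also have "\<dots> \<le> (pi / 2) / a - (- (pi / 2)) / a"
    using a arctan_ubound[of "real n / a"] arctan_lbound[of "- real n / a"]
    by (intro diff_mono divide_right_mono) auto
  finally have wn: "(norm (cls w))\<^sup>2 \<le> pi / a" by simp
  have Dk: "(\<lambda>\<xi>. sym_D n \<xi> * k \<xi>) \<in> L2_space" by (rule mult_L2[OF bdd_symbol_D k(1)])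
  have pm: "p \<in> borel_measurable lebesgue"
  proof -
    have "(\<lambda>\<xi>. complex_of_real (sqrt (a\<^sup>2 + \<xi>\<^sup>2)) * indicator {-real n..real n} \<xi>) \<in> borel_measurable lebesgue"
      by (rule measurable_completion) measurable
    moreover have "(\<lambda>\<xi>. complex_of_real (norm (k \<xi>))) \<in> borel_measurable lebesgue"
      using L2_space_measurable[OF k(1)] by measurable
    moreover have "p = (\<lambda>\<xi>. (complex_of_real (sqrt (a\<^sup>2 + \<xi>\<^sup>2)) * indicator {-real n..real n} \<xi>) * complex_of_real (norm (k \<xi>)))"
      by (auto simp: p_def fun_eq_iff)
    ultimately show ?thesis by (simp only: borel_measurable_times)
  qed
  have psq: "AE \<xi> in lebesgue. (norm (p \<xi>))\<^sup>2 = a\<^sup>2 * (norm (k \<xi>))\<^sup>2 + (norm (sym_D n \<xi> * k \<xi>))\<^sup>2"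
    using k(2) unfolding csupp_def
  proof eventually_elim
    case (elim \<xi>)
    show ?case
    proof (cases "\<xi> \<in> {-real n..real n}")
      case True
      then show ?thesis using pos[of \<xi>] less_imp_le[OF pos[of \<xi>]]
        by (simp add: p_def sym_D_def norm_mult power_mult_distrib abs_mult algebra_simps)
    next
      case False
      then have "k \<xi> = 0" using elim by (auto simp: abs_if split: if_splits)
      then show ?thesis by (simp add: p_def)
    qed
  qed
  have int: "integrable lebesgue (\<lambda>\<xi>. a\<^sup>2 * (norm (k \<xi>))\<^sup>2 + (norm (sym_D n \<xi> * k \<xi>))\<^sup>2)"
    using k(1) Dk by (auto simp: L2_space_iff)
  have pL: "p \<in> L2_space"
    unfolding L2_space_iff using pm int integrable_cong_AE[OF _ _ psq] by (auto simp: borel_measurable_integrable)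
  have pn: "(norm (cls p))\<^sup>2 = a\<^sup>2 * (norm (cls k))\<^sup>2 + (norm (cls (\<lambda>\<xi>. sym_D n \<xi> * k \<xi>)))\<^sup>2"
  proof -
    have "(norm (cls p))\<^sup>2 = (LINT \<xi>|lebesgue. a\<^sup>2 * (norm (k \<xi>))\<^sup>2 + (norm (sym_D n \<xi> * k \<xi>))\<^sup>2)"
      unfolding norm_cls_power2[OF pL] using pm int psq by (intro integral_cong_AE) (auto simp: borel_measurable_integrable)
    then show ?thesis using k(1) Dk by (simp add: norm_cls_power2 L2_space_iff)
  qed
  have ae: "AE \<xi> in lebesgue. w \<xi> \<bullet> p \<xi> = norm (k \<xi>)"
    using k(2) unfolding csupp_def
  proof eventually_elim
    case (elim \<xi>)
    show ?case
    proof (cases "\<xi> \<in> {-real n..real n}")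
      case True
      then show ?thesis using pos[of \<xi>] a by (simp add: p_def w_def inner_complex_def)
    next
      case False
      then have "k \<xi> = 0" using elim by (auto simp: abs_if split: if_splits)
      then show ?thesis by (simp add: p_def)
    qed
  qed
  have "(LINT \<xi>|lebesgue. norm (k \<xi>)) = (LINT \<xi>|lebesgue. w \<xi> \<bullet> p \<xi>)"
    using ae L2_space_measurable[OF k(1)] borel_measurable_integrable[OF integrable_L2_inner[OF wL pL]]
    by (intro integral_cong_AE) (auto elim: eventually_mono)
  also have "\<dots> = cls w \<bullet> cls p" by (rule inner_cls[OF wL pL, symmetric])
  finally have "(LINT \<xi>|lebesgue. norm (k \<xi>))\<^sup>2 = (cls w \<bullet> cls p)\<^sup>2" by simp
  also have "\<dots> \<le> (cls w \<bullet> cls w) * (cls p \<bullet> cls p)" by (rule Cauchy_Schwarz_ineq)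
  also have "\<dots> = (norm (cls w))\<^sup>2 * (norm (cls p))\<^sup>2" by (simp add: power2_norm_eq_inner)
  also have "\<dots> \<le> (pi / a) * (norm (cls p))\<^sup>2" by (intro mult_right_mono wn) auto
  also have "\<dots> = pi * (a * (norm (cls k))\<^sup>2 + (norm (cls (\<lambda>\<xi>. sym_D n \<xi> * k \<xi>)))\<^sup>2 / a)"
    unfolding pn using a by (simp add: field_simps power2_eq_square)
  finally show ?thesis .
qed

text \<open>A band-limited function has the explicit representative \<open>x \<mapsto> FI k (-x)\<close>.\<close>

lemma band_limited_rep:
  fixes n F
  defines "k \<equiv> rep (mulop (sym_P n) (fourier F))"
  shows "csupp (real n) k" "AE x in lebesgue. rep (PN n F) x = FI k (- x)" "(\<lambda>x. FI k (- x)) \<in> L2_space"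
    "cls (\<lambda>x. FI k (- x)) = PN n F"
proof -
  show c: "csupp (real n) k"
    unfolding k_def sym_P_def using csupp_trunc[of "real n" "fourier F"] by (simp add: trunc_def)
  have L: "FI k \<in> L2_space" using FI_csupp_L2 c unfolding k_def by blast
  show L': "(\<lambda>x. FI k (- x)) \<in> L2_space" using affine_L2[OF _ L, of "-1" 0] by simp
  have "fourier (mulop (sym_P n) (fourier F)) = cls (FI k)"
    using fourier_csupp c unfolding k_def by blast
  then show cl: "cls (\<lambda>x. FI k (- x)) = PN n F"
    by (simp add: PN_def fmult_def refl_op_cls[OF L])
  show "AE x in lebesgue. rep (PN n F) x = FI k (- x)"
    using rep_cls[OF L'] by (simp add: cl)
qed

text \<open>A band-limited function is bounded by the L^1 norm of its transform, which
  \<open>weight_bound\<close> controls. The bound is uniform in \<open>n\<close> and passes to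
  \<open>F\<close> along a subsequence converging almost everywhere. The scale \<open>a\<close>
  stays free for later use.\<close>

lemma sobolev:
  assumes F: "H1c F" and a: "0 < a"
  shows "AE x in lebesgue. (norm (rep F x))\<^sup>2 \<le> pi * (a * (norm F)\<^sup>2 + (dn F)\<^sup>2 / a)"
proof -
  have b: "AE x in lebesgue. (norm (rep (PN n F) x))\<^sup>2 \<le> pi * (a * (norm F)\<^sup>2 + (dn F)\<^sup>2 / a)" for n
  proof -
    define k where "k = rep (mulop (sym_P n) (fourier F))"
    note k = band_limited_rep[of n F, folded k_def]
    have kL: "k \<in> L2_space" by (simp add: k_def)
    have "cls (\<lambda>\<xi>. sym_D n \<xi> * k \<xi>) = mulop (\<lambda>\<xi>. sym_D n \<xi> * sym_P n \<xi>) (fourier F)"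
      unfolding k_def mulop_mulop[OF bdd_symbol_D bdd_symbol_P, symmetric] mulop_def[of "sym_D n"] ..
    also have "\<dots> = mulop (sym_D n) (fourier F)"
      by (rule arg_cong[of _ _ "\<lambda>m. mulop m (fourier F)"]) (auto simp: sym_D_def sym_P_def indicator_def)
    finally have nd: "norm (cls (\<lambda>\<xi>. sym_D n \<xi> * k \<xi>)) = norm (DN n F)" by (simp add: DN_def fmult_def)
    have nk: "norm (cls k) \<le> norm F" using norm_mulop[OF bdd_symbol_P, of n "fourier F"] by (simp add: k_def)
    show ?thesis using k(2)
    proof eventually_elim
      case (elim x)
      have "(norm (rep (PN n F) x))\<^sup>2 \<le> (LINT \<xi>|lebesgue. norm (k \<xi>))\<^sup>2"
        unfolding elim by (intro power_mono norm_FI_le csupp_L1(1)[OF kL k(1)]) auto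
      also have "\<dots> \<le> pi * (a * (norm (cls k))\<^sup>2 + (norm (DN n F))\<^sup>2 / a)"
        using weight_bound[OF a kL k(1)] by (simp add: nd)
      also have "\<dots> \<le> pi * (a * (norm F)\<^sup>2 + (dn F)\<^sup>2 / a)"
        using a nk DN_le_dn[OF F] by (intro mult_left_mono add_mono divide_right_mono power_mono) auto
      finally show ?case .
    qed
  qed
  obtain r where r: "strict_mono r" "AE x in lebesgue. (\<lambda>n. rep (PN (r n) F) x) \<longlonglongrightarrow> rep F x"
    using AE_subseq_of_tendsto[OF PN_tendsto[of F]] by blast
  have "AE x in lebesgue. \<forall>n. (norm (rep (PN n F) x))\<^sup>2 \<le> pi * (a * (norm F)\<^sup>2 + (dn F)\<^sup>2 / a)"
    unfolding AE_all_countable using b by blast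
  then show ?thesis using r(2)
  proof eventually_elim
    case (elim x)
    have "(\<lambda>n. (norm (rep (PN (r n) F) x))\<^sup>2) \<longlonglongrightarrow> (norm (rep F x))\<^sup>2"
      by (intro tendsto_intros elim)
    then show ?case by (rule LIMSEQ_le_const2) (use elim in auto)
  qed
qed

text \<open>The bound of \<open>sobolev\<close> at \<open>a = 1\<close>, not the essential supremum
  itself. Being an expression in \<open>norm F\<close> and \<open>dn F\<close>, it is continuous
  along curves in H^1 and monotone in the two norms.\<close>

definition sup_bd :: "cL2 \<Rightarrow> real" where "sup_bd F = sqrt (pi * ((norm F)\<^sup>2 + (dn F)\<^sup>2))"

lemma sup_bd: "H1c F \<Longrightarrow> AE x in lebesgue. norm (rep F x) \<le> sup_bd F"
  using sobolev[of F 1] unfolding sup_bd_def by (auto elim!: eventually_mono intro: real_le_rsqrt)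

lemma sup_bd_nonneg [simp]: "0 \<le> sup_bd F"
  by (simp add: sup_bd_def)

lemma bdd_symbol_rep: "H1c F \<Longrightarrow> bdd_symbol (rep F) (sup_bd F)"
  using sup_bd[of F] by (simp add: bdd_symbol_def)

section \<open>Difference quotients and the product estimate\<close>

lemma norm_cis_minus_one: "norm (cis y - 1) \<le> \<bar>y\<bar>"
proof -
  have "(norm (cis y - 1))\<^sup>2 = 2 - 2 * cos y"
    unfolding cmod_power2 using sin_cos_squared_add[of y] by (simp add: power2_eq_square algebra_simps)
  also have "\<dots> = 4 * (sin (y / 2))\<^sup>2" using cos_double_sin[of "y / 2"] by simp
  also have "\<dots> \<le> 4 * \<bar>y / 2\<bar>\<^sup>2"
    using power_mono[OF abs_sin_x_le_abs_x[of "y / 2"], of 2] by simp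
  finally have "(norm (cis y - 1))\<^sup>2 \<le> \<bar>y\<bar>\<^sup>2" by (simp add: power_divide)
  then show ?thesis by (rule power2_le_imp_le) simp
qed

text \<open>On the Fourier side the increment has symbol \<open>cis (\<xi> * h) - 1\<close>, of
  modulus at most \<open>\<bar>h\<bar> * \<bar>\<xi>\<bar>\<close>. This is read off for
  \<open>PN n F\<close> and passes to the limit.\<close>

lemma translate_le:
  assumes "H1c F" shows "norm (affop h 1 F - F) \<le> \<bar>h\<bar> * dn F"
proof -
  have s: "bdd_symbol (\<lambda>\<xi>. cis (\<xi> * h)) 1" by (rule bdd_symbol_cis) measurable
  have s1: "bdd_symbol (\<lambda>\<xi>. cis (\<xi> * h) - 1) 2"
    using bdd_symbol_add[OF s bdd_symbol_const[of "-1"]] by simp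
  have eq: "affop h 1 F - F = fmult (\<lambda>\<xi>. cis (\<xi> * h) - 1) F" for F
    by (rule fourier_inj)
       (simp add: affop_fmult fourier_fmult fourier_diff mulop_symbol_diff[OF s bdd_symbol_const])
  have "norm (affop h 1 (PN n F) - PN n F) \<le> \<bar>h\<bar> * dn F" for n
  proof -
    have "norm (affop h 1 (PN n F) - PN n F) = norm (fmult (\<lambda>\<xi>. (cis (\<xi> * h) - 1) * sym_P n \<xi>) F)"
      unfolding eq PN_def fmult_fmult[OF s1 bdd_symbol_P] ..
    also have "\<dots> \<le> \<bar>h\<bar> * norm (DN n F)"
      unfolding DN_def
    proof (rule norm_fmult_mono[OF bdd_symbol_mult[OF s1 bdd_symbol_P] bdd_symbol_D])
      from norm_cis_minus_one[of "_ * h"] show "norm ((cis (\<xi> * h) - 1) * sym_P n \<xi>) \<le> \<bar>h\<bar> * norm (sym_D n \<xi>)" for \<xi>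
        by (auto simp: sym_P_def sym_D_def indicator_def norm_mult abs_mult mult.commute)
    qed simp
    also have "\<dots> \<le> \<bar>h\<bar> * dn F" by (intro mult_left_mono DN_le_dn assms) simp
    finally show ?thesis .
  qed
  moreover have "(\<lambda>n. norm (affop h 1 (PN n F) - PN n F)) \<longlonglongrightarrow> norm (affop h 1 F - F)"
    by (intro tendsto_intros bounded_linear.tendsto[OF bounded_linear_affop] PN_tendsto) simp
  ultimately show ?thesis by (intro LIMSEQ_le_const2) auto
qed

text \<open>Converse of \<open>translate_le\<close>: after the cut-off, the difference quotients of
  step \<open>h k\<close> converge to \<open>DN n F\<close>, so a Lipschitz bound for translations
  bounds every truncated derivative.\<close>

lemma translate_bound_DN:
  assumes "\<And>h. h \<noteq> 0 \<Longrightarrow> norm (affop h 1 F - F) \<le> \<bar>h\<bar> * c"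
  shows "norm (DN n F) \<le> c"
proof -
  define h where "h k = inverse (real (Suc k))" for k
  have h: "0 < h k" for k by (simp add: h_def)
  \<comment> \<open>Symbol of the projected difference quotient. The projection makes it bounded by
    \<open>real n\<close> for all \<open>k\<close>, as dominated convergence requires.\<close>
  define m where "m k \<xi> = of_real (1 / h k) * (cis (\<xi> * h k) - 1) * sym_P n \<xi>" for k \<xi>
  have s: "bdd_symbol (\<lambda>\<xi>. cis (\<xi> * t)) 1" for t by (rule bdd_symbol_cis) measurable
  have s1: "bdd_symbol (\<lambda>\<xi>. cis (\<xi> * t) - 1) 2" for t
    using bdd_symbol_add[OF s bdd_symbol_const[of "-1"]] by simp
  have mb: "bdd_symbol (m k) (real n)" for k
  proof (rule bdd_symbolI)
    show "m k \<in> borel_measurable lebesgue" unfolding m_def sym_P_def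
      by (rule measurable_completion) measurable
    show "norm (m k \<xi>) \<le> real n" for \<xi>
    proof -
      have "norm (cis (\<xi> * h k) - 1) / h k \<le> \<bar>\<xi>\<bar>"
        using norm_cis_minus_one[of "\<xi> * h k"] h[of k] by (simp add: pos_divide_le_eq abs_mult)
      then show ?thesis
        using h[of k] by (auto simp: m_def sym_P_def indicator_def norm_mult norm_divide)
    qed
  qed
  have "norm (fmult (m k) F) \<le> c" for k
  proof -
    have eq: "affop t 1 F - F = fmult (\<lambda>\<xi>. cis (\<xi> * t) - 1) F" for t
      by (rule fourier_inj)
         (simp add: affop_fmult fourier_fmult fourier_diff mulop_symbol_diff[OF s bdd_symbol_const])
    have "fmult (m k) F = PN n ((1 / h k) *\<^sub>R (affop (h k) 1 F - F))"
    proof (rule fourier_inj)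
      show "fourier (fmult (m k) F) = fourier (PN n ((1 / h k) *\<^sub>R (affop (h k) 1 F - F)))"
        unfolding eq PN_def fourier_fmult fourier_scaleR
        unfolding mulop_of_real[symmetric] mulop_mulop[OF bdd_symbol_const s1] mulop_mulop[OF bdd_symbol_P bdd_symbol_mult[OF bdd_symbol_const s1]]
        by (rule arg_cong[of _ _ "\<lambda>m. mulop m (fourier F)"]) (auto simp: m_def)
    qed
    then have "norm (fmult (m k) F) \<le> norm ((1 / h k) *\<^sub>R (affop (h k) 1 F - F))" by (simp only: norm_PN)
    also have "\<dots> = norm (affop (h k) 1 F - F) / h k" using h[of k] by simp
    also have "\<dots> \<le> c" using assms[of "h k"] h[of k] by (simp add: pos_divide_le_eq mult.commute)
    finally show ?thesis .
  qed
  moreover have "(\<lambda>k. fmult (m k) F) \<longlonglongrightarrow> DN n F"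
    unfolding DN_def
  proof (rule fmult_tendsto[OF mb])
    show "sym_D n \<in> borel_measurable lebesgue" using bdd_symbol_D by (simp add: bdd_symbol_def)
    fix \<xi> :: real
    have "((\<lambda>z. exp (\<i> * \<xi> * z)) has_field_derivative \<i> * \<xi>) (at 0)"
      by (auto intro!: derivative_eq_intros)
    then have "((\<lambda>z. (exp (\<i> * \<xi> * z) - 1) / z) \<longlongrightarrow> \<i> * \<xi>) (at 0)"
      by (simp add: has_field_derivative_iff)
    moreover have "filterlim (\<lambda>k. complex_of_real (h k)) (at 0) sequentially"
    proof -
      have "h \<longlonglongrightarrow> 0" unfolding h_def by (rule LIMSEQ_inverse_real_of_nat)
      then have "(\<lambda>k. complex_of_real (h k)) \<longlonglongrightarrow> of_real 0" by (rule tendsto_of_real)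
      moreover have "complex_of_real (h k) \<noteq> 0" for k using h[of k] by simp
      ultimately show ?thesis by (simp add: filterlim_at)
    qed
    ultimately have "(\<lambda>k. (exp (\<i> * \<xi> * of_real (h k)) - 1) / of_real (h k)) \<longlonglongrightarrow> \<i> * \<xi>"
      by (rule filterlim_compose)
    then have "(\<lambda>k. (exp (\<i> * \<xi> * of_real (h k)) - 1) / of_real (h k) * sym_P n \<xi>) \<longlonglongrightarrow> \<i> * \<xi> * sym_P n \<xi>"
      by (intro tendsto_intros)
    moreover have "(\<lambda>k. (exp (\<i> * \<xi> * of_real (h k)) - 1) / of_real (h k) * sym_P n \<xi>) = (\<lambda>k. m k \<xi>)"
      by (auto simp: m_def cis_conv_exp mult.assoc)
    ultimately show "(\<lambda>k. m k \<xi>) \<longlonglongrightarrow> sym_D n \<xi>"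
      by (simp add: sym_D_def sym_P_def)
  qed
  ultimately show ?thesis by (intro LIMSEQ_le_const2[OF tendsto_norm]) auto
qed

text \<open>The product rule is applied to increments, \<open>v(x+h) f(x+h) - v(x) f(x) = v(x+h)
  (f(x+h) - f(x)) + f(x) (v(x+h) - v(x))\<close>, and the two lemmas on translations convert
  increments to derivatives and back. In each term one factor is measured in the supremum
  norm.\<close>

lemma product_H1:
  assumes V: "H1c V" and F: "H1c F"
    and \<alpha>: "AE x in lebesgue. norm (rep V x) \<le> \<alpha>" and \<beta>: "AE x in lebesgue. norm (rep F x) \<le> \<beta>"
    and nonneg: "0 \<le> \<alpha>" "0 \<le> \<beta>"
  shows "H1c (mulop (rep V) F)" "dn (mulop (rep V) F) \<le> \<alpha> * dn F + \<beta> * dn V"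
proof -
  have s: "bdd_symbol (rep V) \<alpha>" using \<alpha> nonneg by (simp add: bdd_symbol_def)
  have "norm (affop h 1 (mulop (rep V) F) - mulop (rep V) F) \<le> \<bar>h\<bar> * (\<alpha> * dn F + \<beta> * dn V)" for h
  proof -
    define v where "v = rep V"
    define f where "f = rep F"
    have L: "v \<in> L2_space" "f \<in> L2_space" "(\<lambda>x. v (h + 1 * x)) \<in> L2_space" "(\<lambda>x. f (h + 1 * x)) \<in> L2_space"
      unfolding v_def f_def using rep_L2 by (auto intro!: affine_L2[of 1 _ h, simplified])
    have vh: "bdd_symbol (\<lambda>x. v (h + 1 * x)) \<alpha>"
      using AE_affine[OF _ \<alpha>, of 1 h] L nonneg by (auto simp: v_def bdd_symbol_def L2_space_measurable)
    have fb: "bdd_symbol f \<beta>" using \<beta> nonneg by (auto simp: f_def bdd_symbol_def)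
    have vL: "(\<lambda>x. v x * f x) \<in> L2_space" unfolding v_def f_def by (rule mult_L2[OF s rep_L2])
    have df: "(\<lambda>x. f (h + 1 * x) - f x) \<in> L2_space" "(\<lambda>x. v (h + 1 * x) - v x) \<in> L2_space"
      using L by auto
    have "affop h 1 (mulop (rep V) F) - mulop (rep V) F = cls (\<lambda>x. v (h + 1 * x) * f (h + 1 * x) - v x * f x)"
      using affine_L2[OF _ vL, of 1 h] vL
      by (simp add: mulop_def v_def[symmetric] f_def[symmetric] affop_cls cls_diff)
    also have "\<dots> = cls (\<lambda>x. v (h + 1 * x) * (f (h + 1 * x) - f x) + f x * (v (h + 1 * x) - v x))"
      by (rule arg_cong[of _ _ cls]) (auto simp: algebra_simps)
    also have "\<dots> = cls (\<lambda>x. v (h + 1 * x) * (f (h + 1 * x) - f x)) + cls (\<lambda>x. f x * (v (h + 1 * x) - v x))"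
      by (rule cls_add[OF mult_L2[OF vh df(1)] mult_L2[OF fb df(2)]])
    also have "\<dots> = mulop (\<lambda>x. v (h + 1 * x)) (affop h 1 F - F) + mulop f (affop h 1 V - V)"
    proof -
      have "affop h 1 F - F = cls (\<lambda>x. f (h + 1 * x) - f x)" "affop h 1 V - V = cls (\<lambda>x. v (h + 1 * x) - v x)"
        using L cls_diff[OF L(4) L(2)] cls_diff[OF L(3) L(1)] by (simp_all add: affop_def f_def v_def)
      then show ?thesis by (simp add: mulop_cls[OF vh df(1), simplified] mulop_cls[OF fb df(2), simplified])
    qed
    finally have "norm (affop h 1 (mulop (rep V) F) - mulop (rep V) F)
        \<le> norm (mulop (\<lambda>x. v (h + 1 * x)) (affop h 1 F - F)) + norm (mulop f (affop h 1 V - V))"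
      using norm_triangle_ineq by metis
    also have "\<dots> \<le> \<alpha> * norm (affop h 1 F - F) + \<beta> * norm (affop h 1 V - V)"
      by (intro add_mono norm_mulop vh fb)
    also have "\<dots> \<le> \<alpha> * (\<bar>h\<bar> * dn F) + \<beta> * (\<bar>h\<bar> * dn V)"
      using nonneg by (intro add_mono mult_left_mono translate_le V F) auto
    finally show ?thesis by (simp add: algebra_simps)
  qed
  then have "norm (DN n (mulop (rep V) F)) \<le> \<alpha> * dn F + \<beta> * dn V" for n
    by (rule translate_bound_DN)
  then show "H1c (mulop (rep V) F)" "dn (mulop (rep V) F) \<le> \<alpha> * dn F + \<beta> * dn V"
    by (auto intro: H1cI dn_le)
qed

section \<open>Weak derivatives\<close>

lemma test_function_deriv:
  assumes "test_function \<phi>" shows "test_function (deriv \<phi>)"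
  unfolding test_function_def
proof
  have "(deriv ^^ k) (deriv \<phi>) = (deriv ^^ Suc k) \<phi>" for k
    by (simp add: funpow_Suc_right del: funpow.simps)
  then show "\<forall>k. (deriv ^^ k) (deriv \<phi>) differentiable_on UNIV"
    using assms unfolding test_function_def by metis
  obtain R where R: "\<And>x. R < \<bar>x\<bar> \<Longrightarrow> \<phi> x = 0" using assms by (auto simp: test_function_def)
  have "deriv \<phi> x = 0" if "R < \<bar>x\<bar>" for x
  proof (rule DERIV_imp_deriv)
    have "open {x::real. R < \<bar>x\<bar>}" by (intro open_Collect_less continuous_intros)
    then show "(\<phi> has_real_derivative 0) (at x)"
      by (rule has_field_derivative_transform_within_open[OF DERIV_const[of 0]]) (use R that in auto)
  qed
  then show "\<exists>R. \<forall>x. R < \<bar>x\<bar> \<longrightarrow> deriv \<phi> x = 0" by blast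
qed

lemma test_function_L2:
  assumes "test_function \<phi>" shows "\<phi> \<in> L2_space"
proof -
  obtain R where R: "\<And>x. R < \<bar>x\<bar> \<Longrightarrow> \<phi> x = 0" using assms by (auto simp: test_function_def)
  have "(deriv ^^ 0) \<phi> differentiable_on UNIV" using assms unfolding test_function_def by blast
  then have c: "continuous_on UNIV \<phi>" by (simp add: differentiable_imp_continuous_on)
  then have "compact (\<phi> ` {-R..R})" by (intro compact_continuous_image) (auto intro: continuous_on_subset)
  then obtain B where B: "\<And>x. x \<in> {-R..R} \<Longrightarrow> norm (\<phi> x) \<le> B"
    using compact_imp_bounded bounded_iff by (metis imageI)
  show ?thesis
  proof (rule L2_space_bound[OF indicator_L2[of "{-R..R}" R]])
    show "\<phi> \<in> borel_measurable lebesgue"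
      by (rule measurable_completion) (simp add: borel_measurable_continuous_onI c)
    show "AE x in lebesgue. norm (\<phi> x) \<le> B * norm (indicator {-R..R} x :: complex)"
    proof (rule AE_I2)
      fix x
      show "norm (\<phi> x) \<le> B * norm (indicator {-R..R} x :: complex)"
      proof (cases "x \<in> {-R..R}")
        case False
        then have "R < \<bar>x\<bar>" by auto
        then show ?thesis using R[of x] False by simp
      qed (use B[of x] in simp)
    qed
  qed auto
qed

lemma integrable_scaleR_L2:
  fixes f :: "real \<Rightarrow> 'a::euclidean_space" and p :: "real \<Rightarrow> real"
  assumes "p \<in> L2_space" "f \<in> L2_space" shows "integrable lebesgue (\<lambda>x. p x *\<^sub>R f x)"
proof (rule Bochner_Integration.integrable_bound)
  show "integrable lebesgue (\<lambda>x. (norm (p x))\<^sup>2 + (norm (f x))\<^sup>2)"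
    using assms by (auto simp: L2_space_iff)
  show "(\<lambda>x. p x *\<^sub>R f x) \<in> borel_measurable lebesgue"
    using assms by (intro borel_measurable_scaleR) (auto simp: L2_space_iff)
  show "AE x in lebesgue. norm (p x *\<^sub>R f x) \<le> norm ((norm (p x))\<^sup>2 + (norm (f x))\<^sup>2)"
  proof (rule AE_I2)
    fix x
    have "norm (p x *\<^sub>R f x) \<le> (norm (p x))\<^sup>2 + (norm (f x))\<^sup>2"
    proof -
      have "2 * (\<bar>p x\<bar> * norm (f x)) \<le> (norm (p x))\<^sup>2 + (norm (f x))\<^sup>2"
        using sum_squares_bound[of "\<bar>p x\<bar>" "norm (f x)"] by (simp add: mult.assoc)
      moreover have "0 \<le> \<bar>p x\<bar> * norm (f x)" by simp
      ultimately show ?thesis unfolding norm_scaleR by linarith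
    qed
    then show "norm (p x *\<^sub>R f x) \<le> norm ((norm (p x))\<^sup>2 + (norm (f x))\<^sup>2)" by simp
  qed
qed

lemma has_weak_deriv_diff:
  fixes f g f' g' :: "real \<Rightarrow> 'a::euclidean_space"
  assumes "has_weak_deriv f f'" "has_weak_deriv g g'"
    and "f \<in> L2_space" "g \<in> L2_space" "f' \<in> L2_space" "g' \<in> L2_space"
  shows "has_weak_deriv (\<lambda>x. f x - g x) (\<lambda>x. f' x - g' x)"
  unfolding has_weak_deriv_def
proof (intro allI impI)
  fix \<phi> assume t: "test_function \<phi>"
  note L = test_function_L2[OF t] test_function_L2[OF test_function_deriv[OF t]]
  show "(LINT x|lebesgue. deriv \<phi> x *\<^sub>R (f x - g x)) = - (LINT x|lebesgue. \<phi> x *\<^sub>R (f' x - g' x))"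
    using assms(1,2) t unfolding has_weak_deriv_def
    by (simp add: scaleR_diff_right integrable_scaleR_L2 L assms)
qed

lemma H1_space_diff:
  fixes f g :: "real \<Rightarrow> 'a::euclidean_space"
  assumes "f \<in> H1_space" "g \<in> H1_space" shows "(\<lambda>x. f x - g x) \<in> H1_space"
proof -
  obtain f' g' where "f' \<in> L2_space" "has_weak_deriv f f'" "g' \<in> L2_space" "has_weak_deriv g g'"
    using assms by (auto simp: H1_space_def)
  then show ?thesis
    using assms has_weak_deriv_diff[of f f' g g'] unfolding H1_space_def
    by (auto intro!: bexI[of _ "\<lambda>x. f' x - g' x"])
qed

text \<open>\<open>test_function\<close> asks for differentiability of every iterated
  \<open>deriv\<close>. Membership in a set closed under differentiation proves all of these at
  once, so higher derivatives need not be written down.\<close>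

definition dclosed :: "(real \<Rightarrow> real) set \<Rightarrow> bool" where
  "dclosed X \<longleftrightarrow> (\<forall>g\<in>X. \<exists>g'\<in>X. \<forall>x. (g has_real_derivative g' x) (at x))"

lemma dclosed_iter:
  assumes "dclosed X" "f \<in> X" shows "(deriv ^^ k) f \<in> X"
proof (induction k)
  case (Suc k)
  then obtain g' where g': "g' \<in> X" "\<And>x. ((deriv ^^ k) f has_real_derivative g' x) (at x)"
    using assms(1) by (auto simp: dclosed_def)
  then have "deriv ((deriv ^^ k) f) = g'" by (auto intro!: ext DERIV_imp_deriv)
  then show ?case using g'(1) by simp
qed (simp add: assms)

lemma dclosed_test_function:
  assumes "dclosed X" "f \<in> X" "\<And>x. R < \<bar>x\<bar> \<Longrightarrow> f x = 0" shows "test_function f"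
proof -
  have "g differentiable_on UNIV" if "g \<in> X" for g
    using assms(1) that unfolding dclosed_def differentiable_on_def
    by (meson has_field_derivative_imp_has_derivative differentiable_def)
  then show ?thesis using dclosed_iter[OF assms(1,2)] assms(3) unfolding test_function_def by blast
qed

text \<open>The Leibniz rule sends a product to a sum of two products, so sums of products inherit
  closure under differentiation from the two factors.\<close>

inductive_set prod_span :: "(real \<Rightarrow> real) set \<Rightarrow> (real \<Rightarrow> real) set \<Rightarrow> (real \<Rightarrow> real) set"
  for A B where
  base: "a \<in> A \<Longrightarrow> b \<in> B \<Longrightarrow> (\<lambda>x. a x * b x) \<in> prod_span A B"
| add: "f \<in> prod_span A B \<Longrightarrow> g \<in> prod_span A B \<Longrightarrow> (\<lambda>x. f x + g x) \<in> prod_span A B"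

lemma dclosed_prod_span:
  assumes "dclosed A" "dclosed B" shows "dclosed (prod_span A B)"
  unfolding dclosed_def
proof
  fix g assume "g \<in> prod_span A B"
  then show "\<exists>g'\<in>prod_span A B. \<forall>x. (g has_real_derivative g' x) (at x)"
  proof induction
    case (base a b)
    then obtain a' b' where "a' \<in> A" "b' \<in> B" "\<And>x. (a has_real_derivative a' x) (at x)"
        "\<And>x. (b has_real_derivative b' x) (at x)" using assms unfolding dclosed_def by meson
    then show ?case using base
      by (intro bexI[of _ "\<lambda>x. a' x * b x + a x * b' x"] allI prod_span.intros)
         (auto intro!: derivative_eq_intros)
  next
    case (add f g)
    then obtain f' g' where "f' \<in> prod_span A B" "g' \<in> prod_span A B"
      "\<And>x. (f has_real_derivative f' x) (at x)" "\<And>x. (g has_real_derivative g' x) (at x)" by blast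
    then show ?case
      by (intro bexI[of _ "\<lambda>x. f' x + g' x"] allI DERIV_add prod_span.add)
  qed
qed

text \<open>The classical flat function, with a polynomial in \<open>1 / x\<close> in front.
  Differentiation stays in the family: it replaces \<open>p\<close> by
  \<open>[:0, 0, 1:] * (p - pderiv p)\<close>, where \<open>[:0, 0, 1:]\<close> is the factor
  \<open>(1 / x)\<^sup>2\<close> from the chain rule.\<close>

definition flat :: "real poly \<Rightarrow> real \<Rightarrow> real" where
  "flat p x = (if 0 < x then poly p (1 / x) * exp (- (1 / x)) else 0)"

lemma poly_exp_tendsto: "((\<lambda>y::real. poly p y * exp (- y)) \<longlongrightarrow> 0) at_top"
proof -
  have "((\<lambda>y::real. \<Sum>i\<le>degree p. coeff p i * (y ^ i / exp y)) \<longlongrightarrow> (\<Sum>i\<le>degree p. coeff p i * 0)) at_top"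
    by (intro tendsto_intros tendsto_power_div_exp_0)
  moreover have "(\<Sum>i\<le>degree p. coeff p i * (y ^ i / exp y)) = poly p y * exp (- y)" for y :: real
    by (simp add: poly_altdef sum_distrib_right exp_minus divide_inverse mult.assoc)
  ultimately show ?thesis by simp
qed

lemma flat_deriv: "(flat p has_real_derivative flat ([:0, 0, 1:] * (p - pderiv p)) x) (at x)"
proof -
  consider "x < 0" | "x > 0" | "x = 0" by linarith
  then show ?thesis
  proof cases
    case 1
    then have "flat ([:0, 0, 1:] * (p - pderiv p)) x = 0" by (simp add: flat_def)
    moreover have "(flat p has_real_derivative 0) (at x)"
      by (rule has_field_derivative_transform_within_open[OF DERIV_const[of 0], of "{..<0}"])
         (use 1 in \<open>auto simp: flat_def\<close>)
    ultimately show ?thesis by simp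
  next
    case 2
    have "((\<lambda>x. poly p (1 / x) * exp (- (1 / x))) has_real_derivative
        flat ([:0, 0, 1:] * (p - pderiv p)) x) (at x)"
      using 2 unfolding flat_def
      by (auto intro!: derivative_eq_intros DERIV_chain2[OF poly_DERIV] simp: field_simps power2_eq_square)
    then show ?thesis
      by (rule has_field_derivative_transform_within_open[of _ _ _ "{0<..}"])
         (use 2 in \<open>auto simp: flat_def\<close>)
  next
    case 3
    have r: "((\<lambda>h. flat p h / h) \<longlongrightarrow> 0) (at_right 0)"
    proof (rule Lim_transform_eventually)
      show "((\<lambda>h::real. poly (pCons 0 p) (inverse h) * exp (- inverse h)) \<longlongrightarrow> 0) (at_right 0)"
        by (rule filterlim_compose[OF poly_exp_tendsto filterlim_inverse_at_top_right])
      show "\<forall>\<^sub>F h in at_right 0. poly (pCons 0 p) (inverse h) * exp (- inverse h) = flat p h / h"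
        unfolding eventually_at_right_field by (intro exI[of _ 1]) (auto simp: flat_def divide_inverse)
    qed
    have l: "((\<lambda>h. flat p h / h) \<longlongrightarrow> 0) (at_left 0)"
      by (rule tendsto_eventually) (auto simp: eventually_at_left_field flat_def intro!: exI[of _ "-1"])
    have "((\<lambda>h. flat p h / h) \<longlongrightarrow> 0) (at 0)" using l r by (rule filterlim_split_at)
    then show ?thesis using 3 by (simp add: DERIV_def flat_def)
  qed
qed

text \<open>\<open>flat [:0, 0, 1:]\<close> is the derivative of \<open>flat 1\<close>; the bound 2
  for it is \<open>y\<^sup>2 / 2 \<le> exp y\<close> with \<open>y = 1 / x\<close>.\<close>

lemma flat_bounds: "0 \<le> flat 1 x" "flat 1 x \<le> 1" "0 \<le> flat [:0, 0, 1:] x" "flat [:0, 0, 1:] x \<le> 2"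
proof -
  have "y * y * exp (- y) \<le> 2" if "0 < y" for y :: real
  proof -
    have "y * y \<le> 2 * exp y" using exp_lower_Taylor_quadratic[of y] that by (simp add: power2_eq_square)
    then show ?thesis by (simp add: exp_minus field_simps)
  qed
  from this[of "1 / x"] show "flat [:0, 0, 1:] x \<le> 2" by (simp add: flat_def)
qed (auto simp: flat_def)

definition flats :: "(real \<Rightarrow> real) set" where
  "flats = {\<lambda>x. c * flat p (\<alpha> * x + \<beta>) | c p \<alpha> \<beta>. True}"

lemma flats_in: "(\<lambda>x. c * flat p (\<alpha> * x + \<beta>)) \<in> flats"
  unfolding flats_def by blast

lemma dclosed_flats: "dclosed flats"
  unfolding dclosed_def
proof
  fix g assume "g \<in> flats"
  then obtain c p \<alpha> \<beta> where g: "g = (\<lambda>x. c * flat p (\<alpha> * x + \<beta>))" by (auto simp: flats_def)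
  have "(g has_real_derivative (c * \<alpha>) * flat ([:0, 0, 1:] * (p - pderiv p)) (\<alpha> * x + \<beta>)) (at x)" for x
    unfolding g
    by (rule derivative_eq_intros DERIV_chain2[OF flat_deriv] refl | simp)+
  then show "\<exists>g'\<in>flats. \<forall>x. (g has_real_derivative g' x) (at x)"
    by (intro bexI[OF _ flats_in] allI)
qed

text \<open>A product of two flat functions, vanishing to the left of \<open>-R\<close> and to the
  right of \<open>R\<close>. As \<open>flat 1 1 = exp (-1)\<close>, the factor \<open>exp 2\<close>
  makes the value at 0, and hence the limit for large \<open>R\<close>, equal to 1. The trivial
  factor \<open>1\<close> fits the term to the shape of \<open>flats\<close>.\<close>

definition bump :: "real \<Rightarrow> real \<Rightarrow> real" where
  "bump R x = (exp 2 * flat 1 ((1 / R) * x + 1)) * (1 * flat 1 ((- 1 / R) * x + 1))"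

definition bump' :: "real \<Rightarrow> real \<Rightarrow> real" where
  "bump' R x = exp 2 * (flat [:0, 0, 1:] ((1 / R) * x + 1) * (1 / R) * flat 1 ((- 1 / R) * x + 1)
     + flat 1 ((1 / R) * x + 1) * (flat [:0, 0, 1:] ((- 1 / R) * x + 1) * (- 1 / R)))"

lemma bump_in: "bump R \<in> prod_span flats flats"
  unfolding bump_def[abs_def] by (rule prod_span.base[OF flats_in flats_in])

lemma bump_deriv: "0 < R \<Longrightarrow> (bump R has_real_derivative bump' R x) (at x)"
proof -
  assume R: "0 < R"
  have d: "(flat 1 has_real_derivative flat [:0, 0, 1:] x) (at x)" for x
    using flat_deriv[of 1 x] by simp
  have "((\<lambda>x. flat 1 ((1 / R) * x + 1)) has_real_derivative flat [:0, 0, 1:] ((1 / R) * x + 1) * (1 / R)) (at x)"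
    by (rule DERIV_chain2[OF d]) (use R in \<open>auto intro!: derivative_eq_intros\<close>)
  moreover have "((\<lambda>x. flat 1 ((- 1 / R) * x + 1)) has_real_derivative flat [:0, 0, 1:] ((- 1 / R) * x + 1) * (- 1 / R)) (at x)"
    by (rule DERIV_chain2[OF d]) (use R in \<open>auto intro!: derivative_eq_intros\<close>)
  ultimately show ?thesis
    unfolding bump_def[abs_def] bump'_def
    by (auto intro!: derivative_eq_intros simp: algebra_simps)
qed

lemma bump_support: "0 < R \<Longrightarrow> R < \<bar>x\<bar> \<Longrightarrow> bump R x = 0"
  by (auto simp: bump_def flat_def field_simps abs_if split: if_splits)

text \<open>The chain rule puts a factor \<open>1 / R\<close> in front of the derivative, so a
  cut-off at a large radius costs nothing in the limit.\<close>

lemma bump_bounds: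
  assumes "0 < R" shows "\<bar>bump R x\<bar> \<le> exp 2" "\<bar>bump' R x\<bar> \<le> 4 * exp 2 / R"
proof -
  note fb = flat_bounds
  have m: "\<bar>flat 1 y * flat 1 z\<bar> \<le> 1 * 1" for y z
    unfolding abs_mult by (intro mult_mono) (use fb in auto)
  from this[of "(1 / R) * x + 1" "(- 1 / R) * x + 1"]
  show "\<bar>bump R x\<bar> \<le> exp 2" by (simp add: bump_def abs_mult)
  have k: "\<bar>flat [:0, 0, 1:] y * flat 1 z\<bar> \<le> 2 * 1" for y z
    unfolding abs_mult by (intro mult_mono) (use fb in \<open>auto simp: abs_le_iff intro: order_trans[of _ 0]\<close>)
  have "bump' R x = exp 2 / R * (flat [:0, 0, 1:] ((1 / R) * x + 1) * flat 1 ((- 1 / R) * x + 1)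
      - flat [:0, 0, 1:] ((- 1 / R) * x + 1) * flat 1 ((1 / R) * x + 1))"
    using assms by (simp add: bump'_def field_simps)
  then have "\<bar>bump' R x\<bar> = exp 2 / R * \<bar>flat [:0, 0, 1:] ((1 / R) * x + 1) * flat 1 ((- 1 / R) * x + 1)
      - flat [:0, 0, 1:] ((- 1 / R) * x + 1) * flat 1 ((1 / R) * x + 1)\<bar>"
    using assms by (simp add: abs_mult)
  also have "\<dots> \<le> exp 2 / R * (2 * 1 + 2 * 1)"
    using assms k by (intro mult_left_mono order_trans[OF abs_triangle_ineq4] add_mono) auto
  finally show "\<bar>bump' R x\<bar> \<le> 4 * exp 2 / R" by (simp add: mult.commute)
qed

lemma bump_tendsto: "(\<lambda>m. bump (real (Suc m)) x) \<longlonglongrightarrow> 1"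
proof -
  have c: "isCont (flat 1) 1" by (rule DERIV_isCont[OF flat_deriv])
  have i: "(\<lambda>m. 1 / real (Suc m)) \<longlonglongrightarrow> 0"
    using LIMSEQ_inverse_real_of_nat by (simp add: divide_inverse)
  have "(\<lambda>m. (1 / real (Suc m)) * x + 1) \<longlonglongrightarrow> 0 * x + 1" "(\<lambda>m. - (1 / real (Suc m)) * x + 1) \<longlonglongrightarrow> - 0 * x + 1"
    by (intro tendsto_intros i)+
  then have "(\<lambda>m. flat 1 ((1 / real (Suc m)) * x + 1)) \<longlonglongrightarrow> flat 1 1" "(\<lambda>m. flat 1 (- (1 / real (Suc m)) * x + 1)) \<longlonglongrightarrow> flat 1 1"
    using c by (auto intro!: isCont_tendsto_compose[where g = "flat 1"] simp del: of_nat_Suc)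
  then have "(\<lambda>m. (exp 2 * flat 1 ((1 / real (Suc m)) * x + 1)) * (1 * flat 1 (- (1 / real (Suc m)) * x + 1)))
      \<longlonglongrightarrow> (exp 2 * flat 1 1) * (1 * flat 1 1)"
    by (intro tendsto_intros)
  moreover have "(exp 2 * flat 1 1) * (1 * flat 1 1) = 1"
    by (simp add: flat_def flip: exp_add)
  ultimately show ?thesis by (simp add: bump_def del: of_nat_Suc)
qed

text \<open>The weak derivative identity is tested with \<open>bump R x * p x\<close>, which has
  compact support. The term in which the derivative falls on the cut-off is of order
  \<open>1 / R\<close>, and dominated convergence gives the identity for \<open>p\<close>
  itself.\<close>

lemma weak_deriv_extend:
  fixes f g :: "real \<Rightarrow> complex"
  assumes w: "has_weak_deriv f g" and L: "f \<in> L2_space" "g \<in> L2_space" "p \<in> L2_space" "p' \<in> L2_space"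
    and X: "dclosed X" "p \<in> X" and p: "\<And>x. (p has_real_derivative p' x) (at x)"
  shows "(LINT x|lebesgue. p' x *\<^sub>R f x) = - (LINT x|lebesgue. p x *\<^sub>R g x)"
proof -
  define b where "b m = bump (real (Suc m))" for m
  define b' where "b' m = bump' (real (Suc m))" for m
  have bd: "\<bar>b m x\<bar> \<le> exp 2" "\<bar>b' m x\<bar> \<le> 4 * exp 2 / real (Suc m)" "\<bar>b' m x\<bar> \<le> 4 * exp 2" for m x
  proof -
    show "\<bar>b m x\<bar> \<le> exp 2" and b': "\<bar>b' m x\<bar> \<le> 4 * exp 2 / real (Suc m)"
      using bump_bounds[of "real (Suc m)" x] by (auto simp: b_def b'_def)
    note b'
    also have "\<dots> \<le> 4 * exp 2" by (simp add: divide_le_eq)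
    finally show "\<bar>b' m x\<bar> \<le> 4 * exp 2" .
  qed
  have der: "((\<lambda>x. b m x * p x) has_real_derivative b' m x * p x + b m x * p' x) (at x)" for m x
    using bump_deriv[of "real (Suc m)" x, OF of_nat_0_less_iff[THEN iffD2, OF zero_less_Suc]] p[of x] unfolding b_def b'_def
    by (auto intro!: derivative_eq_intros simp del: of_nat_Suc)
  have t: "test_function (\<lambda>x. b m x * p x)" for m
  proof (rule dclosed_test_function[where R = "real (Suc m)"])
    show "dclosed (prod_span (prod_span flats flats) X)"
      by (intro dclosed_prod_span dclosed_flats X)
    show "(\<lambda>x. b m x * p x) \<in> prod_span (prod_span flats flats) X"
      unfolding b_def by (intro prod_span.base bump_in X)
    show "b m x * p x = 0" if "real (Suc m) < \<bar>x\<bar>" for x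
      using bump_support[OF _ that] by (simp add: b_def)
  qed
  have eq: "(LINT x|lebesgue. (b' m x * p x + b m x * p' x) *\<^sub>R f x) = - (LINT x|lebesgue. (b m x * p x) *\<^sub>R g x)" for m
  proof -
    have d: "deriv (\<lambda>x. b m x * p x) x = b' m x * p x + b m x * p' x" for x
      by (rule DERIV_imp_deriv[OF der])
    show ?thesis using w[unfolded has_weak_deriv_def, rule_format, OF t[of m]] unfolding d .
  qed
  have bm: "b m \<in> borel_measurable lebesgue" "b' m \<in> borel_measurable lebesgue" for m
  proof -
    have fl: "flat q \<in> borel_measurable borel" for q
      by (intro borel_measurable_continuous_onI DERIV_continuous_on[OF has_field_derivative_at_within[OF flat_deriv]])
    have "b m \<in> borel_measurable borel" "b' m \<in> borel_measurable borel"
      unfolding b_def b'_def bump_def[abs_def] bump'_def[abs_def]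
      using fl[of 1] fl[of "[:0, 0, 1:]"] by measurable
    then show "b m \<in> borel_measurable lebesgue" "b' m \<in> borel_measurable lebesgue"
      by (auto intro!: measurable_completion)
  qed
  have bto: "(\<lambda>m. b m x) \<longlonglongrightarrow> 1" for x
    unfolding b_def by (rule bump_tendsto)
  have b'to: "(\<lambda>m. b' m x) \<longlonglongrightarrow> 0" for x
  proof (rule Lim_null_comparison[OF always_eventually])
    show "\<forall>m. norm (b' m x) \<le> 4 * exp 2 * inverse (real (Suc m))"
      using bd(2) by (simp add: divide_inverse del: of_nat_Suc)
    show "(\<lambda>m. 4 * exp 2 * inverse (real (Suc m))) \<longlonglongrightarrow> 0"
      using tendsto_mult[OF tendsto_const[of "4 * exp 2 :: real"] LIMSEQ_inverse_real_of_nat] by (simp del: of_nat_Suc)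
  qed
  have meas: "f \<in> borel_measurable lebesgue" "g \<in> borel_measurable lebesgue" "p \<in> borel_measurable lebesgue" "p' \<in> borel_measurable lebesgue"
    using L by (auto simp: L2_space_measurable)
  have "(\<lambda>m. LINT x|lebesgue. (b' m x * p x + b m x * p' x) *\<^sub>R f x) \<longlonglongrightarrow> (LINT x|lebesgue. p' x *\<^sub>R f x)"
  proof (rule integral_dominated_convergence[where w = "\<lambda>x. (4 * exp 2) * (norm (p x *\<^sub>R f x) + norm (p' x *\<^sub>R f x))"])
    show "integrable lebesgue (\<lambda>x. (4 * exp 2) * (norm (p x *\<^sub>R f x) + norm (p' x *\<^sub>R f x)))"
      using integrable_norm[OF integrable_scaleR_L2[OF L(3,1)]] integrable_norm[OF integrable_scaleR_L2[OF L(4,1)]] by auto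
    show "(\<lambda>x. p' x *\<^sub>R f x) \<in> borel_measurable lebesgue"
      "(\<lambda>x. (b' m x * p x + b m x * p' x) *\<^sub>R f x) \<in> borel_measurable lebesgue" for m
      using meas bm by (auto intro!: borel_measurable_scaleR borel_measurable_times borel_measurable_add)
    show "AE x in lebesgue. (\<lambda>m. (b' m x * p x + b m x * p' x) *\<^sub>R f x) \<longlonglongrightarrow> p' x *\<^sub>R f x"
    proof (rule AE_I2)
      fix x
      have "(\<lambda>m. (b' m x * p x + b m x * p' x) *\<^sub>R f x) \<longlonglongrightarrow> (0 * p x + 1 * p' x) *\<^sub>R f x"
        by (intro tendsto_intros bto b'to)
      then show "(\<lambda>m. (b' m x * p x + b m x * p' x) *\<^sub>R f x) \<longlonglongrightarrow> p' x *\<^sub>R f x" by simp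
    qed
    show "AE x in lebesgue. norm ((b' m x * p x + b m x * p' x) *\<^sub>R f x)
        \<le> (4 * exp 2) * (norm (p x *\<^sub>R f x) + norm (p' x *\<^sub>R f x))" for m
    proof (rule AE_I2)
      fix x
      have "exp 2 \<le> 4 * exp (2::real)" by simp
      then have "\<bar>b m x\<bar> \<le> 4 * exp 2" using bd(1)[of m x] by linarith
      then have "\<bar>b' m x * p x + b m x * p' x\<bar> \<le> 4 * exp 2 * \<bar>p x\<bar> + 4 * exp 2 * \<bar>p' x\<bar>"
        using bd(3)[of m x]
        by (intro order_trans[OF abs_triangle_ineq] add_mono) (auto simp: abs_mult intro!: mult_right_mono)
      then have "\<bar>b' m x * p x + b m x * p' x\<bar> * norm (f x) \<le> (4 * exp 2 * \<bar>p x\<bar> + 4 * exp 2 * \<bar>p' x\<bar>) * norm (f x)"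
        by (rule mult_right_mono) simp
      then show "norm ((b' m x * p x + b m x * p' x) *\<^sub>R f x)
        \<le> (4 * exp 2) * (norm (p x *\<^sub>R f x) + norm (p' x *\<^sub>R f x))"
        unfolding norm_scaleR real_norm_def by (simp only: distrib_left distrib_right mult.assoc)
    qed
  qed
  moreover have "(\<lambda>m. LINT x|lebesgue. (b m x * p x) *\<^sub>R g x) \<longlonglongrightarrow> (LINT x|lebesgue. p x *\<^sub>R g x)"
  proof (rule integral_dominated_convergence[where w = "\<lambda>x. exp 2 * norm (p x *\<^sub>R g x)"])
    show "integrable lebesgue (\<lambda>x. exp 2 * norm (p x *\<^sub>R g x))"
      using integrable_norm[OF integrable_scaleR_L2[OF L(3,2)]] by auto
    show "(\<lambda>x. p x *\<^sub>R g x) \<in> borel_measurable lebesgue"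
      "(\<lambda>x. (b m x * p x) *\<^sub>R g x) \<in> borel_measurable lebesgue" for m
      using meas bm by (auto intro!: borel_measurable_scaleR borel_measurable_times)
    show "AE x in lebesgue. (\<lambda>m. (b m x * p x) *\<^sub>R g x) \<longlonglongrightarrow> p x *\<^sub>R g x"
    proof (rule AE_I2)
      fix x
      have "(\<lambda>m. (b m x * p x) *\<^sub>R g x) \<longlonglongrightarrow> (1 * p x) *\<^sub>R g x" by (intro tendsto_intros bto)
      then show "(\<lambda>m. (b m x * p x) *\<^sub>R g x) \<longlonglongrightarrow> p x *\<^sub>R g x" by simp
    qed
    show "AE x in lebesgue. norm ((b m x * p x) *\<^sub>R g x) \<le> exp 2 * norm (p x *\<^sub>R g x)" for m
      using bd(1)[of m] by (intro AE_I2) (auto simp: abs_mult mult.assoc[symmetric] intro!: mult_right_mono simp del: scaleR_conv_of_real)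
  qed
  ultimately show ?thesis unfolding eq using LIMSEQ_unique tendsto_minus by blast
qed

section \<open>Weak derivatives tested against band-limited functions\<close>

lemma band_limited_deriv:
  assumes k: "k \<in> L2_space" "csupp (real n) k"
  shows "((\<lambda>x. Re (FI k (- x))) has_real_derivative Re (FI (\<lambda>\<xi>. sym_D n \<xi> * k \<xi>) (- x))) (at x)"
    "((\<lambda>x. Im (FI k (- x))) has_real_derivative Im (FI (\<lambda>\<xi>. sym_D n \<xi> * k \<xi>) (- x))) (at x)"
proof -
  have int: "integrable lebesgue k" by (rule csupp_L1(1)[OF k])
  have lim: "((\<lambda>h. (FI k (- (x + h)) - FI k (- x)) / of_real h) \<longlongrightarrow> FI (\<lambda>\<xi>. sym_D n \<xi> * k \<xi>) (- x)) (at 0)"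
    unfolding tendsto_at_iff_sequentially o_def
  proof (intro allI impI)
    fix X :: "nat \<Rightarrow> real" assume X: "\<forall>i. X i \<in> UNIV - {0}" "X \<longlonglongrightarrow> 0"
    \<comment> \<open>The integrand of the difference quotient of \<open>FI k (- x)\<close>. On the
      support of \<open>k\<close> it is at most \<open>real n * norm (k \<xi>)\<close>, so
      differentiation under the integral is dominated convergence.\<close>
    define q where "q m \<xi> = (cis (\<xi> * (x + X m)) - cis (\<xi> * x)) / of_real (X m) * k \<xi>" for m \<xi>
    have "(\<lambda>m. LINT \<xi>|lebesgue. q m \<xi>) \<longlonglongrightarrow> (LINT \<xi>|lebesgue. cis (\<xi> * x) * (sym_D n \<xi> * k \<xi>))"
    proof (rule integral_dominated_convergence[where w = "\<lambda>\<xi>. real n * norm (k \<xi>)"])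
      have km: "k \<in> borel_measurable lebesgue" using k by (simp add: L2_space_measurable)
      have c: "(\<lambda>\<xi>. cis (\<xi> * y)) \<in> borel_measurable lebesgue" for y
        by (rule measurable_completion) measurable
      show "q m \<in> borel_measurable lebesgue" for m
        unfolding q_def using c km by (intro borel_measurable_times borel_measurable_divide borel_measurable_diff) auto
      show "(\<lambda>\<xi>. cis (\<xi> * x) * (sym_D n \<xi> * k \<xi>)) \<in> borel_measurable lebesgue"
        using c km bdd_symbol_D by (intro borel_measurable_times) (auto simp: bdd_symbol_def)
      show "AE \<xi> in lebesgue. (\<lambda>m. q m \<xi>) \<longlonglongrightarrow> cis (\<xi> * x) * (sym_D n \<xi> * k \<xi>)"
        using k(2) unfolding csupp_def
      proof eventually_elim
        case (elim \<xi>)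
        have "((\<lambda>z::complex. exp (\<i> * \<xi> * (x + z))) has_field_derivative \<i> * \<xi> * exp (\<i> * \<xi> * x)) (at 0)"
          by (auto intro!: derivative_eq_intros)
        then have "((\<lambda>z::complex. (exp (\<i> * \<xi> * (x + z)) - exp (\<i> * \<xi> * x)) / z) \<longlongrightarrow> \<i> * \<xi> * exp (\<i> * \<xi> * x)) (at 0)"
          by (simp add: has_field_derivative_iff)
        moreover have "filterlim (\<lambda>m. complex_of_real (X m)) (at 0) sequentially"
        proof -
          have "(\<lambda>m. complex_of_real (X m)) \<longlonglongrightarrow> of_real 0" by (rule tendsto_of_real[OF X(2)])
          then show ?thesis using X(1) by (simp add: filterlim_at)
        qed
        ultimately have "(\<lambda>m. (exp (\<i> * \<xi> * (of_real x + of_real (X m))) - exp (\<i> * \<xi> * x)) / of_real (X m)) \<longlonglongrightarrow> \<i> * \<xi> * exp (\<i> * \<xi> * x)"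
          by (rule filterlim_compose)
        then have lim: "(\<lambda>m. (exp (\<i> * \<xi> * (of_real x + of_real (X m))) - exp (\<i> * \<xi> * x)) / of_real (X m) * k \<xi>) \<longlonglongrightarrow> \<i> * \<xi> * exp (\<i> * \<xi> * x) * k \<xi>"
          by (intro tendsto_intros)
        have e: "\<i> * \<xi> * exp (\<i> * \<xi> * x) * k \<xi> = cis (\<xi> * x) * (sym_D n \<xi> * k \<xi>)"
          using elim by (cases "\<xi> \<in> {-real n..real n}")
            (auto simp: sym_D_def cis_conv_exp abs_if mult_ac split: if_splits)
        show ?case using lim unfolding e[symmetric] by (simp add: q_def cis_conv_exp mult.assoc)
      qed
      show "AE \<xi> in lebesgue. norm (q m \<xi>) \<le> real n * norm (k \<xi>)" for m
        using k(2) unfolding csupp_def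
      proof eventually_elim
        case (elim \<xi>)
        show ?case
        proof (cases "\<bar>\<xi>\<bar> \<le> real n")
          case True
          have "cis (\<xi> * (x + X m)) - cis (\<xi> * x) = cis (\<xi> * x) * (cis (\<xi> * X m) - 1)"
            by (simp add: cis_mult algebra_simps)
          then have "norm (cis (\<xi> * (x + X m)) - cis (\<xi> * x)) \<le> \<bar>\<xi>\<bar> * \<bar>X m\<bar>"
            using norm_cis_minus_one[of "\<xi> * X m"] by (simp add: norm_mult abs_mult)
          also have "\<dots> \<le> real n * \<bar>X m\<bar>" using True by (intro mult_right_mono) auto
          finally have "norm (cis (\<xi> * (x + X m)) - cis (\<xi> * x)) / \<bar>X m\<bar> \<le> real n"
            using X(1) by (simp add: pos_divide_le_eq)
          from mult_right_mono[OF this norm_ge_zero[of "k \<xi>"]]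
          show ?thesis unfolding q_def by (simp add: norm_mult norm_divide)
        qed (use elim in \<open>simp add: q_def\<close>)
      qed
    qed (use int in simp)
    moreover have "(FI k (- (x + X m)) - FI k (- x)) / of_real (X m) = (LINT \<xi>|lebesgue. q m \<xi>) / sqrt (2 * pi)" for m
    proof -
      have i: "integrable lebesgue (\<lambda>\<xi>. cis (\<xi> * y) * k \<xi>)" for y
        using FI_integrable[OF int, of "-y"] by (simp add: mult.commute)
      have "(LINT \<xi>|lebesgue. q m \<xi>) = (LINT \<xi>|lebesgue. (cis (\<xi> * (x + X m)) * k \<xi> - cis (\<xi> * x) * k \<xi>) / of_real (X m))"
        by (rule Bochner_Integration.integral_cong) (auto simp: q_def left_diff_distrib)
      also have "\<dots> = ((LINT \<xi>|lebesgue. cis (\<xi> * (x + X m)) * k \<xi>) - (LINT \<xi>|lebesgue. cis (\<xi> * x) * k \<xi>)) / of_real (X m)"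
        by (simp add: Bochner_Integration.integral_diff[OF i i])
      finally have e: "(LINT \<xi>|lebesgue. q m \<xi>) = \<dots>" .
      have F: "FI k (- y) = (LINT \<xi>|lebesgue. cis (\<xi> * y) * k \<xi>) / sqrt (2 * pi)" for y
        by (simp add: FI_def mult.commute[of y])
      show ?thesis unfolding e F by (simp add: diff_divide_distrib mult.commute)
    qed
    ultimately show "(\<lambda>m. (FI k (- (x + X m)) - FI k (- x)) / of_real (X m)) \<longlonglongrightarrow> FI (\<lambda>\<xi>. sym_D n \<xi> * k \<xi>) (- x)"
      unfolding FI_def[of "\<lambda>\<xi>. sym_D n \<xi> * k \<xi>"] by (auto simp: mult.commute[of x] intro!: tendsto_divide)
  qed
  show "((\<lambda>x. Re (FI k (- x))) has_real_derivative Re (FI (\<lambda>\<xi>. sym_D n \<xi> * k \<xi>) (- x))) (at x)"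
    "((\<lambda>x. Im (FI k (- x))) has_real_derivative Im (FI (\<lambda>\<xi>. sym_D n \<xi> * k \<xi>) (- x))) (at x)"
    using tendsto_Re[OF lim] tendsto_Im[OF lim] by (simp_all add: DERIV_def)
qed

text \<open>Test functions are real valued, so real and imaginary parts are taken separately. The
  set is closed under differentiation because that multiplies \<open>k\<close> by
  \<open>sym_D n\<close>, which keeps the support.\<close>

definition band_limited :: "nat \<Rightarrow> (real \<Rightarrow> real) set" where
  "band_limited n = {\<lambda>x. r (FI k (- x)) | k r. k \<in> L2_space \<and> csupp (real n) k \<and> r \<in> {Re, Im}}"

lemma dclosed_band_limited: "dclosed (band_limited n)"
  unfolding dclosed_def
proof
  fix g assume "g \<in> band_limited n"
  then obtain k r where g: "g = (\<lambda>x. r (FI k (- x)))" "k \<in> L2_space" "csupp (real n) k" "r \<in> {Re, Im}"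
    by (auto simp: band_limited_def)
  have "(\<lambda>\<xi>. sym_D n \<xi> * k \<xi>) \<in> L2_space" by (rule mult_L2[OF bdd_symbol_D g(2)])
  moreover have "csupp (real n) (\<lambda>\<xi>. sym_D n \<xi> * k \<xi>)"
    using g(3) unfolding csupp_def by eventually_elim simp
  ultimately have "(\<lambda>x. r (FI (\<lambda>\<xi>. sym_D n \<xi> * k \<xi>) (- x))) \<in> band_limited n"
    using g(4) unfolding band_limited_def by blast
  then show "\<exists>g'\<in>band_limited n. \<forall>x. (g has_real_derivative g' x) (at x)"
    using band_limited_deriv[OF g(2,3)] g(1,4) by (intro bexI) auto
qed

text \<open>The claim is tested against an arbitrary \<open>K\<close>. Both \<open>PN n K\<close>
  and \<open>DN n K\<close> have smooth band-limited representatives, the second being the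
  derivative of the first, so \<open>weak_deriv_extend\<close> moves the derivative from one side of
  the pairing to the other.\<close>

lemma DN_weak_deriv:
  fixes f g :: "real \<Rightarrow> complex"
  assumes w: "has_weak_deriv f g" and f: "f \<in> L2_space" and g: "g \<in> L2_space"
  shows "DN n (cls f) = PN n (cls g)"
proof -
  have key: "cls f \<bullet> DN n K = - (cls g \<bullet> PN n K)" for K
  proof -
    define k where "k = rep (mulop (sym_P n) (fourier K))"
    define k' where "k' \<xi> = sym_D n \<xi> * k \<xi>" for \<xi>
    note kk = band_limited_rep[of n K, folded k_def]
    have kL: "k \<in> L2_space" by (simp add: k_def)
    define \<phi> where "\<phi> x = FI k (- x)" for x
    define \<phi>' where "\<phi>' x = FI k' (- x)" for x
    have \<phi>: "\<phi> \<in> L2_space" "cls \<phi> = PN n K" using kk(3,4) by (simp_all add: \<phi>_def[abs_def])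
    have k'L: "k' \<in> L2_space" unfolding k'_def by (rule mult_L2[OF bdd_symbol_D kL])
    have k'c: "csupp (real n) k'" using kk(1) unfolding csupp_def k'_def by eventually_elim simp
    have F': "FI k' \<in> L2_space" using FI_csupp_L2[OF csupp_rep_cls[OF k'L k'c]] by (simp add: FI_rep_cls k'L)
    have \<phi>'L: "\<phi>' \<in> L2_space" using affine_L2[OF _ F', of "-1" 0] by (simp add: \<phi>'_def[abs_def])
    have "cls \<phi>' = refl_op (fourier (cls k'))"
      unfolding fourier_cls_csupp[OF k'L k'c] refl_op_cls[OF F'] by (simp add: \<phi>'_def[abs_def])
    also have "cls k' = mulop (sym_D n) (mulop (sym_P n) (fourier K))"
      unfolding k'_def k_def by (simp add: mulop_def)
    also have "\<dots> = mulop (sym_D n) (fourier K)"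
      unfolding mulop_mulop[OF bdd_symbol_D bdd_symbol_P]
      by (rule arg_cong[of _ _ "\<lambda>m. mulop m (fourier K)"]) (auto simp: sym_D_def sym_P_def indicator_def)
    finally have \<phi>': "cls \<phi>' = DN n K" by (simp add: DN_def fmult_def)
    have r: "(LINT x|lebesgue. r (\<phi>' x) *\<^sub>R f x) = - (LINT x|lebesgue. r (\<phi> x) *\<^sub>R g x)" if "r \<in> {Re, Im}" for r :: "complex \<Rightarrow> real"
    proof (rule weak_deriv_extend[OF w f g _ _ dclosed_band_limited[of n]])
      have m: "r \<in> borel_measurable borel" using that by auto
      have n: "norm (r z) \<le> 1 * norm z" for z using that abs_Re_le_cmod abs_Im_le_cmod by auto
      show "(\<lambda>x. r (\<phi> x)) \<in> L2_space"
        by (rule L2_space_bound[OF \<phi>(1) measurable_compose[OF L2_space_measurable[OF \<phi>(1)] m] AE_I2[OF n]])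
      show "(\<lambda>x. r (\<phi>' x)) \<in> L2_space"
        by (rule L2_space_bound[OF \<phi>'L measurable_compose[OF L2_space_measurable[OF \<phi>'L] m] AE_I2[OF n]])
      show "(\<lambda>x. r (\<phi> x)) \<in> band_limited n"
        unfolding band_limited_def \<phi>_def using kL kk(1) that by blast
      show "((\<lambda>x. r (\<phi> x)) has_real_derivative r (\<phi>' x)) (at x)" for x
        using band_limited_deriv[OF kL kk(1), folded k'_def[abs_def]] that unfolding \<phi>_def \<phi>'_def k'_def by auto
    qed
    have rL: "(\<lambda>x. r (h x)) \<in> L2_space" if "r \<in> {Re, Im}" "h \<in> L2_space" for r :: "complex \<Rightarrow> real" and h
    proof -
      have m: "r \<in> borel_measurable borel" using that by auto
      have n: "norm (r z) \<le> 1 * norm z" for z using that abs_Re_le_cmod abs_Im_le_cmod by auto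
      show ?thesis by (rule L2_space_bound[OF that(2) measurable_compose[OF L2_space_measurable[OF that(2)] m] AE_I2[OF n]])
    qed
    \<comment> \<open>Writes the real pairing as integrals against the real functions
      \<open>Re\<close> and \<open>Im\<close> of the second argument, the form in which the weak
      derivative identity is available.\<close>
    have sp: "cls a \<bullet> cls b = Re (LINT x|lebesgue. Re (b x) *\<^sub>R a x) + Im (LINT x|lebesgue. Im (b x) *\<^sub>R a x)"
      if "a \<in> L2_space" "b \<in> L2_space" for a b
    proof -
      have i: "integrable lebesgue (\<lambda>x. Re (b x) *\<^sub>R a x)" "integrable lebesgue (\<lambda>x. Im (b x) *\<^sub>R a x)"
        using that by (auto intro!: integrable_scaleR_L2 rL simp del: scaleR_conv_of_real)
      have "cls a \<bullet> cls b = (LINT x|lebesgue. Re (Re (b x) *\<^sub>R a x) + Im (Im (b x) *\<^sub>R a x))"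
        unfolding inner_cls[OF that] by (rule Bochner_Integration.integral_cong) (auto simp: inner_complex_def)
      also have "\<dots> = (LINT x|lebesgue. Re (Re (b x) *\<^sub>R a x)) + (LINT x|lebesgue. Im (Im (b x) *\<^sub>R a x))"
        by (rule Bochner_Integration.integral_add[OF integrable_Re[OF i(1)] integrable_Im[OF i(2)]])
      finally show ?thesis unfolding integral_Re[OF i(1)] integral_Im[OF i(2)] .
    qed
    show ?thesis
      unfolding \<phi>'[symmetric] \<phi>(2)[symmetric] sp[OF f \<phi>'L] sp[OF g \<phi>(1)] r[of Re, simplified] r[of Im, simplified] by simp
  qed
  have "(DN n (cls f) - PN n (cls g)) \<bullet> K = 0" for K
    using key[of K] by (simp add: inner_diff_left inner_DN inner_PN)
  from this[of "DN n (cls f) - PN n (cls g)"] show ?thesis by simp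
qed

lemma H1_space_weak_deriv:
  fixes f :: "real \<Rightarrow> 'a::euclidean_space"
  assumes "f \<in> H1_space" shows "f \<in> L2_space" "weak_deriv f \<in> L2_space" "has_weak_deriv f (weak_deriv f)"
proof -
  obtain g where "g \<in> L2_space \<and> has_weak_deriv f g" using assms by (auto simp: H1_space_def)
  then have "weak_deriv f \<in> L2_space \<and> has_weak_deriv f (weak_deriv f)"
    unfolding weak_deriv_def by (rule someI[where P = "\<lambda>g. g \<in> L2_space \<and> has_weak_deriv f g"])
  then show "weak_deriv f \<in> L2_space" "has_weak_deriv f (weak_deriv f)" by auto
qed (use assms in \<open>auto simp: H1_space_def\<close>)

lemma H1_norm_ge:
  fixes f :: "real \<Rightarrow> 'a::euclidean_space"
  assumes "f \<in> H1_space" shows "L2_norm f \<le> H1_norm f" "L2_norm (weak_deriv f) \<le> H1_norm f" "H1_norm f < \<infinity>"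
proof -
  obtain a b where ab: "L2_norm f = ennreal a" "L2_norm (weak_deriv f) = ennreal b" "0 \<le> a" "0 \<le> b"
    using L2_norm_eq[OF H1_space_weak_deriv(1)[OF assms]] L2_norm_eq[OF H1_space_weak_deriv(2)[OF assms]]
    by (metis Bochner_Integration.integral_nonneg real_sqrt_ge_0_iff zero_le_power2)
  have "H1_norm f = ennreal (sqrt (a\<^sup>2 + b\<^sup>2))"
    using ab(3,4) by (simp add: H1_norm_def ab enn_powr_def ennreal_power powr_half_sqrt flip: ennreal_plus)
  then show "L2_norm f \<le> H1_norm f" "L2_norm (weak_deriv f) \<le> H1_norm f" "H1_norm f < \<infinity>"
    using ab by (auto intro!: ennreal_leI real_le_rsqrt)
qed

text \<open>The truncated derivatives of \<open>f\<close> are projections of its weak derivative, so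
  they are bounded by it. This is where the H^1 of the definitions enters the Fourier side.\<close>

lemma H1_space_H1c:
  fixes f :: "real \<Rightarrow> complex"
  assumes "f \<in> H1_space"
  shows "H1c (cls f)" "dn (cls f) \<le> norm (cls (weak_deriv f))" "ennreal (dn (cls f)) \<le> H1_norm f" "ennreal (norm (cls f)) \<le> H1_norm f"
proof -
  note w = H1_space_weak_deriv[OF assms]
  have *: "norm (DN n (cls f)) \<le> norm (cls (weak_deriv f))" for n
    unfolding DN_weak_deriv[OF w(3,1,2)] by (rule norm_PN)
  then show "H1c (cls f)" by (rule H1cI)
  from * show d: "dn (cls f) \<le> norm (cls (weak_deriv f))" by (rule dn_le)
  show "ennreal (dn (cls f)) \<le> H1_norm f"
    using H1_norm_ge(2)[OF assms] d unfolding L2_norm_cls[OF w(2)] by (meson ennreal_leI order_trans)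
  show "ennreal (norm (cls f)) \<le> H1_norm f"
    using H1_norm_ge(1)[OF assms] unfolding L2_norm_cls[OF w(1)] .
qed

lemma L2_norm_of_real: "L2_norm (\<lambda>x. complex_of_real (f x)) = L2_norm f"
  by (simp add: L2_norm_alt)

lemma L2_space_of_real: "f \<in> L2_space \<Longrightarrow> (\<lambda>x. complex_of_real (f x)) \<in> L2_space"
  by (auto simp: L2_space_iff)

text \<open>The real unknown \<open>v\<close> is embedded among complex classes, so that one Hilbert
  space serves both unknowns. The embedding carries the weak derivative along and keeps the
  norms.\<close>

lemma H1_space_of_real:
  fixes f :: "real \<Rightarrow> real"
  assumes "f \<in> H1_space"
  defines "F \<equiv> \<lambda>x. complex_of_real (f x)"
  shows "F \<in> L2_space" "H1c (cls F)" "ennreal (dn (cls F)) \<le> H1_norm f" "ennreal (norm (cls F)) \<le> H1_norm f"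
proof -
  note w = H1_space_weak_deriv[OF assms(1)]
  define G where "G = (\<lambda>x. complex_of_real (weak_deriv f x))"
  show F: "F \<in> L2_space" unfolding F_def by (rule L2_space_of_real[OF w(1)])
  have G: "G \<in> L2_space" unfolding G_def by (rule L2_space_of_real[OF w(2)])
  have wd: "has_weak_deriv F G"
    unfolding has_weak_deriv_def
  proof (intro allI impI)
    fix \<phi> assume t: "test_function \<phi>"
    have sc: "c *\<^sub>R F x = complex_of_real (c *\<^sub>R f x)" "c *\<^sub>R G x = complex_of_real (c *\<^sub>R weak_deriv f x)" for c x
      by (simp_all add: F_def G_def scaleR_conv_of_real)
    have "(LINT x|lebesgue. deriv \<phi> x *\<^sub>R F x) = complex_of_real (LINT x|lebesgue. deriv \<phi> x *\<^sub>R f x)"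
      unfolding sc by (rule integral_complex_of_real)
    also have "\<dots> = complex_of_real (- (LINT x|lebesgue. \<phi> x *\<^sub>R weak_deriv f x))"
      using w(3) t by (simp add: has_weak_deriv_def)
    also have "\<dots> = - (LINT x|lebesgue. \<phi> x *\<^sub>R G x)"
      unfolding sc by (simp only: integral_complex_of_real of_real_minus)
    finally show "(LINT x|lebesgue. deriv \<phi> x *\<^sub>R F x) = - (LINT x|lebesgue. \<phi> x *\<^sub>R G x)" .
  qed
  have *: "norm (DN n (cls F)) \<le> norm (cls G)" for n
    unfolding DN_weak_deriv[OF wd F G] by (rule norm_PN)
  then show "H1c (cls F)" by (rule H1cI)
  have "ennreal (dn (cls F)) \<le> ennreal (norm (cls G))" by (intro ennreal_leI dn_le *)
  also have "\<dots> = L2_norm (weak_deriv f)" using L2_norm_of_real[of "weak_deriv f"] L2_norm_cls[OF G] by (simp add: G_def)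
  also have "\<dots> \<le> H1_norm f" by (rule H1_norm_ge(2)[OF assms(1)])
  finally show "ennreal (dn (cls F)) \<le> H1_norm f" .
  have "ennreal (norm (cls F)) = L2_norm f" using L2_norm_of_real[of f] L2_norm_cls[OF F] by (simp add: F_def)
  then show "ennreal (norm (cls F)) \<le> H1_norm f" using H1_norm_ge(1)[OF assms(1)] by simp
qed

section \<open>Bochner integrals in \<open>L\<^sup>2\<close>\<close>

lemma simple_value_Cons: "simple_value ((A, h) # \<sigma>) s x = indicator A s *\<^sub>R h x + simple_value \<sigma> s x"
  and simple_integral_Cons: "simple_integral ((A, h) # \<sigma>) x = measure lebesgue A *\<^sub>R h x + simple_integral \<sigma> x"
  by (simp_all add: simple_value_def simple_integral_def)

lemma simple_L2:
  fixes \<sigma> :: "(real set \<times> (real \<Rightarrow> 'a::euclidean_space)) list"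
  assumes "simple_on t \<sigma>" shows "simple_value \<sigma> s \<in> L2_space" "simple_integral \<sigma> \<in> L2_space"
proof -
  have "(\<lambda>x. simple_value \<sigma> s x) \<in> L2_space \<and> (\<lambda>x. simple_integral \<sigma> x) \<in> L2_space"
    using assms
  proof (induction \<sigma>)
    case Nil
    then show ?case by (simp add: simple_value_def simple_integral_def)
  next
    case (Cons p \<sigma>)
    obtain A h where p: "p = (A, h)" by (cases p)
    then show ?case using Cons
      by (auto simp: simple_on_def simple_value_Cons simple_integral_Cons intro!: L2_space_add L2_space_scaleR)
  qed
  then show "simple_value \<sigma> s \<in> L2_space" "simple_integral \<sigma> \<in> L2_space" by auto
qed

text \<open>On simple functions the prescribed value is the gauge integral of a curve in
  \<open>cL2\<close>. Norm estimates for Bochner integrals are inherited through this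
  identification.\<close>

lemma simple_has_integral:
  assumes "simple_on t \<sigma>"
  shows "((\<lambda>s. cls (simple_value \<sigma> s)) has_integral cls (simple_integral \<sigma>)) {0..t}"
  using assms
proof (induction \<sigma>)
  case Nil
  have "simple_value [] s = (\<lambda>x. 0 :: complex)" "simple_integral [] = (\<lambda>x. 0 :: complex)" for s
    by (auto simp: simple_value_def simple_integral_def)
  then show ?case by (simp add: cls_zero)
next
  case (Cons p \<sigma>)
  obtain A h where p: "p = (A, h)" by (cases p)
  have A: "A \<in> sets lebesgue" "A \<subseteq> {0..t}" "h \<in> L2_space" and s: "simple_on t \<sigma>"
    using Cons(2) by (auto simp: simple_on_def p)
  have "A \<in> lmeasurable" using bounded_set_imp_lmeasurable[OF bounded_subset[OF bounded_closed_interval A(2)] A(1)] .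
  then have "(indicat_real A has_integral measure lebesgue A) UNIV" by (simp add: lmeasurable_iff_has_integral)
  moreover have "indicat_real A = (\<lambda>x. if x \<in> {0..t} then indicat_real A x else 0)"
    using A(2) by (auto simp: indicator_def fun_eq_iff)
  ultimately have "(indicat_real A has_integral measure lebesgue A) {0..t}"
    using has_integral_restrict_UNIV[of "{0..t}" "indicat_real A"] by metis
  then have "((\<lambda>s. indicat_real A s *\<^sub>R cls h) has_integral measure lebesgue A *\<^sub>R cls h) {0..t}"
    by (rule has_integral_scaleR_left)
  from has_integral_add[OF this Cons(1)[OF s]]
  have "((\<lambda>s. indicat_real A s *\<^sub>R cls h + cls (simple_value \<sigma> s)) has_integral
      measure lebesgue A *\<^sub>R cls h + cls (simple_integral \<sigma>)) {0..t}" .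
  moreover have "cls (simple_value (p # \<sigma>) s) = indicat_real A s *\<^sub>R cls h + cls (simple_value \<sigma> s)" for s
  proof -
    have "simple_value (p # \<sigma>) s = (\<lambda>x. indicat_real A s *\<^sub>R h x + simple_value \<sigma> s x)"
      by (auto simp: p simple_value_Cons)
    then show ?thesis using A(3) simple_L2(1)[OF s]
      by (simp add: cls_add cls_scaleR L2_space_scaleR del: scaleR_conv_of_real)
  qed
  moreover have "cls (simple_integral (p # \<sigma>)) = measure lebesgue A *\<^sub>R cls h + cls (simple_integral \<sigma>)"
  proof -
    have "simple_integral (p # \<sigma>) = (\<lambda>x. measure lebesgue A *\<^sub>R h x + simple_integral \<sigma> x)"
      by (auto simp: p simple_integral_Cons)
    then show ?thesis using A(3) simple_L2(2)[OF s]
      by (simp add: cls_add cls_scaleR L2_space_scaleR del: scaleR_conv_of_real)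
  qed
  ultimately show ?case by simp
qed

lemma norm_simple_integral_le:
  assumes s: "simple_on t \<sigma>" "simple_on t \<rho>" and N: "N \<in> borel_measurable (lebesgue_on {0..t})"
    and le: "AE s in lebesgue_on {0..t}. ennreal (norm (cls (simple_value \<sigma> s) + cls (simple_value \<rho> s))) \<le> N s"
  shows "ennreal (norm (cls (simple_integral \<sigma>) + cls (simple_integral \<rho>))) \<le> (\<integral>\<^sup>+ s. N s \<partial>lebesgue_on {0..t})"
proof (cases "(\<integral>\<^sup>+ s. N s \<partial>lebesgue_on {0..t}) = \<infinity>")
  case False
  have "AE s in lebesgue_on {0..t}. N s \<noteq> \<infinity>"
    by (rule nn_integral_PInf_AE[OF N False])
  with le have "AE s in lebesgue_on {0..t}. norm (cls (simple_value \<sigma> s) + cls (simple_value \<rho> s)) \<le> enn2real (N s)"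
    by eventually_elim (metis enn2real_ennreal enn2real_mono infinity_ennreal_def norm_ge_zero top.not_eq_extremum)
  then obtain Z where Z: "Z \<in> null_sets (lebesgue_on {0..t})"
      "{s \<in> space (lebesgue_on {0..t}). \<not> norm (cls (simple_value \<sigma> s) + cls (simple_value \<rho> s)) \<le> enn2real (N s)} \<subseteq> Z"
    by (auto simp: eventually_ae_filter)
  have neg: "negligible Z" using Z(1) by (simp add: negligible_iff_null_sets null_sets_restrict_space)
  have fin: "integrable (lebesgue_on {0..t}) (\<lambda>s. enn2real (N s))"
  proof (rule integrableI_bounded)
    show "(\<lambda>s. enn2real (N s)) \<in> borel_measurable (lebesgue_on {0..t})" using N by measurable
    have "(\<integral>\<^sup>+ s. ennreal (norm (enn2real (N s))) \<partial>lebesgue_on {0..t}) \<le> (\<integral>\<^sup>+ s. N s \<partial>lebesgue_on {0..t})"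
      by (intro nn_integral_mono) (simp add: ennreal_enn2real_if)
    then show "(\<integral>\<^sup>+ s. ennreal (norm (enn2real (N s))) \<partial>lebesgue_on {0..t}) < \<infinity>"
      using False by (simp add: less_top le_less_trans)
  qed
  \<comment> \<open>The hypothesis fails at most on the null set \<open>Z\<close>. Setting the
    integrand to 0 there changes no integral and makes the bound valid at every time.\<close>
  define f where "f s = (if s \<in> Z then 0 else cls (simple_value \<sigma> s) + cls (simple_value \<rho> s))" for s
  have f: "(f has_integral cls (simple_integral \<sigma>) + cls (simple_integral \<rho>)) {0..t}"
    by (rule has_integral_spike[OF neg _ has_integral_add[OF simple_has_integral[OF s(1)] simple_has_integral[OF s(2)]]])
       (auto simp: f_def)
  have g: "(\<lambda>s. enn2real (N s)) integrable_on {0..t}"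
    by (rule integrable_on_lebesgue_on[OF fin]) simp
  have "norm (integral {0..t} f) \<le> integral {0..t} (\<lambda>s. enn2real (N s))"
  proof (rule integral_norm_bound_integral)
    show "f integrable_on {0..t}" using f by (rule has_integral_integrable)
    show "norm (f s) \<le> enn2real (N s)" if "s \<in> {0..t}" for s
      using Z(2) that by (auto simp: f_def space_restrict_space)
  qed (rule g)
  also have "integral {0..t} (\<lambda>s. enn2real (N s)) = (LINT s|lebesgue_on {0..t}. enn2real (N s))"
    by (rule lebesgue_integral_eq_integral[OF fin, symmetric]) simp
  finally have "ennreal (norm (cls (simple_integral \<sigma>) + cls (simple_integral \<rho>)))
      \<le> ennreal (LINT s|lebesgue_on {0..t}. enn2real (N s))"
    unfolding integral_unique[OF f] by (rule ennreal_leI)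
  also have "\<dots> = (\<integral>\<^sup>+ s. ennreal (enn2real (N s)) \<partial>lebesgue_on {0..t})"
    by (rule nn_integral_eq_integral[OF fin, symmetric]) simp
  also have "\<dots> \<le> (\<integral>\<^sup>+ s. N s \<partial>lebesgue_on {0..t})"
    by (intro nn_integral_mono) (simp add: ennreal_enn2real_if)
  finally show ?thesis .
qed simp

text \<open>When the two Duhamel formulas are compared, the sum of the integrands is controlled by
  their cancellation. The two approximating sequences are therefore carried side by side, and the
  integrands are added before the norm is taken.\<close>

lemma has_L2_integral_add_le:
  fixes F1 F2 :: "real \<Rightarrow> real \<Rightarrow> complex"
  assumes I: "has_L2_integral F1 G1 t" "has_L2_integral F2 G2 t"
    and N: "N \<in> borel_measurable (lebesgue_on {0..t})"
    and le: "AE s in lebesgue_on {0..t}. ennreal (norm (cls (F1 s) + cls (F2 s))) \<le> N s"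
  shows "ennreal (norm (cls G1 + cls G2)) \<le> (\<integral>\<^sup>+ s. N s \<partial>lebesgue_on {0..t})"
proof -
  obtain \<sigma> where \<sigma>: "\<And>n. simple_on t (\<sigma> n)"
      "\<And>n. (\<lambda>s. L2_norm (\<lambda>x. F1 s x - simple_value (\<sigma> n) s x)) \<in> borel_measurable (lebesgue_on {0..t})"
      "(\<lambda>n. \<integral>\<^sup>+ s. L2_norm (\<lambda>x. F1 s x - simple_value (\<sigma> n) s x) \<partial>lebesgue_on {0..t}) \<longlonglongrightarrow> 0"
      "(\<lambda>n. L2_norm (\<lambda>x. G1 x - simple_integral (\<sigma> n) x)) \<longlonglongrightarrow> 0"
    using I(1) unfolding has_L2_integral_def by blast
  obtain \<rho> where \<rho>: "\<And>n. simple_on t (\<rho> n)"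
      "\<And>n. (\<lambda>s. L2_norm (\<lambda>x. F2 s x - simple_value (\<rho> n) s x)) \<in> borel_measurable (lebesgue_on {0..t})"
      "(\<lambda>n. \<integral>\<^sup>+ s. L2_norm (\<lambda>x. F2 s x - simple_value (\<rho> n) s x) \<partial>lebesgue_on {0..t}) \<longlonglongrightarrow> 0"
      "(\<lambda>n. L2_norm (\<lambda>x. G2 x - simple_integral (\<rho> n) x)) \<longlonglongrightarrow> 0"
    using I(2) unfolding has_L2_integral_def by blast
  have G: "G1 \<in> L2_space" "G2 \<in> L2_space" and FL: "AE s in lebesgue_on {0..t}. F1 s \<in> L2_space" "AE s in lebesgue_on {0..t}. F2 s \<in> L2_space"
    using I unfolding has_L2_integral_def by auto
  define a where "a n = (\<integral>\<^sup>+ s. L2_norm (\<lambda>x. F1 s x - simple_value (\<sigma> n) s x) \<partial>lebesgue_on {0..t})" for n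
  define b where "b n = (\<integral>\<^sup>+ s. L2_norm (\<lambda>x. F2 s x - simple_value (\<rho> n) s x) \<partial>lebesgue_on {0..t})" for n
  define c where "c n = L2_norm (\<lambda>x. G1 x - simple_integral (\<sigma> n) x)" for n
  define d where "d n = L2_norm (\<lambda>x. G2 x - simple_integral (\<rho> n) x)" for n
  define T where "T = (\<integral>\<^sup>+ s. N s \<partial>lebesgue_on {0..t})"
  have bound: "ennreal (norm (cls G1 + cls G2)) \<le> c n + d n + (T + (a n + b n))" for n
  proof -
    note si = simple_L2(2)[OF \<sigma>(1)[of n]] simple_L2(2)[OF \<rho>(1)[of n]]
    note sv = simple_L2(1)[OF \<sigma>(1)[of n]] simple_L2(1)[OF \<rho>(1)[of n]]
    have cd: "c n = ennreal (norm (cls G1 - cls (simple_integral (\<sigma> n))))" "d n = ennreal (norm (cls G2 - cls (simple_integral (\<rho> n))))"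
      unfolding c_def d_def using G si by (simp_all add: L2_norm_cls L2_space_diff cls_diff)
    define M where "M s = N s + (L2_norm (\<lambda>x. F1 s x - simple_value (\<sigma> n) s x) + L2_norm (\<lambda>x. F2 s x - simple_value (\<rho> n) s x))" for s
    have "ennreal (norm (cls (simple_integral (\<sigma> n)) + cls (simple_integral (\<rho> n)))) \<le> (\<integral>\<^sup>+ s. M s \<partial>lebesgue_on {0..t})"
    proof (rule norm_simple_integral_le[OF \<sigma>(1) \<rho>(1)])
      show "M \<in> borel_measurable (lebesgue_on {0..t})"
        unfolding M_def using N \<sigma>(2) \<rho>(2) by measurable
      show "AE s in lebesgue_on {0..t}. ennreal (norm (cls (simple_value (\<sigma> n) s) + cls (simple_value (\<rho> n) s))) \<le> M s"
        using le FL
      proof eventually_elim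
        case (elim s)
        have "norm (cls (simple_value (\<sigma> n) s) + cls (simple_value (\<rho> n) s))
            \<le> norm (cls (F1 s) + cls (F2 s)) + (norm (cls (F1 s) - cls (simple_value (\<sigma> n) s)) + norm (cls (F2 s) - cls (simple_value (\<rho> n) s)))"
          by norm
        then have "ennreal (norm (cls (simple_value (\<sigma> n) s) + cls (simple_value (\<rho> n) s)))
            \<le> ennreal (norm (cls (F1 s) + cls (F2 s))) + (L2_norm (\<lambda>x. F1 s x - simple_value (\<sigma> n) s x) + L2_norm (\<lambda>x. F2 s x - simple_value (\<rho> n) s x))"
          using elim sv[of s] by (simp add: L2_norm_cls L2_space_diff cls_diff ennreal_leI flip: ennreal_plus)
        also have "\<dots> \<le> M s" unfolding M_def by (intro add_right_mono elim)
        finally show ?case .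
      qed
    qed
    also have "\<dots> = T + (a n + b n)"
      unfolding M_def T_def a_def b_def using N \<sigma>(2) \<rho>(2) by (simp add: nn_integral_add)
    finally have 1: "ennreal (norm (cls (simple_integral (\<sigma> n)) + cls (simple_integral (\<rho> n)))) \<le> T + (a n + b n)" .
    have "norm (cls G1 + cls G2) \<le> norm (cls G1 - cls (simple_integral (\<sigma> n))) + norm (cls G2 - cls (simple_integral (\<rho> n)))
        + norm (cls (simple_integral (\<sigma> n)) + cls (simple_integral (\<rho> n)))" by norm
    then have "ennreal (norm (cls G1 + cls G2)) \<le> c n + d n + ennreal (norm (cls (simple_integral (\<sigma> n)) + cls (simple_integral (\<rho> n))))"
      unfolding cd by (simp add: ennreal_leI flip: ennreal_plus)
    also have "\<dots> \<le> c n + d n + (T + (a n + b n))" by (intro add_left_mono 1)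
    finally show ?thesis .
  qed
  have "(\<lambda>n. c n + d n + (T + (a n + b n))) \<longlonglongrightarrow> 0 + 0 + (T + (0 + 0))"
    unfolding a_def b_def c_def d_def by (intro tendsto_add \<sigma>(3,4) \<rho>(3,4) tendsto_const)
  then have "(\<lambda>n. c n + d n + (T + (a n + b n))) \<longlonglongrightarrow> T" by simp
  from LIMSEQ_le_const[OF this] bound show ?thesis unfolding T_def[symmetric] by blast
qed

text \<open>For a continuous integrand the same simple integrals approximate the Bochner and the
  gauge integral. On the gauge side the fundamental theorem of calculus is available.\<close>

lemma has_L2_integral_continuous:
  fixes F :: "real \<Rightarrow> real \<Rightarrow> complex"
  assumes I: "has_L2_integral F G t" and W: "continuous_on {0..t} W"
    and F: "\<And>s. s \<in> {0..t} \<Longrightarrow> F s \<in> L2_space \<and> cls (F s) = W s"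
  shows "cls G = integral {0..t} W"
proof -
  obtain \<sigma> where \<sigma>: "\<And>n. simple_on t (\<sigma> n)"
      "\<And>n. (\<lambda>s. L2_norm (\<lambda>x. F s x - simple_value (\<sigma> n) s x)) \<in> borel_measurable (lebesgue_on {0..t})"
      "(\<lambda>n. \<integral>\<^sup>+ s. L2_norm (\<lambda>x. F s x - simple_value (\<sigma> n) s x) \<partial>lebesgue_on {0..t}) \<longlonglongrightarrow> 0"
      "(\<lambda>n. L2_norm (\<lambda>x. G x - simple_integral (\<sigma> n) x)) \<longlonglongrightarrow> 0"
    using I unfolding has_L2_integral_def by blast
  have G: "G \<in> L2_space" using I unfolding has_L2_integral_def by auto
  define a where "a n = (\<integral>\<^sup>+ s. L2_norm (\<lambda>x. F s x - simple_value (\<sigma> n) s x) \<partial>lebesgue_on {0..t})" for n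
  have bound: "ennreal (norm (integral {0..t} W - cls (simple_integral (\<sigma> n)))) \<le> a n" for n
  proof (cases "a n = \<infinity>")
    case False
    define g where "g s = enn2real (L2_norm (\<lambda>x. F s x - simple_value (\<sigma> n) s x))" for s
    have gW: "g s = norm (W s - cls (simple_value (\<sigma> n) s))"
      and gL: "L2_norm (\<lambda>x. F s x - simple_value (\<sigma> n) s x) = ennreal (g s)" if "s \<in> {0..t}" for s
      unfolding g_def using F[OF that] simple_L2(1)[OF \<sigma>(1)[of n], of s]
      by (auto simp: L2_norm_cls L2_space_diff cls_diff)
    have gm: "g \<in> borel_measurable (lebesgue_on {0..t})" unfolding g_def using \<sigma>(2)[of n] by measurable
    have eq: "(\<integral>\<^sup>+ s. ennreal (g s) \<partial>lebesgue_on {0..t}) = a n"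
      unfolding a_def by (intro nn_integral_cong) (simp add: gL space_restrict_space)
    have gi: "integrable (lebesgue_on {0..t}) g"
      using eq False gm by (intro integrableI_nonneg) (auto simp: g_def less_top)
    have f: "((\<lambda>s. W s - cls (simple_value (\<sigma> n) s)) has_integral integral {0..t} W - cls (simple_integral (\<sigma> n))) {0..t}"
      by (intro has_integral_diff simple_has_integral \<sigma>(1) integrable_integral integrable_continuous_real W)
    have "norm (integral {0..t} (\<lambda>s. W s - cls (simple_value (\<sigma> n) s))) \<le> integral {0..t} g"
      by (rule integral_norm_bound_integral[OF has_integral_integrable[OF f] integrable_on_lebesgue_on[OF gi]])
         (auto simp: gW)
    also have "\<dots> = (LINT s|lebesgue_on {0..t}. g s)"
      by (rule lebesgue_integral_eq_integral[OF gi, symmetric]) simp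
    finally have "ennreal (norm (integral {0..t} W - cls (simple_integral (\<sigma> n)))) \<le> ennreal (LINT s|lebesgue_on {0..t}. g s)"
      unfolding integral_unique[OF f] by (rule ennreal_leI)
    also have "\<dots> = a n" unfolding eq[symmetric]
      by (rule nn_integral_eq_integral[OF gi, symmetric]) (simp add: g_def)
    finally show ?thesis .
  qed simp
  have "(\<lambda>n. a n + L2_norm (\<lambda>x. G x - simple_integral (\<sigma> n) x)) \<longlonglongrightarrow> 0 + 0"
    unfolding a_def by (intro tendsto_add \<sigma>(3,4))
  moreover have "ennreal (norm (cls G - integral {0..t} W)) \<le> a n + L2_norm (\<lambda>x. G x - simple_integral (\<sigma> n) x)" for n
  proof -
    have "norm (cls G - integral {0..t} W) \<le> norm (integral {0..t} W - cls (simple_integral (\<sigma> n))) + norm (cls G - cls (simple_integral (\<sigma> n)))"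
      by norm
    then have "ennreal (norm (cls G - integral {0..t} W)) \<le> ennreal (norm (integral {0..t} W - cls (simple_integral (\<sigma> n)))) + L2_norm (\<lambda>x. G x - simple_integral (\<sigma> n) x)"
      using G simple_L2(2)[OF \<sigma>(1)[of n]] by (simp add: L2_norm_cls L2_space_diff cls_diff ennreal_leI flip: ennreal_plus)
    also have "\<dots> \<le> a n + L2_norm (\<lambda>x. G x - simple_integral (\<sigma> n) x)" by (intro add_right_mono bound)
    finally show ?thesis .
  qed
  ultimately have "ennreal (norm (cls G - integral {0..t} W)) \<le> 0"
    using LIMSEQ_le_const by fastforce
  then show ?thesis by (simp add: ennreal_eq_0_iff)
qed

text \<open>The embedding of the reals is applied to the values \<open>h\<close> of the
  approximating simple functions; it changes none of the norms.\<close>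

lemma has_L2_integral_of_real:
  fixes F :: "real \<Rightarrow> real \<Rightarrow> real"
  assumes "has_L2_integral F G t"
  shows "has_L2_integral (\<lambda>s x. complex_of_real (F s x)) (\<lambda>x. complex_of_real (G x)) t"
proof -
  obtain \<sigma> where \<sigma>: "\<And>n. simple_on t (\<sigma> n)"
      "\<And>n. (\<lambda>s. L2_norm (\<lambda>x. F s x - simple_value (\<sigma> n) s x)) \<in> borel_measurable (lebesgue_on {0..t})"
      "(\<lambda>n. \<integral>\<^sup>+ s. L2_norm (\<lambda>x. F s x - simple_value (\<sigma> n) s x) \<partial>lebesgue_on {0..t}) \<longlonglongrightarrow> 0"
      "(\<lambda>n. L2_norm (\<lambda>x. G x - simple_integral (\<sigma> n) x)) \<longlonglongrightarrow> 0"
    using assms unfolding has_L2_integral_def by blast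
  define C where "C = map (\<lambda>(A::real set, h::real \<Rightarrow> real). (A, \<lambda>x. complex_of_real (h x)))"
  have Cv: "simple_value (C \<rho>) s x = complex_of_real (simple_value \<rho> s x)" for \<rho> s x
    by (induction \<rho>) (auto simp: C_def simple_value_def indicator_def)
  have Ci: "simple_integral (C \<rho>) x = complex_of_real (simple_integral \<rho> x)" for \<rho> x
    by (induction \<rho>) (auto simp: C_def simple_integral_def scaleR_conv_of_real)
  have Cs: "simple_on t (C \<rho>)" if "simple_on t \<rho>" for \<rho>
    using that by (auto simp: C_def simple_on_def intro: L2_space_of_real)
  have n: "L2_norm (\<lambda>x. complex_of_real (a x) - complex_of_real (b x)) = L2_norm (\<lambda>x. a x - b x)" for a b
    using L2_norm_of_real[of "\<lambda>x. a x - b x"] by simp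
  have G: "G \<in> L2_space" "AE s in lebesgue_on {0..t}. F s \<in> L2_space"
    using assms unfolding has_L2_integral_def by auto
  show ?thesis
    unfolding has_L2_integral_def
  proof (intro conjI exI[of _ "\<lambda>n. C (\<sigma> n)"] allI)
    show "AE s in lebesgue_on {0..t}. (\<lambda>x. complex_of_real (F s x)) \<in> L2_space"
      using G(2) by eventually_elim (rule L2_space_of_real)
  qed (simp_all add: Cv Ci n \<sigma> Cs L2_space_of_real G)
qed

section \<open>The Schroedinger--Debye flow in \<open>H\<^sup>1\<close>\<close>

lemma has_vector_derivative_quotient:
  "(f has_vector_derivative D) (at t within S) \<longleftrightarrow> ((\<lambda>s. (f s - f t) /\<^sub>R (s - t)) \<longlongrightarrow> D) (at t within S)"
proof -
  have "((\<lambda>s. (f s - f t) /\<^sub>R (s - t)) \<longlongrightarrow> D) (at t within S)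
      \<longleftrightarrow> ((\<lambda>s. norm ((f s - f t) /\<^sub>R (s - t) - D)) \<longlongrightarrow> 0) (at t within S)"
    by (simp add: tendsto_norm_zero_iff LIM_zero_iff)
  also have "\<dots> \<longleftrightarrow> ((\<lambda>s. norm ((1 / norm (s - t)) *\<^sub>R (f s - (f t + (s - t) *\<^sub>R D)))) \<longlongrightarrow> 0) (at t within S)"
  proof (rule tendsto_cong)
    have "norm ((f s - f t) /\<^sub>R (s - t) - D) = norm ((1 / norm (s - t)) *\<^sub>R (f s - (f t + (s - t) *\<^sub>R D)))" if "s \<noteq> t" for s
    proof -
      have "(f s - f t) /\<^sub>R (s - t) - D = (1 / (s - t)) *\<^sub>R (f s - (f t + (s - t) *\<^sub>R D))"
        using that by (simp add: diff_diff_eq[symmetric] scaleR_diff_right divide_inverse)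
      then show ?thesis by simp
    qed
    then show "\<forall>\<^sub>F s in at t within S. norm ((f s - f t) /\<^sub>R (s - t) - D)
        = norm ((1 / norm (s - t)) *\<^sub>R (f s - (f t + (s - t) *\<^sub>R D)))"
      by (auto simp: eventually_at_filter)
  qed
  also have "\<dots> \<longleftrightarrow> (f has_vector_derivative D) (at t within S)"
    unfolding tendsto_norm_zero_iff has_vector_derivative_def has_derivative_within
    by (simp add: bounded_linear_scaleR_left)
  finally show ?thesis by simp
qed

lemma tendsto_real_squeeze:
  assumes g: "(g \<longlongrightarrow> (0::ennreal)) F" and le: "\<forall>\<^sub>F s in F. ennreal (h s) \<le> g s" and nn: "\<forall>\<^sub>F s in F. 0 \<le> h s"
  shows "(h \<longlongrightarrow> 0) F"
proof -
  have "((\<lambda>s. ennreal (h s)) \<longlongrightarrow> ennreal 0) F"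
    unfolding ennreal_0 by (rule tendsto_sandwich[OF _ le tendsto_const g]) simp
  then have "((\<lambda>s. enn2real (ennreal (h s))) \<longlongrightarrow> 0) F"
    by (rule tendsto_enn2real) simp
  then show ?thesis
    by (rule Lim_transform_eventually) (use nn in \<open>auto elim: eventually_mono\<close>)
qed

text \<open>Continuity in H^1 on the level of classes, split into convergence in norm and in the
  seminorm \<open>dn\<close>.\<close>

definition cH1 :: "(real \<Rightarrow> cL2) \<Rightarrow> bool" where
  "cH1 W \<longleftrightarrow> (\<forall>t\<ge>0. H1c (W t) \<and> ((\<lambda>s. dn (W s - W t)) \<longlongrightarrow> 0) (at t within {0..}) \<and> (W \<longlongrightarrow> W t) (at t within {0..}))"

lemma cH1I:
  assumes H: "\<And>t. 0 \<le> t \<Longrightarrow> H1c (W t)"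
    and g: "\<And>t. 0 \<le> t \<Longrightarrow> (g t \<longlongrightarrow> 0) (at t within {0..})"
    and d: "\<And>s t. 0 \<le> s \<Longrightarrow> 0 \<le> t \<Longrightarrow> ennreal (dn (W s - W t)) \<le> g t s"
    and n: "\<And>s t. 0 \<le> s \<Longrightarrow> 0 \<le> t \<Longrightarrow> ennreal (norm (W s - W t)) \<le> g t s"
  shows "cH1 W"
  unfolding cH1_def
proof (intro allI impI conjI)
  fix t :: real assume t: "0 \<le> t"
  have ev: "\<forall>\<^sub>F s in at t within {0..}. 0 \<le> s" by (simp add: eventually_at_filter)
  show "H1c (W t)" by (rule H[OF t])
  show "((\<lambda>s. dn (W s - W t)) \<longlongrightarrow> 0) (at t within {0..})"
    by (rule tendsto_real_squeeze[OF g[OF t]])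
       (use ev in \<open>auto elim!: eventually_mono intro: d t dn_nonneg H1c_diff H\<close>)
  have "((\<lambda>s. norm (W s - W t)) \<longlongrightarrow> 0) (at t within {0..})"
    by (rule tendsto_real_squeeze[OF g[OF t]]) (use ev in \<open>auto elim!: eventually_mono intro: n t\<close>)
  then show "(W \<longlongrightarrow> W t) (at t within {0..})" by (simp add: tendsto_norm_zero_iff LIM_zero_iff)
qed

lemma dn_diff_le: "H1c F \<Longrightarrow> H1c G \<Longrightarrow> \<bar>dn F - dn G\<bar> \<le> dn (F - G)"
proof -
  have "dn F \<le> dn G + dn (F - G)" if "H1c F" "H1c G" for F G
  proof (rule dn_le)
    fix n
    have "norm (DN n F) = norm (DN n G + DN n (F - G))"
      by (simp add: linear_diff[OF bounded_linear.linear[OF bounded_linear_DN]])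
    also have "\<dots> \<le> norm (DN n G) + norm (DN n (F - G))" by (rule norm_triangle_ineq)
    also have "\<dots> \<le> dn G + dn (F - G)" by (intro add_mono DN_le_dn that H1c_diff)
    finally show "norm (DN n F) \<le> dn G + dn (F - G)" .
  qed
  from this[of F G] this[of G F] show "H1c F \<Longrightarrow> H1c G \<Longrightarrow> \<bar>dn F - dn G\<bar> \<le> dn (F - G)"
    by (simp add: dn_minus[of G F] abs_le_iff)
qed

lemma cH1_H1c: "cH1 W \<Longrightarrow> 0 \<le> t \<Longrightarrow> H1c (W t)"
  and cH1_tendsto: "cH1 W \<Longrightarrow> 0 \<le> t \<Longrightarrow> (W \<longlongrightarrow> W t) (at t within {0..})"
  by (auto simp: cH1_def)

lemma cH1_dn_tendsto:
  assumes W: "cH1 W" and t: "0 \<le> t" shows "((\<lambda>s. dn (W s)) \<longlongrightarrow> dn (W t)) (at t within {0..})"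
proof -
  have "((\<lambda>s. dn (W s) - dn (W t)) \<longlongrightarrow> 0) (at t within {0..})"
  proof (rule Lim_null_comparison)
    show "\<forall>\<^sub>F s in at t within {0..}. norm (dn (W s) - dn (W t)) \<le> dn (W s - W t)"
      using W t unfolding eventually_at_filter
      by (intro always_eventually) (auto intro!: dn_diff_le cH1_H1c)
    show "((\<lambda>s. dn (W s - W t)) \<longlongrightarrow> 0) (at t within {0..})" using W t by (auto simp: cH1_def)
  qed
  then show ?thesis by (rule LIM_zero_cancel)
qed

lemma cH1_sup_bd_tendsto:
  assumes W: "cH1 W" and t: "0 \<le> t" shows "((\<lambda>s. sup_bd (W s)) \<longlongrightarrow> sup_bd (W t)) (at t within {0..})"
  unfolding sup_bd_def by (intro tendsto_intros cH1_tendsto cH1_dn_tendsto assms)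

lemma cH1_bounded:
  assumes W: "cH1 W"
  shows "\<exists>B. 0 \<le> B \<and> (\<forall>t\<in>{0..T}. norm (W t) \<le> B \<and> dn (W t) \<le> B \<and> sup_bd (W t) \<le> B)"
proof -
  define f where "f t = norm (W t) + dn (W t) + sup_bd (W t)" for t
  have "continuous_on {0..T} f"
    unfolding continuous_on_def f_def
  proof (intro ballI tendsto_add tendsto_norm)
    fix t assume "t \<in> {0..T}"
    then have t: "0 \<le> t" and le: "at t within {0..T} \<le> at t within {0..}" by (auto intro: at_le)
    show "(W \<longlongrightarrow> W t) (at t within {0..T})" "((\<lambda>t. dn (W t)) \<longlongrightarrow> dn (W t)) (at t within {0..T})"
      "((\<lambda>t. sup_bd (W t)) \<longlongrightarrow> sup_bd (W t)) (at t within {0..T})"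
      by (rule tendsto_mono[OF le]; intro cH1_tendsto cH1_dn_tendsto cH1_sup_bd_tendsto W t)+
  qed
  then have "bounded (f ` {0..T})" by (intro compact_imp_bounded compact_continuous_image) auto
  then obtain B where B: "0 < B" "\<And>t. t \<in> {0..T} \<Longrightarrow> norm (f t) \<le> B" by (auto simp: bounded_pos)
  have "norm (W t) \<le> B \<and> dn (W t) \<le> B \<and> sup_bd (W t) \<le> B" if "t \<in> {0..T}" for t
  proof -
    have "0 \<le> norm (W t)" "0 \<le> dn (W t)" "0 \<le> sup_bd (W t)" using that by (auto intro!: dn_nonneg cH1_H1c W)
    then show ?thesis using B(2)[OF that] unfolding f_def real_norm_def by linarith
  qed
  then show ?thesis using B(1) by (intro exI[of _ B]) auto
qed

lemma mulop_rep_commute: "mulop (rep F) G = mulop (rep G) F"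
  by (simp add: mulop_def mult.commute)

lemma mulop_rep_diff:
  assumes "H1c F" "H1c G" shows "mulop (rep F) K - mulop (rep G) K = mulop (rep (F - G)) K"
  unfolding mulop_symbol_diff[OF bdd_symbol_rep[OF assms(1)] bdd_symbol_rep[OF assms(2)], symmetric]
proof (rule mulop_cong_AE[symmetric])
  show "AE x in lebesgue. rep (F - G) x = rep F x - rep G x" by (rule rep_diff)
  show "bdd_symbol (rep (F - G)) (sup_bd (F - G))" by (rule bdd_symbol_rep[OF H1c_diff(1)[OF assms]])
qed

text \<open>The difference of products is split so that one factor is bounded in the supremum norm,
  through \<open>sup_bd\<close>, and the other carries the small L^2 difference.\<close>

lemma cH1_mulop_tendsto:
  assumes A: "cH1 A" and B: "cH1 B" and t: "0 \<le> t"
  shows "((\<lambda>s. mulop (rep (A s)) (B s)) \<longlongrightarrow> mulop (rep (A t)) (B t)) (at t within {0..})"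
proof -
  have "((\<lambda>s. mulop (rep (A s)) (B s) - mulop (rep (A t)) (B t)) \<longlongrightarrow> 0) (at t within {0..})"
  proof (rule Lim_null_comparison)
    show "\<forall>\<^sub>F s in at t within {0..}. norm (mulop (rep (A s)) (B s) - mulop (rep (A t)) (B t))
        \<le> sup_bd (A s) * norm (B s - B t) + sup_bd (B t) * norm (A s - A t)"
      unfolding eventually_at_filter
    proof (intro always_eventually allI impI)
      fix s :: real assume s: "s \<in> {0..}"
      have H: "H1c (A s)" "H1c (A t)" "H1c (B t)" using A B s t by (auto intro: cH1_H1c)
      have "mulop (rep (A s)) (B s) - mulop (rep (A t)) (B t)
          = mulop (rep (A s)) (B s - B t) + (mulop (rep (A s)) (B t) - mulop (rep (A t)) (B t))"
        by (simp add: mulop_diff[OF bdd_symbol_rep[OF H(1)]])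
      \<comment> \<open>Commuting the factors puts the increment of \<open>A\<close> into the L^2
        slot and lets the bounded \<open>B t\<close> act as the symbol.\<close>
      also have "\<dots> = mulop (rep (A s)) (B s - B t) + mulop (rep (B t)) (A s - A t)"
        by (simp add: mulop_rep_diff H mulop_rep_commute[of "A s - A t"])
      finally show "norm (mulop (rep (A s)) (B s) - mulop (rep (A t)) (B t))
        \<le> sup_bd (A s) * norm (B s - B t) + sup_bd (B t) * norm (A s - A t)"
        using norm_triangle_mono[OF norm_mulop[OF bdd_symbol_rep[OF H(1)]] norm_mulop[OF bdd_symbol_rep[OF H(3)]]] by metis
    qed
    have "((\<lambda>s. sup_bd (A s) * norm (B s - B t) + sup_bd (B t) * norm (A s - A t)) \<longlongrightarrow>
        sup_bd (A t) * norm (B t - B t) + sup_bd (B t) * norm (A t - A t)) (at t within {0..})"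
      by (intro tendsto_intros cH1_sup_bd_tendsto cH1_tendsto A B t)
    then show "((\<lambda>s. sup_bd (A s) * norm (B s - B t) + sup_bd (B t) * norm (A s - A t)) \<longlongrightarrow> 0) (at t within {0..})"
      by simp
  qed
  then show ?thesis by (rule LIM_zero_cancel)
qed

definition sqmod :: "cL2 \<Rightarrow> cL2" where "sqmod F = cls (\<lambda>x. complex_of_real ((norm (rep F x))\<^sup>2))"

lemma sqmod_L2:
  assumes "H1c F" shows "(\<lambda>x. complex_of_real ((norm (rep F x))\<^sup>2)) \<in> L2_space"
proof (rule L2_space_bound[OF rep_L2[of F], where c = "sup_bd F"])
  show "(\<lambda>x. complex_of_real ((norm (rep F x))\<^sup>2)) \<in> borel_measurable lebesgue" by measurable
  show "AE x in lebesgue. norm (complex_of_real ((norm (rep F x))\<^sup>2)) \<le> sup_bd F * norm (rep F x)"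
    using sup_bd[OF assms] unfolding norm_of_real by eventually_elim (simp add: power2_eq_square mult_right_mono)
qed

lemma norm_sqmod_diff:
  assumes "H1c F" "H1c G" shows "norm (sqmod F - sqmod G) \<le> (sup_bd F + sup_bd G) * norm (F - G)"
proof -
  have "norm (cls (\<lambda>x. complex_of_real ((norm (rep F x))\<^sup>2) - complex_of_real ((norm (rep G x))\<^sup>2)))
      \<le> (sup_bd F + sup_bd G) * norm (cls (\<lambda>x. rep F x - rep G x))"
  proof (rule norm_cls_mono)
    show "AE x in lebesgue. norm (complex_of_real ((norm (rep F x))\<^sup>2) - complex_of_real ((norm (rep G x))\<^sup>2))
        \<le> (sup_bd F + sup_bd G) * norm (rep F x - rep G x)"
      using sup_bd[OF assms(1)] sup_bd[OF assms(2)]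
    proof eventually_elim
      case (elim x)
      have "norm (complex_of_real ((norm (rep F x))\<^sup>2) - complex_of_real ((norm (rep G x))\<^sup>2))
          = \<bar>norm (rep F x) - norm (rep G x)\<bar> * (norm (rep F x) + norm (rep G x))"
        unfolding of_real_diff[symmetric] norm_of_real power2_eq_square square_diff_square_factored abs_mult by simp
      also have "\<dots> \<le> norm (rep F x - rep G x) * (sup_bd F + sup_bd G)"
        using elim by (intro mult_mono norm_triangle_ineq3 add_mono) auto
      finally show ?case by (simp add: mult.commute)
    qed
  qed (intro L2_space_diff sqmod_L2 rep_L2 add_nonneg_nonneg sup_bd_nonneg assms)+
  then show ?thesis
    unfolding sqmod_def cls_diff[OF sqmod_L2[OF assms(1)] sqmod_L2[OF assms(2)]] cls_diff[OF rep_L2 rep_L2] cls_rep .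
qed

lemma cH1_sqmod_tendsto:
  assumes A: "cH1 A" and t: "0 \<le> t" shows "((\<lambda>s. sqmod (A s)) \<longlongrightarrow> sqmod (A t)) (at t within {0..})"
proof -
  have "((\<lambda>s. sqmod (A s) - sqmod (A t)) \<longlongrightarrow> 0) (at t within {0..})"
  proof (rule Lim_null_comparison)
    show "\<forall>\<^sub>F s in at t within {0..}. norm (sqmod (A s) - sqmod (A t)) \<le> (sup_bd (A s) + sup_bd (A t)) * norm (A s - A t)"
      unfolding eventually_at_filter
      by (intro always_eventually allI impI norm_sqmod_diff cH1_H1c[OF A] t) auto
    have "((\<lambda>s. (sup_bd (A s) + sup_bd (A t)) * norm (A s - A t)) \<longlongrightarrow> (sup_bd (A t) + sup_bd (A t)) * norm (A t - A t)) (at t within {0..})"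
      by (intro tendsto_intros cH1_sup_bd_tendsto cH1_tendsto A t)
    then show "((\<lambda>s. (sup_bd (A s) + sup_bd (A t)) * norm (A s - A t)) \<longlongrightarrow> 0) (at t within {0..})" by simp
  qed
  then show ?thesis by (rule LIM_zero_cancel)
qed

lemma tendsto_continuous_on_Icc:
  assumes "\<And>t. 0 \<le> t \<Longrightarrow> (f \<longlongrightarrow> f t) (at t within {0..})" shows "continuous_on {0..T::real} f"
  unfolding continuous_on_def
proof
  fix t assume "t \<in> {0..T}"
  then have "0 \<le> t" "at t within {0..T} \<le> at t within {0..}" by (auto intro: at_le)
  then show "(f \<longlongrightarrow> f t) (at t within {0..T})" using tendsto_mono assms by blast
qed

text \<open>On a bounded frequency band the generator
  \<open>(1/2) *\<^sub>R J (DN n (DN n F))\<close>, the operator \<open>i/2\<close> times the second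
  derivative, is bounded. There the difference quotients of the symbols are uniformly bounded and
  converge pointwise.\<close>

lemma schr_PN_deriv:
  "((\<lambda>t. schr t (PN n F)) has_vector_derivative (1/2) *\<^sub>R J (DN n (DN n (schr t F)))) (at t within S)"
  unfolding has_vector_derivative_quotient tendsto_at_iff_sequentially o_def
proof (intro allI impI)
  fix X :: "nat \<Rightarrow> real" assume X: "\<forall>i. X i \<in> S - {t}" "X \<longlonglongrightarrow> t"
  define g where "g s \<xi> = cis (- (s * \<xi>\<^sup>2 / 2))" for s \<xi> :: real
  define m where "m k \<xi> = of_real (inverse (X k - t)) * (g (X k) \<xi> - g t \<xi>) * sym_P n \<xi>" for k \<xi>
  \<comment> \<open>The derivative \<open>- \<i> * \<xi>\<^sup>2 / 2\<close> of the phase, written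
    as half of \<open>\<i>\<close> times two factors \<open>sym_D n\<close>, so that it is
    recognised as \<open>J\<close> and \<open>DN n\<close> twice.\<close>
  define D where "D \<xi> = of_real (1/2) * (\<i> * (sym_D n \<xi> * (sym_D n \<xi> * g t \<xi>)))" for \<xi>
  have gs: "bdd_symbol (g s) 1" for s unfolding g_def by (rule bdd_symbol_schr)
  have gd: "bdd_symbol (\<lambda>\<xi>. g s \<xi> - g t \<xi>) 2" for s
  proof (rule bdd_symbolI)
    show "(\<lambda>\<xi>. g s \<xi> - g t \<xi>) \<in> borel_measurable lebesgue" using gs by (intro borel_measurable_diff) (auto simp: bdd_symbol_def)
    show "norm (g s \<xi> - g t \<xi>) \<le> 2" for \<xi> using norm_triangle_ineq4[of "g s \<xi>" "g t \<xi>"] by (simp add: g_def)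
  qed
  have mb: "bdd_symbol (m k) ((real n)\<^sup>2 / 2)" for k
  proof (rule bdd_symbolI)
    show "m k \<in> borel_measurable lebesgue"
      unfolding m_def using gd[of "X k"] bdd_symbol_P[of n]
      by (intro borel_measurable_times) (auto simp: bdd_symbol_def)
    show "norm (m k \<xi>) \<le> (real n)\<^sup>2 / 2" for \<xi>
    proof (cases "\<bar>\<xi>\<bar> \<le> real n")
      case True
      have ne: "X k - t \<noteq> 0" using X(1) by auto
      have "g (X k) \<xi> - g t \<xi> = g t \<xi> * (cis (- ((X k - t) * \<xi>\<^sup>2 / 2)) - 1)"
        by (simp add: g_def right_diff_distrib cis_mult) (simp add: field_simps)
      then have "norm (g (X k) \<xi> - g t \<xi>) \<le> \<bar>- ((X k - t) * \<xi>\<^sup>2 / 2)\<bar>"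
        using norm_cis_minus_one[of "- ((X k - t) * \<xi>\<^sup>2 / 2)"] by (simp add: norm_mult g_def)
      also have "\<dots> = \<bar>X k - t\<bar> * (\<xi>\<^sup>2 / 2)" by (simp add: abs_mult)
      also have "\<dots> \<le> \<bar>X k - t\<bar> * ((real n)\<^sup>2 / 2)"
        using power_mono[OF True, of 2] by (intro mult_left_mono divide_right_mono) auto
      finally have "norm (g (X k) \<xi> - g t \<xi>) \<le> \<bar>X k - t\<bar> * ((real n)\<^sup>2 / 2)" .
      then have "inverse \<bar>X k - t\<bar> * norm (g (X k) \<xi> - g t \<xi>) \<le> inverse \<bar>X k - t\<bar> * (\<bar>X k - t\<bar> * ((real n)\<^sup>2 / 2))"
        by (rule mult_left_mono) simp
      also have "\<dots> = (real n)\<^sup>2 / 2" using ne by simp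
      finally show ?thesis
        by (auto simp: m_def norm_mult sym_P_def indicator_def norm_inverse simp flip: of_real_diff)
    next
      case False
      then have "sym_P n \<xi> = 0" by (auto simp: sym_P_def indicator_def)
      then show ?thesis by (simp add: m_def)
    qed
  qed
  have "(\<lambda>k. fmult (m k) F) \<longlonglongrightarrow> fmult D F"
  proof (rule fmult_tendsto[OF mb])
    show "D \<in> borel_measurable lebesgue"
      unfolding D_def using gs[of t] bdd_symbol_D[of n]
      by (intro borel_measurable_times) (auto simp: bdd_symbol_def)
    fix \<xi> :: real
    have "((\<lambda>s. g s \<xi>) has_vector_derivative - \<i> * (\<xi>\<^sup>2 / 2) * g t \<xi>) (at t within S)"
      unfolding g_def cis_conv_exp
      by (rule derivative_eq_intros has_vector_derivative_real_field refl | simp)+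
    then have "(\<lambda>k. (g (X k) \<xi> - g t \<xi>) /\<^sub>R (X k - t)) \<longlonglongrightarrow> - \<i> * (\<xi>\<^sup>2 / 2) * g t \<xi>"
      using X unfolding has_vector_derivative_quotient tendsto_at_iff_sequentially o_def by blast
    then have "(\<lambda>k. (g (X k) \<xi> - g t \<xi>) /\<^sub>R (X k - t) * sym_P n \<xi>) \<longlonglongrightarrow> - \<i> * (\<xi>\<^sup>2 / 2) * g t \<xi> * sym_P n \<xi>"
      by (intro tendsto_intros)
    moreover have "- \<i> * (\<xi>\<^sup>2 / 2) * g t \<xi> * sym_P n \<xi> = D \<xi>"
      by (auto simp: D_def sym_D_def sym_P_def indicator_def power2_eq_square mult_ac)
    ultimately show "(\<lambda>k. m k \<xi>) \<longlonglongrightarrow> D \<xi>"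
      by (simp add: m_def scaleR_conv_of_real mult.assoc)
  qed
  moreover have "fmult (m k) F = (schr (X k) (PN n F) - schr t (PN n F)) /\<^sub>R (X k - t)" for k
  proof (rule fourier_inj)
    have c: "bdd_symbol (\<lambda>\<xi>. complex_of_real (inverse (X k - t))) \<bar>inverse (X k - t)\<bar>"
      using bdd_symbol_const[of "complex_of_real (inverse (X k - t))"] by (simp only: norm_of_real)
    have "fourier ((schr (X k) (PN n F) - schr t (PN n F)) /\<^sub>R (X k - t))
        = inverse (X k - t) *\<^sub>R (mulop (g (X k)) (mulop (sym_P n) (fourier F)) - mulop (g t) (mulop (sym_P n) (fourier F)))"
      by (simp add: fourier_scaleR fourier_diff schr_def fourier_fmult PN_def g_def[abs_def])
    also have "\<dots> = mulop (\<lambda>\<xi>. complex_of_real (inverse (X k - t))) (mulop (\<lambda>\<xi>. g (X k) \<xi> - g t \<xi>) (mulop (sym_P n) (fourier F)))"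
      by (simp only: mulop_of_real mulop_symbol_diff[OF gs gs])
    also have "\<dots> = mulop (m k) (fourier F)"
      unfolding mulop_mulop[OF gd bdd_symbol_P] mulop_mulop[OF c bdd_symbol_mult[OF gd bdd_symbol_P]]
      by (simp add: m_def[abs_def] mult.assoc)
    finally show "fourier (fmult (m k) F) = fourier ((schr (X k) (PN n F) - schr t (PN n F)) /\<^sub>R (X k - t))"
      by (simp add: fourier_fmult)
  qed
  moreover have "fmult D F = (1/2) *\<^sub>R J (DN n (DN n (schr t F)))"
  proof (rule fourier_inj)
    note DDg = bdd_symbol_mult[OF bdd_symbol_D[of n] bdd_symbol_mult[OF bdd_symbol_D[of n] gs[of t]]]
    have c: "bdd_symbol (\<lambda>\<xi>. complex_of_real (1/2)) (1/2)"
      using bdd_symbol_const[of "complex_of_real (1/2)"] by simp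
    have "fourier ((1/2) *\<^sub>R J (DN n (DN n (schr t F)))) = (1/2) *\<^sub>R J (mulop (sym_D n) (mulop (sym_D n) (mulop (g t) (fourier F))))"
      by (simp add: fourier_scaleR fourier_J DN_def schr_def fourier_fmult g_def[abs_def])
    also have "\<dots> = mulop (\<lambda>\<xi>. complex_of_real (1/2)) (mulop (\<lambda>\<xi>. \<i>) (mulop (sym_D n) (mulop (sym_D n) (mulop (g t) (fourier F)))))"
      by (simp only: mulop_of_real J_def)
    also have "\<dots> = mulop D (fourier F)"
      unfolding mulop_mulop[OF bdd_symbol_D gs] mulop_mulop[OF bdd_symbol_D bdd_symbol_mult[OF bdd_symbol_D gs]]
        mulop_mulop[OF bdd_symbol_i DDg] mulop_mulop[OF c bdd_symbol_mult[OF bdd_symbol_i DDg]]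
      by (simp add: D_def[abs_def])
    finally show "fourier (fmult D F) = fourier ((1/2) *\<^sub>R J (DN n (DN n (schr t F))))"
      by (simp add: fourier_fmult)
  qed
  ultimately show "(\<lambda>k. (schr (X k) (PN n F) - schr t (PN n F)) /\<^sub>R (X k - t)) \<longlonglongrightarrow> (1/2) *\<^sub>R J (DN n (DN n (schr t F)))"
    by simp
qed

text \<open>Product rule for the group acting on a moving vector. The group is only strongly
  continuous, so the first term passes to the limit through \<open>schr_tendsto2\<close>.\<close>

lemma schr_PN_product_deriv:
  assumes W: "(W has_vector_derivative W') (at t within S)"
  shows "((\<lambda>s. schr s (PN n (W s))) has_vector_derivative
    schr t (PN n W') + (1/2) *\<^sub>R J (DN n (DN n (schr t (W t))))) (at t within S)"
  unfolding has_vector_derivative_quotient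
proof -
  have "((\<lambda>s. PN n ((W s - W t) /\<^sub>R (s - t))) \<longlongrightarrow> PN n W') (at t within S)"
    using W unfolding has_vector_derivative_quotient by (intro bounded_linear.tendsto[OF bounded_linear_PN])
  from schr_tendsto2[OF this, of 0 1]
  have 1: "((\<lambda>s. schr s (PN n ((W s - W t) /\<^sub>R (s - t)))) \<longlongrightarrow> schr t (PN n W')) (at t within S)" by simp
  have 2: "((\<lambda>s. (schr s (PN n (W t)) - schr t (PN n (W t))) /\<^sub>R (s - t)) \<longlongrightarrow> (1/2) *\<^sub>R J (DN n (DN n (schr t (W t))))) (at t within S)"
    using schr_PN_deriv unfolding has_vector_derivative_quotient .
  have "schr s (PN n ((W s - W t) /\<^sub>R (s - t))) + (schr s (PN n (W t)) - schr t (PN n (W t))) /\<^sub>R (s - t)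
      = (schr s (PN n (W s)) - schr t (PN n (W t))) /\<^sub>R (s - t)" for s
  proof -
    have "schr s (PN n ((W s - W t) /\<^sub>R (s - t))) = (schr s (PN n (W s)) - schr s (PN n (W t))) /\<^sub>R (s - t)"
      by (simp add: linear_diff[OF bounded_linear.linear[OF bounded_linear_PN]] linear_scale[OF bounded_linear.linear[OF bounded_linear_PN]]
          linear_scale[OF bounded_linear.linear[OF bounded_linear_schr]] schr_diff)
    then show ?thesis by (simp add: algebra_simps)
  qed
  with tendsto_add[OF 1 2] show "((\<lambda>s. (schr s (PN n (W s)) - schr t (PN n (W t))) /\<^sub>R (s - t)) \<longlongrightarrow>
      schr t (PN n W') + (1/2) *\<^sub>R J (DN n (DN n (schr t (W t))))) (at t within S)" by simp
qed

lemma norm_sqmod: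
  assumes "H1c F" shows "norm (sqmod F) \<le> sup_bd F * norm F"
proof -
  have "norm (cls (\<lambda>x. complex_of_real ((norm (rep F x))\<^sup>2))) \<le> sup_bd F * norm (cls (rep F))"
  proof (rule norm_cls_mono[OF sqmod_L2[OF assms] rep_L2])
    show "AE x in lebesgue. norm (complex_of_real ((norm (rep F x))\<^sup>2)) \<le> sup_bd F * norm (rep F x)"
      using sup_bd[OF assms] unfolding norm_of_real
      by eventually_elim (simp add: power2_eq_square mult_right_mono)
  qed simp
  then show ?thesis by (simp only: sqmod_def cls_rep)
qed

text \<open>Pointwise \<open>Re (F K cnj F)\<close> is \<open>Re K\<close> times the squared modulus
  of \<open>F\<close>. Thus the interaction energy is also a trilinear form, which can be
  differentiated.\<close>

lemma inner_mulop_sqmod: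
  assumes "H1c F" shows "mulop (rep F) K \<bullet> F = K \<bullet> sqmod F"
proof -
  have L: "(\<lambda>x. rep F x * rep K x) \<in> L2_space" by (rule mult_L2[OF bdd_symbol_rep[OF assms] rep_L2])
  have "mulop (rep F) K \<bullet> cls (rep F) = (LINT x|lebesgue. (rep F x * rep K x) \<bullet> rep F x)"
    unfolding mulop_def by (rule inner_cls[OF L rep_L2])
  also have "\<dots> = (LINT x|lebesgue. rep K x \<bullet> complex_of_real ((norm (rep F x))\<^sup>2))"
  proof (rule Bochner_Integration.integral_cong[OF refl])
    fix x
    show "(rep F x * rep K x) \<bullet> rep F x = rep K x \<bullet> complex_of_real ((norm (rep F x))\<^sup>2)"
      unfolding inner_complex_def Re_complex_of_real Im_complex_of_real cmod_power2
      by (simp add: power2_eq_square algebra_simps)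
  qed
  also have "\<dots> = cls (rep K) \<bullet> sqmod F"
    unfolding sqmod_def by (rule inner_cls[OF rep_L2 sqmod_L2[OF assms], symmetric])
  finally show ?thesis by simp
qed

text \<open>For real \<open>V\<close> the form \<open>Re (F V cnj G)\<close> is symmetric in
  \<open>F\<close> and \<open>G\<close>. This merges the two derivatives that fall on the factors of
  the squared modulus.\<close>

lemma inner_mulop_real:
  assumes "H1c F" "H1c G" and real: "AE x in lebesgue. Im (rep V x) = 0"
  shows "mulop (rep F) V \<bullet> G = F \<bullet> mulop (rep G) V"
proof -
  have L: "(\<lambda>x. rep F x * rep V x) \<in> L2_space" "(\<lambda>x. rep G x * rep V x) \<in> L2_space"
    using mult_L2[OF bdd_symbol_rep rep_L2] assms by auto
  have "mulop (rep F) V \<bullet> cls (rep G) = (LINT x|lebesgue. (rep F x * rep V x) \<bullet> rep G x)"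
    unfolding mulop_def by (rule inner_cls[OF L(1) rep_L2])
  also have "\<dots> = (LINT x|lebesgue. rep F x \<bullet> (rep G x * rep V x))"
  proof (rule integral_cong_AE)
    show "AE x in lebesgue. (rep F x * rep V x) \<bullet> rep G x = rep F x \<bullet> (rep G x * rep V x)"
      using real by eventually_elim (simp add: inner_complex_def algebra_simps)
  qed (use borel_measurable_integrable[OF integrable_L2_inner[OF L(1) rep_L2]]
        borel_measurable_integrable[OF integrable_L2_inner[OF rep_L2 L(2)]] in auto)
  also have "\<dots> = cls (rep F) \<bullet> mulop (rep G) V"
    unfolding mulop_def by (rule inner_cls[OF rep_L2 L(2), symmetric])
  finally show ?thesis by simp
qed

text \<open>Pointwise orthogonality of a complex number and a purely imaginary multiple of it; this
  is the mechanism of mass conservation.\<close>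

lemma inner_real_mulop_J:
  assumes "H1c V" and real: "AE x in lebesgue. Im (rep V x) = 0"
  shows "F \<bullet> J (mulop (rep V) F) = 0"
proof -
  have L: "(\<lambda>x. rep V x * rep F x) \<in> L2_space" by (rule mult_L2[OF bdd_symbol_rep[OF assms(1)] rep_L2])
  have "cls (rep F) \<bullet> J (mulop (rep V) F) = (LINT x|lebesgue. rep F x \<bullet> (\<i> * (rep V x * rep F x)))"
    unfolding mulop_def J_cls[OF L] by (rule inner_cls[OF rep_L2 L2_space_mult_const[OF L]])
  also have "\<dots> = 0"
    by (rule integral_eq_zero_AE, use real in eventually_elim) (simp add: inner_complex_def algebra_simps)
  finally show ?thesis by simp
qed

text \<open>Bernstein's inequality: on the band of radius \<open>n\<close> the derivative costs a
  factor \<open>real n\<close>.\<close>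

lemma H1c_PN_any: "H1c (PN n K)" "dn (PN n K) \<le> real n * norm K"
proof -
  have "norm (DN m (PN n K)) \<le> real n * norm K" for m
  proof (cases "m \<le> n")
    case True
    have "norm (DN m K) \<le> norm (DN n K)" by (rule norm_DN_mono[OF True])
    also have "\<dots> \<le> real n * norm K" unfolding DN_def by (rule norm_fmult[OF bdd_symbol_D])
    finally show ?thesis using True by (simp add: DN_PN)
  next
    case False
    then show ?thesis using norm_fmult[OF bdd_symbol_D, of n K] by (simp add: DN_PN DN_def[symmetric])
  qed
  then show "H1c (PN n K)" "dn (PN n K) \<le> real n * norm K" by (auto intro: H1cI dn_le)
qed

lemma sup_bd_mono: "norm F \<le> a \<Longrightarrow> dn F \<le> b \<Longrightarrow> H1c F \<Longrightarrow> sup_bd F \<le> sqrt (pi * (a\<^sup>2 + b\<^sup>2))"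
  unfolding sup_bd_def by (intro real_sqrt_le_mono mult_left_mono add_mono power_mono) (auto simp: dn_nonneg)

text \<open>Pointwise multiplication is not bounded on L^2, but by Bernstein and
  \<open>sup_bd\<close> it becomes so after a cut-off in one factor. Then the product rule for
  bounded bilinear maps differentiates the interaction energy.\<close>

lemma bounded_bilinear_mulop_PN: "bounded_bilinear (\<lambda>V K. mulop (rep (PN n K)) V)"
proof (rule bounded_bilinear.intro)
  interpret P: bounded_linear "PN n" by (rule bounded_linear_PN)
  fix V V' K K' :: cL2 and r :: real
  note b = bdd_symbol_rep[OF H1c_PN_any(1)[of n]]
  show "mulop (rep (PN n K)) (V + V') = mulop (rep (PN n K)) V + mulop (rep (PN n K)) V'"
    by (rule mulop_add[OF b])
  show "mulop (rep (PN n (K + K'))) V = mulop (rep (PN n K)) V + mulop (rep (PN n K')) V"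
    using mulop_rep_diff[OF H1c_PN_any(1)[of n "K + K'"] H1c_PN_any(1)[of n K'], of V] by (simp add: P.add algebra_simps)
  show "mulop (rep (PN n K)) (r *\<^sub>R V) = r *\<^sub>R mulop (rep (PN n K)) V"
    by (rule mulop_scaleR[OF b])
  show "mulop (rep (PN n (r *\<^sub>R K))) V = r *\<^sub>R mulop (rep (PN n K)) V"
  proof -
    have L: "(\<lambda>x. rep (PN n K) x * rep V x) \<in> L2_space" by (rule mult_L2[OF b rep_L2])
    have "r *\<^sub>R mulop (rep (PN n K)) V = cls (\<lambda>x. r *\<^sub>R (rep (PN n K) x * rep V x))"
      unfolding mulop_def by (rule cls_scaleR[OF L, symmetric])
    also have "\<dots> = cls (\<lambda>x. rep (r *\<^sub>R PN n K) x * rep V x)"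
      by (rule cls_eqI[OF L2_space_scaleR[OF L]], use rep_scaleR[of r "PN n K"] in eventually_elim) simp
    finally show ?thesis by (simp add: P.scaleR mulop_def)
  qed
next
  show "\<exists>C. \<forall>V K. norm (mulop (rep (PN n K)) V) \<le> norm V * norm K * C"
  proof (intro exI allI)
    fix V K
    have "sup_bd (PN n K) \<le> sqrt (pi * ((norm K)\<^sup>2 + (real n * norm K)\<^sup>2))"
      by (rule sup_bd_mono[OF norm_PN H1c_PN_any(2,1)])
    also have "\<dots> = norm K * sqrt (pi * (1 + (real n)\<^sup>2))"
    proof -
      have "pi * ((norm K)\<^sup>2 + (real n * norm K)\<^sup>2) = (norm K)\<^sup>2 * (pi * (1 + (real n)\<^sup>2))"
        by (simp add: power_mult_distrib algebra_simps)
      then show ?thesis by (simp only: real_sqrt_mult) simp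
    qed
    finally have "norm (mulop (rep (PN n K)) V) \<le> (norm K * sqrt (pi * (1 + (real n)\<^sup>2))) * norm V"
      using norm_mulop[OF bdd_symbol_rep[OF H1c_PN_any(1)[of n K]], of V]
      by (meson mult_right_mono norm_ge_zero order_trans)
    then show "norm (mulop (rep (PN n K)) V) \<le> norm V * norm K * sqrt (pi * (1 + (real n)\<^sup>2))"
      by (simp add: mult_ac)
  qed
qed

lemma inner_schr_schr [simp]: "schr t F \<bullet> schr t G = F \<bullet> G"
  by (simp add: inner_schr schr_schr)

section \<open>Mass, energy and uniform bounds for a single flow\<close>

locale SD_flow =
  fixes \<tau> :: real and u0 :: "real \<Rightarrow> complex" and v0 :: "real \<Rightarrow> real"
    and u :: "real \<Rightarrow> real \<Rightarrow> complex" and v :: "real \<Rightarrow> real \<Rightarrow> real"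
  assumes tau: "0 < \<tau>" and u0: "u0 \<in> H1_space" and v0: "v0 \<in> H1_space"
    and SD: "SD_solution \<tau> u0 v0 u v"
begin

definition "U t = cls (u t)"
definition "V t = cls (\<lambda>x. complex_of_real (v t x))"
definition "U0 = cls u0"
definition "V0 = cls (\<lambda>x. complex_of_real (v0 x))"
definition "X t = mulop (rep (V t)) (U t)"
definition "Q t = sqmod (U t)"
text \<open>The interaction picture: with the free evolution removed, the curve is differentiable in
  L^2, and its norms agree with those of \<open>U t\<close>.\<close>

definition "W t = schr (- t) (U t)"
definition "V' t = - (1 / \<tau>) *\<^sub>R (V t + Q t)"

lemma u_H1: "0 \<le> t \<Longrightarrow> u t \<in> H1_space" and v_H1: "0 \<le> t \<Longrightarrow> v t \<in> H1_space"
  using SD by (auto simp: SD_solution_def C_H1_def)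

lemma u_L2: "0 \<le> t \<Longrightarrow> u t \<in> L2_space" and v_L2: "0 \<le> t \<Longrightarrow> (\<lambda>x. complex_of_real (v t x)) \<in> L2_space"
  using u_H1 v_H1 H1_space_weak_deriv(1) H1_space_of_real(1) by auto

lemma cH1_U: "cH1 U"
proof (rule cH1I[where g = "\<lambda>t s. H1_norm (\<lambda>x. u s x - u t x)"])
  show "((\<lambda>s. H1_norm (\<lambda>x. u s x - u t x)) \<longlongrightarrow> 0) (at t within {0..})" if "0 \<le> t" for t
    using SD that by (auto simp: SD_solution_def C_H1_def)
  show "H1c (U t)" if "0 \<le> t" for t unfolding U_def by (rule H1_space_H1c(1)[OF u_H1[OF that]])
  fix s t :: real assume "0 \<le> s" "0 \<le> t"
  then have "U s - U t = cls (\<lambda>x. u s x - u t x)" "(\<lambda>x. u s x - u t x) \<in> H1_space"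
    by (auto simp: U_def cls_diff u_L2 intro!: H1_space_diff u_H1)
  then show "ennreal (dn (U s - U t)) \<le> H1_norm (\<lambda>x. u s x - u t x)"
    "ennreal (norm (U s - U t)) \<le> H1_norm (\<lambda>x. u s x - u t x)"
    using H1_space_H1c(3,4) by auto
qed

lemma cH1_V: "cH1 V"
proof (rule cH1I[where g = "\<lambda>t s. H1_norm (\<lambda>x. v s x - v t x)"])
  show "((\<lambda>s. H1_norm (\<lambda>x. v s x - v t x)) \<longlongrightarrow> 0) (at t within {0..})" if "0 \<le> t" for t
    using SD that by (auto simp: SD_solution_def C_H1_def)
  show "H1c (V t)" if "0 \<le> t" for t unfolding V_def by (rule H1_space_of_real(2)[OF v_H1[OF that]])
  fix s t :: real assume "0 \<le> s" "0 \<le> t"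
  then have e: "V s - V t = cls (\<lambda>x. complex_of_real (v s x - v t x))" and h: "(\<lambda>x. v s x - v t x) \<in> H1_space"
    by (auto simp: V_def cls_diff v_L2 intro!: H1_space_diff v_H1)
  show "ennreal (dn (V s - V t)) \<le> H1_norm (\<lambda>x. v s x - v t x)"
    "ennreal (norm (V s - V t)) \<le> H1_norm (\<lambda>x. v s x - v t x)"
    unfolding e using H1_space_of_real(3,4)[OF h] .
qed

lemma H1c_U: "0 \<le> t \<Longrightarrow> H1c (U t)" and H1c_V: "0 \<le> t \<Longrightarrow> H1c (V t)"
  using cH1_H1c cH1_U cH1_V by auto

lemma V_real:
  assumes "0 \<le> t" shows "AE x in lebesgue. Im (rep (V t) x) = 0"
  using rep_cls[OF v_L2[OF assms]] unfolding V_def by eventually_elim simp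

lemma X_cls:
  assumes "0 \<le> s"
  shows "(\<lambda>x. u s x * complex_of_real (v s x)) \<in> L2_space \<and> cls (\<lambda>x. u s x * complex_of_real (v s x)) = X s"
proof -
  have b: "bdd_symbol (rep (V s)) (sup_bd (V s))" by (rule bdd_symbol_rep[OF H1c_V[OF assms]])
  have L: "(\<lambda>x. rep (V s) x * u s x) \<in> L2_space" by (rule mult_L2[OF b u_L2[OF assms]])
  have ae: "AE x in lebesgue. rep (V s) x * u s x = u s x * complex_of_real (v s x)"
    using rep_cls[OF v_L2[OF assms]] unfolding V_def by eventually_elim simp
  show ?thesis
    using L2_space_AE[OF L ae] cls_eqI[OF L ae] mulop_cls[OF b u_L2[OF assms]] by (simp add: X_def U_def)
qed

lemma Q_cls:
  assumes "0 \<le> s"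
  shows "(\<lambda>x. complex_of_real ((cmod (u s x))\<^sup>2)) \<in> L2_space \<and> cls (\<lambda>x. complex_of_real ((cmod (u s x))\<^sup>2)) = Q s"
proof -
  note L = sqmod_L2[OF H1c_U[OF assms]]
  have ae: "AE x in lebesgue. complex_of_real ((norm (rep (U s) x))\<^sup>2) = complex_of_real ((cmod (u s x))\<^sup>2)"
    using rep_cls[OF u_L2[OF assms]] unfolding U_def by eventually_elim simp
  show ?thesis
    using L2_space_AE[OF L ae] cls_eqI[OF L ae] by (simp only: Q_def sqmod_def)
qed

lemma X_tendsto: "0 \<le> t \<Longrightarrow> (X \<longlongrightarrow> X t) (at t within {0..})"
  unfolding X_def[abs_def] by (rule cH1_mulop_tendsto[OF cH1_V cH1_U])

lemma Q_tendsto: "0 \<le> t \<Longrightarrow> (Q \<longlongrightarrow> Q t) (at t within {0..})"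
  unfolding Q_def[abs_def] by (rule cH1_sqmod_tendsto[OF cH1_U])

lemma schr_X_continuous: "continuous_on {0..T} (\<lambda>s. schr (c + d * s) (X s))"
  by (rule tendsto_continuous_on_Icc) (intro schr_tendsto2 X_tendsto)

lemma Q_continuous: "continuous_on {0..T} Q"
  by (rule tendsto_continuous_on_Icc[OF Q_tendsto])

lemma duhamel_U:
  assumes t: "0 \<le> t" shows "U t = schr t U0 - J (integral {0..t} (\<lambda>s. schr (t - s) (X s)))"
proof -
  obtain G where G: "has_L2_integral (\<lambda>s. schroedinger (t - s) (\<lambda>x. u s x * of_real (v s x))) G t"
    "AE x in lebesgue. u t x = schroedinger t u0 x - \<i> * G x"
    using SD t unfolding SD_solution_def by blast
  have "cls G = integral {0..t} (\<lambda>s. schr (t - s) (X s))"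
  proof (rule has_L2_integral_continuous[OF G(1)])
    show "continuous_on {0..t} (\<lambda>s. schr (t - s) (X s))" using schr_X_continuous[of t t "-1"] by simp
    show "schroedinger (t - s) (\<lambda>x. u s x * complex_of_real (v s x)) \<in> L2_space
      \<and> cls (schroedinger (t - s) (\<lambda>x. u s x * complex_of_real (v s x))) = schr (t - s) (X s)" if "s \<in> {0..t}" for s
      using cls_schroedinger[OF conjunct1[OF X_cls], of s "t - s"] X_cls[of s] that by auto
  qed
  moreover have GL: "G \<in> L2_space" using G(1) by (simp add: has_L2_integral_def)
  moreover have S: "schroedinger t u0 \<in> L2_space" "cls (schroedinger t u0) = schr t U0"
    using cls_schroedinger[OF H1_space_weak_deriv(1)[OF u0]] by (auto simp: U0_def)
  moreover have "U t = cls (\<lambda>x. schroedinger t u0 x - \<i> * G x)"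
    unfolding U_def by (rule cls_eqI[OF u_L2[OF t] G(2)])
  ultimately show ?thesis by (simp add: cls_diff L2_space_mult_const flip: J_cls)
qed

text \<open>With the factor \<open>exp (- t / \<tau>)\<close> pulled out, the integrand does not
  depend on \<open>t\<close>, and the fundamental theorem of calculus can differentiate it.\<close>

lemma duhamel_V:
  assumes t: "0 \<le> t"
  shows "V t = exp (- t / \<tau>) *\<^sub>R (V0 - (1 / \<tau>) *\<^sub>R integral {0..t} (\<lambda>s. exp (s / \<tau>) *\<^sub>R Q s))"
proof -
  obtain G where G: "has_L2_integral (\<lambda>s x. exp (- (t - s) / \<tau>) * (cmod (u s x))\<^sup>2) G t"
    "AE x in lebesgue. v t x = exp (- t / \<tau>) * v0 x - (1 / \<tau>) * G x"
    using SD t unfolding SD_solution_def by blast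
  have c: "continuous_on {0..t} (\<lambda>s. exp (s / \<tau>) *\<^sub>R Q s)"
    using tau by (intro continuous_intros Q_continuous) auto
  have e: "exp (- (t - s) / \<tau>) = exp (- t / \<tau>) * exp (s / \<tau>)" for s
    by (simp add: exp_add[symmetric] diff_divide_distrib)
  have "cls (\<lambda>x. complex_of_real (G x)) = integral {0..t} (\<lambda>s. exp (- t / \<tau>) *\<^sub>R (exp (s / \<tau>) *\<^sub>R Q s))"
  proof (rule has_L2_integral_continuous[OF has_L2_integral_of_real[OF G(1)]])
    show "continuous_on {0..t} (\<lambda>s. exp (- t / \<tau>) *\<^sub>R (exp (s / \<tau>) *\<^sub>R Q s))"
      by (intro continuous_intros c)
    fix s assume "s \<in> {0..t}"
    then have s: "0 \<le> s" by simp
    have "(\<lambda>x. complex_of_real (exp (- (t - s) / \<tau>) * (cmod (u s x))\<^sup>2))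
        = (\<lambda>x. exp (- (t - s) / \<tau>) *\<^sub>R complex_of_real ((cmod (u s x))\<^sup>2))"
      by (simp add: scaleR_conv_of_real)
    then show "(\<lambda>x. complex_of_real (exp (- (t - s) / \<tau>) * (cmod (u s x))\<^sup>2)) \<in> L2_space
      \<and> cls (\<lambda>x. complex_of_real (exp (- (t - s) / \<tau>) * (cmod (u s x))\<^sup>2)) = exp (- t / \<tau>) *\<^sub>R (exp (s / \<tau>) *\<^sub>R Q s)"
      using Q_cls[OF s] cls_scaleR[OF conjunct1[OF Q_cls[OF s]], of "exp (- (t - s) / \<tau>)"]
        L2_space_scaleR[OF conjunct1[OF Q_cls[OF s]], of "exp (- (t - s) / \<tau>)"] e by (simp only: scaleR_scaleR)
  qed
  also have "\<dots> = exp (- t / \<tau>) *\<^sub>R integral {0..t} (\<lambda>s. exp (s / \<tau>) *\<^sub>R Q s)"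
    by (rule integral_cmul)
  finally have Gc: "cls (\<lambda>x. complex_of_real (G x)) = exp (- t / \<tau>) *\<^sub>R integral {0..t} (\<lambda>s. exp (s / \<tau>) *\<^sub>R Q s)" .
  have GL: "(\<lambda>x. complex_of_real (G x)) \<in> L2_space"
    using G(1) by (intro L2_space_of_real) (simp add: has_L2_integral_def)
  have v0L: "(\<lambda>x. complex_of_real (v0 x)) \<in> L2_space" by (rule H1_space_of_real(1)[OF v0])
  have "V t = cls (\<lambda>x. exp (- t / \<tau>) *\<^sub>R complex_of_real (v0 x) - (1 / \<tau>) *\<^sub>R complex_of_real (G x))"
    unfolding V_def by (rule cls_eqI[OF v_L2[OF t]], use G(2) in eventually_elim) (simp add: scaleR_conv_of_real)
  also have "\<dots> = exp (- t / \<tau>) *\<^sub>R V0 - (1 / \<tau>) *\<^sub>R cls (\<lambda>x. complex_of_real (G x))"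
    unfolding V0_def
    using cls_diff[OF L2_space_scaleR[OF v0L, of "exp (- t / \<tau>)"] L2_space_scaleR[OF GL, of "1 / \<tau>"]]
    by (simp only: cls_scaleR[OF v0L] cls_scaleR[OF GL])
  finally show ?thesis by (simp add: Gc scaleR_diff_right)
qed

lemma U_0: "U 0 = U0" and V_0: "V 0 = V0"
  using duhamel_U[of 0] duhamel_V[of 0] by (simp_all add: linear_0[OF bounded_linear.linear[OF bounded_linear_J]])

text \<open>Applying \<open>schr (- t)\<close> to Duhamel's formula removes \<open>t\<close> from
  the integrand, so the derivative in time is the integrand itself.\<close>

lemma W_deriv:
  assumes "t \<in> {0..T}"
  shows "(W has_vector_derivative - J (schr (- t) (X t))) (at t within {0..T})"
proof (rule has_vector_derivative_transform[OF assms])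
  have c: "continuous_on {0..T} (\<lambda>s. schr (- s) (X s))" for T using schr_X_continuous[of T 0 "-1"] by simp
  show "W t = U0 - J (integral {0..t} (\<lambda>s. schr (- s) (X s)))" if "t \<in> {0..T}" for t
  proof -
    have t: "0 \<le> t" using that by simp
    have i: "(\<lambda>s. schr (t - s) (X s)) integrable_on {0..t}"
      using schr_X_continuous[of t t "-1"] by (intro integrable_continuous_real) simp
    have "schr (- t) (integral {0..t} (\<lambda>s. schr (t - s) (X s))) = integral {0..t} (\<lambda>s. schr (- s) (X s))"
      using integral_linear[OF i bounded_linear_schr, of "-t"] by (simp add: o_def schr_schr)
    then show ?thesis
      unfolding W_def duhamel_U[OF t] by (simp add: schr_diff schr_schr schr_J)
  qed
  have "((\<lambda>t. integral {0..t} (\<lambda>s. schr (- s) (X s))) has_vector_derivative schr (- t) (X t)) (at t within {0..T})"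
    by (rule integral_has_vector_derivative[OF c assms])
  from has_vector_derivative_diff[OF has_vector_derivative_const bounded_linear.has_vector_derivative[OF bounded_linear_J this]]
  show "((\<lambda>t. U0 - J (integral {0..t} (\<lambda>s. schr (- s) (X s)))) has_vector_derivative - J (schr (- t) (X t))) (at t within {0..T})"
    by simp
qed

lemma V_deriv:
  assumes "t \<in> {0..T}" shows "(V has_vector_derivative V' t) (at t within {0..T})"
proof (rule has_vector_derivative_transform[OF assms])
  define I where "I t = V0 - (1 / \<tau>) *\<^sub>R integral {0..t} (\<lambda>s. exp (s / \<tau>) *\<^sub>R Q s)" for t
  show "V t = exp (- t / \<tau>) *\<^sub>R I t" if "t \<in> {0..T}" for t
    using duhamel_V[of t] that by (simp add: I_def)
  have c: "continuous_on {0..T} (\<lambda>s. exp (s / \<tau>) *\<^sub>R Q s)"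
    using tau by (intro continuous_intros Q_continuous) auto
  have "(I has_vector_derivative 0 - (1 / \<tau>) *\<^sub>R (exp (t / \<tau>) *\<^sub>R Q t)) (at t within {0..T})"
    unfolding I_def
    by (intro has_vector_derivative_diff has_vector_derivative_const bounded_linear.has_vector_derivative[OF bounded_linear_scaleR_right]
        integral_has_vector_derivative[OF c assms])
  moreover have "((\<lambda>t. exp (- t / \<tau>)) has_field_derivative - (1 / \<tau>) * exp (- t / \<tau>)) (at t within {0..T})"
    using tau by (auto intro!: derivative_eq_intros)
  ultimately have "((\<lambda>t. exp (- t / \<tau>) *\<^sub>R I t) has_vector_derivative
      exp (- t / \<tau>) *\<^sub>R (0 - (1 / \<tau>) *\<^sub>R (exp (t / \<tau>) *\<^sub>R Q t)) + (- (1 / \<tau>) * exp (- t / \<tau>)) *\<^sub>R I t) (at t within {0..T})"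
    by (intro has_vector_derivative_scaleR)
  moreover have "exp (- t / \<tau>) *\<^sub>R (0 - (1 / \<tau>) *\<^sub>R (exp (t / \<tau>) *\<^sub>R Q t)) + (- (1 / \<tau>) * exp (- t / \<tau>)) *\<^sub>R I t = V' t"
  proof -
    have "V t = exp (- t / \<tau>) *\<^sub>R I t" using duhamel_V[of t] assms by (simp add: I_def)
    moreover have "exp (- t / \<tau>) * exp (t / \<tau>) = 1" by (simp flip: exp_add)
    ultimately show ?thesis by (simp add: V'_def scaleR_add_right)
  qed
  ultimately show "((\<lambda>t. exp (- t / \<tau>) *\<^sub>R I t) has_vector_derivative V' t) (at t within {0..T})" by simp
qed

text \<open>The squared norm can be differentiated along \<open>W\<close>. Its derivative pairs
  \<open>U s\<close> with \<open>J (X s)\<close>, which vanishes because the potential is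
  real.\<close>

lemma mass:
  assumes "0 \<le> t" shows "norm (U t) = norm U0"
proof -
  have d: "((\<lambda>t. W t \<bullet> W t) has_vector_derivative 0) (at s within {0..t})" if s: "s \<in> {0..t}" for s
  proof -
    have "W s \<bullet> J (schr (- s) (X s)) = U s \<bullet> J (X s)"
      by (simp add: W_def flip: schr_J)
    also have "\<dots> = 0" unfolding X_def using s by (intro inner_real_mulop_J H1c_V V_real) auto
    finally have "W s \<bullet> (- J (schr (- s) (X s))) + (- J (schr (- s) (X s))) \<bullet> W s = 0" by (simp add: inner_commute)
    then show ?thesis
      using bounded_bilinear.has_vector_derivative[OF bounded_bilinear_inner W_deriv[OF s] W_deriv[OF s]] by simp
  qed
  have "((\<lambda>t. 0::real) has_integral W t \<bullet> W t - W 0 \<bullet> W 0) {0..t}"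
    by (rule fundamental_theorem_of_calculus[OF assms d])
  then have "W t \<bullet> W t = W 0 \<bullet> W 0" using has_integral_0 has_integral_unique by fastforce
  then have "(norm (U t))\<^sup>2 = (norm U0)\<^sup>2" by (simp add: power2_norm_eq_inner W_def U_0)
  then show ?thesis by simp
qed

text \<open>The curve \<open>U\<close> is differentiable in time only after the frequency cut-off \<open>PN n\<close>, so the energy identity
  is proved for the truncated energy first; the error terms vanish as \<open>n \<rightarrow> \<infinity>\<close>.\<close>

definition "trunc_energy n t = (norm (DN n (U t)))\<^sup>2 / 2 + V t \<bullet> sqmod (PN n (U t)) + (norm (V t))\<^sup>2 / 2"

text \<open>The first term is the error of the cut-off: only frequencies above \<open>n\<close>
  enter the product. The second tends to \<open>X t\<close> paired with \<open>J (X t)\<close>,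
  which is 0. The last two tend to the dissipation.\<close>

definition "energy_rate n t = - (DN n (U t) \<bullet> J (DN n (mulop (rep (V t)) (U t - PN n (U t)))))
  - 2 * (mulop (rep (V t)) (PN n (U t)) \<bullet> J (PN n (X t))) + V' t \<bullet> sqmod (PN n (U t)) + V t \<bullet> V' t"

lemma trunc_energy_deriv:
  assumes t: "t \<in> {0..T}"
  shows "(trunc_energy n has_vector_derivative energy_rate n t) (at t within {0..T})"
proof -
  have t0: "0 \<le> t" using t by simp
  define F where "F s = PN n (U s)" for s
  define F' where "F' = - J (PN n (X t)) + (1/2) *\<^sub>R J (DN n (DN n (U t)))"
  have HF: "H1c (F s)" for s unfolding F_def by (rule H1c_PN_any)
  \<comment> \<open>\<open>F\<close> and its derivative are fixed by the projection, so the bilinear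
    map of \<open>bounded_bilinear_mulop_PN\<close> applies to them without changing them.\<close>
  have PF: "PN n (F s) = F s" for s by (simp add: F_def DN_PN)
  have PF': "PN n F' = F'"
    unfolding F'_def
    by (simp add: linear_add[OF bounded_linear.linear[OF bounded_linear_PN]] linear_diff[OF bounded_linear.linear[OF bounded_linear_PN]] linear_neg[OF bounded_linear.linear[OF bounded_linear_PN]]
        linear_scale[OF bounded_linear.linear[OF bounded_linear_PN]] PN_J DN_PN)
  have dF: "(F has_vector_derivative F') (at t within {0..T})"
  proof -
    have "F = (\<lambda>s. schr s (PN n (W s)))"
      by (rule ext) (simp add: F_def W_def schr_PN schr_schr)
    moreover have "schr t (PN n (- J (schr (- t) (X t)))) + (1/2) *\<^sub>R J (DN n (DN n (schr t (W t)))) = F'"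
      by (simp add: F'_def W_def schr_schr schr_PN linear_neg[OF bounded_linear.linear[OF bounded_linear_PN]]
          linear_neg[OF bounded_linear.linear[OF bounded_linear_schr]] schr_J PN_J)
    ultimately show ?thesis using schr_PN_product_deriv[OF W_deriv[OF t], of n] by simp
  qed
  have dDW: "((\<lambda>s. DN n (W s)) has_vector_derivative DN n (- J (schr (- t) (X t)))) (at t within {0..T})"
    by (rule bounded_linear.has_vector_derivative[OF bounded_linear_DN W_deriv[OF t]])
  \<comment> \<open>\<open>DN n\<close> commutes with the isometric group, so the kinetic term may
    be computed along the differentiable curve \<open>W\<close>.\<close>
  have d1: "((\<lambda>s. DN n (W s) \<bullet> DN n (W s)) has_vector_derivative - 2 * (DN n (U t) \<bullet> J (DN n (X t)))) (at t within {0..T})"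
  proof -
    have "DN n (W t) \<bullet> DN n (- J (schr (- t) (X t))) = - (DN n (U t) \<bullet> J (DN n (X t)))"
      by (simp add: W_def linear_neg[OF bounded_linear.linear[OF bounded_linear_DN]] DN_J flip: schr_DN schr_J)
    then show ?thesis
      using bounded_bilinear.has_vector_derivative[OF bounded_bilinear_inner dDW dDW] by (simp add: inner_commute)
  qed
  have d2: "((\<lambda>s. mulop (rep (F s)) (V s) \<bullet> F s) has_vector_derivative
      2 * (mulop (rep (F t)) (V t) \<bullet> F') + V' t \<bullet> sqmod (F t)) (at t within {0..T})"
  proof -
    have "((\<lambda>s. mulop (rep (PN n (F s))) (V s)) has_vector_derivative
        mulop (rep (PN n F')) (V t) + mulop (rep (PN n (F t))) (V' t)) (at t within {0..T})"
      by (rule bounded_bilinear.has_vector_derivative[OF bounded_bilinear_mulop_PN V_deriv[OF t] dF])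
    then have b: "((\<lambda>s. mulop (rep (F s)) (V s)) has_vector_derivative
        mulop (rep F') (V t) + mulop (rep (F t)) (V' t)) (at t within {0..T})"
      by (simp only: PF PF')
    have HF': "H1c F'" using H1c_PN_any(1)[of n F'] by (simp add: PF')
    have "mulop (rep (F t)) (V t) \<bullet> F' + (mulop (rep F') (V t) + mulop (rep (F t)) (V' t)) \<bullet> F t
        = 2 * (mulop (rep (F t)) (V t) \<bullet> F') + V' t \<bullet> sqmod (F t)"
      using inner_mulop_real[OF HF' HF V_real[OF t0], of t] inner_mulop_sqmod[OF HF, of t "V' t"]
      by (simp add: inner_add_left inner_add_right inner_commute)
    then show ?thesis
      using bounded_bilinear.has_vector_derivative[OF bounded_bilinear_inner b dF] by simp
  qed
  have d3: "((\<lambda>s. V s \<bullet> V s) has_vector_derivative 2 * (V t \<bullet> V' t)) (at t within {0..T})"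
    using bounded_bilinear.has_vector_derivative[OF bounded_bilinear_inner V_deriv[OF t] V_deriv[OF t]] by (simp add: inner_commute)
  have "trunc_energy n = (\<lambda>s. (1/2) *\<^sub>R (DN n (W s) \<bullet> DN n (W s)) + mulop (rep (F s)) (V s) \<bullet> F s + (1/2) *\<^sub>R (V s \<bullet> V s))"
    by (rule ext) (simp add: trunc_energy_def inner_mulop_sqmod[OF HF] F_def[symmetric] power2_norm_eq_inner W_def flip: schr_DN)
  moreover have "((\<lambda>s. (1/2) *\<^sub>R (DN n (W s) \<bullet> DN n (W s)) + mulop (rep (F s)) (V s) \<bullet> F s + (1/2) *\<^sub>R (V s \<bullet> V s))
      has_vector_derivative (1/2) *\<^sub>R (- 2 * (DN n (U t) \<bullet> J (DN n (X t)))) +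
        (2 * (mulop (rep (F t)) (V t) \<bullet> F') + V' t \<bullet> sqmod (F t)) + (1/2) *\<^sub>R (2 * (V t \<bullet> V' t))) (at t within {0..T})"
    by (intro has_vector_derivative_add bounded_linear.has_vector_derivative[OF bounded_linear_scaleR_right] d1 d2 d3)
  moreover have "(1/2) *\<^sub>R (- 2 * (DN n (U t) \<bullet> J (DN n (X t)))) +
        (2 * (mulop (rep (F t)) (V t) \<bullet> F') + V' t \<bullet> sqmod (F t)) + (1/2) *\<^sub>R (2 * (V t \<bullet> V' t)) = energy_rate n t"
  proof -
    \<comment> \<open>After integration by parts the interaction term contributes
      \<open>DN n (U t) \<bullet> J (DN n Y)\<close>. It cancels the kinetic contribution of
      \<open>X t\<close> up to \<open>X t - Y\<close>, the product of the potential with the high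
      frequencies.\<close>
    define Y where "Y = mulop (rep (V t)) (F t)"
    have Y: "mulop (rep (F t)) (V t) = Y" by (simp add: Y_def mulop_rep_commute)
    have "2 * (Y \<bullet> F') = - 2 * (Y \<bullet> J (PN n (X t))) + Y \<bullet> J (DN n (DN n (U t)))"
      by (simp add: F'_def inner_add_right inner_diff_right)
    also have "Y \<bullet> J (DN n (DN n (U t))) = DN n (U t) \<bullet> J (DN n Y)"
      using inner_J_left[of Y "DN n (DN n (U t))"] inner_DN[of n "J Y" "DN n (U t)"]
      by (simp add: DN_J inner_commute)
    finally have "2 * (Y \<bullet> F') = - 2 * (Y \<bullet> J (PN n (X t))) + DN n (U t) \<bullet> J (DN n Y)" .
    moreover have "mulop (rep (V t)) (U t - PN n (U t)) = X t - Y"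
      by (simp add: X_def Y_def F_def mulop_diff[OF bdd_symbol_rep[OF H1c_V[OF t0]]])
    ultimately show ?thesis
      unfolding energy_rate_def Y F_def[symmetric] Y_def[symmetric]
      by (simp add: linear_diff[OF bounded_linear.linear[OF bounded_linear_DN]] J_diff inner_diff_right)
  qed
  ultimately show ?thesis by simp
qed

end

lemma sup_bd_PN: "H1c F \<Longrightarrow> sup_bd (PN n F) \<le> sup_bd F"
  using sup_bd_mono[OF norm_PN dn_PN(2) H1c_PN_any(1), of F n] by (simp add: sup_bd_def)

lemma sqmod_PN_tendsto:
  assumes "H1c F" shows "(\<lambda>n. sqmod (PN n F)) \<longlonglongrightarrow> sqmod F"
proof -
  have "(\<lambda>n. sqmod (PN n F) - sqmod F) \<longlonglongrightarrow> 0"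
  proof (rule Lim_null_comparison[OF always_eventually])
    show "\<forall>n. norm (sqmod (PN n F) - sqmod F) \<le> (2 * sup_bd F) * norm (PN n F - F)"
    proof
      fix n
      have "norm (sqmod (PN n F) - sqmod F) \<le> (sup_bd (PN n F) + sup_bd F) * norm (PN n F - F)"
        by (rule norm_sqmod_diff[OF H1c_PN_any(1) assms])
      also have "\<dots> \<le> (2 * sup_bd F) * norm (PN n F - F)"
        using sup_bd_PN[OF assms, of n] by (intro mult_right_mono) auto
      finally show "norm (sqmod (PN n F) - sqmod F) \<le> (2 * sup_bd F) * norm (PN n F - F)" .
    qed
    have "(\<lambda>n. (2 * sup_bd F) * norm (PN n F - F)) \<longlonglongrightarrow> (2 * sup_bd F) * norm (F - F)"
      by (intro tendsto_intros PN_tendsto)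
    then show "(\<lambda>n. (2 * sup_bd F) * norm (PN n F - F)) \<longlonglongrightarrow> 0" by simp
  qed
  then show ?thesis by (rule LIM_zero_cancel)
qed

text \<open>The fourth power of the L^4 norm is at most the squared supremum times the squared L^2
  norm, and \<open>sobolev\<close> bounds the supremum at any scale \<open>a\<close>.\<close>

lemma norm_sqmod_power2:
  assumes F: "H1c F" and a: "0 < a"
  shows "(norm (sqmod F))\<^sup>2 \<le> pi * (a * (norm F)\<^sup>2 + (dn F)\<^sup>2 / a) * (norm F)\<^sup>2"
proof -
  define c where "c = sqrt (pi * (a * (norm F)\<^sup>2 + (dn F)\<^sup>2 / a))"
  have c2: "c\<^sup>2 = pi * (a * (norm F)\<^sup>2 + (dn F)\<^sup>2 / a)" unfolding c_def using a by simp
  have "norm (cls (\<lambda>x. complex_of_real ((norm (rep F x))\<^sup>2))) \<le> c * norm (cls (rep F))"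
  proof (rule norm_cls_mono[OF sqmod_L2[OF F] rep_L2])
    show "AE x in lebesgue. norm (complex_of_real ((norm (rep F x))\<^sup>2)) \<le> c * norm (rep F x)"
      using sobolev[OF F a] unfolding norm_of_real
    proof eventually_elim
      case (elim x)
      then have "norm (rep F x) \<le> c" unfolding c_def by (rule real_le_rsqrt)
      then show ?case by (simp add: power2_eq_square mult_right_mono)
    qed
    show "0 \<le> c" unfolding c_def using a by simp
  qed
  then have "norm (sqmod F) \<le> c * norm F" by (simp only: sqmod_def cls_rep)
  then have "(norm (sqmod F))\<^sup>2 \<le> (c * norm F)\<^sup>2" by (rule power_mono) simp
  then show ?thesis by (simp only: power_mult_distrib c2)
qed

text \<open>In the Gagliardo--Nirenberg inequality the parameter \<open>a\<close> makes the derivative term as small as required;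
  \<open>a = 2\<pi>A\<^sup>2 + 1\<close> absorbs the focusing part of the energy and leads to the following constant.\<close>

definition H1_bound :: "real \<Rightarrow> real" where
  "H1_bound A = 4 * (A\<^sup>2 + A * sqrt (pi * (A\<^sup>2 + A\<^sup>2) * A\<^sup>2) + pi * (2 * pi * A\<^sup>2 + 1) * A ^ 4 / 2)"

context SD_flow
begin

definition "energy t = (dn (U t))\<^sup>2 / 2 + V t \<bullet> Q t + (norm (V t))\<^sup>2 / 2"

lemma trunc_energy_tendsto:
  assumes "0 \<le> t" shows "(\<lambda>n. trunc_energy n t) \<longlonglongrightarrow> energy t"
  unfolding trunc_energy_def energy_def Q_def
  by (intro tendsto_intros DN_tendsto_dn sqmod_PN_tendsto H1c_U assms) simp_all

text \<open>The derivative of the product is distributed by \<open>product_H1\<close>. In either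
  term the tail of \<open>U s\<close> appears, in \<open>dn\<close> or in \<open>sup_bd\<close>, so
  the bound tends to 0 with the cut-off removed.\<close>

lemma rate_main_le:
  assumes s: "0 \<le> s"
  shows "\<bar>DN n (U s) \<bullet> J (DN n (mulop (rep (V s)) (U s - PN n (U s))))\<bar>
    \<le> dn (U s) * (sup_bd (V s) * dn (U s - PN n (U s)) + sup_bd (U s - PN n (U s)) * dn (V s))"
proof -
  note HU = H1c_U[OF s] and HV = H1c_V[OF s]
  have HZ: "H1c (U s - PN n (U s))" by (rule H1c_diff(1)[OF HU H1c_PN_any(1)])
  note p = product_H1[OF HV HZ sup_bd[OF HV] sup_bd[OF HZ] sup_bd_nonneg sup_bd_nonneg]
  have "\<bar>DN n (U s) \<bullet> J (DN n (mulop (rep (V s)) (U s - PN n (U s))))\<bar>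
      \<le> norm (DN n (U s)) * norm (DN n (mulop (rep (V s)) (U s - PN n (U s))))"
    using Cauchy_Schwarz_ineq2[of "DN n (U s)" "J (DN n (mulop (rep (V s)) (U s - PN n (U s))))"] by simp
  also have "\<dots> \<le> dn (U s) * dn (mulop (rep (V s)) (U s - PN n (U s)))"
    by (intro mult_mono DN_le_dn HU p(1) dn_nonneg) auto
  also have "\<dots> \<le> dn (U s) * (sup_bd (V s) * dn (U s - PN n (U s)) + sup_bd (U s - PN n (U s)) * dn (V s))"
    by (intro mult_left_mono p(2) dn_nonneg HU)
  finally show ?thesis .
qed

text \<open>What remains in the limit is \<open>V' s\<close> paired with \<open>V s + Q s\<close>,
  and \<open>V' s\<close> is \<open>- 1 / \<tau>\<close> times that vector.\<close>

lemma energy_rate_tendsto: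
  assumes s: "0 \<le> s"
  shows "(\<lambda>n. energy_rate n s) \<longlonglongrightarrow> - (1 / \<tau>) * (norm (V s + Q s))\<^sup>2"
proof -
  note HU = H1c_U[OF s] and HV = H1c_V[OF s]
  have n0: "(\<lambda>n. norm (U s - PN n (U s))) \<longlonglongrightarrow> 0"
    using tendsto_norm[OF tendsto_diff[OF tendsto_const[of "U s"] PN_tendsto[of "U s"]]] by simp
  have "(\<lambda>n. sup_bd (U s - PN n (U s))) \<longlonglongrightarrow> sqrt (pi * (0\<^sup>2 + 0\<^sup>2))"
    unfolding sup_bd_def by (intro tendsto_intros n0 dn_tail HU)
  then have s0: "(\<lambda>n. sup_bd (U s - PN n (U s))) \<longlonglongrightarrow> 0" by simp
  have "(\<lambda>n. dn (U s) * (sup_bd (V s) * dn (U s - PN n (U s)) + sup_bd (U s - PN n (U s)) * dn (V s)))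
      \<longlonglongrightarrow> dn (U s) * (sup_bd (V s) * 0 + 0 * dn (V s))"
    by (intro tendsto_intros dn_tail HU s0)
  then have b0: "(\<lambda>n. dn (U s) * (sup_bd (V s) * dn (U s - PN n (U s)) + sup_bd (U s - PN n (U s)) * dn (V s))) \<longlonglongrightarrow> 0"
    by simp
  have t1: "(\<lambda>n. DN n (U s) \<bullet> J (DN n (mulop (rep (V s)) (U s - PN n (U s))))) \<longlonglongrightarrow> 0"
    by (rule Lim_null_comparison[OF always_eventually b0]) (use rate_main_le[OF s] in simp)
  have t2: "(\<lambda>n. mulop (rep (V s)) (PN n (U s)) \<bullet> J (PN n (X s))) \<longlonglongrightarrow> mulop (rep (V s)) (U s) \<bullet> J (X s)"
    by (intro tendsto_inner bounded_linear.tendsto[OF bounded_linear_mulop[OF bdd_symbol_rep[OF HV]]]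
        bounded_linear.tendsto[OF bounded_linear_J] PN_tendsto)
  have t3: "(\<lambda>n. V' s \<bullet> sqmod (PN n (U s))) \<longlonglongrightarrow> V' s \<bullet> Q s"
    unfolding Q_def by (intro tendsto_intros sqmod_PN_tendsto HU)
  have "(\<lambda>n. energy_rate n s) \<longlonglongrightarrow> - 0 - 2 * (mulop (rep (V s)) (U s) \<bullet> J (X s)) + V' s \<bullet> Q s + V s \<bullet> V' s"
    unfolding energy_rate_def by (intro tendsto_intros t1 t2 t3)
  moreover have "- 0 - 2 * (mulop (rep (V s)) (U s) \<bullet> J (X s)) + V' s \<bullet> Q s + V s \<bullet> V' s = - (1 / \<tau>) * (norm (V s + Q s))\<^sup>2"
    unfolding X_def[symmetric] V'_def power2_norm_eq_inner
    by (simp add: inner_add inner_commute add_divide_distrib)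
  ultimately show ?thesis by simp
qed

text \<open>Majorant for the limit in \<open>n\<close> under the time integral. It may depend on
  \<tau> and on the solution, since the energy identity is proved for one flow at a time.\<close>

lemma energy_rate_bounded: "\<exists>C. \<forall>s\<in>{0..t}. \<forall>n. \<bar>energy_rate n s\<bar> \<le> C"
proof -
  obtain B1 B2 where B12: "0 \<le> B1" "\<forall>s\<in>{0..t}. norm (U s) \<le> B1 \<and> dn (U s) \<le> B1 \<and> sup_bd (U s) \<le> B1"
      "0 \<le> B2" "\<forall>s\<in>{0..t}. norm (V s) \<le> B2 \<and> dn (V s) \<le> B2 \<and> sup_bd (V s) \<le> B2"
    using cH1_bounded[OF cH1_U, of t] cH1_bounded[OF cH1_V, of t] by blast
  define B where "B = max B1 B2"
  define S where "S = sqrt (pi * ((2 * B)\<^sup>2 + (2 * B)\<^sup>2))"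
  define D where "D = (1 / \<tau>) * (B + B * B)"
  have B0: "0 \<le> B" using B12 by (simp add: B_def)
  have bound: "\<bar>energy_rate n s\<bar> \<le> B * (B * (2 * B) + S * B) + 2 * ((B * B) * (B * B)) + D * (B * B) + B * D"
    if s: "s \<in> {0..t}" for s n
  proof -
    have s0: "0 \<le> s" using s by simp
    note HU = H1c_U[OF s0] and HV = H1c_V[OF s0]
    have b: "norm (U s) \<le> B" "dn (U s) \<le> B" "sup_bd (U s) \<le> B" "norm (V s) \<le> B" "dn (V s) \<le> B" "sup_bd (V s) \<le> B"
      using B12 s by (auto simp: B_def le_max_iff_disj)
    have P: "norm (PN n (U s)) \<le> B" "dn (PN n (U s)) \<le> B" "sup_bd (PN n (U s)) \<le> B"
      using norm_PN[of n "U s"] dn_PN(2)[OF HU, of n] sup_bd_PN[OF HU, of n] b by linarith+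
    have HZ: "H1c (U s - PN n (U s))" by (rule H1c_diff(1)[OF HU H1c_PN_any(1)])
    have Z: "norm (U s - PN n (U s)) \<le> 2 * B" "dn (U s - PN n (U s)) \<le> 2 * B"
      using norm_triangle_ineq4[of "U s" "PN n (U s)"] H1c_diff(2)[OF HU H1c_PN_any(1), of n "U s"] b P by linarith+
    have ZS: "sup_bd (U s - PN n (U s)) \<le> S" unfolding S_def by (rule sup_bd_mono[OF Z HZ])
    have S0: "0 \<le> S" by (simp add: S_def)
    have nX: "norm (X s) \<le> B * B"
      using norm_mulop[OF bdd_symbol_rep[OF HV], of "U s"] mult_mono[OF b(6) b(1) B0 norm_ge_zero] by (simp add: X_def)
    have nVP: "norm (mulop (rep (V s)) (PN n (U s))) \<le> B * B"
      using norm_mulop[OF bdd_symbol_rep[OF HV], of "PN n (U s)"] mult_mono[OF b(6) P(1) B0 norm_ge_zero] by simp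
    have nQ: "norm (Q s) \<le> B * B"
      using norm_sqmod[OF HU] mult_mono[OF b(3) b(1) B0 norm_ge_zero] by (simp add: Q_def)
    have nS: "norm (sqmod (PN n (U s))) \<le> B * B"
      using norm_sqmod[OF H1c_PN_any(1), of n "U s"] mult_mono[OF P(3) P(1) B0 norm_ge_zero] by simp
    have "norm (V s + Q s) \<le> B + B * B" using norm_triangle_ineq[of "V s" "Q s"] b(4) nQ by linarith
    then have nV': "norm (V' s) \<le> D"
      using tau by (simp add: V'_def D_def divide_right_mono)
    have D0: "0 \<le> D" using nV' norm_ge_zero order_trans by blast
    have 1: "\<bar>DN n (U s) \<bullet> J (DN n (mulop (rep (V s)) (U s - PN n (U s))))\<bar> \<le> B * (B * (2 * B) + S * B)"
      by (rule order_trans[OF rate_main_le[OF s0]])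
         (intro mult_mono add_mono b Z ZS B0 S0 add_nonneg_nonneg mult_nonneg_nonneg dn_nonneg HZ HV sup_bd_nonneg)
    have 2: "\<bar>mulop (rep (V s)) (PN n (U s)) \<bullet> J (PN n (X s))\<bar> \<le> (B * B) * (B * B)"
      using B0 norm_PN[of n "X s"] nX
      by (intro order_trans[OF Cauchy_Schwarz_ineq2] mult_mono nVP) auto
    have 3: "\<bar>V' s \<bullet> sqmod (PN n (U s))\<bar> \<le> D * (B * B)"
      using D0 by (intro order_trans[OF Cauchy_Schwarz_ineq2] mult_mono nV' nS) auto
    have 4: "\<bar>V s \<bullet> V' s\<bar> \<le> B * D"
      using B0 by (intro order_trans[OF Cauchy_Schwarz_ineq2] mult_mono nV' b) auto
    show ?thesis unfolding energy_rate_def using 1 2 3 4 by linarith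
  qed
  then show ?thesis by blast
qed

theorem energy_identity:
  assumes t: "0 \<le> t"
  shows "energy t - energy 0 = - (1 / \<tau>) * integral {0..t} (\<lambda>s. (norm (V s + Q s))\<^sup>2)"
proof -
  obtain C where C: "\<And>s n. s \<in> {0..t} \<Longrightarrow> \<bar>energy_rate n s\<bar> \<le> C" using energy_rate_bounded[of t] by blast
  have ftc: "(energy_rate n has_integral trunc_energy n t - trunc_energy n 0) {0..t}" for n
    by (rule fundamental_theorem_of_calculus[OF t trunc_energy_deriv])
  have "(\<lambda>n. integral {0..t} (energy_rate n)) \<longlonglongrightarrow> integral {0..t} (\<lambda>s. - (1 / \<tau>) * (norm (V s + Q s))\<^sup>2)"
  proof (rule dominated_convergence(2)[where h = "\<lambda>s. C"])
    show "energy_rate n integrable_on {0..t}" for n using ftc by blast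
    show "(\<lambda>s. C) integrable_on {0..t}" by (rule integrable_const_ivl)
    show "norm (energy_rate n s) \<le> C" if "s \<in> {0..t}" for n s using C[OF that] by simp
    show "(\<lambda>n. energy_rate n s) \<longlonglongrightarrow> - (1 / \<tau>) * (norm (V s + Q s))\<^sup>2" if "s \<in> {0..t}" for s
      using energy_rate_tendsto that by simp
  qed
  moreover have "(\<lambda>n. integral {0..t} (energy_rate n)) \<longlonglongrightarrow> energy t - energy 0"
    unfolding integral_unique[OF ftc] by (intro tendsto_diff trunc_energy_tendsto t order_refl)
  ultimately show ?thesis using LIMSEQ_unique by fastforce
qed

lemma VQ_continuous: "continuous_on {0..T} (\<lambda>s. V s + Q s)"
  by (intro tendsto_continuous_on_Icc tendsto_add cH1_tendsto[OF cH1_V] Q_tendsto)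

text \<open>Completing the square in \<open>V t + Q t\<close> leaves
  \<open>- (norm (Q t))\<^sup>2 / 2\<close> as the only negative term of the energy. By conservation
  of mass it is at most a constant plus \<open>(dn (U t))\<^sup>2 / 4\<close>. The energy decreases,
  so seminorm and dissipation are bounded by the data.\<close>

theorem uniform_bounds:
  assumes A: "norm U0 \<le> A" "dn U0 \<le> A" "norm V0 \<le> A" and t: "0 \<le> t"
  shows "norm (U t) \<le> A" "(dn (U t))\<^sup>2 \<le> H1_bound A"
    "integral {0..t} (\<lambda>s. (norm (V s + Q s))\<^sup>2) \<le> \<tau> * H1_bound A"
proof -
  have A0: "0 \<le> A" using A(1) norm_ge_zero order_trans by blast
  show nU: "norm (U t) \<le> A" using mass[OF t] A(1) by simp
  define I where "I = integral {0..t} (\<lambda>s. (norm (V s + Q s))\<^sup>2)"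
  have I0: "0 \<le> I" unfolding I_def
    by (intro integral_nonneg integrable_continuous_real continuous_intros VQ_continuous) auto
  have HU0: "H1c U0" using H1c_U[of 0] by (simp add: U_0)
  have sq: "x\<^sup>2 \<le> A\<^sup>2" if "0 \<le> x" "x \<le> A" for x using that by (intro power_mono) auto
  have "(norm (sqmod U0))\<^sup>2 \<le> pi * (1 * (norm U0)\<^sup>2 + (dn U0)\<^sup>2 / 1) * (norm U0)\<^sup>2"
    by (rule norm_sqmod_power2[OF HU0]) simp
  also have "\<dots> \<le> pi * (A\<^sup>2 + A\<^sup>2) * A\<^sup>2"
    using sq[OF norm_ge_zero A(1)] sq[OF dn_nonneg[OF HU0] A(2)]
    by (intro mult_mono add_mono) auto
  finally have nQ0: "norm (Q 0) \<le> sqrt (pi * (A\<^sup>2 + A\<^sup>2) * A\<^sup>2)"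
    unfolding Q_def U_0 by (rule real_le_rsqrt)
  have "energy 0 \<le> A\<^sup>2 / 2 + A * sqrt (pi * (A\<^sup>2 + A\<^sup>2) * A\<^sup>2) + A\<^sup>2 / 2"
  proof -
    have "V0 \<bullet> Q 0 \<le> norm V0 * norm (Q 0)" by (rule norm_cauchy_schwarz)
    also have "\<dots> \<le> A * sqrt (pi * (A\<^sup>2 + A\<^sup>2) * A\<^sup>2)" by (intro mult_mono A nQ0 A0) auto
    finally show ?thesis
      unfolding energy_def U_0 V_0 using sq[OF dn_nonneg[OF HU0] A(2)] sq[OF norm_ge_zero A(3)] by linarith
  qed
  then have e0: "energy 0 \<le> A\<^sup>2 + A * sqrt (pi * (A\<^sup>2 + A\<^sup>2) * A\<^sup>2)" by simp
  define a where "a = 2 * pi * A\<^sup>2 + 1"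
  have a1: "0 < a" unfolding a_def by (simp add: add_nonneg_pos)
  have "(norm (Q t))\<^sup>2 \<le> pi * (a * (norm (U t))\<^sup>2 + (dn (U t))\<^sup>2 / a) * (norm (U t))\<^sup>2"
    unfolding Q_def by (rule norm_sqmod_power2[OF H1c_U[OF t] a1])
  also have "\<dots> \<le> pi * (a * A\<^sup>2 + (dn (U t))\<^sup>2 / a) * A\<^sup>2"
    using a1 sq[OF norm_ge_zero nU] by (intro mult_mono add_mono) auto
  also have "\<dots> = pi * a * A ^ 4 + (pi * A\<^sup>2 / a) * (dn (U t))\<^sup>2"
    by (simp add: algebra_simps power2_eq_square power4_eq_xxxx)
  also have "\<dots> \<le> pi * a * A ^ 4 + (1 / 2) * (dn (U t))\<^sup>2"
    using a1 by (intro add_left_mono mult_right_mono) (auto simp: a_def pos_divide_le_eq)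
  finally have nQ: "(norm (Q t))\<^sup>2 \<le> pi * a * A ^ 4 + (1 / 2) * (dn (U t))\<^sup>2" .
  have "(norm (V t + Q t))\<^sup>2 = (norm (V t))\<^sup>2 + 2 * (V t \<bullet> Q t) + (norm (Q t))\<^sup>2"
    by (simp add: power2_norm_eq_inner inner_add inner_commute)
  then have e: "energy t = (dn (U t))\<^sup>2 / 2 + (norm (V t + Q t))\<^sup>2 / 2 - (norm (Q t))\<^sup>2 / 2"
    by (simp add: energy_def add_divide_distrib)
  have e': "energy t = energy 0 - (1 / \<tau>) * I" using energy_identity[OF t] by (simp add: I_def)
  \<comment> \<open>One half of \<open>d / 2\<close> absorbs the derivative part of
    \<open>q\<close>, which leaves \<open>d / 4\<close>; this is the origin of the factor 4 in
    \<open>H1_bound\<close>.\<close>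
  have arith: "d / 4 + i \<le> 4 * (k + l / 2) / 4"
    if "x = d / 2 + n / 2 - q / 2" "x = y - i" "0 \<le> n" "q \<le> l + (1 / 2) * d" "y \<le> k"
    for d i k l n q x y :: real using that by simp
  have fin: "(dn (U t))\<^sup>2 / 4 + (1 / \<tau>) * I \<le> H1_bound A / 4"
    using arith[OF e e' zero_le_power2 nQ e0] by (simp only: H1_bound_def a_def)
  have I1: "0 \<le> (1 / \<tau>) * I" using I0 tau by simp
  show "(dn (U t))\<^sup>2 \<le> H1_bound A" using fin I1 by linarith
  have "0 \<le> (dn (U t))\<^sup>2" by simp
  with fin have "(1 / \<tau>) * I \<le> H1_bound A / 4" "0 \<le> H1_bound A / 4" using I1 by linarith+
  then have "(1 / \<tau>) * I \<le> H1_bound A" by linarith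
  then show "integral {0..t} (\<lambda>s. (norm (V s + Q s))\<^sup>2) \<le> \<tau> * H1_bound A"
    using tau unfolding I_def[symmetric] by (simp add: field_simps)
qed

text \<open>Young's inequality \<open>x \<le> (sqrt \<tau> + x\<^sup>2 / sqrt \<tau>) / 2\<close> is
  balanced so that the constant and the dissipation, which is of size \<tau>, both contribute order
  \<open>sqrt \<tau>\<close>.\<close>

lemma integral_VQ_le:
  assumes A: "norm U0 \<le> A" "dn U0 \<le> A" "norm V0 \<le> A" and t: "0 \<le> t" "t \<le> T"
  shows "integral {0..t} (\<lambda>s. norm (V s + Q s)) \<le> sqrt \<tau> * (T + H1_bound A) / 2"
proof -
  have st: "0 < sqrt \<tau>" using tau by simp
  have i: "(\<lambda>s. (norm (V s + Q s))\<^sup>2) integrable_on {0..t}" "(\<lambda>s. norm (V s + Q s)) integrable_on {0..t}"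
    by (intro integrable_continuous_real continuous_intros VQ_continuous)+
  have i2: "((\<lambda>s. (sqrt \<tau> + (1 / sqrt \<tau>) * (norm (V s + Q s))\<^sup>2) / 2) has_integral
      (sqrt \<tau> * t + (1 / sqrt \<tau>) * integral {0..t} (\<lambda>s. (norm (V s + Q s))\<^sup>2)) / 2) {0..t}"
    using has_integral_const_real[of "sqrt \<tau>" 0 t] t
    by (intro has_integral_divide has_integral_add has_integral_mult_right integrable_integral i) (simp add: mult.commute)
  have "integral {0..t} (\<lambda>s. norm (V s + Q s)) \<le> (sqrt \<tau> * t + (1 / sqrt \<tau>) * integral {0..t} (\<lambda>s. (norm (V s + Q s))\<^sup>2)) / 2"
  proof (rule has_integral_le[OF integrable_integral[OF i(2)] i2])
    fix s
    have "0 \<le> (sqrt \<tau> - norm (V s + Q s))\<^sup>2" by simp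
    then have "2 * sqrt \<tau> * norm (V s + Q s) \<le> (sqrt \<tau>)\<^sup>2 + (norm (V s + Q s))\<^sup>2" by (simp add: power2_diff)
    then show "norm (V s + Q s) \<le> (sqrt \<tau> + (1 / sqrt \<tau>) * (norm (V s + Q s))\<^sup>2) / 2"
      using st by (simp add: field_simps power2_eq_square)
  qed
  also have "\<dots> \<le> (sqrt \<tau> * T + (1 / sqrt \<tau>) * (\<tau> * H1_bound A)) / 2"
    using uniform_bounds(3)[OF A t(1)] t st by (intro divide_right_mono add_mono mult_left_mono) auto
  also have "(1 / sqrt \<tau>) * (\<tau> * H1_bound A) = sqrt \<tau> * H1_bound A"
    using tau by (simp add: real_div_sqrt mult.assoc[symmetric])
  finally show ?thesis by (simp add: algebra_simps)
qed

end

section \<open>Comparison with the cubic equation\<close>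

text \<open>The integrating factor \<open>exp (- b * t)\<close> makes
  \<open>a + b * integral {0..t} z\<close> nonincreasing.\<close>

lemma gronwall_const:
  fixes z :: "real \<Rightarrow> real"
  assumes z: "continuous_on {0..T} z" and b: "0 \<le> b" and t: "t \<in> {0..T}"
    and le: "\<And>t. t \<in> {0..T} \<Longrightarrow> z t \<le> a + b * integral {0..t} z"
  shows "z t \<le> a * exp (b * t)"
proof -
  define \<Phi> where "\<Phi> t = (a + b * integral {0..t} z) * exp (- b * t)" for t
  have d: "(\<Phi> has_real_derivative (b * z t - b * (a + b * integral {0..t} z)) * exp (- b * t)) (at t within {0..T})"
    if "t \<in> {0..T}" for t
  proof -
    have "((\<lambda>t. integral {0..t} z) has_real_derivative z t) (at t within {0..T})"
      using integral_has_vector_derivative[OF z that] by (simp add: has_real_derivative_iff_has_vector_derivative)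
    then show ?thesis unfolding \<Phi>_def by (auto intro!: derivative_eq_intros simp: algebra_simps)
  qed
  have "\<Phi> t \<le> \<Phi> 0"
  proof (rule DERIV_nonpos_imp_decreasing_open[where f = \<Phi> and a = 0 and b = t])
    show "0 \<le> t" using t by simp
    show "continuous_on {0..t} \<Phi>"
      using t by (intro continuous_on_subset[OF DERIV_continuous_on[OF d]]) auto
    show "\<exists>y. (\<Phi> has_real_derivative y) (at x) \<and> y \<le> 0" if "0 < x" "x < t" for x
    proof (intro exI conjI)
      have x: "x \<in> {0..T}" using that t by simp
      have "at x within {0..T} = at x" using that t by (intro at_within_interior) simp
      then show "(\<Phi> has_real_derivative (b * z x - b * (a + b * integral {0..x} z)) * exp (- b * x)) (at x)"
        using d[OF x] by simp
      have "b * z x \<le> b * (a + b * integral {0..x} z)" by (intro mult_left_mono le x b)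
      then show "(b * z x - b * (a + b * integral {0..x} z)) * exp (- b * x) \<le> 0"
        by (intro mult_nonpos_nonneg) auto
    qed
  qed
  then have "(a + b * integral {0..t} z) * exp (- b * t) \<le> a" by (simp add: \<Phi>_def)
  then have "(a + b * integral {0..t} z) * exp (- b * t) * exp (b * t) \<le> a * exp (b * t)"
    by (intro mult_right_mono) auto
  then have "a + b * integral {0..t} z \<le> a * exp (b * t)"
    by (simp only: mult.assoc exp_add[symmetric]) simp
  then show ?thesis using le[OF t] by linarith
qed

text \<open>The factor that arises is
  \<open>(norm a)\<^sup>2 + norm a * norm b + (norm b)\<^sup>2\<close>; the constant 2 dominates it
  with room to spare.\<close>

lemma cubic_diff_le:
  fixes a b :: complex
  assumes "norm a \<le> \<alpha>" "norm b \<le> \<beta>"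
  shows "norm (of_real ((norm a)\<^sup>2) * a - of_real ((norm b)\<^sup>2) * b) \<le> 2 * (\<alpha>\<^sup>2 + \<beta>\<^sup>2) * norm (a - b)"
proof -
  have "of_real ((norm a)\<^sup>2) * a - of_real ((norm b)\<^sup>2) * b
      = of_real ((norm a)\<^sup>2) * (a - b) + of_real ((norm a)\<^sup>2 - (norm b)\<^sup>2) * b"
    by (simp add: algebra_simps)
  then have "norm (of_real ((norm a)\<^sup>2) * a - of_real ((norm b)\<^sup>2) * b)
      \<le> (norm a)\<^sup>2 * norm (a - b) + \<bar>(norm a)\<^sup>2 - (norm b)\<^sup>2\<bar> * norm b"
    using norm_triangle_ineq[of "of_real ((norm a)\<^sup>2) * (a - b)" "of_real ((norm a)\<^sup>2 - (norm b)\<^sup>2) * b"]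
    unfolding norm_mult norm_of_real by simp
  also have "\<bar>(norm a)\<^sup>2 - (norm b)\<^sup>2\<bar> = \<bar>norm a - norm b\<bar> * (norm a + norm b)"
    unfolding power2_eq_square square_diff_square_factored abs_mult by simp
  also have "(norm a)\<^sup>2 * norm (a - b) + \<bar>norm a - norm b\<bar> * (norm a + norm b) * norm b
      \<le> (norm a)\<^sup>2 * norm (a - b) + norm (a - b) * (norm a + norm b) * norm b"
    by (intro add_left_mono mult_right_mono norm_triangle_ineq3) auto
  also have "\<dots> = ((norm a)\<^sup>2 + norm a * norm b + (norm b)\<^sup>2) * norm (a - b)"
    by (simp add: algebra_simps power2_eq_square)
  also have "\<dots> \<le> (2 * (\<alpha>\<^sup>2 + \<beta>\<^sup>2)) * norm (a - b)"
  proof (rule mult_right_mono)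
    have "(norm a)\<^sup>2 \<le> \<alpha>\<^sup>2" "(norm b)\<^sup>2 \<le> \<beta>\<^sup>2" using assms by (auto intro: power_mono)
    moreover have "2 * (norm a * norm b) \<le> (norm a)\<^sup>2 + (norm b)\<^sup>2"
      using sum_squares_bound[of "norm a" "norm b"] by (simp add: mult.assoc)
    moreover have "0 \<le> (norm a)\<^sup>2" "0 \<le> (norm b)\<^sup>2" by auto
    ultimately show "(norm a)\<^sup>2 + norm a * norm b + (norm b)\<^sup>2 \<le> 2 * (\<alpha>\<^sup>2 + \<beta>\<^sup>2)"
      unfolding distrib_left by linarith
  qed simp
  finally show ?thesis .
qed

lemma integrable_lebesgue_on_mono:
  fixes f :: "real \<Rightarrow> real"
  assumes "integrable (lebesgue_on {0..T}) f" "t \<le> T" shows "integrable (lebesgue_on {0..t}) f"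
proof -
  have "set_integrable lebesgue {0..T} f"
    using assms(1) by (simp add: integrable_restrict_space set_integrable_def)
  then have "set_integrable lebesgue {0..t} f"
    by (rule set_integrable_subset) (use assms(2) in auto)
  then show ?thesis by (simp add: integrable_restrict_space set_integrable_def)
qed

lemma continuous_integrable_lebesgue_on:
  fixes f :: "real \<Rightarrow> real"
  assumes "continuous_on {0..T} f" shows "integrable (lebesgue_on {0..T}) f"
proof -
  have "f absolutely_integrable_on {0..T}"
    using assms by (metis absolutely_integrable_continuous box_real(2))
  then show ?thesis by (simp add: integrable_restrict_space set_integrable_def)
qed

text \<open>Collects what follows from the regularity class of the limit alone: its supremum norm in
  space is measurable in time, finite at almost all times, and has an integrable fourth
  power.\<close>

locale L4_Linf_curve =
  fixes w :: "real \<Rightarrow> real \<Rightarrow> complex"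
  assumes C: "w \<in> C_L2" and fin: "\<And>T. 0 < T \<Longrightarrow> mixed_norm 4 \<infinity> T w < \<infinity>"
begin

definition "P t = cls (w t)"
definition "beta t = space_norm \<infinity> (w t)"
text \<open>\<open>enn2real\<close> sends infinity to 0, so \<open>b t\<close> bounds the curve only
  at times with \<open>beta t < \<infinity>\<close>, which are almost all.\<close>

definition "b t = enn2real (beta t)"

lemma w_L2: "0 \<le> t \<Longrightarrow> w t \<in> L2_space"
  using C by (auto simp: C_L2_def)

lemma P_tendsto:
  assumes "0 \<le> t" shows "(P \<longlongrightarrow> P t) (at t within {0..})"
proof -
  have "((\<lambda>s. norm (P s - P t)) \<longlongrightarrow> 0) (at t within {0..})"
  proof (rule tendsto_real_squeeze)
    show "((\<lambda>s. L2_norm (\<lambda>x. w s x - w t x)) \<longlongrightarrow> 0) (at t within {0..})"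
      using C assms by (auto simp: C_L2_def)
    show "\<forall>\<^sub>F s in at t within {0..}. ennreal (norm (P s - P t)) \<le> L2_norm (\<lambda>x. w s x - w t x)"
      unfolding eventually_at_filter
      by (intro always_eventually) (use assms in \<open>auto simp: P_def L2_norm_cls L2_space_diff w_L2 cls_diff\<close>)
  qed auto
  then show ?thesis by (simp add: tendsto_norm_zero_iff LIM_zero_iff)
qed

lemma beta_eq: "beta t = esssup lebesgue (\<lambda>x. ennreal (norm (w t x)))"
  by (simp add: beta_def space_norm_def Lp_norm_def)

lemma beta_le_iff:
  assumes "0 \<le> t" shows "beta t \<le> z \<longleftrightarrow> (AE x in lebesgue. ennreal (norm (w t x)) \<le> z)"
proof
  assume "beta t \<le> z"
  moreover have "AE x in lebesgue. ennreal (norm (w t x)) \<le> beta t" unfolding beta_eq by (rule esssup_AE)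
  ultimately show "AE x in lebesgue. ennreal (norm (w t x)) \<le> z" by (auto elim: eventually_mono)
next
  assume "AE x in lebesgue. ennreal (norm (w t x)) \<le> z"
  then show "beta t \<le> z" unfolding beta_eq
    using L2_space_measurable[OF w_L2[OF assms]] by (intro esssup_I) measurable
qed

lemma b_bound:
  assumes "0 \<le> t" "beta t < \<infinity>" shows "AE x in lebesgue. norm (w t x) \<le> b t"
proof -
  have "AE x in lebesgue. ennreal (norm (w t x)) \<le> beta t" using beta_le_iff[OF assms(1)] by blast
  then show ?thesis
  proof eventually_elim
    case (elim x)
    have "enn2real (ennreal (norm (w t x))) \<le> enn2real (beta t)"
      by (rule enn2real_mono[OF elim]) (use assms(2) in simp)
    then show ?case by (simp add: b_def)
  qed
qed

text \<open>The \<open>L\<^sup>\<infinity>\<close> norm is lower semicontinuous along a curve that is continuous in \<open>L\<^sup>2\<close>.\<close>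

lemma beta_measurable [measurable]: "beta \<in> borel_measurable (lebesgue_on {0..T})"
proof (rule borel_measurableI_le)
  fix z
  have "closed {t \<in> {0..T}. beta t \<le> z}"
    unfolding closed_sequential_limits
  proof (intro allI impI, elim conjE)
    fix X l assume X: "\<forall>n. X n \<in> {t \<in> {0..T}. beta t \<le> z}" "X \<longlonglongrightarrow> l"
    then have l: "l \<in> {0..T}" using closed_sequentially[of "{0..T}" X l] by auto
    have XT: "X n \<in> {0..T}" for n using X by auto
    have "continuous_on {0..T} P" by (rule tendsto_continuous_on_Icc[OF P_tendsto])
    then have "(\<lambda>n. P (X n)) \<longlonglongrightarrow> P l"
      using X(2) l XT unfolding continuous_on_sequentially o_def by blast
    then obtain r where r: "AE x in lebesgue. (\<lambda>n. rep (P (X (r n))) x) \<longlonglongrightarrow> rep (P l) x"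
      using AE_subseq_of_tendsto by blast
    have "AE x in lebesgue. \<forall>n. ennreal (norm (w (X n) x)) \<le> z"
      unfolding AE_all_countable using X beta_le_iff by auto
    moreover have "AE x in lebesgue. \<forall>n. rep (P (X n)) x = w (X n) x"
      unfolding AE_all_countable P_def using rep_cls[OF w_L2] XT by auto
    moreover have "AE x in lebesgue. rep (P l) x = w l x"
      unfolding P_def using rep_cls[OF w_L2] l by auto
    ultimately have "AE x in lebesgue. ennreal (norm (w l x)) \<le> z"
      using r
    proof eventually_elim
      case (elim x)
      have "(\<lambda>n. ennreal (norm (rep (P (X (r n))) x))) \<longlonglongrightarrow> ennreal (norm (rep (P l) x))"
        by (intro tendsto_ennrealI tendsto_norm elim)
      then have "ennreal (norm (rep (P l) x)) \<le> z"
        by (rule LIMSEQ_le_const2) (use elim in auto)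
      then show ?case using elim by simp
    qed
    then show "l \<in> {t \<in> {0..T}. beta t \<le> z}" using l beta_le_iff by auto
  qed
  then have "{t \<in> {0..T}. beta t \<le> z} \<in> sets lebesgue" by simp
  then show "{t \<in> space (lebesgue_on {0..T}). beta t \<le> z} \<in> sets (lebesgue_on {0..T})"
    by (auto simp: space_restrict_space sets_restrict_space_iff)
qed

lemma b_measurable [measurable]: "b \<in> borel_measurable (lebesgue_on {0..T})"
  unfolding b_def[abs_def] by measurable

lemma b_nonneg [simp]: "0 \<le> b t"
  by (simp add: b_def)

lemma
  assumes "0 < T"
  shows beta_finite_AE: "AE t in lebesgue_on {0..T}. beta t < \<infinity>"
    and b4_integrable: "integrable (lebesgue_on {0..T}) (\<lambda>t. (b t) ^ 4)"
proof -
  define I where "I = (\<integral>\<^sup>+ t. enn_powr (beta t) 4 \<partial>lebesgue_on {0..T})"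
  have "mixed_norm 4 \<infinity> T w = enn_powr I (1/4)"
    by (simp add: mixed_norm_def Lp_norm_def[of 4] I_def beta_def)
  then have I: "I \<noteq> \<infinity>" using fin[OF assms] by (auto simp: enn_powr_def split: if_splits)
  have e: "enn_powr (beta t) 4 = (if beta t = \<infinity> then \<infinity> else ennreal ((b t) ^ 4))" for t
    by (simp add: enn_powr_def b_def powr_numeral)
  have m: "(\<lambda>t. enn_powr (beta t) 4) \<in> borel_measurable (lebesgue_on {0..T})"
    unfolding e by measurable
  have "AE t in lebesgue_on {0..T}. enn_powr (beta t) 4 \<noteq> \<infinity>"
    by (rule nn_integral_PInf_AE[OF m]) (use I in \<open>simp add: I_def\<close>)
  then show ae: "AE t in lebesgue_on {0..T}. beta t < \<infinity>"
    by eventually_elim (auto simp: e less_top split: if_splits)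
  have "(\<integral>\<^sup>+ t. ennreal (norm ((b t) ^ 4)) \<partial>lebesgue_on {0..T}) \<le> I"
    unfolding I_def by (intro nn_integral_mono) (auto simp: e)
  then show "integrable (lebesgue_on {0..T}) (\<lambda>t. (b t) ^ 4)"
    using I by (intro integrableI_bounded) (auto simp: less_top le_less_trans)
qed

lemma b_integrable:
  assumes "0 < T" shows "integrable (lebesgue_on {0..T}) b"
proof (rule Bochner_Integration.integrable_bound)
  show "integrable (lebesgue_on {0..T}) (\<lambda>t. 1 + (b t) ^ 4)"
    using b4_integrable[OF assms] continuous_integrable_lebesgue_on[of T "\<lambda>t. 1"] by auto
  show "AE t in lebesgue_on {0..T}. norm (b t) \<le> norm (1 + (b t) ^ 4)"
  proof (rule AE_I2)
    fix t
    have "b t \<le> 1 + (b t) ^ 4"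
    proof (cases "b t \<le> 1")
      case False
      then have "b t \<le> (b t) ^ 4" using power_increasing[of 1 4 "b t"] by simp
      then show ?thesis by simp
    next
      case True
      moreover have "0 \<le> (b t) ^ 4" by simp
      ultimately show ?thesis by linarith
    qed
    then show "norm (b t) \<le> norm (1 + (b t) ^ 4)" by simp
  qed
qed measurable

lemma cubic_L2:
  assumes "0 \<le> s" "beta s < \<infinity>" shows "(\<lambda>x. of_real ((cmod (w s x))\<^sup>2) * w s x) \<in> L2_space"
    "(\<lambda>x. complex_of_real ((cmod (w s x))\<^sup>2)) \<in> L2_space"
proof -
  have m: "w s \<in> borel_measurable lebesgue" by (rule L2_space_measurable[OF w_L2[OF assms(1)]])
  show "(\<lambda>x. of_real ((cmod (w s x))\<^sup>2) * w s x) \<in> L2_space"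
  proof (rule L2_space_bound[OF w_L2[OF assms(1)]])
    show "(\<lambda>x. of_real ((cmod (w s x))\<^sup>2) * w s x) \<in> borel_measurable lebesgue"
      using m by measurable
    show "AE x in lebesgue. norm (of_real ((cmod (w s x))\<^sup>2) * w s x) \<le> (b s)\<^sup>2 * norm (w s x)"
      using b_bound[OF assms] unfolding norm_mult norm_of_real
      by eventually_elim (simp add: mult_right_mono power_mono)
  qed
  show "(\<lambda>x. complex_of_real ((cmod (w s x))\<^sup>2)) \<in> L2_space"
  proof (rule L2_space_bound[OF w_L2[OF assms(1)]])
    show "(\<lambda>x. complex_of_real ((cmod (w s x))\<^sup>2)) \<in> borel_measurable lebesgue"
      using m by measurable
    show "AE x in lebesgue. norm (complex_of_real ((cmod (w s x))\<^sup>2)) \<le> b s * norm (w s x)"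
      using b_bound[OF assms] unfolding norm_of_real
      by eventually_elim (simp add: power2_eq_square mult_right_mono)
  qed
qed

end

locale SD_NLS = SD_flow \<tau> u0 v0 u v + L4_Linf_curve w
  for \<tau> :: real and u0 :: "real \<Rightarrow> complex" and v0 :: "real \<Rightarrow> real"
    and u :: "real \<Rightarrow> real \<Rightarrow> complex" and v :: "real \<Rightarrow> real \<Rightarrow> real" and w :: "real \<Rightarrow> real \<Rightarrow> complex" +
  fixes p0 :: "real \<Rightarrow> complex" and A T :: real
  assumes p0: "p0 \<in> L2_space" and NLS: "NLS_L2_solution p0 w" and T: "0 < T"
    and A: "norm U0 \<le> A" "dn U0 \<le> A" "norm V0 \<le> A"
begin

definition "M = sqrt (pi * (A\<^sup>2 + H1_bound A))"
text \<open>The Lipschitz coefficient of the cubic term from \<open>cubic_diff_le\<close>, with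
  \<open>M\<close> bounding \<open>U s\<close> and \<open>b s\<close> bounding the limit.\<close>

definition "k s = 2 * (M\<^sup>2 + (b s)\<^sup>2)"
definition "y s = norm (U s - P s)"
text \<open>The inhomogeneous part of the Gronwall inequality: the distance of the data, plus the
  time integral of the relaxation defect multiplied by the bound \<open>M\<close> for the
  solution.\<close>

definition "\<delta> = norm (U0 - cls p0) + M * (sqrt \<tau> * (T + H1_bound A) / 2)"
text \<open>The summand 1 keeps \<open>\<kappa>\<close> positive, so that \<open>y_gronwall\<close>
  may divide by it.\<close>

definition "\<kappa> = 1 + integral {0..T} (\<lambda>s. (k s)\<^sup>2)"

lemma M_nonneg: "0 \<le> M"
proof -
  have "0 \<le> (dn (U 0))\<^sup>2" by simp
  then have "0 \<le> H1_bound A" using uniform_bounds(2)[OF A order_refl] by linarith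
  then show ?thesis by (simp add: M_def)
qed

lemma sup_U: "0 \<le> t \<Longrightarrow> sup_bd (U t) \<le> M"
  unfolding sup_bd_def M_def
  by (intro real_sqrt_le_mono mult_left_mono add_mono power_mono uniform_bounds A) auto

lemma k_nonneg: "0 \<le> k s" and y_nonneg: "0 \<le> y s"
  by (auto simp: k_def y_def)

lemma k_measurable [measurable]: "k \<in> borel_measurable (lebesgue_on {0..t})"
  unfolding k_def[abs_def] by measurable

text \<open>\<open>(k s)\<^sup>2\<close> grows like \<open>(b s) ^ 4\<close>, the power that
  membership in L^4 with values in L^infinity makes integrable.\<close>

lemma k2_integrable:
  assumes "t \<le> T" shows "integrable (lebesgue_on {0..t}) (\<lambda>s. (k s)\<^sup>2)"
proof (rule integrable_lebesgue_on_mono[OF _ assms])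
  show "integrable (lebesgue_on {0..T}) (\<lambda>s. (k s)\<^sup>2)"
  proof (rule Bochner_Integration.integrable_bound)
    show "integrable (lebesgue_on {0..T}) (\<lambda>s. 8 * M ^ 4 + 8 * (b s) ^ 4)"
      using b4_integrable[OF T] continuous_integrable_lebesgue_on[of T "\<lambda>t. 8 * M ^ 4"] by auto
    show "AE s in lebesgue_on {0..T}. norm ((k s)\<^sup>2) \<le> norm (8 * M ^ 4 + 8 * (b s) ^ 4)"
    proof (rule AE_I2)
      fix s
      have "2 * (M\<^sup>2 * (b s)\<^sup>2) \<le> (M\<^sup>2)\<^sup>2 + ((b s)\<^sup>2)\<^sup>2"
        using sum_squares_bound[of "M\<^sup>2" "(b s)\<^sup>2"] by (simp add: mult.assoc)
      moreover have "(k s)\<^sup>2 = 4 * ((M\<^sup>2)\<^sup>2 + 2 * (M\<^sup>2 * (b s)\<^sup>2) + ((b s)\<^sup>2)\<^sup>2)"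
        by (simp add: k_def power2_eq_square algebra_simps)
      moreover have "(M\<^sup>2)\<^sup>2 = M ^ 4" "((b s)\<^sup>2)\<^sup>2 = (b s) ^ 4" by (simp_all flip: power_mult)
      ultimately have "(k s)\<^sup>2 \<le> 8 * M ^ 4 + 8 * (b s) ^ 4" by simp
      then show "norm ((k s)\<^sup>2) \<le> norm (8 * M ^ 4 + 8 * (b s) ^ 4)" by simp
    qed
  qed measurable
qed

lemma k2_int_le:
  assumes "t \<le> T" shows "integral {0..t} (\<lambda>s. (k s)\<^sup>2) \<le> \<kappa>"
proof -
  have "integral {0..t} (\<lambda>s. (k s)\<^sup>2) \<le> integral {0..T} (\<lambda>s. (k s)\<^sup>2)"
    using assms by (intro integral_subset_le integrable_on_lebesgue_on[OF k2_integrable]) auto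
  then show ?thesis by (simp add: \<kappa>_def)
qed

lemma kappa_ge_1: "1 \<le> \<kappa>"
  unfolding \<kappa>_def using integral_nonneg[OF integrable_on_lebesgue_on[OF k2_integrable[OF order_refl]]] by auto

lemma y_continuous: "continuous_on {0..t} y"
  unfolding y_def[abs_def]
  by (intro tendsto_continuous_on_Icc tendsto_intros cH1_tendsto[OF cH1_U] P_tendsto)

lemma ky_integrable:
  assumes "t \<le> T" shows "integrable (lebesgue_on {0..t}) (\<lambda>s. k s * y s)"
proof (rule Bochner_Integration.integrable_bound)
  have y2: "integrable (lebesgue_on {0..t}) (\<lambda>s. (y s)\<^sup>2)" and y1: "integrable (lebesgue_on {0..t}) y"
    by (intro continuous_integrable_lebesgue_on continuous_intros y_continuous)+
  show "integrable (lebesgue_on {0..t}) (\<lambda>s. (k s)\<^sup>2 + (y s)\<^sup>2)"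
    using k2_integrable[OF assms] y2 by auto
  show "(\<lambda>s. k s * y s) \<in> borel_measurable (lebesgue_on {0..t})"
    using borel_measurable_integrable[OF y1] by measurable
  show "AE s in lebesgue_on {0..t}. norm (k s * y s) \<le> norm ((k s)\<^sup>2 + (y s)\<^sup>2)"
  proof (rule AE_I2)
    fix s
    have "2 * (k s * y s) \<le> (k s)\<^sup>2 + (y s)\<^sup>2" using sum_squares_bound[of "k s" "y s"] by (simp add: mult.assoc)
    moreover have "0 \<le> k s * y s" by (intro mult_nonneg_nonneg k_nonneg y_nonneg)
    ultimately show "norm (k s * y s) \<le> norm ((k s)\<^sup>2 + (y s)\<^sup>2)" by simp
  qed
qed

text \<open>Membership of \<open>s\<close> in the interval is included because the almost everywhere
  arguments that use it also need \<open>0 \<le> s\<close>.\<close>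

lemma beta_finite:
  assumes "t \<le> T" shows "AE s in lebesgue_on {0..t}. s \<in> {0..t} \<and> beta s < \<infinity>"
proof -
  have "AE s in lebesgue. s \<in> {0..T} \<longrightarrow> beta s < \<infinity>"
    using beta_finite_AE[OF T] by (simp add: AE_restrict_space_iff)
  then have "AE s in lebesgue. s \<in> {0..t} \<longrightarrow> s \<in> {0..t} \<and> beta s < \<infinity>"
    by eventually_elim (use assms in auto)
  then show ?thesis by (simp add: AE_restrict_space_iff)
qed

text \<open>With the limit called \<open>w\<close>,
  \<open>u v + |w|^2 w = u (v + |u|^2) + (|w|^2 w - |u|^2 u)\<close>. The first summand is the
  relaxation defect times a bounded function, the second the difference of cubic terms.\<close>

lemma nonlinearity_le:
  assumes s: "0 \<le> s" "beta s < \<infinity>"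
  shows "norm (X s + cls (\<lambda>x. of_real ((cmod (w s x))\<^sup>2) * w s x)) \<le> M * norm (V s + Q s) + k s * y s"
proof -
  note HU = H1c_U[OF s(1)]
  have bU: "bdd_symbol (rep (U s)) (sup_bd (U s))" by (rule bdd_symbol_rep[OF HU])
  define Y where "Y = cls (\<lambda>x. of_real ((cmod (w s x))\<^sup>2) * w s x)"
  define q where "q x = complex_of_real ((norm (rep (U s) x))\<^sup>2)" for x
  have q: "q \<in> L2_space" "cls q = Q s" using sqmod_L2[OF HU] by (simp_all add: q_def[abs_def] Q_def sqmod_def)
  have uq: "(\<lambda>x. rep (U s) x * q x) \<in> L2_space" by (rule mult_L2[OF bU q(1)])
  have "mulop (rep (U s)) (Q s) = cls (\<lambda>x. rep (U s) x * q x)"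
    unfolding q(2)[symmetric] by (rule mulop_cls[OF bU q(1)])
  then have "Y - mulop (rep (U s)) (Q s) = cls (\<lambda>x. of_real ((cmod (w s x))\<^sup>2) * w s x - rep (U s) x * q x)"
    unfolding Y_def by (simp only: cls_diff[OF cubic_L2(1)[OF s] uq])
  moreover have "norm (cls (\<lambda>x. of_real ((cmod (w s x))\<^sup>2) * w s x - rep (U s) x * q x))
      \<le> k s * norm (cls (\<lambda>x. w s x - rep (U s) x))"
  proof (rule norm_cls_mono)
    show "AE x in lebesgue. norm (of_real ((cmod (w s x))\<^sup>2) * w s x - rep (U s) x * q x) \<le> k s * norm (w s x - rep (U s) x)"
      using b_bound[OF s] sup_bd[OF HU]
    proof eventually_elim
      case (elim x)
      have "norm (rep (U s) x) \<le> M" using elim(2) sup_U[OF s(1)] by linarith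
      from cubic_diff_le[OF elim(1) this] show ?case
        by (simp add: q_def k_def mult.commute[of "rep (U s) x"] add.commute)
    qed
  qed (use cubic_L2(1)[OF s] uq w_L2[OF s(1)] k_nonneg in auto)
  moreover have "norm (cls (\<lambda>x. w s x - rep (U s) x)) = y s"
    using w_L2[OF s(1)] by (simp add: y_def P_def cls_diff norm_minus_commute)
  ultimately have 1: "norm (Y - mulop (rep (U s)) (Q s)) \<le> k s * y s" by simp
  have 2: "norm (mulop (rep (U s)) (V s + Q s)) \<le> M * norm (V s + Q s)"
    using norm_mulop[OF bU, of "V s + Q s"] sup_U[OF s(1)] by (meson mult_right_mono norm_ge_zero order_trans)
  have e: "X s + Y = mulop (rep (U s)) (V s + Q s) + (Y - mulop (rep (U s)) (Q s))"
    by (simp add: X_def mulop_rep_commute[of "V s"] mulop_add[OF bU])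
  show ?thesis unfolding Y_def[symmetric] e by (rule norm_triangle_mono[OF 2 1])
qed

text \<open>The nonlinearities enter the two Duhamel formulas with opposite signs, so the difference
  of the solutions contains the sum \<open>cls G1 + cls G2\<close>. The isometric group drops out of
  the norms.\<close>

lemma y_duhamel:
  assumes t: "t \<in> {0..T}"
  shows "y t \<le> norm (U0 - cls p0) + M * integral {0..t} (\<lambda>s. norm (V s + Q s)) + integral {0..t} (\<lambda>s. k s * y s)"
proof -
  have t0: "0 \<le> t" and tT: "t \<le> T" using t by auto
  define F1 where "F1 s = schroedinger (t - s) (\<lambda>x. u s x * complex_of_real (v s x))" for s
  define F2 where "F2 s = schroedinger (t - s) (\<lambda>x. of_real ((cmod (w s x))\<^sup>2) * w s x)" for s
  obtain G1 where G1: "has_L2_integral F1 G1 t" "AE x in lebesgue. u t x = schroedinger t u0 x - \<i> * G1 x"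
    using SD t0 unfolding SD_solution_def F1_def by blast
  obtain G2 where G2: "has_L2_integral F2 G2 t" "AE x in lebesgue. w t x = schroedinger t p0 x + \<i> * G2 x"
    using NLS t0 unfolding NLS_L2_solution_def F2_def by blast
  have GL: "G1 \<in> L2_space" "G2 \<in> L2_space" using G1(1) G2(1) by (auto simp: has_L2_integral_def)
  define N where "N s = M * norm (V s + Q s) + k s * y s" for s
  have N0: "0 \<le> N s" for s unfolding N_def by (intro add_nonneg_nonneg mult_nonneg_nonneg M_nonneg k_nonneg y_nonneg) auto
  have iVQ: "integrable (lebesgue_on {0..t}) (\<lambda>s. norm (V s + Q s))"
    by (intro continuous_integrable_lebesgue_on continuous_intros VQ_continuous)
  then have iN: "integrable (lebesgue_on {0..t}) N"
    unfolding N_def using ky_integrable[OF tT] by auto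
  have "ennreal (norm (cls G1 + cls G2)) \<le> (\<integral>\<^sup>+ s. ennreal (N s) \<partial>lebesgue_on {0..t})"
  proof (rule has_L2_integral_add_le[OF G1(1) G2(1)])
    show "(\<lambda>s. ennreal (N s)) \<in> borel_measurable (lebesgue_on {0..t})"
      using borel_measurable_integrable[OF iN] by measurable
    show "AE s in lebesgue_on {0..t}. ennreal (norm (cls (F1 s) + cls (F2 s))) \<le> ennreal (N s)"
      using beta_finite[OF tT]
    proof eventually_elim
      case (elim s)
      then have s: "0 \<le> s" "beta s < \<infinity>" by auto
      have "cls (F1 s) + cls (F2 s) = schr (t - s) (X s + cls (\<lambda>x. of_real ((cmod (w s x))\<^sup>2) * w s x))"
        unfolding F1_def F2_def
        using cls_schroedinger[OF conjunct1[OF X_cls[OF s(1)]]] cls_schroedinger[OF cubic_L2(1)[OF s]] X_cls[OF s(1)]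
        by (simp add: linear_add[OF bounded_linear.linear[OF bounded_linear_schr]])
      then show ?case using nonlinearity_le[OF s] by (simp add: N_def ennreal_leI)
    qed
  qed
  also have "\<dots> = ennreal (LINT s|lebesgue_on {0..t}. N s)"
    using iN N0 by (intro nn_integral_eq_integral) auto
  also have "(LINT s|lebesgue_on {0..t}. N s) = M * (LINT s|lebesgue_on {0..t}. norm (V s + Q s)) + (LINT s|lebesgue_on {0..t}. k s * y s)"
    unfolding N_def using iVQ ky_integrable[OF tT] by simp
  also have "\<dots> = M * integral {0..t} (\<lambda>s. norm (V s + Q s)) + integral {0..t} (\<lambda>s. k s * y s)"
    by (simp add: lebesgue_integral_eq_integral[OF iVQ] lebesgue_integral_eq_integral[OF ky_integrable[OF tT]])
  finally have "ennreal (norm (cls G1 + cls G2)) \<le> ennreal (M * integral {0..t} (\<lambda>s. norm (V s + Q s)) + integral {0..t} (\<lambda>s. k s * y s))" .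
  moreover have "0 \<le> M * integral {0..t} (\<lambda>s. norm (V s + Q s)) + integral {0..t} (\<lambda>s. k s * y s)"
    by (intro add_nonneg_nonneg mult_nonneg_nonneg M_nonneg integral_nonneg integrable_on_lebesgue_on[OF iVQ]
        integrable_on_lebesgue_on[OF ky_integrable[OF tT]] k_nonneg y_nonneg) auto
  ultimately have G: "norm (cls G1 + cls G2) \<le> M * integral {0..t} (\<lambda>s. norm (V s + Q s)) + integral {0..t} (\<lambda>s. k s * y s)"
    by (simp add: ennreal_le_iff)
  have su: "schroedinger t u0 \<in> L2_space" "cls (schroedinger t u0) = schr t U0"
    using cls_schroedinger[OF H1_space_weak_deriv(1)[OF u0]] by (auto simp: U0_def)
  have sp: "schroedinger t p0 \<in> L2_space" "cls (schroedinger t p0) = schr t (cls p0)"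
    using cls_schroedinger[OF p0] by auto
  have "U t = cls (\<lambda>x. schroedinger t u0 x - \<i> * G1 x)"
    unfolding U_def by (rule cls_eqI[OF u_L2[OF t0] G1(2)])
  then have Ut: "U t = schr t U0 - J (cls G1)"
    using su GL by (simp add: cls_diff L2_space_mult_const flip: J_cls)
  have "P t = cls (\<lambda>x. schroedinger t p0 x + \<i> * G2 x)"
    unfolding P_def by (rule cls_eqI[OF w_L2[OF t0] G2(2)])
  then have Pt: "P t = schr t (cls p0) + J (cls G2)"
    using sp GL by (simp add: cls_add L2_space_mult_const flip: J_cls)
  have "U t - P t = schr t (U0 - cls p0) - J (cls G1 + cls G2)"
    unfolding Ut Pt by (simp add: schr_diff J_add)
  then have "y t \<le> norm (U0 - cls p0) + norm (cls G1 + cls G2)"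
    unfolding y_def using norm_triangle_ineq4[of "schr t (U0 - cls p0)" "J (cls G1 + cls G2)"] by simp
  then show ?thesis using G by linarith
qed

text \<open>Cauchy-Schwarz in time replaces the square integrable coefficient \<open>k\<close> by
  the constant \<open>\<kappa>\<close>. What results is a Gronwall inequality with constant
  coefficient for the square of \<open>y\<close>.\<close>

lemma y_gronwall:
  assumes t: "t \<in> {0..T}" shows "(y t)\<^sup>2 \<le> 2 * \<delta>\<^sup>2 * exp (2 * \<kappa> * t)"
proof (rule gronwall_const[where z = "\<lambda>s. (y s)\<^sup>2" and T = T])
  show "continuous_on {0..T} (\<lambda>s. (y s)\<^sup>2)" by (intro continuous_intros y_continuous)
  show "0 \<le> 2 * \<kappa>" using kappa_ge_1 by simp
  fix t assume t: "t \<in> {0..T}"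
  then have t0: "0 \<le> t" and tT: "t \<le> T" by auto
  define p where "p = integral {0..t} (\<lambda>s. k s * y s)"
  define q where "q = integral {0..t} (\<lambda>s. (y s)\<^sup>2)"
  have iy: "(\<lambda>s. (y s)\<^sup>2) integrable_on {0..t}"
    by (intro integrable_continuous_real continuous_intros y_continuous)
  have iky: "(\<lambda>s. k s * y s) integrable_on {0..t}" by (rule integrable_on_lebesgue_on[OF ky_integrable[OF tT]]) simp
  have ik: "(\<lambda>s. (k s)\<^sup>2) integrable_on {0..t}" by (rule integrable_on_lebesgue_on[OF k2_integrable[OF tT]]) simp
  have q0: "0 \<le> q" unfolding q_def by (rule integral_nonneg[OF iy]) simp
  have p0: "0 \<le> p" unfolding p_def by (rule integral_nonneg[OF iky]) (simp add: k_nonneg y_nonneg)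
  have pq: "p\<^sup>2 \<le> \<kappa> * q"
  proof (cases "p = 0")
    case False
    then have pp: "0 < p" using p0 by simp
    have kp: "0 < \<kappa>" using kappa_ge_1 by linarith
    \<comment> \<open>With this weight \<open>\<eta> * \<kappa>\<close> equals \<open>p\<close> and
      cancels one of the two copies of \<open>p\<close> on the left. What remains is
      \<open>p \<le> \<kappa> * q / p\<close>.\<close>
    define \<eta> where "\<eta> = p / \<kappa>"
    have eta: "0 < \<eta>" using pp kp by (simp add: \<eta>_def)
    have "2 * p \<le> integral {0..t} (\<lambda>s. \<eta> * (k s)\<^sup>2 + (1 / \<eta>) * (y s)\<^sup>2)"
    proof -
      have "integral {0..t} (\<lambda>s. 2 * (k s * y s)) \<le> integral {0..t} (\<lambda>s. \<eta> * (k s)\<^sup>2 + (1 / \<eta>) * (y s)\<^sup>2)"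
      proof (rule integral_le)
        show "(\<lambda>s. 2 * (k s * y s)) integrable_on {0..t}" using iky by (rule integrable_on_mult_right)
        show "(\<lambda>s. \<eta> * (k s)\<^sup>2 + (1 / \<eta>) * (y s)\<^sup>2) integrable_on {0..t}"
          by (intro integrable_add integrable_on_mult_right ik iy)
        fix s
        have "0 \<le> (\<eta> * k s - y s)\<^sup>2" by simp
        then have "2 * \<eta> * (k s * y s) \<le> \<eta>\<^sup>2 * (k s)\<^sup>2 + (y s)\<^sup>2"
          by (simp add: power2_diff power_mult_distrib mult_ac)
        then show "2 * (k s * y s) \<le> \<eta> * (k s)\<^sup>2 + (1 / \<eta>) * (y s)\<^sup>2"
          using eta by (simp add: field_simps power2_eq_square)
      qed
      then show ?thesis by (simp add: p_def)
    qed
    also have "\<dots> = \<eta> * integral {0..t} (\<lambda>s. (k s)\<^sup>2) + (1 / \<eta>) * q"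
      unfolding q_def
      by (subst Henstock_Kurzweil_Integration.integral_add) (auto intro!: integrable_on_mult_right ik iy simp: integrable_on_divide iy)
    also have "\<dots> \<le> \<eta> * \<kappa> + (1 / \<eta>) * q"
      using k2_int_le[OF tT] eta by (intro add_right_mono mult_left_mono) auto
    also have "\<dots> = p + \<kappa> * q / p" using pp kp by (simp add: \<eta>_def)
    finally have "p \<le> \<kappa> * q / p" by simp
    then show ?thesis using pp by (simp add: pos_le_divide_eq power2_eq_square)
  qed (use q0 kappa_ge_1 in simp)
  have "y t \<le> \<delta> + p"
    using y_duhamel[OF t] mult_left_mono[OF integral_VQ_le[OF A t0 tT] M_nonneg] unfolding \<delta>_def p_def by linarith
  then have "(y t)\<^sup>2 \<le> (\<delta> + p)\<^sup>2" by (rule power_mono[OF _ y_nonneg])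
  also have "\<dots> \<le> 2 * \<delta>\<^sup>2 + 2 * p\<^sup>2"
    using sum_squares_bound[of \<delta> p] by (simp add: power2_sum)
  also have "\<dots> \<le> 2 * \<delta>\<^sup>2 + 2 * \<kappa> * q" using pq by simp
  finally show "(y t)\<^sup>2 \<le> 2 * \<delta>\<^sup>2 + 2 * \<kappa> * integral {0..t} (\<lambda>s. (y s)\<^sup>2)" by (simp add: q_def)
qed (rule t)

definition "Y = sqrt (2 * exp (2 * \<kappa> * T)) * \<delta>"

lemma delta_nonneg: "0 \<le> \<delta>"
proof -
  have "0 \<le> integral {0..T} (\<lambda>s. norm (V s + Q s))"
    by (intro integral_nonneg integrable_continuous_real continuous_intros VQ_continuous) auto
  also have "\<dots> \<le> sqrt \<tau> * (T + H1_bound A) / 2" using integral_VQ_le[OF A _ order_refl] T by simp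
  finally show ?thesis unfolding \<delta>_def by (intro add_nonneg_nonneg mult_nonneg_nonneg M_nonneg) auto
qed

lemma y_le:
  assumes t: "t \<in> {0..T}" shows "y t \<le> Y"
proof (rule power2_le_imp_le)
  have "(y t)\<^sup>2 \<le> 2 * \<delta>\<^sup>2 * exp (2 * \<kappa> * t)" by (rule y_gronwall[OF t])
  also have "\<dots> \<le> 2 * \<delta>\<^sup>2 * exp (2 * \<kappa> * T)"
    using t kappa_ge_1 by (intro mult_left_mono) auto
  also have "\<dots> = Y\<^sup>2" by (simp add: Y_def power_mult_distrib)
  finally show "(y t)\<^sup>2 \<le> Y\<^sup>2" .
  show "0 \<le> Y" unfolding Y_def using delta_nonneg by simp
qed

theorem mixed_norm_u: "mixed_norm \<infinity> 2 T (\<lambda>t x. u t x - w t x) \<le> ennreal Y"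
proof -
  have eq: "L2_norm (\<lambda>x. u t x - w t x) = ennreal (y t)" if "t \<in> {0..T}" for t
    using that u_L2[of t] w_L2[of t] by (simp add: L2_norm_cls L2_space_diff cls_diff y_def U_def P_def)
  have "mixed_norm \<infinity> 2 T (\<lambda>t x. u t x - w t x) = esssup (lebesgue_on {0..T}) (\<lambda>t. L2_norm (\<lambda>x. u t x - w t x))"
    unfolding mixed_norm_def Lp_norm_def by simp
  also have "\<dots> \<le> ennreal Y"
  proof (rule esssup_I)
    have "(\<lambda>t. ennreal (y t)) \<in> borel_measurable (lebesgue_on {0..T})"
      using borel_measurable_integrable[OF continuous_integrable_lebesgue_on[OF y_continuous]] by measurable
    then show "(\<lambda>t. L2_norm (\<lambda>x. u t x - w t x)) \<in> borel_measurable (lebesgue_on {0..T})"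
      by (rule measurable_cong[THEN iffD1, rotated]) (simp add: eq space_restrict_space)
    show "AE t in lebesgue_on {0..T}. L2_norm (\<lambda>x. u t x - w t x) \<le> ennreal Y"
      by (rule AE_I2) (simp add: eq space_restrict_space y_le ennreal_leI)
  qed
  finally show ?thesis .
qed

text \<open>\<open>v + |w|^2 = (v + |u|^2) + (|w|^2 - |u|^2)\<close>: the first summand is the
  relaxation defect, and the second is at most \<open>(M + b t) * y t\<close>, where
  \<open>y t \<le> Y\<close> and \<open>b\<close> is integrable in time.\<close>

theorem mixed_norm_v:
  "mixed_norm 1 2 T (\<lambda>t x. v t x + (cmod (w t x))\<^sup>2)
    \<le> ennreal (sqrt \<tau> * (T + H1_bound A) / 2 + Y * (LINT t|lebesgue_on {0..T}. M + b t))"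
proof -
  define N where "N t = norm (V t + Q t) + Y * (M + b t)" for t
  have Y0: "0 \<le> Y" using y_le[of 0] y_nonneg[of 0] T by simp
  have N0: "0 \<le> N t" for t unfolding N_def by (intro add_nonneg_nonneg mult_nonneg_nonneg Y0 M_nonneg) auto
  have iVQ: "integrable (lebesgue_on {0..T}) (\<lambda>s. norm (V s + Q s))"
    by (intro continuous_integrable_lebesgue_on continuous_intros VQ_continuous)
  have iM: "integrable (lebesgue_on {0..T}) (\<lambda>t. M + b t)"
    using b_integrable[OF T] continuous_integrable_lebesgue_on[of T "\<lambda>t. M"] by auto
  have iN: "integrable (lebesgue_on {0..T}) N" unfolding N_def using iVQ iM by auto
  have p1: "enn_powr z 1 = z" for z by (cases z) (auto simp: enn_powr_def)
  have "mixed_norm 1 2 T (\<lambda>t x. v t x + (cmod (w t x))\<^sup>2)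
      = (\<integral>\<^sup>+ t. L2_norm (\<lambda>x. v t x + (cmod (w t x))\<^sup>2) \<partial>lebesgue_on {0..T})"
    by (simp add: mixed_norm_def Lp_norm_def[of 1] p1)
  also have "\<dots> \<le> (\<integral>\<^sup>+ t. ennreal (N t) \<partial>lebesgue_on {0..T})"
  proof (rule nn_integral_mono_AE, use beta_finite[OF order_refl] in eventually_elim)
    case (elim t)
    then have t: "0 \<le> t" "beta t < \<infinity>" "t \<in> {0..T}" by auto
    note c = cubic_L2(2)[OF t(1,2)]
    have L: "(\<lambda>x. complex_of_real (v t x) + complex_of_real ((cmod (w t x))\<^sup>2)) \<in> L2_space"
      by (rule L2_space_add[OF v_L2[OF t(1)] c])
    have "L2_norm (\<lambda>x. v t x + (cmod (w t x))\<^sup>2) = L2_norm (\<lambda>x. complex_of_real (v t x) + complex_of_real ((cmod (w t x))\<^sup>2))"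
      using L2_norm_of_real[of "\<lambda>x. v t x + (cmod (w t x))\<^sup>2"] by simp
    also have "\<dots> = ennreal (norm (V t + cls (\<lambda>x. complex_of_real ((cmod (w t x))\<^sup>2))))"
      unfolding L2_norm_cls[OF L] cls_add[OF v_L2[OF t(1)] c] V_def ..
    also have "\<dots> \<le> ennreal (N t)"
    proof (rule ennreal_leI)
      have "norm (cls (\<lambda>x. complex_of_real ((cmod (w t x))\<^sup>2)) - Q t) \<le> (M + b t) * y t"
      proof -
        have "norm (cls (\<lambda>x. complex_of_real ((cmod (w t x))\<^sup>2) - complex_of_real ((norm (rep (U t) x))\<^sup>2)))
            \<le> (M + b t) * norm (cls (\<lambda>x. w t x - rep (U t) x))"
        proof (rule norm_cls_mono)
          show "AE x in lebesgue. norm (complex_of_real ((cmod (w t x))\<^sup>2) - complex_of_real ((norm (rep (U t) x))\<^sup>2))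
              \<le> (M + b t) * norm (w t x - rep (U t) x)"
            using b_bound[OF t(1,2)] sup_bd[OF H1c_U[OF t(1)]]
          proof eventually_elim
            case (elim x)
            have m: "norm (rep (U t) x) \<le> M" using elim(2) sup_U[OF t(1)] by linarith
            have "norm (complex_of_real ((cmod (w t x))\<^sup>2) - complex_of_real ((norm (rep (U t) x))\<^sup>2))
                = \<bar>norm (w t x) - norm (rep (U t) x)\<bar> * (norm (w t x) + norm (rep (U t) x))"
              unfolding of_real_diff[symmetric] norm_of_real power2_eq_square square_diff_square_factored abs_mult by simp
            also have "\<dots> \<le> norm (w t x - rep (U t) x) * (b t + M)"
              using elim m by (intro mult_mono norm_triangle_ineq3 add_mono) auto
            finally show ?case by (simp add: mult.commute add.commute)
          qed
          show "0 \<le> M + b t" using M_nonneg by simp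
        qed (intro L2_space_diff c sqmod_L2 H1c_U t(1) w_L2 rep_L2)+
        moreover have "norm (cls (\<lambda>x. w t x - rep (U t) x)) = y t"
          using w_L2[OF t(1)] by (simp add: y_def P_def cls_diff norm_minus_commute)
        ultimately show ?thesis
          unfolding cls_diff[OF c sqmod_L2[OF H1c_U[OF t(1)]]] by (simp only: Q_def sqmod_def)
      qed
      also have "\<dots> \<le> (M + b t) * Y" using y_le[OF t(3)] M_nonneg by (intro mult_left_mono) auto
      finally have 1: "norm (cls (\<lambda>x. complex_of_real ((cmod (w t x))\<^sup>2)) - Q t) \<le> (M + b t) * Y" .
      have "V t + cls (\<lambda>x. complex_of_real ((cmod (w t x))\<^sup>2)) = (V t + Q t) + (cls (\<lambda>x. complex_of_real ((cmod (w t x))\<^sup>2)) - Q t)"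
        by simp
      then show "norm (V t + cls (\<lambda>x. complex_of_real ((cmod (w t x))\<^sup>2))) \<le> N t"
        unfolding N_def using norm_triangle_mono[OF order_refl 1, of "V t + Q t"] by (simp add: mult.commute)
    qed
    finally show ?case .
  qed
  also have "\<dots> = ennreal (LINT t|lebesgue_on {0..T}. N t)"
    using iN N0 by (intro nn_integral_eq_integral) auto
  also have "(LINT t|lebesgue_on {0..T}. N t) = integral {0..T} (\<lambda>s. norm (V s + Q s)) + Y * (LINT t|lebesgue_on {0..T}. M + b t)"
    unfolding N_def using iVQ iM by (simp add: lebesgue_integral_eq_integral[OF iVQ])
  also have "ennreal \<dots> \<le> ennreal (sqrt \<tau> * (T + H1_bound A) / 2 + Y * (LINT t|lebesgue_on {0..T}. M + b t))"
    using integral_VQ_le[OF A _ order_refl] T by (intro ennreal_leI add_right_mono) auto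
  finally show ?thesis .
qed

end

context SD_NLS
begin

text \<open>This constant and the next depend on the limit, on \<open>A\<close> and on
  \<open>T\<close>, but not on \<tau> or on the solution of the system.\<close>

definition "L = (LINT t|lebesgue_on {0..T}. M + b t)"
definition "K = sqrt (2 * exp (2 * \<kappa> * T)) * (1 + M * ((T + H1_bound A) / 2))"

text \<open>Both errors are brought to the form of a constant independent of \<tau> times the same
  small quantity, ready for the limit.\<close>

lemma mixed_norm_le:
  defines "\<epsilon> \<equiv> norm (U0 - cls p0) + sqrt \<tau>"
  shows "mixed_norm \<infinity> 2 T (\<lambda>t x. u t x - w t x) \<le> ennreal (K * \<epsilon>)"
    and "mixed_norm 1 2 T (\<lambda>t x. v t x + (cmod (w t x))\<^sup>2) \<le> ennreal (((T + H1_bound A) / 2 + K * L) * \<epsilon>)"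
proof -
  define R where "R = (T + H1_bound A) / 2"
  have "0 \<le> (dn (U 0))\<^sup>2" by simp
  then have R: "0 \<le> R" unfolding R_def using order_trans[OF _ uniform_bounds(2)[OF A order_refl]] T by simp
  have st: "0 \<le> sqrt \<tau>" using tau by simp
  define n where "n = norm (U0 - cls p0)"
  have n: "0 \<le> n" by (simp add: n_def)
  have e: "\<epsilon> = n + sqrt \<tau>" by (simp add: \<epsilon>_def n_def)
  have MR: "0 \<le> M * R" using M_nonneg R by simp
  have "\<delta> = n + (M * R) * sqrt \<tau>" by (simp add: \<delta>_def n_def R_def)
  also have "\<dots> \<le> (n + (M * R) * sqrt \<tau>) + (sqrt \<tau> + (M * R) * n)"
    using st mult_nonneg_nonneg[OF MR n] by simp
  also have "\<dots> = (1 + M * R) * \<epsilon>" by (simp add: e algebra_simps)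
  finally have "\<delta> \<le> (1 + M * R) * \<epsilon>" .
  then have Y: "Y \<le> K * \<epsilon>"
    unfolding Y_def K_def R_def[symmetric] mult.assoc by (intro mult_left_mono) auto
  show "mixed_norm \<infinity> 2 T (\<lambda>t x. u t x - w t x) \<le> ennreal (K * \<epsilon>)"
    using mixed_norm_u ennreal_leI[OF Y] by (rule order_trans)
  have "0 \<le> L" unfolding L_def using M_nonneg by (intro Bochner_Integration.integral_nonneg) simp
  then have "Y * L \<le> K * \<epsilon> * L" by (rule mult_right_mono[OF Y])
  moreover have "sqrt \<tau> * R \<le> \<epsilon> * R" using n R by (intro mult_right_mono) (auto simp: e)
  ultimately have "sqrt \<tau> * R + Y * L \<le> (R + K * L) * \<epsilon>"
    by (simp add: algebra_simps)
  from order_trans[OF mixed_norm_v ennreal_leI, folded L_def, OF this[unfolded R_def times_divide_eq_right]]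
  show "mixed_norm 1 2 T (\<lambda>t x. v t x + (cmod (w t x))\<^sup>2) \<le> ennreal (((T + H1_bound A) / 2 + K * L) * \<epsilon>)"
    by simp
qed

end

text \<open>Dropping the nonnegative derivative term leaves
  \<open>norm v^2 \<le> - 2 * (v \<bullet> |u|^2)\<close>. Cauchy-Schwarz bounds the right side, and
  one factor \<open>norm v\<close> is cancelled.\<close>

lemma norm_le_of_SD_energy_nonpos:
  assumes u0: "u0 \<in> H1_space" and v0: "v0 \<in> H1_space" and E: "SD_energy u0 v0 \<le> 0"
  shows "norm (cls (\<lambda>x. complex_of_real (v0 x))) \<le> 2 * norm (sqmod (cls u0))"
proof -
  let ?v = "\<lambda>x. complex_of_real (v0 x)" and ?q = "\<lambda>x. complex_of_real ((cmod (u0 x))\<^sup>2)"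
  note H = H1_space_H1c(1)[OF u0] and u = H1_space_weak_deriv[OF u0] and v = H1_space_of_real(1)[OF v0]
  have ae: "AE x in lebesgue. ?q x = complex_of_real ((norm (rep (cls u0) x))\<^sup>2)"
    using rep_cls[OF u(1)] by eventually_elim simp
  have ae': "AE x in lebesgue. complex_of_real ((norm (rep (cls u0) x))\<^sup>2) = ?q x"
    using ae by eventually_elim simp
  have q: "?q \<in> L2_space"
    by (rule L2_space_AE[OF sqmod_L2[OF H] ae'])
  have cq: "cls ?q = sqmod (cls u0)"
    unfolding sqmod_def by (rule cls_eqI[OF q ae])
  have i1: "integrable lebesgue (\<lambda>x. (cmod (weak_deriv u0 x))\<^sup>2)" using u(2) by (simp add: L2_space_iff)
  have i2: "integrable lebesgue (\<lambda>x. 2 * (v0 x * (cmod (u0 x))\<^sup>2))"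
    using integrable_L2_inner[OF v q] by (simp add: inner_complex_def)
  have i3: "integrable lebesgue (\<lambda>x. (v0 x)\<^sup>2)"
    using v by (simp add: L2_space_iff)
  define D where "D = (LINT x|lebesgue. (cmod (weak_deriv u0 x))\<^sup>2)"
  have "0 \<le> D" by (simp add: D_def)
  moreover have "(LINT x|lebesgue. v0 x * (cmod (u0 x))\<^sup>2) = cls ?v \<bullet> sqmod (cls u0)"
    unfolding cq[symmetric] inner_cls[OF v q] by (simp add: inner_complex_def)
  moreover have "(LINT x|lebesgue. (v0 x)\<^sup>2) = (norm (cls ?v))\<^sup>2"
    by (simp add: norm_cls_power2[OF v])
  moreover have "SD_energy u0 v0 = D
      + (LINT x|lebesgue. 2 * (v0 x * (cmod (u0 x))\<^sup>2)) + (LINT x|lebesgue. (v0 x)\<^sup>2)"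
    unfolding SD_energy_def mult.assoc D_def
    by (subst Bochner_Integration.integral_add[OF Bochner_Integration.integrable_add[OF i1 i2] i3],
        subst Bochner_Integration.integral_add[OF i1 i2]) simp
  ultimately have "(norm (cls ?v))\<^sup>2 \<le> - 2 * (cls ?v \<bullet> sqmod (cls u0))" using E by simp
  also have "\<dots> \<le> 2 * (norm (cls ?v) * norm (sqmod (cls u0)))"
    using Cauchy_Schwarz_ineq2[of "cls ?v" "sqmod (cls u0)"] by linarith
  finally have "norm (cls ?v) * norm (cls ?v) \<le> norm (cls ?v) * (2 * norm (sqmod (cls u0)))"
    by (simp add: power2_eq_square)
  then show ?thesis
    by (cases "norm (cls ?v) = 0") (auto simp: mult_le_cancel_left)
qed

theorem theorem1p3:
  fixes u0 :: "real \<Rightarrow> real \<Rightarrow> complex" and v0 :: "real \<Rightarrow> real \<Rightarrow> real"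
    and u_lim0 :: "real \<Rightarrow> complex"
    and u :: "real \<Rightarrow> real \<Rightarrow> real \<Rightarrow> complex" and v :: "real \<Rightarrow> real \<Rightarrow> real \<Rightarrow> real"
    and u_lim :: "real \<Rightarrow> real \<Rightarrow> complex"
  assumes data: "\<And>\<tau>. \<tau> \<in> {0<..<1} \<Longrightarrow> u0 \<tau> \<in> H1_space \<and> v0 \<tau> \<in> H1_space"
    and i: "u_lim0 \<in> H1_space" "((\<lambda>\<tau>. H1_norm (\<lambda>x. u0 \<tau> x - u_lim0 x)) \<longlongrightarrow> 0) (at_right 0)"
    and ii_or_iii:
      "(SUP \<tau>\<in>{0<..<1}. L2_norm (v0 \<tau>)) < \<infinity> \<or>
       (SUP \<tau>\<in>{0<..<1}. ereal (SD_energy (u0 \<tau>) (v0 \<tau>))) \<le> 0 \<and>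
       (\<exists>\<gamma> C. 0 < \<gamma> \<and> \<gamma> < 1 \<and>
          (\<forall>\<tau>\<in>{0<..<1}. L2_norm (v0 \<tau>) \<le> ennreal (C * \<tau> powr (- 1 + \<gamma>))))"
    and SD: "\<And>\<tau>. \<tau> \<in> {0<..<1} \<Longrightarrow> SD_solution \<tau> (u0 \<tau>) (v0 \<tau>) (u \<tau>) (v \<tau>)"
    and NLS: "NLS_L2_solution u_lim0 u_lim"
  shows "\<forall>T>0.
    ((\<lambda>\<tau>. mixed_norm \<infinity> 2 T (\<lambda>t x. u \<tau> t x - u_lim t x)) \<longlongrightarrow> 0) (at_right 0) \<and>
    ((\<lambda>\<tau>. mixed_norm 1 2 T (\<lambda>t x. v \<tau> t x + (cmod (u_lim t x))\<^sup>2)) \<longlongrightarrow> 0) (at_right 0)"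
proof (intro allI impI)
  fix T :: real assume T: "0 < T"
  define U where U_eq: "U \<tau> = cls (u0 \<tau>)" for \<tau>
  define V where V_eq: "V \<tau> = cls (\<lambda>x. complex_of_real (v0 \<tau> x))" for \<tau>
  define P where P_eq: "P = cls u_lim0"
  \<comment> \<open>The data converge in H^1, so for small \<tau> both their norm and their seminorm
    exceed those of the limit by less than 1.\<close>
  define a where "a = norm P + dn P + 1"
  have HP: "H1c P" unfolding P_eq by (rule H1_space_H1c(1)[OF i(1)])
  have a0: "0 \<le> a" unfolding a_def by (intro add_nonneg_nonneg dn_nonneg HP) auto
  have H: "u0 \<tau> \<in> H1_space" "v0 \<tau> \<in> H1_space" "H1c (U \<tau>)" if "\<tau> \<in> {0<..<1}" for \<tau>
    using data[OF that] H1_space_H1c(1) by (auto simp: U_eq)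
  have diff: "H1c (U \<tau> - P)" "ennreal (dn (U \<tau> - P)) \<le> H1_norm (\<lambda>x. u0 \<tau> x - u_lim0 x)"
      "ennreal (norm (U \<tau> - P)) \<le> H1_norm (\<lambda>x. u0 \<tau> x - u_lim0 x)" if t: "\<tau> \<in> {0<..<1}" for \<tau>
    using H1_space_H1c[OF H1_space_diff[OF H(1)[OF t] i(1)]]
      H1_space_weak_deriv(1)[OF H(1)[OF t]] H1_space_weak_deriv(1)[OF i(1)]
    by (auto simp: U_eq P_eq cls_diff)
  have near0: "\<forall>\<^sub>F \<tau> in at_right 0. \<tau> \<in> {0<..<1::real}"
    by (rule eventually_at_rightI[of 0 1]) auto
  have nP: "((\<lambda>\<tau>. norm (U \<tau> - P)) \<longlongrightarrow> 0) (at_right 0)"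
    by (rule tendsto_real_squeeze[OF i(2)]) (use near0 diff in \<open>auto elim!: eventually_mono\<close>)
  have dP: "((\<lambda>\<tau>. dn (U \<tau> - P)) \<longlongrightarrow> 0) (at_right 0)"
    by (rule tendsto_real_squeeze[OF i(2)]) (use near0 diff in \<open>auto elim!: eventually_mono intro: dn_nonneg\<close>)
  have U: "\<forall>\<^sub>F \<tau> in at_right 0. \<tau> \<in> {0<..<1} \<and> norm (U \<tau>) \<le> a \<and> dn (U \<tau>) \<le> a"
    using near0 order_tendstoD(2)[OF nP zero_less_one] order_tendstoD(2)[OF dP zero_less_one]
  proof eventually_elim
    case (elim \<tau>)
    have "norm (U \<tau>) \<le> norm P + norm (U \<tau> - P)" by (rule norm_triangle_sub)
    moreover have "dn (U \<tau>) \<le> dn P + dn (U \<tau> - P)"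
      using dn_diff_le[OF H(3)[OF elim(1)] HP] by linarith
    ultimately have "norm (U \<tau>) \<le> a" "dn (U \<tau>) \<le> a"
      using elim dn_nonneg[OF HP] norm_ge_zero[of P] unfolding a_def by linarith+
    then show ?case using elim(1) by simp
  qed
  \<comment> \<open>A bound for the initial \<open>v\<close> that does not depend on \<tau>. Under
    (ii) it is the supremum; under (iii) the sign of the energy bounds it by the squared modulus of
    the initial \<open>u\<close>, which \<open>a\<close> controls.\<close>
  obtain B where B: "norm (V \<tau>) \<le> B" if "\<tau> \<in> {0<..<1}" "norm (U \<tau>) \<le> a" "dn (U \<tau>) \<le> a" for \<tau>
    using ii_or_iii
  proof
    assume S: "(SUP \<tau>\<in>{0<..<1}. L2_norm (v0 \<tau>)) < \<infinity>"
    define s where "s = enn2real (SUP \<tau>\<in>{0<..<1}. L2_norm (v0 \<tau>))"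
    have s: "(SUP \<tau>\<in>{0<..<1}. L2_norm (v0 \<tau>)) = ennreal s" using S by (simp add: s_def)
    have "norm (V \<tau>) \<le> s" if t: "\<tau> \<in> {0<..<1}" for \<tau>
    proof -
      have "ennreal (norm (V \<tau>)) = L2_norm (v0 \<tau>)"
        using L2_norm_cls[OF H1_space_of_real(1)[OF H(2)[OF t]]] by (simp add: V_eq L2_norm_of_real)
      also have "\<dots> \<le> ennreal s" unfolding s[symmetric] by (rule SUP_upper[OF t])
      finally show ?thesis by (simp add: s_def)
    qed
    then show thesis by (intro that) auto
  next
    assume E: "(SUP \<tau>\<in>{0<..<1}. ereal (SD_energy (u0 \<tau>) (v0 \<tau>))) \<le> 0 \<and>
       (\<exists>\<gamma> C. 0 < \<gamma> \<and> \<gamma> < 1 \<and>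
          (\<forall>\<tau>\<in>{0<..<1}. L2_norm (v0 \<tau>) \<le> ennreal (C * \<tau> powr (- 1 + \<gamma>))))"
    have "norm (V \<tau>) \<le> 2 * (sqrt (pi * (a\<^sup>2 + a\<^sup>2)) * a)"
      if t: "\<tau> \<in> {0<..<1}" "norm (U \<tau>) \<le> a" "dn (U \<tau>) \<le> a" for \<tau>
    proof -
      have "ereal (SD_energy (u0 \<tau>) (v0 \<tau>)) \<le> 0"
        using SUP_upper[OF t(1), of "\<lambda>\<tau>. ereal (SD_energy (u0 \<tau>) (v0 \<tau>))"] E by (meson order_trans)
      then have "norm (V \<tau>) \<le> 2 * norm (sqmod (U \<tau>))"
        using norm_le_of_SD_energy_nonpos[OF H(1,2)[OF t(1)]] by (simp add: U_eq V_eq)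
      also have "\<dots> \<le> 2 * (sup_bd (U \<tau>) * norm (U \<tau>))" using norm_sqmod[OF H(3)[OF t(1)]] by simp
      also have "\<dots> \<le> 2 * (sqrt (pi * (a\<^sup>2 + a\<^sup>2)) * a)"
        unfolding sup_bd_def using t dn_nonneg[OF H(3)[OF t(1)]] a0
        by (intro mult_left_mono mult_mono real_sqrt_le_mono add_mono power_mono) auto
      finally show ?thesis .
    qed
    then show thesis by (rule that)
  qed
  define A where "A = max a B"
  define \<epsilon> where "\<epsilon> \<tau> = norm (U \<tau> - P) + sqrt \<tau>" for \<tau>
  have flow: "\<forall>\<^sub>F \<tau> in at_right 0. SD_NLS \<tau> (u0 \<tau>) (v0 \<tau>) (u \<tau>) (v \<tau>) u_lim u_lim0 A T"
    using U
  proof eventually_elim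
    case (elim \<tau>)
    then have t: "\<tau> \<in> {0<..<1}" by simp
    interpret SD_flow \<tau> "u0 \<tau>" "v0 \<tau>" "u \<tau>" "v \<tau>"
      by unfold_locales (use t H[OF t] SD[OF t] in auto)
    show ?case
      by unfold_locales (use elim B[OF t] NLS T H1_space_weak_deriv(1)[OF i(1)] in
        \<open>auto simp: NLS_L2_solution_def A_def U0_def V0_def U_eq V_eq\<close>)
  qed
  have "(\<epsilon> \<longlongrightarrow> 0 + sqrt 0) (at_right 0)"
    unfolding \<epsilon>_def[abs_def] by (intro tendsto_add nP tendsto_real_sqrt tendsto_ident_at)
  then have "((\<lambda>\<tau>. ennreal (c * \<epsilon> \<tau>)) \<longlongrightarrow> ennreal (c * (0 + sqrt 0))) (at_right 0)" for c
    by (intro tendsto_ennrealI tendsto_mult tendsto_const)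
  then have lim: "((\<lambda>\<tau>. ennreal (c * \<epsilon> \<tau>)) \<longlongrightarrow> 0) (at_right 0)" for c by simp
  have squeeze: "(f \<longlongrightarrow> 0) (at_right 0)" if "\<forall>\<^sub>F \<tau> in at_right 0. f \<tau> \<le> ennreal (c * \<epsilon> \<tau>)" for f c
    by (rule tendsto_sandwich[OF _ that tendsto_const lim]) simp
  have e: "norm (SD_flow.U0 (u0 \<tau>) - cls u_lim0) + sqrt \<tau> = \<epsilon> \<tau>"
    if "SD_NLS \<tau> (u0 \<tau>) (v0 \<tau>) (u \<tau>) (v \<tau>) u_lim u_lim0 A T" for \<tau>
  proof -
    interpret SD_NLS \<tau> "u0 \<tau>" "v0 \<tau>" "u \<tau>" "v \<tau>" u_lim u_lim0 A T by (rule that)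
    show ?thesis by (simp add: \<epsilon>_def U_eq P_eq U0_def)
  qed
  have "((\<lambda>\<tau>. mixed_norm \<infinity> 2 T (\<lambda>t x. u \<tau> t x - u_lim t x)) \<longlongrightarrow> 0) (at_right 0)"
  proof (rule squeeze)
    show "\<forall>\<^sub>F \<tau> in at_right 0. mixed_norm \<infinity> 2 T (\<lambda>t x. u \<tau> t x - u_lim t x) \<le> ennreal (SD_NLS.K u_lim A T * \<epsilon> \<tau>)"
      using flow
    proof eventually_elim
      case (elim \<tau>)
      show ?case using SD_NLS.mixed_norm_le(1)[OF elim] unfolding e[OF elim] .
    qed
  qed
  moreover have "((\<lambda>\<tau>. mixed_norm 1 2 T (\<lambda>t x. v \<tau> t x + (cmod (u_lim t x))\<^sup>2)) \<longlongrightarrow> 0) (at_right 0)"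
  proof (rule squeeze)
    show "\<forall>\<^sub>F \<tau> in at_right 0. mixed_norm 1 2 T (\<lambda>t x. v \<tau> t x + (cmod (u_lim t x))\<^sup>2) \<le> ennreal (((T + H1_bound A) / 2 + SD_NLS.K u_lim A T * SD_NLS.L u_lim A T) * \<epsilon> \<tau>)"
      using flow
    proof eventually_elim
      case (elim \<tau>)
      show ?case using SD_NLS.mixed_norm_le(2)[OF elim] unfolding e[OF elim] .
    qed
  qed
  ultimately show "((\<lambda>\<tau>. mixed_norm \<infinity> 2 T (\<lambda>t x. u \<tau> t x - u_lim t x)) \<longlongrightarrow> 0) (at_right 0) \<and>
    ((\<lambda>\<tau>. mixed_norm 1 2 T (\<lambda>t x. v \<tau> t x + (cmod (u_lim t x))\<^sup>2)) \<longlongrightarrow> 0) (at_right 0)" ..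
qed

end
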